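(* Let $n\in\mathbb{N}$ and $\mathcal{G}\in\mathbb{G}$, and let $(U,P)=(\boldsymbol{U}^n_{\mathcal{G}},P^n_{\mathcal{G}})\in\mathbb{V}(\mathcal{G})\times\mathbb{Q}_0(\mathcal{G})$ be a Galerkin approximation. Then $$c_2\,\mathcal{E}^{\mathsf{pde}}_{\mathcal{G}}(U,P,\boldsymbol{S}^n(DU))^{1/\tilde t}\le\|\mathcal{R}^{\mathsf{pde}}(U,P,\boldsymbol{S}^n(DU))\|_{W^{-1,\tilde t}(\Omega)}+{\rm osc}_{\mathcal{G}}(U,\boldsymbol{S}^n(DU))^{1/\tilde t},$$ where $${\rm osc}_{\mathcal{G}}(U,\boldsymbol{S}^n(DU))=\sum_{E\in\mathcal{G}}\Big\{\min_{\boldsymbol{f}_E\in\mathbb{P}_{2\ell-1}^d}\|h_{\mathcal{G}}(\boldsymbol{f}-\boldsymbol{f}_E)\|_{\tilde t;E}^{\tilde t}+\|\boldsymbol{S}^n(DU)-\Pi_{\mathcal{G}}\boldsymbol{S}^n(DU)\|_{\tilde t;E}^{\tilde t}\Big\}.$$ The constant $c_2>0$ depends solely on the shape-regularity of $\mathcal{G}$, on $\tilde t$, and on the dimension $d$ (besides the data declared fixed once and for all in the context).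
   Context: **Domain, spaces.** $d\in\{2,3\}$; $\Omega\subset\mathbb{R}^d$ is a bounded open Lipschitz domain with polyhedral boundary. $\mathbb{R}^{d\times d}_{\rm sym}$: symmetric matrices; $Dv=\frac12(\nabla v+(\nabla v)^{T})$. $\|\cdot\|_{s;\omega}$, $\|\cdot\|_{1,s;\omega}$ are the norms of $L^s(\omega)$, $W^{1,s}(\omega)$ ($\omega=\Omega$ is omitted); $s'$ is the conjugate exponent; $L^s_0$ are the mean-zero functions; $W^{-1,s'}(\omega)^d$ is the dual of $W^{1,s}_0(\omega)^d$ ($1<s<\infty$). **Exponents.** $\frac{2d}{d+1}<r<\infty$. If $r\le\frac{3d}{d+2}$: $\tilde r=\frac12\frac{dr}{d-r}$, $t$ is fixed with $\frac{2d}{d+1}<t<r$, and $\tilde t=\frac12\frac{dt}{d-t}$. Otherwise $t=r$ and $\tilde t=t'=\tilde r=r'$. A right-hand side $\boldsymbol{f}\in L^{r'}(\Omega)^d$ is given. **Meshes.** $\mathcal{G}_0$ is a regular conforming partition of $\Omega$ into closed simplices. A routine REFINE takes a partition $\mathcal{G}$ ($\mathcal{G}_0$ or an earlier output) and $\mathcal{M}\subset\mathcal{G}$ and returns a regular conforming simplicial refinement by bisection in which every element of $\mathcal{M}$ has been bisected at least once. $\mathbb{G}$ is the set of all partitions obtained from $\mathcal{G}_0$ by finitely many applications of REFINE; it is assumed shape-regular (diameter over inscribed ball diameter uniformly bounded). $\mathcal{N}^{\mathcal{G}}(E)=\{E'\in\mathcal{G}:E'\cap E\ne\emptyset\}$;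 $\mathcal{U}^{\mathcal{G}}(\omega)=\bigcup\{E\in\mathcal{G}:E\cap\omega\neq\emptyset\}$; $h_{\mathcal{G}}(x)=|\mathcal{U}^{\mathcal{G}}(\{x\})|^{1/d}$. Sides are the $(d-1)$-dimensional faces with interior inside $\Omega$. **Finite elements.** For $E\in\mathcal{G}$, $F_E:E\to\hat E$ is the affine bijection onto the reference simplex. For given subspaces $\mathbb{V}\subseteq W^{1,\infty}_0(\Omega)^d$, $\mathbb{Q}\subseteq L^\infty(\Omega)$ and finite-dimensional spaces $\mathbb{P}_1^d\subseteq\hat{\mathbb{P}}_{\mathbb{V}}\subseteq\mathbb{P}_\ell^d$, $\mathbb{P}_0\subseteq\hat{\mathbb{P}}_{\mathbb{Q}}\subseteq\mathbb{P}_{\jmath}$ ($\ell\ge\jmath$) of polynomials on $\hat E$ ($\mathbb{P}_m$: degree at most $m$), $\mathbb{V}(\mathcal{G})=\{V\in\mathbb{V}:V|_E\circ F_E^{-1}\in\hat{\mathbb{P}}_{\mathbb{V}}\ \forall E\in\mathcal{G},\ V|_{\partial\Omega}=0\}$, $\mathbb{Q}(\mathcal{G})=\{Q\in\mathbb{Q}:Q|_E\circ F_E^{-1}\in\hat{\mathbb{P}}_{\mathbb{Q}}\ \forall E\in\mathcal{G}\}$, $\mathbb{Q}_0(\mathcal{G})=\mathbb{Q}(\mathcal{G})\cap L^1_0(\Omega)$. $\mathbb{P}_m(\mathcal{G};X)$: $X$-valued $\mathcal{G}$-piecewise polynomials of degree at most $m$. The spaces are nested under refinement, and each has a finite locally supported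 basis: if a basis function does not vanish identically on $E\in\mathcal{G}$, its support lies in $\mathcal{U}^{\mathcal{G}}(E)$. Assumed, for every $\mathcal{G}\in\mathbb{G}$ with constants independent of $\mathcal{G}$: (i) a linear projection $\mathfrak{I}^{\mathcal{G}}_{\rm div}:W^{1,1}_0(\Omega)^d\to\mathbb{V}(\mathcal{G})$ such that for all $s\in(1,\infty)$, $v\in W^{1,s}_0(\Omega)^d$: $\int_\Omega Q\,{\rm div}\,v=\int_\Omega Q\,{\rm div}\,\mathfrak{I}^{\mathcal{G}}_{\rm div}v$ for $Q\in\mathbb{Q}(\mathcal{G})$; if $\mathcal{G}_\star\in\mathbb{G}$, $E\in\mathcal{G}$, $\mathcal{N}^{\mathcal{G}}(E)\subset\mathcal{G}_\star$, then $\mathfrak{I}^{\mathcal{G}_\star}_{\rm div}v|_{\mathcal{U}^{\mathcal{G}_\star}(E)}=\mathfrak{I}^{\mathcal{G}}_{\rm div}v|_{\mathcal{U}^{\mathcal{G}}(E)}$; and $\int_E|\mathfrak{I}^{\mathcal{G}}_{\rm div}v|+h_{\mathcal{G}}|\nabla\mathfrak{I}^{\mathcal{G}}_{\rm div}v|\,dx\le c_1\int_{\mathcal{U}^{\mathcal{G}}(E)}|v|+h_{\mathcal{G}}|\nabla v|\,dx$ for $E\in\mathcal{G}$; (ii) a linear projection $\Pi_{\mathcal{G}}:L^1(\Omega;\mathbb{R}^{d\times d}_{\rm sym})\to\mathbb{P}_{\ell-1}(\mathcal{G};\mathbb{R}^{d\times d}_{\rm sym})$ with $\int_E|\Pi_{\mathcal{G}}S|\le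 c\int_{\mathcal{U}^{\mathcal{G}}(E)}|S|$; (iii) a linear projection $\mathfrak{I}^{\mathcal{G}}_{\mathbb{Q}}:L^1(\Omega)\to\mathbb{Q}(\mathcal{G})$ with $\int_E|\mathfrak{I}^{\mathcal{G}}_{\mathbb{Q}}q|\le c\int_{\mathcal{U}^{\mathcal{G}}(E)}|q|$. The reference spaces, degrees, projectors and their stability constants are fixed once and for all. **Explicit stress maps.** For $n\in\mathbb{N}$, $\boldsymbol{S}^n:\Omega\times\mathbb{R}^{d\times d}_{\rm sym}\to\mathbb{R}^{d\times d}_{\rm sym}$ is measurable in $x$, continuous in $\delta$ for a.e. $x$, strictly monotone ($(\boldsymbol{S}^n(x,\delta_1)-\boldsymbol{S}^n(x,\delta_2)):(\delta_1-\delta_2)>0$ for $\delta_1\ne\delta_2$, a.e. $x$), and, with $\tilde c_1,\tilde c_2>0$ and nonnegative $\tilde m\in L^1(\Omega)$, $\tilde k\in L^{r'}(\Omega)$ independent of $n$, $|\boldsymbol{S}^n(x,\delta)|\le\tilde c_1|\delta|^{r-1}+\tilde k(x)$ and $\boldsymbol{S}^n(x,\delta):\delta\ge\tilde c_2|\delta|^r-\tilde m(x)$. Write $\boldsymbol{S}^n(Dv)=\boldsymbol{S}^n(\cdot,Dv)$. **Convection.** $\mathcal{B}[v,w,h]=\frac12\int_\Omega(v\otimes h):\nabla w-(v\otimes w):\nabla h\,dx$ with $(v\otimes w)_{ij}=v_iw_j$, $(\nabla w)_{ij}=\partial_iw_j$; ${\rm B}[v,v]_j=\frac12\sum_{i}\big(v_i\partial_iv_j+\partial_i(v_iv_j)\big)$,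 so $\int_\Omega{\rm B}[v,v]\cdot w\,dx=\mathcal{B}[v,v,w]$. **Galerkin approximation.** $(U,P)\in\mathbb{V}(\mathcal{G})\times\mathbb{Q}_0(\mathcal{G})$ with $\int_\Omega\boldsymbol{S}^n(DU):DV+{\rm B}[U,U]\cdot V-P\,{\rm div}V\,dx=\int_\Omega\boldsymbol{f}\cdot V\,dx$ for all $V\in\mathbb{V}(\mathcal{G})$ and $\int_\Omega Q\,{\rm div}U\,dx=0$ for all $Q\in\mathbb{Q}(\mathcal{G})$. **Residual.** $\langle\mathcal{R}^{\mathsf{pde}}(v,q,T),w\rangle=\int_\Omega T:Dw+{\rm B}[v,v]\cdot w-q\,{\rm div}w-\boldsymbol{f}\cdot w\,dx$. **Indicators.** For $E\in\mathcal{G}$, with $S=\boldsymbol{S}^n(DU)$, $\mathcal{E}^{\mathsf{pde}}_{\mathcal{G}}(U,P,S;E)=\|h_{\mathcal{G}}(-{\rm div}\,\Pi_{\mathcal{G}}S+{\rm B}[U,U]+\nabla P-\boldsymbol{f})\|_{\tilde t;E}^{\tilde t}+\|h_{\mathcal{G}}^{1/\tilde t}[\![\Pi_{\mathcal{G}}S-P\,{\rm id}]\!]\|_{\tilde t;\partial E}^{\tilde t}+\|S-\Pi_{\mathcal{G}}S\|_{\tilde t;E}^{\tilde t}$ (derivatives elementwise), where $[\![\cdot]\!]$ is the normal jump across interior sides and $[\![\cdot]\!]|_{\partial\Omega}=0$. $\mathcal{E}^{\mathsf{pde}}_{\mathcal{G}}(U,P,S)$ denotes the sum over all $E\in\mathcal{G}$.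 *)

theory Defs
  imports "HOL-Analysis.Analysis"
begin

text \<open>Elements of function spaces on \<open>\<Omega>\<close> are represented by functions on the whole space, considered
  up to equality almost everywhere on \<open>\<Omega>\<close>; values outside \<open>\<Omega>\<close> are irrelevant.\<close>

definition conj_exp :: "real \<Rightarrow> real" where
  "conj_exp s = s / (s - 1)"

definition Lp :: "(real^'d) set \<Rightarrow> real \<Rightarrow> (real^'d \<Rightarrow> 'b::euclidean_space) set" where
  "Lp \<omega> s = {u \<in> borel_measurable (lebesgue_on \<omega>).
     integrable (lebesgue_on \<omega>) (\<lambda>x. norm (u x) powr s)}"

definition Linf :: "(real^'d) set \<Rightarrow> (real^'d \<Rightarrow> 'b::euclidean_space) set" where
  "Linf \<omega> = {u \<in> borel_measurable (lebesgue_on \<omega>). \<exists>C. AE x in lebesgue_on \<omega>. norm (u x) \<le> C}"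

definition L10 :: "(real^'d) set \<Rightarrow> (real^'d \<Rightarrow> real) set" where
  "L10 \<omega> = {q \<in> Lp \<omega> 1. (LINT x|lebesgue_on \<omega>. q x) = 0}"

definition Lnorm :: "(real^'d) set \<Rightarrow> real \<Rightarrow> (real^'d \<Rightarrow> 'b::euclidean_space) \<Rightarrow> real" where
  "Lnorm \<omega> s u = (LINT x|lebesgue_on \<omega>. norm (u x) powr s) powr (1 / s)"

definition pd :: "'d \<Rightarrow> (real^'d \<Rightarrow> real) \<Rightarrow> real^'d \<Rightarrow> real" where
  "pd i \<phi> x = frechet_derivative \<phi> (at x) (axis i 1)"

primrec Ck :: "nat \<Rightarrow> (real^'d \<Rightarrow> real) \<Rightarrow> bool" where
  "Ck 0 \<phi> \<longleftrightarrow> continuous_on UNIV \<phi>"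
| "Ck (Suc k) \<phi> \<longleftrightarrow> \<phi> differentiable_on UNIV \<and> (\<forall>i. Ck k (pd i \<phi>))"

definition test_fun :: "(real^'d) set \<Rightarrow> (real^'d \<Rightarrow> real) \<Rightarrow> bool" where
  "test_fun \<Omega> \<phi> \<longleftrightarrow> (\<forall>k. Ck k \<phi>) \<and> compact (closure {x. \<phi> x \<noteq> 0}) \<and> closure {x. \<phi> x \<noteq> 0} \<subseteq> \<Omega>"

definition is_weak_pd ::
  "(real^'d) set \<Rightarrow> 'd \<Rightarrow> (real^'d \<Rightarrow> real) \<Rightarrow> (real^'d \<Rightarrow> real) \<Rightarrow> bool" where
  "is_weak_pd \<Omega> i u g \<longleftrightarrow>
     (\<forall>K. compact K \<and> K \<subseteq> \<Omega> \<longrightarrow> u absolutely_integrable_on K \<and> g absolutely_integrable_on K) \<and>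
     (\<forall>\<phi>. test_fun \<Omega> \<phi> \<longrightarrow>
        (LINT x|lebesgue_on \<Omega>. u x * pd i \<phi> x) = - (LINT x|lebesgue_on \<Omega>. g x * \<phi> x))"

text \<open>The weak derivative is unique up to null sets, so the choice below is immaterial.\<close>

definition wpd :: "(real^'d) set \<Rightarrow> 'd \<Rightarrow> (real^'d \<Rightarrow> real) \<Rightarrow> real^'d \<Rightarrow> real" where
  "wpd \<Omega> i u = (SOME g. is_weak_pd \<Omega> i u g)"

definition wgrad_scalar :: "(real^'d) set \<Rightarrow> (real^'d \<Rightarrow> real) \<Rightarrow> real^'d \<Rightarrow> real^'d" where
  "wgrad_scalar \<Omega> q x = (\<chi> i. wpd \<Omega> i q x)"

definition wgrad :: "(real^'d) set \<Rightarrow> (real^'d \<Rightarrow> real^'d) \<Rightarrow> real^'d \<Rightarrow> real^'d^'d" where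
  "wgrad \<Omega> v x = (\<chi> i j. wpd \<Omega> i (\<lambda>y. v y $ j) x)"

definition sgrad :: "(real^'d) set \<Rightarrow> (real^'d \<Rightarrow> real^'d) \<Rightarrow> real^'d \<Rightarrow> real^'d^'d" where
  "sgrad \<Omega> v x = (1/2) *\<^sub>R (wgrad \<Omega> v x + transpose (wgrad \<Omega> v x))"

definition wdiv :: "(real^'d) set \<Rightarrow> (real^'d \<Rightarrow> real^'d) \<Rightarrow> real^'d \<Rightarrow> real" where
  "wdiv \<Omega> v x = (\<Sum>i\<in>UNIV. wpd \<Omega> i (\<lambda>y. v y $ i) x)"

definition wdiv_tensor :: "(real^'d) set \<Rightarrow> (real^'d \<Rightarrow> real^'d^'d) \<Rightarrow> real^'d \<Rightarrow> real^'d" where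
  "wdiv_tensor \<Omega> T x = (\<chi> j. \<Sum>i\<in>UNIV. wpd \<Omega> i (\<lambda>y. T y $ i $ j) x)"

definition W1 :: "(real^'d) set \<Rightarrow> real \<Rightarrow> (real^'d \<Rightarrow> real^'d) set" where
  "W1 \<Omega> s = {v \<in> Lp \<Omega> s. \<forall>i j. \<exists>g \<in> Lp \<Omega> s. is_weak_pd \<Omega> i (\<lambda>y. v y $ j) g}"

definition W1norm :: "(real^'d) set \<Rightarrow> real \<Rightarrow> (real^'d \<Rightarrow> real^'d) \<Rightarrow> real" where
  "W1norm \<Omega> s v =
     (Lnorm \<Omega> s v powr s + Lnorm \<Omega> s (wgrad \<Omega> v) powr s) powr (1 / s)"

definition W10 :: "(real^'d) set \<Rightarrow> real \<Rightarrow> (real^'d \<Rightarrow> real^'d) set" where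
  "W10 \<Omega> s = {v \<in> W1 \<Omega> s. \<exists>\<phi> :: nat \<Rightarrow> real^'d \<Rightarrow> real^'d.
     (\<forall>k j. test_fun \<Omega> (\<lambda>x. \<phi> k x $ j)) \<and> (\<lambda>k. W1norm \<Omega> s (\<lambda>x. v x - \<phi> k x)) \<longlonglongrightarrow> 0}"

text \<open>Test functions are not dense for the exponent infinity; as usual
  \<open>W\<^sup>1\<^sup>,\<^sup>\<infinity>\<close> with zero boundary values is the intersection of \<open>W\<^sup>1\<^sup>,\<^sup>\<infinity>\<close> with the
  zero boundary value space of exponent 1.\<close>

definition W10_infty :: "(real^'d) set \<Rightarrow> (real^'d \<Rightarrow> real^'d) set" where
  "W10_infty \<Omega> = {v \<in> W10 \<Omega> 1 \<inter> Linf \<Omega>.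
     \<forall>i j. \<exists>g \<in> Linf \<Omega>. is_weak_pd \<Omega> i (\<lambda>y. v y $ j) g}"

definition dual_norm :: "(real^'d) set \<Rightarrow> real \<Rightarrow> ((real^'d \<Rightarrow> real^'d) \<Rightarrow> real) \<Rightarrow> real" where
  "dual_norm \<Omega> s R =
     (SUP w \<in> {w \<in> W10 \<Omega> (conj_exp s). W1norm \<Omega> (conj_exp s) w \<le> 1}. \<bar>R w\<bar>)"

definition sym_mats :: "(real^'d^'d) set" where
  "sym_mats = {A. transpose A = A}"

definition L1_sym :: "(real^'d) set \<Rightarrow> (real^'d \<Rightarrow> real^'d^'d) set" where
  "L1_sym \<Omega> = {T \<in> Lp \<Omega> 1. AE x in lebesgue_on \<Omega>. T x \<in> sym_mats}"

definition lipschitz_boundary :: "(real^'d) set \<Rightarrow> bool" where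
  "lipschitz_boundary \<Omega> \<longleftrightarrow> (\<forall>x \<in> frontier \<Omega>. \<exists>\<nu> \<rho> L g. norm \<nu> = 1 \<and> \<rho> > 0 \<and> L-lipschitz_on UNIV g \<and>
     \<Omega> \<inter> ball x \<rho> = {y \<in> ball x \<rho>. g (y - (y \<bullet> \<nu>) *\<^sub>R \<nu>) < y \<bullet> \<nu>})"

definition polyhedral_boundary :: "(real^'d) set \<Rightarrow> bool" where
  "polyhedral_boundary \<Omega> \<longleftrightarrow> (\<exists>\<F>. finite \<F> \<and> frontier \<Omega> = \<Union>\<F> \<and>
     (\<forall>T \<in> \<F>. polytope T \<and> aff_dim T = int CARD('d) - 1))"

definition polyhedral_lipschitz_domain :: "(real^'d) set \<Rightarrow> bool" where
  "polyhedral_lipschitz_domain \<Omega> \<longleftrightarrow> open \<Omega> \<and> bounded \<Omega> \<and> connected \<Omega> \<and> \<Omega> \<noteq> {} \<and>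
     lipschitz_boundary \<Omega> \<and> polyhedral_boundary \<Omega>"

definition admissible_exps :: "real \<Rightarrow> real \<Rightarrow> real \<Rightarrow> real \<Rightarrow> bool" where
  "admissible_exps d r t tt \<longleftrightarrow> 2 * d / (d + 1) < r \<and>
     (if r \<le> 3 * d / (d + 2)
      then 2 * d / (d + 1) < t \<and> t < r \<and> tt = 1/2 * (d * t / (d - t))
      else t = r \<and> tt = conj_exp r)"

type_synonym 'd mesh = "(real^'d) set set"

definition conforming_partition :: "(real^'d) set \<Rightarrow> 'd mesh \<Rightarrow> bool" where
  "conforming_partition \<Omega> \<G> \<longleftrightarrow>
     triangulation \<G> \<and> (\<forall>E \<in> \<G>. int CARD('d) simplex E) \<and> \<Union>\<G> = closure \<Omega>"

definition bisection :: "(real^'d) set \<Rightarrow> (real^'d) set \<Rightarrow> (real^'d) set \<Rightarrow> bool" where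
  "bisection E E1 E2 \<longleftrightarrow> (\<exists>C a b. \<not> affine_dependent C \<and> E = convex hull C \<and> a \<in> C \<and> b \<in> C \<and> a \<noteq> b \<and>
     E1 = convex hull (insert (midpoint a b) (C - {b})) \<and>
     E2 = convex hull (insert (midpoint a b) (C - {a})))"

definition bisection_step :: "('d::finite) mesh \<Rightarrow> 'd mesh \<Rightarrow> bool" where
  "bisection_step \<G> \<G>' \<longleftrightarrow>
     (\<exists>E \<in> \<G>. \<exists>E1 E2. bisection E E1 E2 \<and> \<G>' = (\<G> - {E}) \<union> {E1, E2})"

text \<open>Intermediate collections in a chain of bisections may have hanging nodes.\<close>

definition bisection_refinement :: "('d::finite) mesh \<Rightarrow> 'd mesh \<Rightarrow> bool" where
  "bisection_refinement = bisection_step\<^sup>*\<^sup>*"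

inductive_set meshes :: "'d mesh \<Rightarrow> ('d mesh \<Rightarrow> (real^'d) set set \<Rightarrow> 'd mesh) \<Rightarrow> 'd mesh set"
  for \<G>0 refine where
  initial: "\<G>0 \<in> meshes \<G>0 refine"
| refined: "\<G> \<in> meshes \<G>0 refine \<Longrightarrow> M \<subseteq> \<G> \<Longrightarrow> refine \<G> M \<in> meshes \<G>0 refine"

text \<open>Since bisection strictly shrinks elements, a marked element has been bisected iff it no longer
  belongs to the refined partition.\<close>

definition refine_routine ::
  "(real^'d) set \<Rightarrow> 'd mesh \<Rightarrow> ('d mesh \<Rightarrow> (real^'d) set set \<Rightarrow> 'd mesh) \<Rightarrow> bool" where
  "refine_routine \<Omega> \<G>0 refine \<longleftrightarrow> (\<forall>\<G> \<in> meshes \<G>0 refine. \<forall>M. M \<subseteq> \<G> \<longrightarrow>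
     conforming_partition \<Omega> (refine \<G> M) \<and> bisection_refinement \<G> (refine \<G> M) \<and>
     M \<inter> refine \<G> M = {})"

definition inball_diameter :: "(real^'d) set \<Rightarrow> real" where
  "inball_diameter E = Sup {2 * \<rho> | x \<rho>. 0 \<le> \<rho> \<and> cball x \<rho> \<subseteq> E}"

definition shape_regular :: "real \<Rightarrow> ('d::finite) mesh \<Rightarrow> bool" where
  "shape_regular \<kappa> \<G> \<longleftrightarrow> (\<forall>E \<in> \<G>. diameter E \<le> \<kappa> * inball_diameter E)"

definition neighbours :: "'d mesh \<Rightarrow> (real^'d) set \<Rightarrow> (real^'d) set set" where
  "neighbours \<G> \<omega> = {E \<in> \<G>. E \<inter> \<omega> \<noteq> {}}"

definition patch :: "'d mesh \<Rightarrow> (real^'d) set \<Rightarrow> (real^'d) set" where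
  "patch \<G> \<omega> = \<Union>(neighbours \<G> \<omega>)"

definition hmesh :: "'d mesh \<Rightarrow> real^'d \<Rightarrow> real" where
  "hmesh \<G> x = measure lebesgue (patch \<G> {x}) powr (1 / real CARD('d))"

definition polys :: "nat \<Rightarrow> (real^'d \<Rightarrow> 'b::real_vector) set" where
  "polys m = {p. \<exists>c :: ('d \<Rightarrow> nat) \<Rightarrow> 'b. p =
     (\<lambda>x. \<Sum>\<alpha> | (\<Sum>i\<in>UNIV. \<alpha> i) \<le> m. (\<Prod>i\<in>UNIV. (x $ i) ^ \<alpha> i) *\<^sub>R c \<alpha>)}"

definition lin_space :: "('a \<Rightarrow> 'b::real_vector) set \<Rightarrow> bool" where
  "lin_space X \<longleftrightarrow> (\<lambda>x. 0) \<in> X \<and>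
     (\<forall>u \<in> X. \<forall>v \<in> X. \<forall>a b. (\<lambda>x. a *\<^sub>R u x + b *\<^sub>R v x) \<in> X)"

text \<open>Closure under modification on null sets: the set represents a space of equivalence classes.\<close>

definition class_space :: "(real^'d) set \<Rightarrow> (real^'d \<Rightarrow> 'b::real_vector) set \<Rightarrow> bool" where
  "class_space \<Omega> X \<longleftrightarrow> lin_space X \<and>
     (\<forall>u \<in> X. \<forall>v. (AE x in lebesgue_on \<Omega>. u x = v x) \<longrightarrow> v \<in> X)"

definition ref_simplex :: "(real^'d) set" where
  "ref_simplex = convex hull (insert 0 Basis)"

text \<open>Polynomials on the reference simplex are represented by their unique polynomial extension
  to the whole space.\<close>

definition reference_spaces ::
  "(real^'d \<Rightarrow> real^'d) set \<Rightarrow> (real^'d \<Rightarrow> real) set \<Rightarrow> nat \<Rightarrow> nat \<Rightarrow> bool" where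
  "reference_spaces PV PQ l j \<longleftrightarrow> lin_space PV \<and> lin_space PQ \<and>
     polys 1 \<subseteq> PV \<and> PV \<subseteq> polys l \<and> polys 0 \<subseteq> PQ \<and> PQ \<subseteq> polys j \<and> j \<le> l"

definition affine_bijection :: "(real^'d \<Rightarrow> real^'d) \<Rightarrow> (real^'d) set \<Rightarrow> (real^'d) set \<Rightarrow> bool" where
  "affine_bijection F E E' \<longleftrightarrow> (\<exists>A b. linear A \<and> F = (\<lambda>x. A x + b)) \<and> bij_betw F E E'"

definition zero_boundary_values :: "(real^'d) set \<Rightarrow> (real^'d \<Rightarrow> real^'d) \<Rightarrow> bool" where
  "zero_boundary_values \<Omega> V \<longleftrightarrow> (\<exists>V'. continuous_on (closure \<Omega>) V' \<and>
     (AE x in lebesgue_on \<Omega>. V x = V' x) \<and> (\<forall>x \<in> frontier \<Omega>. V' x = 0))"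

definition piecewise ::
  "(real^'d \<Rightarrow> 'b) set \<Rightarrow> ((real^'d) set \<Rightarrow> real^'d \<Rightarrow> real^'d) \<Rightarrow> 'd mesh \<Rightarrow> (real^'d \<Rightarrow> 'b) set" where
  "piecewise P F \<G> = {u. \<forall>E \<in> \<G>. \<exists>p \<in> P. AE x in lebesgue_on E. u x = p (F E x)}"

definition FE_V :: "(real^'d) set \<Rightarrow> (real^'d \<Rightarrow> real^'d) set \<Rightarrow> (real^'d \<Rightarrow> real^'d) set \<Rightarrow>
    ((real^'d) set \<Rightarrow> real^'d \<Rightarrow> real^'d) \<Rightarrow> 'd mesh \<Rightarrow> (real^'d \<Rightarrow> real^'d) set" where
  "FE_V \<Omega> VV PV F \<G> = {V \<in> VV \<inter> piecewise PV F \<G>. zero_boundary_values \<Omega> V}"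

definition FE_Q :: "(real^'d \<Rightarrow> real) set \<Rightarrow> (real^'d \<Rightarrow> real) set \<Rightarrow>
    ((real^'d) set \<Rightarrow> real^'d \<Rightarrow> real^'d) \<Rightarrow> 'd mesh \<Rightarrow> (real^'d \<Rightarrow> real) set" where
  "FE_Q QQ PQ F \<G> = QQ \<inter> piecewise PQ F \<G>"

definition piecewise_polys ::
  "nat \<Rightarrow> 'd mesh \<Rightarrow> 'b::real_vector set \<Rightarrow> (real^'d \<Rightarrow> 'b) set" where
  "piecewise_polys m \<G> X = piecewise {p \<in> polys m. range p \<subseteq> X} (\<lambda>E x. x) \<G>"

definition local_basis ::
  "(real^'d) set \<Rightarrow> 'd mesh \<Rightarrow> (real^'d \<Rightarrow> 'b::real_vector) set \<Rightarrow> (real^'d \<Rightarrow> 'b) set \<Rightarrow> bool" where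
  "local_basis \<Omega> \<G> X B \<longleftrightarrow> finite B \<and> B \<subseteq> X \<and>
     (\<forall>u \<in> X. \<exists>c. AE x in lebesgue_on \<Omega>. u x = (\<Sum>\<phi>\<in>B. c \<phi> *\<^sub>R \<phi> x)) \<and>
     (\<forall>c. (AE x in lebesgue_on \<Omega>. (\<Sum>\<phi>\<in>B. c \<phi> *\<^sub>R \<phi> x) = 0) \<longrightarrow> (\<forall>\<phi> \<in> B. c \<phi> = 0)) \<and>
     (\<forall>\<phi> \<in> B. \<forall>E \<in> \<G>. \<not> (AE x in lebesgue_on E. \<phi> x = 0) \<longrightarrow>
        (AE x in lebesgue_on (\<Omega> - patch \<G> E). \<phi> x = 0))"

definition linear_projection :: "(real^'d) set \<Rightarrow> (real^'d \<Rightarrow> 'b::real_vector) set \<Rightarrow>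
    (real^'d \<Rightarrow> 'b) set \<Rightarrow> ((real^'d \<Rightarrow> 'b) \<Rightarrow> real^'d \<Rightarrow> 'b) \<Rightarrow> bool" where
  "linear_projection \<Omega> X Y I \<longleftrightarrow>
     (\<forall>u \<in> X. I u \<in> Y) \<and>
     (\<forall>u \<in> Y. AE x in lebesgue_on \<Omega>. I u x = u x) \<and>
     (\<forall>u \<in> X. \<forall>v \<in> X. \<forall>a b. AE x in lebesgue_on \<Omega>.
        I (\<lambda>y. a *\<^sub>R u y + b *\<^sub>R v y) x = a *\<^sub>R I u x + b *\<^sub>R I v x) \<and>
     (\<forall>u \<in> X. \<forall>v \<in> X. (AE x in lebesgue_on \<Omega>. u x = v x) \<longrightarrow> (AE x in lebesgue_on \<Omega>. I u x = I v x))"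

definition div_projection :: "(real^'d) set \<Rightarrow> 'd mesh set \<Rightarrow>
    ('d mesh \<Rightarrow> (real^'d \<Rightarrow> real^'d) set) \<Rightarrow> ('d mesh \<Rightarrow> (real^'d \<Rightarrow> real) set) \<Rightarrow>
    ('d mesh \<Rightarrow> (real^'d \<Rightarrow> real^'d) \<Rightarrow> real^'d \<Rightarrow> real^'d) \<Rightarrow> real \<Rightarrow> bool" where
  "div_projection \<Omega> GG V Q J c1 \<longleftrightarrow> (\<forall>\<G> \<in> GG.
     linear_projection \<Omega> (W10 \<Omega> 1) (V \<G>) (J \<G>) \<and>
     (\<forall>s > 1. \<forall>v \<in> W10 \<Omega> s.
        (\<forall>q \<in> Q \<G>. (LINT x|lebesgue_on \<Omega>. q x * wdiv \<Omega> v x)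
                  = (LINT x|lebesgue_on \<Omega>. q x * wdiv \<Omega> (J \<G> v) x)) \<and>
        (\<forall>\<G>' \<in> GG. \<forall>E \<in> \<G>. neighbours \<G> E \<subseteq> \<G>' \<longrightarrow>
           (AE x in lebesgue_on (patch \<G> E). J \<G>' v x = J \<G> v x)) \<and>
        (\<forall>E \<in> \<G>.
           (LINT x|lebesgue_on E. norm (J \<G> v x) + hmesh \<G> x * norm (wgrad \<Omega> (J \<G> v) x))
           \<le> c1 * (LINT x|lebesgue_on (patch \<G> E). norm (v x) + hmesh \<G> x * norm (wgrad \<Omega> v x)))))"

definition local_L1_projection :: "(real^'d) set \<Rightarrow> 'd mesh set \<Rightarrow> (real^'d \<Rightarrow> 'b::euclidean_space) set \<Rightarrow>
    ('d mesh \<Rightarrow> (real^'d \<Rightarrow> 'b) set) \<Rightarrow> ('d mesh \<Rightarrow> (real^'d \<Rightarrow> 'b) \<Rightarrow> real^'d \<Rightarrow> 'b) \<Rightarrow> real \<Rightarrow> bool" where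
  "local_L1_projection \<Omega> GG X Y I c \<longleftrightarrow> (\<forall>\<G> \<in> GG.
     linear_projection \<Omega> X (Y \<G>) (I \<G>) \<and>
     (\<forall>u \<in> X. \<forall>E \<in> \<G>. (LINT x|lebesgue_on E. norm (I \<G> u x))
                       \<le> c * (LINT x|lebesgue_on (patch \<G> E). norm (u x))))"

definition discretization :: "(real^'d) set \<Rightarrow>
    (real^'d \<Rightarrow> real^'d) set \<Rightarrow> (real^'d \<Rightarrow> real) set \<Rightarrow> nat \<Rightarrow>
    ('d mesh \<Rightarrow> (real^'d \<Rightarrow> real^'d) \<Rightarrow> real^'d \<Rightarrow> real^'d) \<Rightarrow> real \<Rightarrow>
    ('d mesh \<Rightarrow> (real^'d \<Rightarrow> real^'d^'d) \<Rightarrow> real^'d \<Rightarrow> real^'d^'d) \<Rightarrow> real \<Rightarrow>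
    ('d mesh \<Rightarrow> (real^'d \<Rightarrow> real) \<Rightarrow> real^'d \<Rightarrow> real) \<Rightarrow> real \<Rightarrow>
    'd mesh \<Rightarrow> ('d mesh \<Rightarrow> (real^'d) set set \<Rightarrow> 'd mesh) \<Rightarrow>
    (real^'d \<Rightarrow> real^'d) set \<Rightarrow> (real^'d \<Rightarrow> real) set \<Rightarrow>
    ((real^'d) set \<Rightarrow> real^'d \<Rightarrow> real^'d) \<Rightarrow> bool" where
  "discretization \<Omega> PV PQ l J c1 Pr cP IQ cQ \<G>0 refine VV QQ F \<longleftrightarrow>
     conforming_partition \<Omega> \<G>0 \<and> refine_routine \<Omega> \<G>0 refine \<and>
     (\<exists>\<kappa>0. \<forall>\<G> \<in> meshes \<G>0 refine. shape_regular \<kappa>0 \<G>) \<and>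
     (\<forall>\<G> \<in> meshes \<G>0 refine. \<forall>E \<in> \<G>. affine_bijection (F E) E ref_simplex) \<and>
     class_space \<Omega> VV \<and> VV \<subseteq> W10_infty \<Omega> \<and> class_space \<Omega> QQ \<and> QQ \<subseteq> Linf \<Omega> \<and>
     (\<forall>\<G> \<in> meshes \<G>0 refine. \<forall>\<G>' \<in> meshes \<G>0 refine. bisection_refinement \<G> \<G>' \<longrightarrow>
        FE_V \<Omega> VV PV F \<G> \<subseteq> FE_V \<Omega> VV PV F \<G>' \<and> FE_Q QQ PQ F \<G> \<subseteq> FE_Q QQ PQ F \<G>') \<and>
     (\<forall>\<G> \<in> meshes \<G>0 refine. (\<exists>B. local_basis \<Omega> \<G> (FE_V \<Omega> VV PV F \<G>) B) \<and>
        (\<exists>B. local_basis \<Omega> \<G> (FE_Q QQ PQ F \<G>) B)) \<and>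
     div_projection \<Omega> (meshes \<G>0 refine) (FE_V \<Omega> VV PV F) (FE_Q QQ PQ F) J c1 \<and>
     local_L1_projection \<Omega> (meshes \<G>0 refine) (L1_sym \<Omega>)
        (\<lambda>\<G>. piecewise_polys (l - 1) \<G> sym_mats) Pr cP \<and>
     local_L1_projection \<Omega> (meshes \<G>0 refine) (Lp \<Omega> 1) (FE_Q QQ PQ F) IQ cQ"

definition stress_maps ::
  "(real^'d) set \<Rightarrow> real \<Rightarrow> (nat \<Rightarrow> real^'d \<Rightarrow> real^'d^'d \<Rightarrow> real^'d^'d) \<Rightarrow> bool" where
  "stress_maps \<Omega> r S \<longleftrightarrow>
     (\<forall>n. (\<forall>x \<in> \<Omega>. \<forall>\<delta> \<in> sym_mats. S n x \<delta> \<in> sym_mats) \<and>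
        (\<forall>\<delta> \<in> sym_mats. (\<lambda>x. S n x \<delta>) \<in> borel_measurable (lebesgue_on \<Omega>)) \<and>
        (AE x in lebesgue_on \<Omega>. continuous_on sym_mats (S n x)) \<and>
        (AE x in lebesgue_on \<Omega>. \<forall>\<delta>1 \<in> sym_mats. \<forall>\<delta>2 \<in> sym_mats. \<delta>1 \<noteq> \<delta>2 \<longrightarrow>
           (S n x \<delta>1 - S n x \<delta>2) \<bullet> (\<delta>1 - \<delta>2) > 0)) \<and>
     (\<exists>a1 > 0. \<exists>a2 > 0. \<exists>m \<in> Lp \<Omega> 1. \<exists>k \<in> Lp \<Omega> (conj_exp r).
        (AE x in lebesgue_on \<Omega>. 0 \<le> m x \<and> 0 \<le> k x) \<and>
        (\<forall>n. AE x in lebesgue_on \<Omega>. \<forall>\<delta> \<in> sym_mats.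
           norm (S n x \<delta>) \<le> a1 * norm \<delta> powr (r - 1) + k x \<and>
           S n x \<delta> \<bullet> \<delta> \<ge> a2 * norm \<delta> powr r - m x))"

definition convection :: "(real^'d) set \<Rightarrow> (real^'d \<Rightarrow> real^'d) \<Rightarrow> real^'d \<Rightarrow> real^'d" where
  "convection \<Omega> v x = (\<chi> j. 1/2 * (\<Sum>i\<in>UNIV.
     v x $ i * wpd \<Omega> i (\<lambda>y. v y $ j) x + wpd \<Omega> i (\<lambda>y. v y $ i * v y $ j) x))"

definition galerkin :: "(real^'d) set \<Rightarrow> (real^'d \<Rightarrow> real^'d) set \<Rightarrow> (real^'d \<Rightarrow> real) set \<Rightarrow>
    (real^'d \<Rightarrow> real^'d^'d \<Rightarrow> real^'d^'d) \<Rightarrow> (real^'d \<Rightarrow> real^'d) \<Rightarrow>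
    (real^'d \<Rightarrow> real^'d) \<Rightarrow> (real^'d \<Rightarrow> real) \<Rightarrow> bool" where
  "galerkin \<Omega> V Q S f U P \<longleftrightarrow> U \<in> V \<and> P \<in> Q \<inter> L10 \<Omega> \<and>
     (\<forall>w \<in> V. (LINT x|lebesgue_on \<Omega>. S x (sgrad \<Omega> U x) \<bullet> sgrad \<Omega> w x
                 + convection \<Omega> U x \<bullet> w x - P x * wdiv \<Omega> w x)
             = (LINT x|lebesgue_on \<Omega>. f x \<bullet> w x)) \<and>
     (\<forall>q \<in> Q. (LINT x|lebesgue_on \<Omega>. q x * wdiv \<Omega> U x) = 0)"

definition residual :: "(real^'d) set \<Rightarrow> (real^'d \<Rightarrow> real^'d) \<Rightarrow> (real^'d \<Rightarrow> real^'d) \<Rightarrow>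
    (real^'d \<Rightarrow> real) \<Rightarrow> (real^'d \<Rightarrow> real^'d^'d) \<Rightarrow> (real^'d \<Rightarrow> real^'d) \<Rightarrow> real" where
  "residual \<Omega> f v q T w = (LINT x|lebesgue_on \<Omega>.
     T x \<bullet> sgrad \<Omega> w x + convection \<Omega> v x \<bullet> w x - q x * wdiv \<Omega> w x - f x \<bullet> w x)"

definition outer_normal :: "(real^'d) set \<Rightarrow> (real^'d) set \<Rightarrow> real^'d" where
  "outer_normal E F = (THE \<nu>. norm \<nu> = 1 \<and> (\<forall>x \<in> F. \<forall>y \<in> E. \<nu> \<bullet> (y - x) \<le> 0))"

text \<open>Surface measure on a facet \<open>F\<close> of \<open>E\<close>: by Fubini, the \<open>(d-1)\<close>-dimensional measure of a subset of
  the flat set \<open>F\<close> is the \<open>d\<close>-dimensional measure of the right prism of height one above it.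
  The closest point map of the affine hull projects the prism orthogonally onto \<open>F\<close>.\<close>

definition facet_measure :: "(real^'d) set \<Rightarrow> (real^'d) set \<Rightarrow> (real^'d) measure" where
  "facet_measure E F =
     distr (lebesgue_on {x + s *\<^sub>R outer_normal E F | x s. x \<in> F \<and> 0 \<le> s \<and> s \<le> 1})
       borel (closest_point (affine hull F))"

definition boundary_norm ::
  "(real^'d) set \<Rightarrow> real \<Rightarrow> ((real^'d) set \<Rightarrow> real^'d \<Rightarrow> real^'d) \<Rightarrow> real" where
  "boundary_norm E s g =
     (\<Sum>F | F facet_of E. LINT x:F|facet_measure E F. norm (g F x) powr s) powr (1 / s)"

text \<open>One-sided trace of a piecewise polynomial: its continuous representative on the closed element.\<close>

definition elem_trace :: "(real^'d) set \<Rightarrow> (real^'d \<Rightarrow> 'b::real_normed_vector) \<Rightarrow> real^'d \<Rightarrow> 'b" where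
  "elem_trace E u = (SOME g. continuous_on E g \<and> (AE x in lebesgue_on E. u x = g x))"

text \<open>An interior side is a facet of exactly two elements, with opposite outer normals.\<close>

definition normal_jump :: "(real^'d) set \<Rightarrow> 'd mesh \<Rightarrow> (real^'d \<Rightarrow> real^'d^'d) \<Rightarrow>
    (real^'d) set \<Rightarrow> real^'d \<Rightarrow> real^'d" where
  "normal_jump \<Omega> \<G> T F x = (if rel_interior F \<subseteq> \<Omega>
     then (\<Sum>E | E \<in> \<G> \<and> F facet_of E. elem_trace E T x *v outer_normal E F) else 0)"

text \<open>Here \<open>PrS\<close> is the projection of the stress \<open>S\<close>. Elementwise derivatives are weak derivatives
  on the interior of the element.\<close>

definition indicator_pde :: "(real^'d) set \<Rightarrow> 'd mesh \<Rightarrow> (real^'d \<Rightarrow> real^'d) \<Rightarrow> real \<Rightarrow>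
    (real^'d \<Rightarrow> real^'d) \<Rightarrow> (real^'d \<Rightarrow> real) \<Rightarrow> (real^'d \<Rightarrow> real^'d^'d) \<Rightarrow> (real^'d \<Rightarrow> real^'d^'d) \<Rightarrow>
    (real^'d) set \<Rightarrow> real" where
  "indicator_pde \<Omega> \<G> f tt U P S PrS E =
     Lnorm E tt (\<lambda>x. hmesh \<G> x *\<^sub>R (- wdiv_tensor (interior E) PrS x + convection (interior E) U x
        + wgrad_scalar (interior E) P x - f x)) powr tt
     + boundary_norm E tt (\<lambda>F x. hmesh \<G> x powr (1 / tt) *\<^sub>R
         normal_jump \<Omega> \<G> (\<lambda>y. PrS y - P y *\<^sub>R mat 1) F x) powr tt
     + Lnorm E tt (\<lambda>x. S x - PrS x) powr tt"

definition osc :: "'d mesh \<Rightarrow> (real^'d \<Rightarrow> real^'d) \<Rightarrow> real \<Rightarrow> nat \<Rightarrow>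
    (real^'d \<Rightarrow> real^'d^'d) \<Rightarrow> (real^'d \<Rightarrow> real^'d^'d) \<Rightarrow> real" where
  "osc \<G> f tt l S PrS = (\<Sum>E\<in>\<G>.
     (INF fE \<in> polys (2 * l - 1). Lnorm E tt (\<lambda>x. hmesh \<G> x *\<^sub>R (f x - fE x)) powr tt)
     + Lnorm E tt (\<lambda>x. S x - PrS x) powr tt)"

end

theory Submission
  imports Defs
begin

text \<open>
  Integrating by parts on each element turns the residual into integrals of polynomial element residuals
  and side jumps, up to oscillation. A polynomial residual or jump \<open>p\<close> is bounded by testing with \<open>p\<close> times a
  smooth bump function supported in a ball, weighted by \<open>\<rho> * M powr (q - 2)\<close> with \<open>\<rho>\<close> the radius and \<open>M\<close>
  the root mean square of \<open>p\<close> near the ball. For element residuals the ball lies inside the element; for jumps it is centred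
  on the side and meets only the two adjacent elements. The radii are comparable to the mesh size by shape regularity,
  and on polynomials of bounded degree all norms over comparable balls are equivalent. The bubbles of all elements
  have disjoint supports, as have those of all sides, so each sum is a single test function, and its norm is absorbed
  by a weighted Young inequality.
\<close>

text \<open>The power of \<open>M\<close> is the duality map of \<open>L^q\<close>: a bubble has
  size about \<open>\<rho> * M powr (q - 1)\<close> and gradient about
  \<open>M powr (q - 1)\<close>, so that its energy with exponent \<open>conj_exp q\<close> and its
  pairing with the residual are both about \<open>\<rho> ^ d * M powr q\<close>. This balance is
  what allows absorption for every \<open>q > 1\<close>. Balls instead of products of barycentric
  coordinates keep integration by parts elementary: a bubble meets at most one hyperplane of the
  mesh, so Gauss' theorem for half-spaces is enough, and its boundary term comes out in the same
  prism form as the surface measure. Three points need care. The residual contains weak derivatives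
  on the whole domain, the indicator those on element interiors; both must be identified with
  derivatives of polynomials, which for products of velocity components needs a product rule. The
  Sobolev norm contains the function as well as its gradient, so the radius of the domain enters the
  constant. The infimum in the oscillation is only approached, with a mesh-dependent error that is
  sent to zero at the end.\<close>

abbreviation leb :: "'a::euclidean_space set \<Rightarrow> 'a measure" where
  "leb S \<equiv> lebesgue_on S"

type_synonym 'd sfield = "real^'d \<Rightarrow> real"
type_synonym 'd vfield = "real^'d \<Rightarrow> real^'d"
type_synonym 'd tfield = "real^'d \<Rightarrow> real^'d^'d"

abbreviation meas_on :: "'a::euclidean_space set \<Rightarrow> ('a \<Rightarrow> 'b::topological_space) set" where
  "meas_on S \<equiv> borel_measurable (leb S)"

section \<open>Smooth functions\<close>

lemma pd_eq:
  "(\<phi> has_derivative D) (at x) \<Longrightarrow> pd i \<phi> x = D (axis i 1)" by (simp add: pd_def frechet_derivative_at[symmetric])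

lemma has_derivative_pd:
  fixes \<phi> :: "real^'d \<Rightarrow> real"
  assumes "\<phi> differentiable (at x)"
  shows "(\<phi> has_derivative (\<lambda>h. \<Sum>i\<in>UNIV. h $ i * pd i \<phi> x)) (at x)"
proof -
  let ?D = "frechet_derivative \<phi> (at x)"
  have D: "(\<phi> has_derivative ?D) (at x)" using assms frechet_derivative_works by blast
  then have lin: "linear ?D" by (rule has_derivative_linear)
  have "?D h = (\<Sum>i\<in>UNIV. h $ i * pd i \<phi> x)" for h
  proof -
    have "?D h = ?D (\<Sum>i\<in>UNIV. h $ i *\<^sub>R axis i 1)" by (simp add: basis_expansion[of h, unfolded scalar_mult_eq_scaleR])
    also have "\<dots> = (\<Sum>i\<in>UNIV. h $ i * pd i \<phi> x)" by (simp add: linear_sum[OF lin] linear_cmul[OF lin] pd_def)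
    finally show ?thesis .
  qed
  then show ?thesis by (intro has_derivative_eq_rhs[OF D]) auto
qed

lemma pd_add:
  "f differentiable (at x) \<Longrightarrow> g differentiable (at x) \<Longrightarrow>
   pd i (\<lambda>x. f x + g x) x = pd i f x + pd i g x"
  by (rule pd_eq[THEN trans, OF has_derivative_add[OF has_derivative_pd has_derivative_pd]])
     (auto simp: axis_def if_distrib if_distribR cong: if_cong)

lemma pd_mult:
  "f differentiable (at x) \<Longrightarrow> g differentiable (at x) \<Longrightarrow>
   pd i (\<lambda>x. f x * g x) x = f x * pd i g x + pd i f x * g x"
  by (rule pd_eq[THEN trans, OF has_derivative_mult[OF has_derivative_pd has_derivative_pd]])
     (auto simp: axis_def if_distrib if_distribR cong: if_cong)

lemma pd_cmult:
  "f differentiable (at x) \<Longrightarrow> pd i (\<lambda>x. c * f x) x = c * pd i f x"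
  by (rule pd_eq[THEN trans, OF has_derivative_mult_right[OF has_derivative_pd]])
     (auto simp: axis_def if_distrib if_distribR cong: if_cong)

lemma Ck_differentiable: "Ck (Suc k) f \<Longrightarrow> f differentiable (at x)"
  by (auto simp: differentiable_on_eq_differentiable_at)

lemma Ck_Suc_imp: "Ck (Suc k) f \<Longrightarrow> Ck k f"
proof (induction k arbitrary: f)
  case 0
  then show ?case by (auto intro: differentiable_imp_continuous_on)
next
  case (Suc k)
  then show ?case by (metis Ck.simps(2))
qed

lemma Ck_continuous: "Ck k f \<Longrightarrow> continuous_on UNIV f"
  by (induction k) (auto dest: Ck_Suc_imp intro: differentiable_imp_continuous_on)

lemma Ck_add: "Ck k f \<Longrightarrow> Ck k g \<Longrightarrow> Ck k (\<lambda>x. f x + g x)"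
proof (induction k arbitrary: f g)
  case 0
  then show ?case by (auto intro: continuous_intros)
next
  case (Suc k)
  have "pd i (\<lambda>x. f x + g x) = (\<lambda>x. pd i f x + pd i g x)" for i using Suc.prems by (auto simp: pd_add Ck_differentiable)
  with Suc show ?case by (auto simp: differentiable_on_eq_differentiable_at)
qed

lemma Ck_mult: "Ck k f \<Longrightarrow> Ck k g \<Longrightarrow> Ck k (\<lambda>x. f x * g x)"
proof (induction k arbitrary: f g)
  case 0
  then show ?case by (auto intro: continuous_intros)
next
  case (Suc k)
  have "pd i (\<lambda>x. f x * g x) = (\<lambda>x. f x * pd i g x + pd i f x * g x)" for i
    using Suc.prems by (auto simp: pd_mult Ck_differentiable)
  moreover have "Ck k f" "Ck k g" using Suc.prems by (auto intro: Ck_Suc_imp simp del: Ck.simps)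
  ultimately show ?case using Suc by (auto simp: differentiable_on_eq_differentiable_at intro!: Ck_add)
qed

text \<open>\<open>flat 0\<close> is the classical \<open>exp (- 1 / s)\<close> extended by zero.
  The powers in the denominator are what differentiation produces, so the whole family is closed
  under derivatives.\<close>

definition flat :: "nat \<Rightarrow> real \<Rightarrow> real" where
  "flat k s = (if s \<le> 0 then 0 else exp (- 1 / s) / s ^ k)"

lemma flat_tendsto_right: "((\<lambda>h. exp (- 1 / h) / h ^ k) \<longlongrightarrow> (0::real)) (at_right 0)"
proof -
  have "((\<lambda>h::real. inverse h ^ k / exp (inverse h)) \<longlongrightarrow> 0) (at_right 0)"
    by (rule filterlim_compose[OF tendsto_power_div_exp_0 filterlim_inverse_at_top_right])
  then show ?thesis by (rule tendsto_cong[THEN iffD1, rotated])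
       (auto simp: exp_minus field_simps intro!: always_eventually)
qed

lemma flat_deriv: "(flat k has_real_derivative (flat (k + 2) s - k * flat (k + 1) s)) (at s)"
proof -
  consider "s < 0" | "s > 0" | "s = 0" by linarith
  then show ?thesis
  proof cases
    case 1
    have "((\<lambda>s. 0::real) has_real_derivative 0) (at s)" by simp
    then have "(flat k has_real_derivative 0) (at s)" by (rule has_field_derivative_transform_within_open[of _ _ _ "{..<0}"])
         (use 1 in \<open>auto simp: flat_def\<close>)
    then show ?thesis using 1 by (simp add: flat_def)
  next
    case 2
    have P: "((\<lambda>s. s ^ k) has_real_derivative real k * s ^ k / s) (at s)" using DERIV_pow[of k s] 2 by (cases k) auto
    have E: "((\<lambda>s. exp (- 1 / s)) has_real_derivative exp (- 1 / s) / s\<^sup>2) (at s)"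
      using 2 by (auto intro!: derivative_eq_intros simp: power2_eq_square)
    have "((\<lambda>s. exp (- 1 / s) / s ^ k) has_real_derivative (flat (k + 2) s - k * flat (k + 1) s)) (at s)"
      by (rule DERIV_cong[OF DERIV_divide[OF E P]])
         (use 2 in \<open>auto simp: flat_def field_simps power2_eq_square\<close>)
    then show ?thesis by (rule has_field_derivative_transform_within_open[of _ _ _ "{0<..}"])
         (use 2 in \<open>auto simp: flat_def\<close>)
  next
    case 3
    have L: "((\<lambda>h. (flat k (0 + h) - flat k 0) / h) \<longlongrightarrow> 0) (at_left 0)"
    proof (rule Lim_transform_eventually[OF tendsto_const])
      show "\<forall>\<^sub>F h in at_left 0. 0 = (flat k (0 + h) - flat k 0) / h" by (auto simp: eventually_at_filter flat_def)
    qed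
    \<comment> \<open>At the origin the right difference quotient is
      \<open>exp (- 1 / h) / h ^ (k + 1)\<close>, again of the form treated by
      \<open>flat_tendsto_right\<close>.\<close>
    have R: "((\<lambda>h. (flat k (0 + h) - flat k 0) / h) \<longlongrightarrow> 0) (at_right 0)"
    proof (rule Lim_transform_eventually[OF flat_tendsto_right[of "k + 1"]])
      show "\<forall>\<^sub>F h in at_right 0. exp (- 1 / h) / h ^ (k + 1) = (flat k (0 + h) - flat k 0) / h"
        by (auto simp: eventually_at_filter flat_def field_simps)
    qed
    have "((\<lambda>h. (flat k (0 + h) - flat k 0) / h) \<longlongrightarrow> 0) (at 0)" using L R by (rule filterlim_split_at)
    then show ?thesis using 3 by (simp add: DERIV_def flat_def)
  qed
qed

text \<open>A class of expressions rather than all smooth functions: it contains polynomials and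
  bumps and is closed under partial derivatives, which makes \<open>Ck k\<close> for every
  \<open>k\<close> an induction on \<open>k\<close>. All \<open>flat k\<close> are included since
  differentiating one leads to the next two.\<close>

inductive smooth :: "(real^'d \<Rightarrow> real) \<Rightarrow> bool" where
  smooth_const: "smooth (\<lambda>x. c)"
| smooth_coord: "smooth (\<lambda>x. x $ i)"
| smooth_add: "smooth u \<Longrightarrow> smooth v \<Longrightarrow> smooth (\<lambda>x. u x + v x)"
| smooth_mult: "smooth u \<Longrightarrow> smooth v \<Longrightarrow> smooth (\<lambda>x. u x * v x)"
| smooth_flat: "smooth u \<Longrightarrow> smooth (\<lambda>x. flat k (u x))"

lemma smooth_diff: "smooth u \<Longrightarrow> smooth v \<Longrightarrow> smooth (\<lambda>x. u x - v x)"
  using smooth_add[of u "\<lambda>x. -1 * v x"] smooth_mult[of "\<lambda>x. -1" v] smooth_const by auto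

lemma smooth_deriv:
  assumes "smooth u"
  shows "\<exists>D. (\<forall>x. (u has_derivative D x) (at x)) \<and> (\<forall>e. smooth (\<lambda>x. D x e))"
  using assms
proof induction
  case (smooth_const c)
  show ?case by (rule exI[of _ "\<lambda>x h. 0"]) (auto intro: smooth.intros)
next
  case (smooth_coord i)
  show ?case
    by (rule exI[of _ "\<lambda>x h. h $ i"]) (auto intro: smooth.intros bounded_linear_imp_has_derivative bounded_linear_vec_nth)
next
  case (smooth_add u v)
  then obtain D D' where "\<forall>x. (u has_derivative D x) (at x)" "\<forall>e. smooth (\<lambda>x. D x e)"
    "\<forall>x. (v has_derivative D' x) (at x)" "\<forall>e. smooth (\<lambda>x. D' x e)" by blast
  then show ?case by (intro exI[of _ "\<lambda>x h. D x h + D' x h"]) (auto intro: smooth.intros has_derivative_add)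
next
  case (smooth_mult u v)
  then obtain D D' where "\<forall>x. (u has_derivative D x) (at x)" "\<forall>e. smooth (\<lambda>x. D x e)"
    "\<forall>x. (v has_derivative D' x) (at x)" "\<forall>e. smooth (\<lambda>x. D' x e)" by blast
  then show ?case using smooth_mult(1,2)
    by (intro exI[of _ "\<lambda>x h. u x * D' x h + D x h * v x"])
       (auto intro!: smooth.intros(3,4) has_derivative_mult)
next
  case (smooth_flat u k)
  then obtain D where D: "\<forall>x. (u has_derivative D x) (at x)" "\<forall>e. smooth (\<lambda>x. D x e)" by blast
  have "((\<lambda>x. flat k (u x)) has_derivative
      (\<lambda>h. D x h * (flat (k + 2) (u x) - real k * flat (k + 1) (u x)))) (at x)" for x
    using has_derivative_compose[OF D(1)[rule_format]
        flat_deriv[of k "u x", unfolded has_field_derivative_def]]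
    by (simp add: mult.commute)
  then show ?case using D smooth_flat(1)
    by (intro exI[of _ "\<lambda>x h. D x h * (flat (k + 2) (u x) - real k * flat (k + 1) (u x))"])
       (auto intro!: smooth.intros smooth_diff)
qed

lemma smooth_differentiable: "smooth u \<Longrightarrow> u differentiable (at x)"
  using smooth_deriv differentiable_def by blast

lemma smooth_pd: assumes "smooth u" shows "smooth (pd i u)"
proof -
  obtain D where D: "\<forall>x. (u has_derivative D x) (at x)" "\<forall>e. smooth (\<lambda>x. D x e)" using smooth_deriv[OF assms] by blast
  have "pd i u = (\<lambda>x. D x (axis i 1))" using D by (auto intro: pd_eq)
  then show ?thesis using D by simp
qed

lemma smooth_continuous: "smooth u \<Longrightarrow> continuous_on UNIV u"
  by (meson smooth_differentiable differentiable_imp_continuous_on differentiable_on_eq_differentiable_at open_UNIV)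

lemma smooth_Ck: "smooth u \<Longrightarrow> Ck k u"
  by (induction k arbitrary: u)
     (auto simp: smooth_continuous smooth_pd smooth_differentiable differentiable_on_eq_differentiable_at)

lemma smooth_sum: "finite I \<Longrightarrow> (\<And>i. i \<in> I \<Longrightarrow> smooth (u i)) \<Longrightarrow> smooth (\<lambda>x. \<Sum>i\<in>I. u i x)"
  by (induction I rule: finite_induct) (auto intro: smooth.intros)

lemma smooth_prod: "finite I \<Longrightarrow> (\<And>i. i \<in> I \<Longrightarrow> smooth (u i)) \<Longrightarrow> smooth (\<lambda>x. \<Prod>i\<in>I. u i x)"
  by (induction I rule: finite_induct) (auto intro: smooth.intros)

lemma test_fun_smooth:
  assumes "smooth u" "\<And>x. x \<notin> K \<Longrightarrow> u x = 0" "compact K" "K \<subseteq> \<D>"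
  shows "test_fun \<D> u"
proof -
  have "closure {x. u x \<noteq> 0} \<subseteq> K" using assms by (intro closure_minimal) (auto dest: compact_imp_closed)
  then show ?thesis using assms smooth_Ck by (auto simp: test_fun_def compact_eq_bounded_closed intro: bounded_subset)
qed

lemma test_fun_mult_Ck:
  assumes "test_fun \<D> \<phi>" "\<And>k. Ck k u"
  shows "test_fun \<D> (\<lambda>x. u x * \<phi> x)"
proof -
  have "closure {x. u x * \<phi> x \<noteq> 0} \<subseteq> closure {x. \<phi> x \<noteq> 0}" by (intro closure_mono) auto
  then show ?thesis using assms by (auto simp: test_fun_def Ck_mult compact_eq_bounded_closed intro: bounded_subset)
qed

lemma test_fun_subset: "test_fun A \<phi> \<Longrightarrow> A \<subseteq> B \<Longrightarrow> test_fun B \<phi>"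
  by (auto simp: test_fun_def)

lemma test_fun_support:
  assumes "test_fun \<D> \<phi>"
  obtains K where "compact K" "K \<subseteq> \<D>" "\<And>x. x \<notin> K \<Longrightarrow> \<phi> x = 0"
proof (rule that[of "closure {x. \<phi> x \<noteq> 0}"])
  show "x \<notin> closure {x. \<phi> x \<noteq> 0} \<Longrightarrow> \<phi> x = 0" for x using closure_subset[of "{x. \<phi> x \<noteq> 0}"] by auto
qed (use assms in \<open>auto simp: test_fun_def\<close>)

lemma pd_eq_0_outside:
  assumes "closed K" "\<And>y. y \<notin> K \<Longrightarrow> \<phi> y = (0::real)" "x \<notin> K"
  shows "pd i \<phi> x = 0"
proof -
  have "((\<lambda>y. 0) has_derivative (\<lambda>h. 0)) (at x)" by simp
  then have "(\<phi> has_derivative (\<lambda>h. 0)) (at x)"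
    by (rule has_derivative_transform_within_open[of _ _ _ _ "- K"]) (use assms in auto)
  then show ?thesis by (rule pd_eq)
qed

lemma test_fun_pd_0:
  assumes "test_fun \<D> \<phi>" "x \<notin> \<D>"
  shows "\<phi> x = 0" "pd i \<phi> x = 0"
proof -
  obtain K where K: "compact K" "K \<subseteq> \<D>" "\<And>x. x \<notin> K \<Longrightarrow> \<phi> x = 0" using test_fun_support assms by blast
  then show "\<phi> x = 0" "pd i \<phi> x = 0" using assms by (auto intro!: pd_eq_0_outside[of K] dest: compact_imp_closed)
qed

section \<open>The divergence theorem on half-spaces\<close>

lemma integral_translate:
  fixes f :: "'a::euclidean_space \<Rightarrow> real"
  assumes [measurable]: "f \<in> borel_measurable borel"
  shows "(LINT x|lebesgue. f (x + a)) = (LINT x|lebesgue. f x)"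
proof -
  have "(\<integral>x. f (a + x) \<partial>lborel) = integral\<^sup>L (distr lborel borel ((+) a)) f" by (subst integral_distr) auto
  then show ?thesis by (simp add: integral_completion lborel_distr_plus add.commute)
qed

lemma integral_scale_translate:
  fixes f :: "'a::euclidean_space \<Rightarrow> real"
  assumes [measurable]: "f \<in> borel_measurable borel" and "c > 0"
  shows "(LINT x|lebesgue. f x) = c ^ DIM('a) * (LINT x|lebesgue. f (z + c *\<^sub>R x))"
proof -
  have "(\<integral>x. f x \<partial>lborel) = (\<integral>x. f x \<partial>density (distr lborel borel (\<lambda>x. z + c *\<^sub>R x)) (\<lambda>_. ennreal (abs c ^ DIM('a))))"
    using assms(2) lborel_affine[of c z] by simp
  also have "\<dots> = (\<integral>x. c ^ DIM('a) * f x \<partial>distr lborel borel (\<lambda>x. z + c *\<^sub>R x))" using assms(2) by (subst integral_density) auto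
  also have "\<dots> = (\<integral>x. c ^ DIM('a) * f (z + c *\<^sub>R x) \<partial>lborel)" by (subst integral_distr) auto
  finally show ?thesis by (simp add: integral_completion)
qed

lemma integrable_bounded_support:
  fixes f :: "'a::euclidean_space \<Rightarrow> real"
  assumes "f \<in> borel_measurable borel" "\<And>x. abs (f x) \<le> B" "\<And>x. x \<notin> cball 0 r \<Longrightarrow> f x = 0"
  shows "integrable lebesgue f"
proof (rule Bochner_Integration.integrable_bound)
  show "integrable lebesgue (\<lambda>x::'a. B * indicator (cball 0 r) x :: real)"
    using emeasure_bounded_finite[OF bounded_cball, of "0::'a" r]
    by (intro integrable_mult_right integrable_real_indicator) (auto simp: top.not_eq_extremum)
  show "f \<in> borel_measurable lebesgue" using assms(1) by (simp add: measurable_completion)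
  have "B \<ge> 0" using assms(2)[of 0] by linarith
  then have "norm (f x) \<le> norm (B * indicator (cball 0 r) x)" for x
    using assms(2)[of x] assms(3)[of x] by (cases "x \<in> cball 0 r") auto
  then show "AE x in lebesgue. norm (f x) \<le> norm (B * indicator (cball 0 r) x)" by simp
qed

text \<open>Half-open, so that stacked slabs tile without overlap.\<close>

abbreviation slab :: "'a::real_inner \<Rightarrow> real \<Rightarrow> real \<Rightarrow> 'a set" where
  "slab \<nu> a c \<equiv> {x. a < x \<bullet> \<nu> \<and> x \<bullet> \<nu> \<le> c}"

lemma borel_slab [measurable]: "slab \<nu> a c \<in> sets (borel :: 'a::euclidean_space measure)"
proof -
  have "slab \<nu> a c = {x. a < x \<bullet> \<nu>} \<inter> {x. x \<bullet> \<nu> \<le> c}" by auto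
  also have "\<dots> \<in> sets borel" by (intro sets.Int borel_open borel_closed)
       (auto intro!: open_Collect_less closed_Collect_le continuous_intros)
  finally show ?thesis .
qed

text \<open>The slab of height \<open>k * s\<close> is a stack of \<open>k\<close> translates of the
  first one along \<open>\<nu>\<close>, and \<open>h\<close> does not see such translations.\<close>

lemma slab_integral_multiple:
  fixes h :: "'a::euclidean_space \<Rightarrow> real"
  assumes [measurable]: "h \<in> borel_measurable borel" and "norm \<nu> = 1"
    and inv: "\<And>x s. h (x + s *\<^sub>R \<nu>) = h x"
    and int: "\<And>a c. integrable lebesgue (\<lambda>x. indicator (slab \<nu> a c) x * h x)"
    and "s \<ge> 0"
  shows "(LINT x|lebesgue. indicator (slab \<nu> b (b + real k * s)) x * h x)
    = real k * (LINT x|lebesgue. indicator (slab \<nu> b (b + s)) x * h x)"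
proof (induction k)
  case 0
  have "slab \<nu> b (b + real 0 * s) = {}" by auto
  then show ?case by simp
next
  case (Suc k)
  let ?t = "real k * s"
  have nn: "\<nu> \<bullet> \<nu> = 1" using assms(2) by (simp add: dot_square_norm)
  have t: "?t \<ge> 0" using assms by simp
  have "(LINT x|lebesgue. indicator (slab \<nu> b (b + real (Suc k) * s)) x * h x)
    = (LINT x|lebesgue. indicator (slab \<nu> b (b + ?t)) x * h x + indicator (slab \<nu> (b + ?t) (b + ?t + s)) x * h x)"
  proof (intro Bochner_Integration.integral_cong refl)
    have eq: "b + real (Suc k) * s = b + ?t + s" by (simp add: algebra_simps)
    have gen: "indicator (slab \<nu> b (b + t + s)) x * h x
      = indicator (slab \<nu> b (b + t)) x * h x + indicator (slab \<nu> (b + t) (b + t + s)) x * h x"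
      if "t \<ge> 0" for t x using that assms(5) by (auto simp: indicator_def)
    show "indicator (slab \<nu> b (b + real (Suc k) * s)) x * h x
      = indicator (slab \<nu> b (b + ?t)) x * h x + indicator (slab \<nu> (b + ?t) (b + ?t + s)) x * h x" for x
      unfolding eq by (rule gen[OF t])
  qed
  also have "\<dots> = (LINT x|lebesgue. indicator (slab \<nu> b (b + ?t)) x * h x)
      + (LINT x|lebesgue. indicator (slab \<nu> (b + ?t) (b + ?t + s)) x * h x)" by (intro Bochner_Integration.integral_add int)
  also have "(LINT x|lebesgue. indicator (slab \<nu> (b + ?t) (b + ?t + s)) x * h x)
      = (LINT x|lebesgue. indicator (slab \<nu> (b + ?t) (b + ?t + s)) (x + ?t *\<^sub>R \<nu>) * h (x + ?t *\<^sub>R \<nu>))"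
    by (rule integral_translate[symmetric]) measurable
  also have "\<dots> = (LINT x|lebesgue. indicator (slab \<nu> b (b + s)) x * h x)"
    by (intro Bochner_Integration.integral_cong) (auto simp: indicator_def inv inner_add_left nn)
  finally show ?case unfolding Suc.IH by (simp add: algebra_simps)
qed

text \<open>Stacking gives the claim for heights \<open>k / n\<close>. Since \<open>h\<close> is
  nonnegative the integral is monotone in the height, so a real height is squeezed between two such
  multiples with error \<open>F 1 / n\<close>.\<close>

lemma slab_integral_scale:
  fixes h :: "'a::euclidean_space \<Rightarrow> real"
  assumes h: "h \<in> borel_measurable borel" and \<nu>: "norm \<nu> = 1"
    and inv: "\<And>x s. h (x + s *\<^sub>R \<nu>) = h x"
    and int: "\<And>a c. integrable lebesgue (\<lambda>x. indicator (slab \<nu> a c) x * h x)"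
    and nonneg: "\<And>x. h x \<ge> 0" and "\<rho> \<ge> 0"
  shows "(LINT x|lebesgue. indicator (slab \<nu> b (b + \<rho>)) x * h x)
    = \<rho> * (LINT x|lebesgue. indicator (slab \<nu> b (b + 1)) x * h x)"
proof -
  define F where "F \<tau> = (LINT x|lebesgue. indicator (slab \<nu> b (b + \<tau>)) x * h x)" for \<tau>
  have mono: "F s \<le> F t" if "s \<le> t" for s t unfolding F_def using that
    by (intro integral_mono int) (auto simp: indicator_def nonneg)
  have mult: "F (real k * s) = real k * F s" if "s \<ge> 0" for k s
    unfolding F_def by (rule slab_integral_multiple[OF h \<nu> inv int that])
  have F1: "F 1 \<ge> 0" unfolding F_def by (intro integral_nonneg_AE) (auto simp: nonneg)
  have bd: "abs (F \<rho> - \<rho> * F 1) \<le> F 1 / real n" if n: "n > 0" for n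
  proof -
    define k where "k = nat \<lfloor>real n * \<rho>\<rfloor>"
    have k1: "real k \<le> real n * \<rho>" "real n * \<rho> \<le> real (Suc k)"
      unfolding k_def using assms(6) by (auto simp: of_nat_floor) linarith
    have k: "real k * (1 / real n) \<le> \<rho>" "\<rho> \<le> real (Suc k) * (1 / real n)" using k1 n by (simp_all add: field_simps)
    have Fn: "F 1 = real n * F (1 / real n)" using mult[of "1 / real n" n] n by simp
    have a: "real k * F (1 / real n) \<le> F \<rho>" using mono[OF k(1)] mult[of "1 / real n" k] by simp
    have b: "F \<rho> \<le> real (Suc k) * F (1 / real n)" using mono[OF k(2)] mult[of "1 / real n" "Suc k"] by (simp del: of_nat_Suc)
    define q where "q = F (1 / real n)"
    have q: "q \<ge> 0" "F 1 = real n * q" using Fn F1 n by (auto simp: q_def zero_le_mult_iff)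
    have c: "real k * q \<le> real n * \<rho> * q" "real n * \<rho> * q \<le> (real k + 1) * q"
      using k1 q by (auto intro!: mult_right_mono simp: add.commute)
    have "F 1 / real n = q" using q n by simp
    then show ?thesis using a b c q unfolding q_def[symmetric] q(2)
      by (simp add: algebra_simps abs_le_iff)
  qed
  have "(\<lambda>n. F 1 / real n) \<longlonglongrightarrow> 0" using tendsto_mult_right_zero[OF lim_1_over_n, of "F 1"] by simp
  then have "abs (F \<rho> - \<rho> * F 1) \<le> 0" by (rule tendsto_lowerbound) (auto intro!: eventually_sequentiallyI[of 1] bd)
  then show ?thesis by (simp add: F_def)
qed

lemma compact_support_bounded:
  fixes f :: "'a::euclidean_space \<Rightarrow> real"
  assumes "continuous_on UNIV f" "\<And>x. x \<notin> cball 0 r \<Longrightarrow> f x = 0"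
  obtains B where "B \<ge> 0" "\<And>x. abs (f x) \<le> B"
proof -
  have "bounded (f ` cball 0 r)"
    using assms(1) by (intro compact_imp_bounded compact_continuous_image) (auto intro: continuous_on_subset)
  then obtain B where B: "\<And>x. x \<in> cball 0 r \<Longrightarrow> abs (f x) \<le> B" unfolding bounded_iff by fastforce
  show ?thesis
  proof (rule that[of "max B 0"])
    show "abs (f x) \<le> max B 0" for x using B[of x] assms(2)[of x] by (cases "x \<in> cball 0 r") auto
  qed auto
qed

lemma integrable_compact_support:
  fixes f :: "'a::euclidean_space \<Rightarrow> real"
  assumes f: "continuous_on UNIV f" "\<And>x. x \<notin> cball z r \<Longrightarrow> f x = 0"
  shows "integrable lebesgue f"
proof -
  have 0: "x \<notin> cball 0 (norm z + r) \<Longrightarrow> f x = 0" for x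
    using norm_triangle_ineq2[of x z] by (intro f(2)) (auto simp: dist_norm norm_minus_commute)
  obtain B where "\<And>x. abs (f x) \<le> B" using compact_support_bounded[OF f(1) 0] by blast
  then show ?thesis by (rule integrable_bounded_support[OF borel_measurable_continuous_onI[OF f(1)] _ 0])
qed

lemma line_derivative:
  fixes g :: "real^'d \<Rightarrow> real"
  assumes "\<And>x. g differentiable (at x)"
  shows "((\<lambda>s. g (x + s *\<^sub>R h)) has_real_derivative (\<Sum>i\<in>UNIV. h $ i * pd i g (x + s *\<^sub>R h))) (at s)"
proof -
  have "((\<lambda>s. x + s *\<^sub>R h) has_derivative (\<lambda>s. s *\<^sub>R h)) (at s)" by (auto intro!: derivative_eq_intros)
  from has_derivative_compose[OF this has_derivative_pd[OF assms]]
  show ?thesis by (rule has_derivative_imp_has_field_derivative) (simp add: sum_distrib_left mult_ac)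
qed

lemma Ck1_lipschitz:
  fixes g :: "real^'d \<Rightarrow> real"
  assumes "Ck 1 g" "\<And>x. x \<notin> cball 0 r \<Longrightarrow> g x = 0"
  obtains L where "L \<ge> 0" "\<And>x h. abs (g (x + h) - g x) \<le> L * norm h" "\<And>x i. abs (pd i g x) \<le> L"
proof -
  have diff: "g differentiable (at x)" for x using Ck_differentiable[of 0 g] assms(1) by simp
  have "\<exists>B\<ge>0. \<forall>x. abs (pd i g x) \<le> B" for i
  proof -
    have "continuous_on UNIV (pd i g)" using assms(1) by simp
    then show ?thesis
      using compact_support_bounded[of "pd i g" r] pd_eq_0_outside[of "cball 0 r" g] assms(2) by (metis closed_cball)
  qed
  then obtain B where B: "\<And>i. B i \<ge> 0" "\<And>i x. abs (pd i g x) \<le> B i" by metis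
  define L where "L = (\<Sum>i\<in>UNIV. B i)"
  show ?thesis
  proof (rule that)
    show "L \<ge> 0" by (simp add: L_def B sum_nonneg)
    show "abs (pd i g x) \<le> L" for x i using B(2)[of i x] member_le_sum[of i UNIV B] B(1) by (simp add: L_def)
    show "abs (g (x + h) - g x) \<le> L * norm h" for x h
    proof -
      obtain s where s: "g (x + 1 *\<^sub>R h) - g (x + 0 *\<^sub>R h) = (1 - 0) * (\<Sum>i\<in>UNIV. h $ i * pd i g (x + s *\<^sub>R h))"
        using MVT2[of 0 1 "\<lambda>s. g (x + s *\<^sub>R h)" "\<lambda>s. \<Sum>i\<in>UNIV. h $ i * pd i g (x + s *\<^sub>R h)"]
          line_derivative[OF diff] by auto
      have "abs (\<Sum>i\<in>UNIV. h $ i * pd i g (x + s *\<^sub>R h)) \<le> (\<Sum>i\<in>UNIV. norm h * B i)" by (intro order_trans[OF sum_abs] sum_mono)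
           (auto simp: abs_mult intro!: mult_mono B component_le_norm_cart)
      then show ?thesis using s by (simp add: L_def sum_distrib_left mult.commute)
    qed
  qed
qed

text \<open>The boundary integral over the hyperplane appears as an integral over the slab of height one
  above it. The proof integrates difference quotients in the direction \<open>i\<close>: by translation
  invariance only the integral over a thin slab survives.\<close>

lemma half_space_divergence:
  fixes g :: "real^'d \<Rightarrow> real"
  assumes g: "Ck 1 g" and supp: "\<And>x. x \<notin> cball 0 r \<Longrightarrow> g x = 0" and \<nu>: "norm \<nu> = 1"
  shows "(LINT x|lebesgue. indicator {x. x \<bullet> \<nu> \<le> b} x * pd i g x)
    = \<nu> $ i * (LINT x|lebesgue. indicator (slab \<nu> b (b + 1)) x * g (x - (x \<bullet> \<nu> - b) *\<^sub>R \<nu>))"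
proof -
  have nn: "\<nu> \<bullet> \<nu> = 1" using \<nu> by (simp add: dot_square_norm)
  have diff: "g differentiable (at x)" for x using Ck_differentiable[of 0 g] g by simp
  have contg: "continuous_on UNIV g" using g Ck_continuous by blast
  then have gm[measurable]: "g \<in> borel_measurable borel" by (rule borel_measurable_continuous_onI)
  have pm[measurable]: "pd i g \<in> borel_measurable borel" using g by (intro borel_measurable_continuous_onI) simp
  obtain L where L: "L \<ge> 0" "\<And>x h. abs (g (x + h) - g x) \<le> L * norm h" "\<And>x i. abs (pd i g x) \<le> L"
    using Ck1_lipschitz[OF g supp] by blast
  obtain G where G: "\<And>x. abs (g x) \<le> G" using compact_support_bounded[OF contg supp] by blast
  define H where "H c = {x::real^'d. x \<bullet> \<nu> \<le> c}" for c
  have Hm[measurable]: "H c \<in> sets borel" for c unfolding H_def by (intro borel_closed closed_Collect_le continuous_intros)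
  define e :: "real^'d" where "e = axis i 1"
  have ne: "norm e = 1" by (simp add: e_def)
  have e\<nu>: "e \<bullet> \<nu> = \<nu> $ i" by (simp add: e_def inner_axis inner_commute)
  \<comment> \<open>The steps \<open>t n\<close> are normalised so that moving by \<open>t n\<close>
    in direction \<open>i\<close> lifts the hyperplane by exactly \<open>1 / (n + 1)\<close>. If the
    direction is parallel to the hyperplane, any nonzero step will do.\<close>
  define c where "c = (if \<nu> $ i = 0 then 1 else 1 / \<nu> $ i)"
  define t where "t n = c / real (Suc n)" for n
  have c0: "c \<noteq> 0" by (simp add: c_def)
  have t0: "t n \<noteq> 0" "abs (t n) \<le> abs c" for n using c0 by (simp_all add: t_def field_simps abs_mult divide_le_eq)
  have intg: "integrable lebesgue (\<lambda>x. indicator (H c) x * g x)" for c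
    by (rule integrable_bounded_support[where B = G and r = r]) (use G supp order_trans[OF abs_ge_zero G] in \<open>auto simp: indicator_def\<close>)
  define Q where "Q n = (LINT x|lebesgue. indicator (H b) x * ((g (x + t n *\<^sub>R e) - g x) / t n))" for n
  have lim1: "Q \<longlonglongrightarrow> (LINT x|lebesgue. indicator (H b) x * pd i g x)" unfolding Q_def
  proof (rule integral_dominated_convergence[where w = "\<lambda>x. L * indicator (cball 0 (r + abs c)) x"])
    show "(\<lambda>x. indicator (H b) x * pd i g x) \<in> borel_measurable lebesgue" by (rule measurable_completion) measurable
    show "(\<lambda>x. indicator (H b) x * ((g (x + t n *\<^sub>R e) - g x) / t n)) \<in> borel_measurable lebesgue" for n
      by (rule measurable_completion) measurable
    show "integrable lebesgue (\<lambda>x. L * indicator (cball 0 (r + abs c)) x :: real)"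
      by (rule integrable_bounded_support[where B = L and r = "r + abs c"]) (use L in \<open>auto simp: indicator_def\<close>)
    show "AE x in lebesgue. (\<lambda>n. indicator (H b) x * ((g (x + t n *\<^sub>R e) - g x) / t n))
         \<longlonglongrightarrow> indicator (H b) x * pd i g x"
    proof (rule AE_I2)
      fix x
      have "((\<lambda>s. g (x + s *\<^sub>R e)) has_real_derivative pd i g x) (at 0)"
        using line_derivative[OF diff, of x e 0] by (simp add: e_def axis_def if_distrib if_distribR cong: if_cong)
      then have d: "((\<lambda>h. (g (x + h *\<^sub>R e) - g x) / h) \<longlongrightarrow> pd i g x) (at 0)" by (simp add: DERIV_def)
      have "t \<longlonglongrightarrow> 0" unfolding t_def using tendsto_mult_right_zero[OF LIMSEQ_Suc[OF lim_1_over_n], of c] by simp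
      then have "filterlim t (at 0) sequentially" using t0 by (auto simp: filterlim_at)
      then have "(\<lambda>n. (g (x + t n *\<^sub>R e) - g x) / t n) \<longlonglongrightarrow> pd i g x" by (rule filterlim_compose[OF d])
      then show "(\<lambda>n. indicator (H b) x * ((g (x + t n *\<^sub>R e) - g x) / t n))
         \<longlonglongrightarrow> indicator (H b) x * pd i g x" by (intro tendsto_intros)
    qed
    show "AE x in lebesgue. norm (indicator (H b) x * ((g (x + t n *\<^sub>R e) - g x) / t n))
           \<le> L * indicator (cball 0 (r + abs c)) x" for n
    proof (rule AE_I2)
      fix x
      have 1: "abs ((g (x + t n *\<^sub>R e) - g x) / t n) \<le> L" using L(2)[of x "t n *\<^sub>R e"] t0[of n] ne by (simp add: divide_le_eq)
      have 2: "g (x + t n *\<^sub>R e) = 0 \<and> g x = 0" if "x \<notin> cball 0 (r + abs c)"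
      proof -
        have "norm x > r + abs c" using that by simp
        moreover have "norm (x + t n *\<^sub>R e) \<ge> norm x - abs (t n)" using norm_diff_ineq[of x "t n *\<^sub>R e"] ne by simp
        ultimately show ?thesis using t0(2)[of n] by (auto intro!: supp)
      qed
      show "norm (indicator (H b) x * ((g (x + t n *\<^sub>R e) - g x) / t n))
           \<le> L * indicator (cball 0 (r + abs c)) x" using 1 2 L(1) by (auto simp: indicator_def simp del: abs_divide)
    qed
  qed
  have Q: "Q n = ((LINT x|lebesgue. indicator (H (b + t n * \<nu> $ i)) x * g x) - (LINT x|lebesgue. indicator (H b) x * g x)) / t n" for n
  proof -
    have sh: "indicator (H b) x * g (x + t n *\<^sub>R e) = indicator (H (b + t n * \<nu> $ i)) (x + t n *\<^sub>R e) * g (x + t n *\<^sub>R e)" for x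
      by (auto simp: indicator_def H_def inner_add_left e\<nu>)
    have "integrable lebesgue (\<lambda>x. indicator (H b) x * g (x + t n *\<^sub>R e))"
    proof (rule integrable_bounded_support[where B = G and r = "r + abs (t n)"])
      show "indicator (H b) x * g (x + t n *\<^sub>R e) = 0" if "x \<notin> cball 0 (r + abs (t n))" for x
        using that norm_diff_ineq[of x "t n *\<^sub>R e"] ne by (auto intro!: supp)
      show "abs (indicator (H b) x * g (x + t n *\<^sub>R e)) \<le> G" for x using G[of "x + t n *\<^sub>R e"] by (auto simp: indicator_def)
    qed measurable
    then have "Q n = ((LINT x|lebesgue. indicator (H b) x * g (x + t n *\<^sub>R e)) - (LINT x|lebesgue. indicator (H b) x * g x)) / t n"
      unfolding Q_def using intg[of b]
      by (simp add: right_diff_distrib diff_divide_distrib times_divide_eq_right)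
    also have "(LINT x|lebesgue. indicator (H b) x * g (x + t n *\<^sub>R e)) = (LINT x|lebesgue. indicator (H (b + t n * \<nu> $ i)) x * g x)"
      unfolding sh by (rule integral_translate) measurable
    finally show ?thesis .
  qed
  show ?thesis
  proof (cases "\<nu> $ i = 0")
    case True
    then have "Q = (\<lambda>n. 0)" by (auto simp: Q)
    with lim1 have "(LINT x|lebesgue. indicator (H b) x * pd i g x) = 0" by (simp add: LIMSEQ_const_iff)
    with True show ?thesis by (simp add: H_def)
  next
    case False
    have tau: "t n * \<nu> $ i = 1 / real (Suc n)" "1 / t n = \<nu> $ i * real (Suc n)" for n using False by (simp_all add: t_def c_def)
    define h where "h x = g (x - (x \<bullet> \<nu> - b) *\<^sub>R \<nu>)" for x
    have hm[measurable]: "h \<in> borel_measurable borel"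
      unfolding h_def by (intro borel_measurable_continuous_onI continuous_on_compose2[OF contg]) (auto intro!: continuous_intros)
    have hG: "abs (h x) \<le> G" for x by (simp add: h_def G)
    have h0: "h x = 0" if "norm x > r + abs (x \<bullet> \<nu> - b)" for x
    proof -
      have "norm (x - (x \<bullet> \<nu> - b) *\<^sub>R \<nu>) \<ge> norm x - abs (x \<bullet> \<nu> - b)"
        using norm_triangle_ineq2[of x "(x \<bullet> \<nu> - b) *\<^sub>R \<nu>"] \<nu> by simp
      with that show ?thesis by (auto simp: h_def intro!: supp)
    qed
    have hint: "integrable lebesgue (\<lambda>x. indicator (slab \<nu> a c) x * h x)" for a c
    proof (rule integrable_bounded_support[where B = G and r = "r + abs (a - b) + abs (c - b)"])
      show "abs (indicator (slab \<nu> a c) x * h x) \<le> G" for x using hG[of x] by (auto simp: indicator_def)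
      show "indicator (slab \<nu> a c) x * h x = 0" if "x \<notin> cball 0 (r + abs (a - b) + abs (c - b))" for x
        using that h0[of x] by (auto simp: indicator_def)
    qed measurable
    have inv: "h (x + s *\<^sub>R \<nu>) = h x" for x s by (simp add: h_def inner_add_left nn algebra_simps)
    define S where "S n = slab \<nu> b (b + 1 / real (Suc n))" for n
    have Sm[measurable]: "S n \<in> sets borel" for n unfolding S_def by measurable
    have mh: "(LINT x|lebesgue. indicator (slab \<nu> b (b + 1)) x * h x)
        = real (Suc n) * (LINT x|lebesgue. indicator (S n) x * h x)" for n
      using slab_integral_multiple[OF hm \<nu> inv hint, of "1 / real (Suc n)" b "Suc n"] by (simp add: S_def del: of_nat_Suc)
    have gint: "integrable lebesgue (\<lambda>x. indicator (S n) x * g x)" for n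
      by (rule integrable_bounded_support[where B = G and r = r]) (use G supp order_trans[OF abs_ge_zero G] in \<open>auto simp: indicator_def\<close>)
    have Q': "Q n = \<nu> $ i * (real (Suc n) * (LINT x|lebesgue. indicator (S n) x * g x))" for n
    proof -
      have "(LINT x|lebesgue. indicator (S n) x * g x)
        = (LINT x|lebesgue. indicator (H (b + 1 / real (Suc n))) x * g x - indicator (H b) x * g x)"
        by (intro Bochner_Integration.integral_cong)
           (auto simp: indicator_def H_def S_def simp del: of_nat_Suc intro: add_increasing2)
      also have "\<dots> = (LINT x|lebesgue. indicator (H (b + 1 / real (Suc n))) x * g x) - (LINT x|lebesgue. indicator (H b) x * g x)"
        by (intro Bochner_Integration.integral_diff intg)
      finally show ?thesis unfolding Q tau(1) mult.assoc[symmetric] tau(2)[symmetric] by simp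
    qed
    \<comment> \<open>\<open>D n\<close> measures the cost of replacing \<open>g\<close> on a thin
      slab by its value at the foot point. By the Lipschitz bound this is at most
      \<open>L / (n + 1)\<close> pointwise, so after multiplication by \<open>n + 1\<close> only
      \<open>L\<close> times the volume of the slab inside a ball is left, and these slabs shrink to
      the empty set.\<close>
    define D where "D n = real (Suc n) * (LINT x|lebesgue. indicator (S n) x * g x) - (LINT x|lebesgue. indicator (slab \<nu> b (b + 1)) x * h x)" for n
    define m where "m n = (LINT x|lebesgue. L * indicator (S n \<inter> cball 0 (r + 1)) x)" for n
    have mint: "integrable lebesgue (\<lambda>x. L * indicator (S n \<inter> cball 0 (r + 1)) x :: real)" for n
      by (rule integrable_bounded_support[where B = L and r = "r + 1"]) (use L in \<open>auto simp: indicator_def\<close>)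
    have bd: "abs (D n) \<le> m n" for n
    proof -
      have dint: "integrable lebesgue (\<lambda>x. real (Suc n) * (indicator (S n) x * g x - indicator (S n) x * h x))"
        using gint hint unfolding S_def by (intro integrable_mult_right Bochner_Integration.integrable_diff)
      have "D n = (LINT x|lebesgue. real (Suc n) * (indicator (S n) x * g x - indicator (S n) x * h x))"
        unfolding D_def mh[of n] using gint[of n] hint[of b "b + 1 / real (Suc n)"]
        by (simp add: S_def right_diff_distrib del: of_nat_Suc)
      also have "abs \<dots> \<le> m n" unfolding m_def
      proof (rule integral_abs_bound_integral[OF dint mint])
        fix x
        show "abs (real (Suc n) * (indicator (S n) x * g x - indicator (S n) x * h x)) \<le> L * indicator (S n \<inter> cball 0 (r + 1)) x"
        proof (cases "x \<in> S n \<and> norm x \<le> r + 1")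
          case True
          then have s: "abs (x \<bullet> \<nu> - b) \<le> 1 / real (Suc n)" by (auto simp: S_def simp del: of_nat_Suc)
          have "abs (g x - h x) \<le> L * abs (x \<bullet> \<nu> - b)"
            using L(2)[of x "- ((x \<bullet> \<nu> - b) *\<^sub>R \<nu>)"] \<nu> by (simp add: h_def abs_minus_commute)
          also have "\<dots> \<le> L * (1 / real (Suc n))" by (intro mult_left_mono s L)
          finally have "real (Suc n) * abs (g x - h x) \<le> L" by (simp add: field_simps del: of_nat_Suc)
          then show ?thesis using True by (simp add: abs_mult del: of_nat_Suc)
        next
          case False
          have "g x = 0 \<and> h x = 0" if "x \<in> S n"
          proof -
            have "1 / real (Suc n) \<le> 1" by simp
            moreover have "0 < x \<bullet> \<nu> - b" "x \<bullet> \<nu> - b \<le> 1 / real (Suc n)"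
              using that unfolding S_def by (auto simp del: of_nat_Suc)
            ultimately have "abs (x \<bullet> \<nu> - b) \<le> 1" by linarith
            moreover have "norm x > r + 1" using False that by auto
            ultimately show ?thesis using h0[of x] supp[of x] by auto
          qed
          then show ?thesis using L(1) by (auto simp: indicator_def)
        qed
      qed
      finally show ?thesis .
    qed
    have "m \<longlonglongrightarrow> (\<integral>x. 0 \<partial>(lebesgue :: (real^'d) measure))" unfolding m_def
    proof (rule integral_dominated_convergence[where w = "\<lambda>x. L * indicator (cball 0 (r + 1)) x"])
      show "(\<lambda>x. L * indicator (S n \<inter> cball 0 (r + 1)) x :: real) \<in> borel_measurable lebesgue" for n
        using mint by (rule borel_measurable_integrable)
      show "integrable lebesgue (\<lambda>x::real^'d. L * indicator (cball 0 (r + 1)) x :: real)"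
        by (rule integrable_bounded_support[where B = L and r = "r + 1"]) (use L in \<open>auto simp: indicator_def\<close>)
      show "AE x in lebesgue. (\<lambda>n. L * indicator (S n \<inter> cball 0 (r + 1)) x :: real) \<longlonglongrightarrow> 0"
      proof (rule AE_I2)
        fix x :: "real^'d"
        have "\<forall>\<^sub>F n in sequentially. x \<notin> S n"
        proof (cases "x \<bullet> \<nu> > b")
          case True
          then obtain N where N: "1 / real (Suc N) < x \<bullet> \<nu> - b"
            using reals_Archimedean[of "x \<bullet> \<nu> - b"] by (auto simp: inverse_eq_divide)
          have "x \<notin> S n" if "n \<ge> N" for n
          proof -
            have "1 / real (Suc n) \<le> 1 / real (Suc N)" using that by (simp add: frac_le)
            then show ?thesis using N by (auto simp: S_def simp del: of_nat_Suc)
          qed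
          then show ?thesis by (auto simp: eventually_sequentially)
        qed (auto simp: S_def)
        then have "\<forall>\<^sub>F n in sequentially. 0 = (L * indicator (S n \<inter> cball 0 (r + 1)) x :: real)" by eventually_elim auto
        then show "(\<lambda>n. L * indicator (S n \<inter> cball 0 (r + 1)) x :: real) \<longlonglongrightarrow> 0"
          by (rule Lim_transform_eventually[OF tendsto_const])
      qed
      show "AE x in lebesgue. norm (L * indicator (S n \<inter> cball 0 (r + 1)) x) \<le> L * indicator (cball 0 (r + 1)) x" for n
        using L(1) by (intro AE_I2) (auto simp: indicator_def)
    qed auto
    then have m0: "m \<longlonglongrightarrow> 0" by simp
    have D0: "D \<longlonglongrightarrow> 0" by (rule Lim_null_comparison[OF _ m0]) (simp add: bd)
    have "(\<lambda>n. \<nu> $ i * (D n + (LINT x|lebesgue. indicator (slab \<nu> b (b + 1)) x * h x))) \<longlonglongrightarrow> \<nu> $ i * (0 + (LINT x|lebesgue. indicator (slab \<nu> b (b + 1)) x * h x))"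
      by (intro tendsto_intros D0)
    then have "Q \<longlonglongrightarrow> \<nu> $ i * (LINT x|lebesgue. indicator (slab \<nu> b (b + 1)) x * h x)" by (simp add: D_def Q'[abs_def] fun_eq_iff)
    with lim1 show ?thesis unfolding H_def h_def using LIMSEQ_unique by blast
  qed
qed

text \<open>The half-space formula is applied with a half-space so large that it contains the
  support and that its bounding plane, at distance \<open>abs r + 1\<close> from the origin, misses
  it.\<close>

lemma integral_pd_compact_support:
  fixes g :: "real^'d \<Rightarrow> real"
  assumes g: "Ck 1 g" and supp: "\<And>x. x \<notin> cball 0 r \<Longrightarrow> g x = 0"
  shows "(LINT x|lebesgue. pd i g x) = 0"
proof -
  obtain \<nu> :: "real^'d" where \<nu>: "norm \<nu> = 1" using vector_choose_size[of 1] by auto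
  have b: "abs (x \<bullet> \<nu>) \<le> norm x" for x using Cauchy_Schwarz_ineq2[of x \<nu>] \<nu> by simp
  have 1: "indicator {x. x \<bullet> \<nu> \<le> abs r} x * pd i g x = pd i g x" for x
    using pd_eq_0_outside[of "cball 0 r" g x] supp b[of x] by (auto simp: indicator_def)
  have 2: "indicator (slab \<nu> (abs r + 1) (abs r + 1 + 1)) x * g (x - (x \<bullet> \<nu> - (abs r + 1)) *\<^sub>R \<nu>) = 0" for x
  proof -
    have "(x - (x \<bullet> \<nu> - (abs r + 1)) *\<^sub>R \<nu>) \<bullet> \<nu> = abs r + 1" using \<nu> by (simp add: inner_diff_left dot_square_norm)
    then have "norm (x - (x \<bullet> \<nu> - (abs r + 1)) *\<^sub>R \<nu>) > r" using b[of "x - (x \<bullet> \<nu> - (abs r + 1)) *\<^sub>R \<nu>"] by linarith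
    then show ?thesis by (simp add: supp)
  qed
  have 3: "indicator {x. x \<bullet> \<nu> \<le> abs r + 1} x * pd i g x = pd i g x" for x
    using 1[of x] by (auto simp: indicator_def split: if_splits)
  show ?thesis using half_space_divergence[OF g supp \<nu>, where b = "abs r + 1" and i = i] unfolding 2 3 by simp
qed

section \<open>Polynomials on balls\<close>

text \<open>Generation instead of multi-index sums: every closure property becomes an induction. The
  index is only an upper bound for the degree.\<close>

inductive polyd :: "nat \<Rightarrow> (real^'d \<Rightarrow> real) \<Rightarrow> bool" where
  polyd_const: "polyd m (\<lambda>x. c)"
| polyd_add: "polyd m p \<Longrightarrow> polyd m q \<Longrightarrow> polyd m (\<lambda>x. p x + q x)"
| polyd_times: "polyd m p \<Longrightarrow> polyd (Suc m) (\<lambda>x. x $ i * p x)"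

lemma polyd_mono: "polyd m p \<Longrightarrow> m \<le> n \<Longrightarrow> polyd n p"
proof (induction arbitrary: n rule: polyd.induct)
  case (polyd_times m p i)
  then obtain n' where "n = Suc n'" "m \<le> n'" by (cases n) auto
  with polyd_times show ?case by (auto intro: polyd.intros)
qed (auto intro: polyd.intros)

lemma polyd_cmult: "polyd m p \<Longrightarrow> polyd m (\<lambda>x. c * p x)"
proof (induction rule: polyd.induct)
  case (polyd_times m p i)
  then show ?case using polyd.polyd_times[of m "\<lambda>x. c * p x" i] by (simp add: mult.left_commute)
qed (auto intro: polyd.intros simp: distrib_left)

lemma polyd_diff: "polyd m p \<Longrightarrow> polyd m q \<Longrightarrow> polyd m (\<lambda>x. p x - q x)"
  using polyd_add[of m p "\<lambda>x. -1 * q x"] polyd_cmult[of m q "-1"] by simp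

lemma polyd_mult: "polyd m p \<Longrightarrow> polyd n q \<Longrightarrow> polyd (m + n) (\<lambda>x. p x * q x)"
proof (induction rule: polyd.induct)
  case (polyd_times m p i)
  then show ?case using polyd.polyd_times[of "m + n" "\<lambda>x. p x * q x" i] by (simp add: mult.assoc)
qed (auto intro: polyd.intros polyd_cmult polyd_mono[of n _ "_ + n"] simp: distrib_right)

lemma polyd_sum: "(\<And>i. i \<in> I \<Longrightarrow> polyd m (p i)) \<Longrightarrow> polyd m (\<lambda>x. \<Sum>i\<in>I. p i x)"
  by (induction I rule: infinite_finite_induct) (auto intro: polyd.intros)

lemma polyd_coord: "polyd (Suc 0) (\<lambda>x. x $ i)"
  using polyd_times[of 0 "\<lambda>x. 1" i] polyd_const[of 0 1] by simp

lemma polyd_power: "polyd k (\<lambda>x. (x $ i) ^ k)"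
  by (induction k) (auto intro: polyd.intros polyd_const[of 0 1, simplified])

lemma polyd_monomial: "finite I \<Longrightarrow> polyd (\<Sum>i\<in>I. \<alpha> i) (\<lambda>x. \<Prod>i\<in>I. (x $ i) ^ \<alpha> i)"
  by (induction I rule: finite_induct) (auto intro: polyd.intros polyd_mult polyd_power)

lemma polys_imp_polyd:
  assumes "p \<in> polys m" "linear T"
  shows "polyd m (\<lambda>x. T (p x))"
proof -
  obtain c where p: "p = (\<lambda>x. \<Sum>\<alpha> | (\<Sum>i\<in>UNIV. \<alpha> i) \<le> m. (\<Prod>i\<in>UNIV. (x $ i) ^ \<alpha> i) *\<^sub>R c \<alpha>)"
    using assms(1) by (auto simp: polys_def)
  have "polyd m (\<lambda>x. \<Sum>\<alpha> | (\<Sum>i\<in>UNIV. \<alpha> i) \<le> m. T (c \<alpha>) * (\<Prod>i\<in>UNIV. (x $ i) ^ \<alpha> i))"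
    by (intro polyd_sum polyd_cmult polyd_mono[OF polyd_monomial]) auto
  then show ?thesis unfolding p by (simp add: linear_sum[OF assms(2)] linear_cmul[OF assms(2)] mult.commute)
qed

lemma polyd_affine:
  fixes p :: "real^'d \<Rightarrow> real" and A :: "real^'e \<Rightarrow> real^'d"
  assumes "polyd m p" "linear A"
  shows "polyd m (\<lambda>x. p (A x + b))"
  using assms(1)
proof (induction rule: polyd.induct)
  case (polyd_times m p i)
  have "(A x + b) $ i = (\<Sum>k\<in>UNIV. (A (axis k 1) $ i) * x $ k) + b $ i" for x
  proof -
    have "A x = A (\<Sum>k\<in>UNIV. x $ k *\<^sub>R axis k 1)" by (simp add: basis_expansion[of x, unfolded scalar_mult_eq_scaleR])
    also have "\<dots> = (\<Sum>k\<in>UNIV. x $ k *\<^sub>R A (axis k 1))" by (simp add: linear_sum[OF assms(2)] linear_cmul[OF assms(2)])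
    finally show ?thesis by (simp add: mult.commute)
  qed
  moreover have "polyd (Suc 0) (\<lambda>x. (\<Sum>k\<in>UNIV. (A (axis k 1) $ i) * x $ k) + b $ i)"
    by (intro polyd_add polyd_sum polyd_cmult polyd_coord polyd_const)
  ultimately have "polyd (Suc 0) (\<lambda>x. (A x + b) $ i)" by (simp only:)
  from polyd_mult[OF this polyd_times.IH] show ?case by simp
qed (auto intro: polyd.intros)

lemma polyd_smooth: "polyd m p \<Longrightarrow> smooth p"
  by (induction rule: polyd.induct) (auto intro: smooth.intros)

lemma polyd_deriv: "polyd m p \<Longrightarrow> \<exists>D. (\<forall>x. (p has_derivative D x) (at x)) \<and> (\<forall>e. polyd m (\<lambda>x. D x e))"
proof (induction rule: polyd.induct)
  case (polyd_const m c)
  show ?case by (rule exI[of _ "\<lambda>x h. 0"]) (auto intro: polyd.intros)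
next
  case (polyd_add m p q)
  then obtain D D' where "\<forall>x. (p has_derivative D x) (at x)" "\<forall>e. polyd m (\<lambda>x. D x e)"
    "\<forall>x. (q has_derivative D' x) (at x)" "\<forall>e. polyd m (\<lambda>x. D' x e)" by blast
  then show ?case by (intro exI[of _ "\<lambda>x h. D x h + D' x h"]) (auto intro: polyd.intros has_derivative_add)
next
  case (polyd_times m p i)
  then obtain D where D: "\<forall>x. (p has_derivative D x) (at x)" "\<forall>e. polyd m (\<lambda>x. D x e)" by blast
  have "((\<lambda>x. x $ i) has_derivative (\<lambda>h. h $ i)) (at x)" for x :: "real^'a"
    by (intro bounded_linear_imp_has_derivative bounded_linear_vec_nth)
  with D polyd_times(1) show ?case by (intro exI[of _ "\<lambda>x h. x $ i * D x h + h $ i * p x"])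
       (auto intro!: polyd.polyd_add polyd.polyd_times polyd_cmult has_derivative_mult intro: polyd_mono)
qed

lemma polyd_pd: assumes "polyd m p" shows "polyd m (pd i p)"
proof -
  obtain D where D: "\<forall>x. (p has_derivative D x) (at x)" "\<forall>e. polyd m (\<lambda>x. D x e)" using polyd_deriv[OF assms] by blast
  have "pd i p = (\<lambda>x. D x (axis i 1))" using D by (auto intro: pd_eq)
  then show ?thesis using D by simp
qed

text \<open>Along the line through the origin and \<open>x\<close> the function is a univariate
  polynomial that vanishes at all small positive parameters, hence identically, in particular at
  parameter one.\<close>

lemma polyd_zero_on_ball:
  assumes "polyd m p" "\<And>x. x \<in> ball 0 1 \<Longrightarrow> p x = 0"
  shows "p = (\<lambda>x. 0)"
proof
  fix x
  have "\<exists>P. \<forall>t. p (t *\<^sub>R x) = poly P t" using assms(1)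
  proof (induction rule: polyd.induct)
    case (polyd_const m c)
    show ?case by (rule exI[of _ "[:c:]"]) simp
  next
    case (polyd_add m p q)
    then show ?case by (metis poly_add)
  next
    case (polyd_times m p i)
    then obtain P where "\<forall>t. p (t *\<^sub>R x) = poly P t" by blast
    then show ?case by (intro exI[of _ "[:0, x $ i:] * P"]) simp
  qed
  then obtain P where P: "\<And>t. p (t *\<^sub>R x) = poly P t" by blast
  have "{0<..<1 / (norm x + 1)} \<subseteq> {t. poly P t = 0}"
  proof safe
    fix t assume t: "t \<in> {0<..<1 / (norm x + 1)}"
    have "norm x + 1 > 0" by (simp add: add_nonneg_pos)
    with t have "t * (norm x + 1) < 1" "t > 0" by (auto simp: pos_less_divide_eq)
    then have "norm (t *\<^sub>R x) < 1" by (simp add: algebra_simps)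
    then show "poly P t = 0" using assms(2)[of "t *\<^sub>R x"] P by simp
  qed
  moreover have "infinite {0<..<1 / (norm x + 1)}" by (simp add: add_nonneg_pos)
  ultimately have "P = 0" using poly_roots_finite finite_subset by blast
  then show "p x = 0" using P[of 1] by simp
qed

section \<open>Equivalence of polynomial norms by orthonormalisation over the unit ball\<close>

definition ball_inner :: "(real^'d \<Rightarrow> real) \<Rightarrow> (real^'d \<Rightarrow> real) \<Rightarrow> real" where
  "ball_inner p q = (LINT x|lebesgue. indicator (ball 0 1) x * (p x * q x))"

lemma integrable_ball_mult:
  fixes p :: "'a::euclidean_space \<Rightarrow> real"
  assumes "continuous_on UNIV p"
  shows "integrable lebesgue (\<lambda>x. indicator (ball z r) x * p x)"
proof -
  have "bounded (p ` cball z r)"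
    by (intro compact_imp_bounded compact_continuous_image) (use assms in \<open>auto intro: continuous_on_subset\<close>)
  then obtain B where B: "\<And>x. x \<in> cball z r \<Longrightarrow> abs (p x) \<le> B" unfolding bounded_iff by fastforce
  show ?thesis
  proof (rule integrable_bounded_support[where B = "abs B" and r = "norm z + r"])
    show "abs (indicator (ball z r) x * p x) \<le> abs B" for x using B[of x] by (auto simp: indicator_def)
    show "indicator (ball z r) x * p x = 0" if "x \<notin> cball 0 (norm z + r)" for x
      using that norm_triangle_ineq2[of x z] by (auto simp: indicator_def dist_norm norm_minus_commute)
    show "(\<lambda>x. indicator (ball z r) x * p x) \<in> borel_measurable borel"
      using assms by (intro borel_measurable_times borel_measurable_indicator borel_measurable_continuous_onI) auto
  qed
qed

lemma ball_inner_integrable: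
  "polyd m p \<Longrightarrow> polyd n q \<Longrightarrow> integrable lebesgue (\<lambda>x. indicator (ball 0 1) x * (p x * q x))"
  by (intro integrable_ball_mult continuous_intros smooth_continuous polyd_smooth)

lemma ball_inner_commute: "ball_inner p q = ball_inner q p"
  by (simp add: ball_inner_def mult.commute)

lemma ball_inner_add:
  assumes "polyd m p" "polyd m q" "polyd m r"
  shows "ball_inner (\<lambda>x. p x + q x) r = ball_inner p r + ball_inner q r"
  unfolding ball_inner_def using ball_inner_integrable[OF assms(1,3)] ball_inner_integrable[OF assms(2,3)]
  by (simp add: distrib_left distrib_right)

lemma ball_inner_cmult: "ball_inner (\<lambda>x. c * p x) r = c * ball_inner p r"
proof -
  have "(\<lambda>x. indicator (ball 0 1) x * (c * p x * r x)) = (\<lambda>x. c * (indicator (ball 0 1) x * (p x * r x)))" by auto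
  then show ?thesis by (simp add: ball_inner_def)
qed

lemma ball_inner_diff:
  assumes "polyd m p" "polyd m q" "polyd m r"
  shows "ball_inner (\<lambda>x. p x - q x) r = ball_inner p r - ball_inner q r"
  using ball_inner_add[OF assms(1) polyd_cmult[OF assms(2), of "-1"] assms(3)] ball_inner_cmult[of "-1" q r]
  by simp

lemma ball_inner_sum:
  assumes "\<And>i. i \<in> I \<Longrightarrow> polyd m (p i)" "polyd m r"
  shows "ball_inner (\<lambda>x. \<Sum>i\<in>I. p i x) r = (\<Sum>i\<in>I. ball_inner (p i) r)"
  using assms(1)
proof (induction I rule: infinite_finite_induct)
  case (insert i I)
  then show ?case using ball_inner_add[of m "p i" "\<lambda>x. \<Sum>i\<in>I. p i x" r] polyd_sum[of I m p] assms(2) by simp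
qed (auto simp: ball_inner_def)

lemma ball_inner_nonneg: "ball_inner p p \<ge> 0"
  unfolding ball_inner_def by (intro integral_nonneg_AE) auto

text \<open>The set where \<open>p\<close> is nonzero inside the ball is open and negligible, hence
  empty, and a polynomial vanishing on the ball is zero.\<close>

lemma ball_inner_eq_0:
  assumes "polyd m p" "ball_inner p p = 0"
  shows "p = (\<lambda>x. 0)"
proof (rule polyd_zero_on_ball[OF assms(1)])
  have cont: "continuous_on UNIV p" using assms(1) polyd_smooth smooth_continuous by blast
  have "AE x in lebesgue. indicator (ball 0 1) x * (p x * p x) = 0"
    using integral_nonneg_eq_0_iff_AE[OF ball_inner_integrable[OF assms(1,1)]] assms(2)
    by (auto simp: ball_inner_def)
  then have "AE x in lebesgue. x \<notin> {x. x \<in> ball 0 1 \<and> p x \<noteq> 0}" by eventually_elim (auto simp: indicator_def)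
  moreover have op: "open {x. x \<in> ball 0 1 \<and> p x \<noteq> 0}"
  proof -
    have "{x. x \<in> ball 0 1 \<and> p x \<noteq> 0} = ball 0 1 \<inter> {x. p x \<noteq> 0}" by auto
    then show ?thesis using open_Int[OF open_ball open_Collect_neq[OF cont continuous_on_const]] by metis
  qed
  ultimately have "negligible {x. x \<in> ball 0 1 \<and> p x \<noteq> 0}" by (simp add: negligible_iff_null_sets AE_iff_null_sets)
  then have "{x. x \<in> ball 0 1 \<and> p x \<noteq> 0} = {}" using op open_not_negligible by blast
  then show "p x = 0" if "x \<in> ball 0 1" for x using that by blast
qed

inductive lspan :: "('a \<Rightarrow> real) set \<Rightarrow> ('a \<Rightarrow> real) \<Rightarrow> bool" for S where
  lspan_base: "b \<in> S \<Longrightarrow> lspan S (\<lambda>x. c * b x)"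
| lspan_zero: "lspan S (\<lambda>x. 0)"
| lspan_add: "lspan S p \<Longrightarrow> lspan S q \<Longrightarrow> lspan S (\<lambda>x. p x + q x)"

lemma lspan_cmult: "lspan S p \<Longrightarrow> lspan S (\<lambda>x. c * p x)"
  by (induction rule: lspan.induct)
     (auto intro: lspan.intros simp: distrib_left mult.assoc[symmetric])

lemma lspan_trans: "lspan S p \<Longrightarrow> (\<And>b. b \<in> S \<Longrightarrow> lspan S' b) \<Longrightarrow> lspan S' p"
  by (induction rule: lspan.induct) (auto intro: lspan.intros lspan_cmult)

lemma lspan_sum: "(\<And>i. i \<in> I \<Longrightarrow> lspan S (p i)) \<Longrightarrow> lspan S (\<lambda>x. \<Sum>i\<in>I. p i x)"
  by (induction I rule: infinite_finite_induct) (auto intro: lspan.intros)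

lemma lspan_member: "b \<in> S \<Longrightarrow> lspan S b"
  using lspan_base[of b S 1] by simp

text \<open>In the step from \<open>m\<close> to \<open>Suc m\<close> the constant one and all
  products of a coordinate with an earlier generator suffice, because a polynomial is built from
  constants, sums and such products.\<close>

lemma polyd_finite_span:
  "\<exists>S :: (real^'d \<Rightarrow> real) set. finite S \<and> (\<forall>b\<in>S. polyd m b) \<and> (\<forall>p. polyd m p \<longrightarrow> lspan S p)"
proof (induction m)
  case 0
  have "lspan {\<lambda>x. 1} p" if "polyd m p" "m = 0" for m and p :: "real^'d \<Rightarrow> real" using that
  proof (induction rule: polyd.induct)
    case (polyd_const m c)
    show ?case using lspan_base[of "\<lambda>x. 1" "{\<lambda>x. 1}" c] by simp
  qed (auto intro: lspan.intros)
  then show ?case by (intro exI[of _ "{\<lambda>x. 1}"]) (auto intro: polyd.intros)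
next
  case (Suc m)
  then obtain S :: "(real^'d \<Rightarrow> real) set" where S: "finite S" "\<And>b. b \<in> S \<Longrightarrow> polyd m b" "\<And>p. polyd m p \<Longrightarrow> lspan S p"
    by blast
  define S' :: "(real^'d \<Rightarrow> real) set" where "S' = insert (\<lambda>x. 1) ((\<lambda>(i, b) x. x $ i * b x) ` (UNIV \<times> S))"
  have times: "lspan S' (\<lambda>x. x $ i * p x)" if "lspan S p" for p i using that
  proof (induction rule: lspan.induct)
    case (lspan_base b c)
    then have "(\<lambda>x. x $ i * b x) \<in> S'" by (auto simp: S'_def)
    from lspan.lspan_base[OF this, of c] show ?case by (simp add: mult.left_commute)
  qed (auto intro: lspan.intros simp: distrib_left)
  have "lspan S' p" if "polyd n p" "n = Suc m" for n p using that
  proof (induction rule: polyd.induct)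
    case (polyd_const n c)
    show ?case using lspan_base[of "\<lambda>x. 1" S' c] by (simp add: S'_def)
  next
    case (polyd_times n p i)
    then show ?case using times S(3) by blast
  qed (auto intro: lspan.intros)
  moreover have "\<forall>b\<in>S'. polyd (Suc m) b" "finite S'" using S by (auto simp: S'_def intro: polyd.intros)
  ultimately show ?case by blast
qed

lemma gram_schmidt:
  assumes "finite S" "\<And>b. b \<in> S \<Longrightarrow> polyd m b"
  shows "\<exists>E. finite E \<and> (\<forall>e\<in>E. polyd m e) \<and>
    (\<forall>e\<in>E. \<forall>e'\<in>E. ball_inner e e' = (if e = e' then 1 else 0)) \<and> (\<forall>b\<in>S. lspan E b)" using assms
proof (induction S rule: finite_induct)
  case empty
  show ?case by (rule exI[of _ "{}"]) auto
next
  case (insert b S)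
  then obtain E where E: "finite E" "\<And>e. e \<in> E \<Longrightarrow> polyd m e"
    "\<And>e e'. e \<in> E \<Longrightarrow> e' \<in> E \<Longrightarrow> ball_inner e e' = (if e = e' then 1 else 0)" "\<And>b. b \<in> S \<Longrightarrow> lspan E b"
    by (metis insertCI)
  have b: "polyd m b" using insert.prems by simp
  define p where "p = (\<lambda>x. \<Sum>e\<in>E. ball_inner b e * e x)"
  define b' where "b' = (\<lambda>x. b x - p x)"
  have p: "polyd m p" "lspan E p" using E unfolding p_def by (auto intro!: polyd_sum polyd_cmult lspan_sum lspan_base)
  have b'd: "polyd m b'" using p b by (simp add: b'_def polyd_diff)
  have orth: "ball_inner b' e = 0" if e: "e \<in> E" for e
  proof -
    have "ball_inner p e = (\<Sum>e'\<in>E. ball_inner (\<lambda>x. ball_inner b e' * e' x) e)"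
      unfolding p_def using E e by (intro ball_inner_sum[where m = m]) (auto intro: polyd_cmult)
    also have "\<dots> = (\<Sum>e'\<in>E. if e' = e then ball_inner b e' else 0)" using E e by (intro sum.cong) (auto simp: ball_inner_cmult)
    also have "\<dots> = ball_inner b e" using E e by simp
    finally show ?thesis unfolding b'_def using ball_inner_diff[OF b p(1) E(2)[OF e]] by simp
  qed
  show ?case
  \<comment> \<open>A remainder of norm zero vanishes identically by \<open>ball_inner_eq_0\<close>;
    then \<open>b\<close> is already spanned and nothing is added.\<close>
  proof (cases "ball_inner b' b' = 0")
    case True
    then have "b' = (\<lambda>x. 0)" using ball_inner_eq_0 b'd by blast
    then have "b = p" by (auto simp: b'_def fun_eq_iff)
    then show ?thesis using E p by (intro exI[of _ E]) auto
  next
    case False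
    then have pos: "ball_inner b' b' > 0" using ball_inner_nonneg[of b'] by simp
    define s where "s = 1 / sqrt (ball_inner b' b')"
    have s: "s * (s * ball_inner b' b') = 1" "s \<noteq> 0" using pos by (auto simp: s_def field_simps)
    define e0 where "e0 = (\<lambda>x. s * b' x)"
    have e0: "polyd m e0" unfolding e0_def by (intro polyd_cmult b'd)
    have n0: "ball_inner e0 e0 = 1" unfolding e0_def ball_inner_cmult ball_inner_commute[of _ "\<lambda>x. s * b' x"] by (rule s)
    have o0: "ball_inner e0 e = 0" "ball_inner e e0 = 0" if "e \<in> E" for e
    proof -
      show "ball_inner e0 e = 0" unfolding e0_def ball_inner_cmult using orth[OF that] by simp
      then show "ball_inner e e0 = 0" by (simp add: ball_inner_commute)
    qed
    have sub: "lspan (insert e0 E) q" if "lspan E q" for q using that by (rule lspan_trans) (auto intro: lspan_member)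
    have "lspan (insert e0 E) (\<lambda>x. (1 / s) * e0 x + p x)" by (intro lspan_add lspan_base sub p) simp
    also have "(\<lambda>x. (1 / s) * e0 x + p x) = b" using s(2) by (auto simp: e0_def b'_def)
    finally have "\<forall>c\<in>insert b S. lspan (insert e0 E) c" using E(4) sub by auto
    moreover have "\<forall>e\<in>insert e0 E. \<forall>e'\<in>insert e0 E. ball_inner e e' = (if e = e' then 1 else 0)"
      using n0 o0 E(3) by (metis insert_iff zero_neq_one)
    ultimately show ?thesis using E e0 by (intro exI[of _ "insert e0 E"]) auto
  qed
qed

lemma continuous_bounded_cball:
  fixes f :: "'a::euclidean_space \<Rightarrow> real"
  assumes "continuous_on UNIV f"
  shows "\<exists>B. \<forall>x\<in>cball z r. abs (f x) \<le> B"
proof -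
  have "bounded (f ` cball z r)"
    by (intro compact_imp_bounded compact_continuous_image) (use assms in \<open>auto intro: continuous_on_subset\<close>)
  then show ?thesis unfolding bounded_iff by fastforce
qed

text \<open>Expand \<open>p\<close> in an orthonormal basis. Each coefficient is at most the norm of
  \<open>p\<close>, and the finitely many basis functions and their partial derivatives are bounded
  on the compact ball of radius \<open>K\<close>, whatever its size.\<close>

lemma polyd_bound_unit:
  "\<exists>C. \<forall>p :: real^'d \<Rightarrow> real. polyd m p \<longrightarrow> (\<forall>x\<in>cball 0 K. (p x)\<^sup>2 \<le> C * ball_inner p p \<and> (\<forall>i. (pd i p x)\<^sup>2 \<le> C * ball_inner p p))"
proof -
  obtain S :: "(real^'d \<Rightarrow> real) set" where S: "finite S" "\<forall>b\<in>S. polyd m b" "\<forall>p. polyd m p \<longrightarrow> lspan S p"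
    using polyd_finite_span by blast
  obtain E where E': "finite E" "\<forall>e\<in>E. polyd m e"
    "\<forall>e\<in>E. \<forall>e'\<in>E. ball_inner e e' = (if e = e' then 1 else 0)" "\<forall>b\<in>S. lspan E b"
    using gram_schmidt[OF S(1) S(2)[rule_format]] by blast
  note E = E'(1) E'(2-4)[rule_format]
  have "\<exists>B. \<forall>x\<in>cball 0 K. abs (e x) \<le> B \<and> (\<forall>i. abs (pd i e x) \<le> B)" if "e \<in> E" for e
  proof -
    have e: "smooth e" using E(2) that polyd_smooth by blast
    obtain B where B: "\<forall>x\<in>cball 0 K. abs (e x) \<le> B" using continuous_bounded_cball[OF smooth_continuous[OF e]] by blast
    have "\<forall>i. \<exists>B. \<forall>x\<in>cball 0 K. abs (pd i e x) \<le> B" by (intro allI continuous_bounded_cball smooth_continuous smooth_pd e)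
    from choice[OF this] obtain B' where B': "\<forall>i. \<forall>x\<in>cball 0 K. abs (pd i e x) \<le> B' i" by blast
    have "B' i \<le> (\<Sum>i\<in>UNIV. abs (B' i))" for i
      using member_le_sum[of i UNIV "\<lambda>i. abs (B' i)"] by (auto intro: order_trans[OF abs_ge_self])
    moreover have "0 \<le> (\<Sum>i\<in>UNIV. abs (B' i))" by (simp add: sum_nonneg)
    ultimately show ?thesis
      using order_trans[OF B[rule_format] abs_ge_self] order_trans[OF B'[rule_format]] by (intro exI[of _ "abs B + (\<Sum>i\<in>UNIV. abs (B' i))"]) (auto intro: add_increasing2 add_increasing order_trans)
  qed
  then obtain B where B: "\<And>e x. e \<in> E \<Longrightarrow> x \<in> cball 0 K \<Longrightarrow> abs (e x) \<le> B e"
     "\<And>e x i. e \<in> E \<Longrightarrow> x \<in> cball 0 K \<Longrightarrow> abs (pd i e x) \<le> B e" by metis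
  define C where "C = (\<Sum>e\<in>E. abs (B e))"
  have main: "(p x)\<^sup>2 \<le> C\<^sup>2 * ball_inner p p \<and> (\<forall>i. (pd i p x)\<^sup>2 \<le> C\<^sup>2 * ball_inner p p)"
      if p: "polyd m p" and x: "x \<in> cball 0 K" for p and x :: "real^'d"
  proof -
    have lE: "lspan E p" by (rule lspan_trans[OF S(3)[rule_format, OF p] E(4)])
    have rep: "(\<lambda>x. \<Sum>e\<in>E. ball_inner p e * e x) = p"
    proof -
      have "polyd m p \<and> (\<forall>x. (\<Sum>e\<in>E. ball_inner p e * e x) = p x)" using lE
      proof (induction rule: lspan.induct)
        case (lspan_base b c)
        have "(\<Sum>e\<in>E. ball_inner (\<lambda>x. c * b x) e * e x) = (\<Sum>e\<in>E. if e = b then c * b x else 0)" for x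
          using lspan_base E(3) by (intro sum.cong) (auto simp: ball_inner_cmult)
        then show ?case using lspan_base E by (auto intro: polyd_cmult)
      next
        case lspan_zero
        show ?case by (auto intro: polyd.intros simp: ball_inner_def)
      next
        case (lspan_add p q)
        have "(\<Sum>e\<in>E. ball_inner (\<lambda>x. p x + q x) e * e x) = (\<Sum>e\<in>E. (ball_inner p e + ball_inner q e) * e x)" for x
          using lspan_add E(2) by (intro sum.cong) (auto simp: ball_inner_add[where m = m])
        then show ?case using lspan_add by (auto intro: polyd.intros simp: distrib_right sum.distrib)
      qed
      then show ?thesis by auto
    qed
    define q where "q = sqrt (ball_inner p p)"
    have q: "q \<ge> 0" "q\<^sup>2 = ball_inner p p" using ball_inner_nonneg[of p] by (auto simp: q_def)
    \<comment> \<open>Cauchy-Schwarz against a unit vector, read off from the nonnegative square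
      norm of \<open>p\<close> minus its projection.\<close>
    have cs: "abs (ball_inner p e) \<le> q" if e: "e \<in> E" for e
    proof -
      define a where "a = ball_inner p e"
      have ae: "polyd m (\<lambda>x. a * e x)" using E(2)[OF e] by (rule polyd_cmult)
      have d: "polyd m (\<lambda>x. p x - a * e x)" by (rule polyd_diff[OF p ae])
      have "0 \<le> ball_inner (\<lambda>x. p x - a * e x) (\<lambda>x. p x - a * e x)" by (rule ball_inner_nonneg)
      also have "\<dots> = ball_inner p (\<lambda>x. p x - a * e x) - ball_inner (\<lambda>x. a * e x) (\<lambda>x. p x - a * e x)"
        by (rule ball_inner_diff[OF p ae d])
      also have "ball_inner p (\<lambda>x. p x - a * e x) = ball_inner p p - a * ball_inner e p"
        unfolding ball_inner_commute[of p "\<lambda>x. p x - a * e x"] ball_inner_diff[OF p ae p] ball_inner_cmult ..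
      also have "ball_inner (\<lambda>x. a * e x) (\<lambda>x. p x - a * e x) = a * (ball_inner p e - a * ball_inner e e)"
        unfolding ball_inner_cmult[of a e] ball_inner_commute[of e "\<lambda>x. p x - a * e x"] ball_inner_diff[OF p ae E(2)[OF e]] ..
      also have "ball_inner e e = 1" using E(3) e by simp
      finally have "a\<^sup>2 \<le> q\<^sup>2" unfolding q(2) using ball_inner_commute[of e p]
        by (simp add: a_def power2_eq_square algebra_simps)
      then show ?thesis using q(1) unfolding a_def by (simp add: abs_le_square_iff[symmetric])
    qed
    have comb: "(\<Sum>e\<in>E. ball_inner p e * f e)\<^sup>2 \<le> C\<^sup>2 * ball_inner p p"
      if f: "\<And>e. e \<in> E \<Longrightarrow> abs (f e) \<le> B e" for f
    proof -
      have "abs (\<Sum>e\<in>E. ball_inner p e * f e) \<le> (\<Sum>e\<in>E. q * abs (B e))" by (intro order_trans[OF sum_abs] sum_mono)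
           (use q order_trans[OF f abs_ge_self] cs in \<open>auto simp: abs_mult intro!: mult_mono\<close>)
      also have "\<dots> = abs (q * C)" using q(1) by (simp add: C_def sum_distrib_left abs_mult sum_nonneg)
      finally have "(\<Sum>e\<in>E. ball_inner p e * f e)\<^sup>2 \<le> (q * C)\<^sup>2" by (simp add: abs_le_square_iff)
      then show ?thesis by (simp add: power_mult_distrib q mult.commute)
    qed
    have pdp: "pd i p x = (\<Sum>e\<in>E. ball_inner p e * pd i e x)" for i
    proof -
      have "((\<lambda>x. \<Sum>e\<in>E. ball_inner p e * e x) has_derivative (\<lambda>h. \<Sum>e\<in>E. ball_inner p e * (\<Sum>k\<in>UNIV. h $ k * pd k e x))) (at x)"
        using E(2) by (intro has_derivative_sum has_derivative_mult_right has_derivative_pd)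
                      (auto intro: smooth_differentiable polyd_smooth)
      then have "pd i (\<lambda>x. \<Sum>e\<in>E. ball_inner p e * e x) x = (\<Sum>e\<in>E. ball_inner p e * (\<Sum>k\<in>UNIV. axis i 1 $ k * pd k e x))"
        by (rule pd_eq)
      also have "\<dots> = (\<Sum>e\<in>E. ball_inner p e * pd i e x)" by (simp add: axis_def if_distrib if_distribR cong: if_cong)
      finally show ?thesis unfolding rep .
    qed
    have "(\<Sum>e\<in>E. ball_inner p e * e x) = p x" by (rule fun_cong[OF rep])
    then show ?thesis using comb[of "\<lambda>e. e x"] comb[of "\<lambda>e. pd _ e x"] B x by (simp add: pdp)
  qed
  then show ?thesis by blast
qed

text \<open>On a finite-dimensional space the seminorms below are controlled by the mean square over
  the unit ball, and affine scaling transports this to every ball.\<close>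

lemma polyd_bound:
  "\<exists>C>0. \<forall>(p :: real^'d \<Rightarrow> real) z \<rho>. polyd m p \<longrightarrow> \<rho> > 0 \<longrightarrow> (\<forall>x\<in>cball z (K * \<rho>).
     (p x)\<^sup>2 \<le> C / \<rho> ^ CARD('d) * (LINT y|lebesgue. indicator (ball z \<rho>) y * (p y)\<^sup>2) \<and>
     (\<forall>i. (\<rho> * pd i p x)\<^sup>2 \<le> C / \<rho> ^ CARD('d) * (LINT y|lebesgue. indicator (ball z \<rho>) y * (p y)\<^sup>2)))"
proof -
  obtain C where C: "\<And>p :: real^'d \<Rightarrow> real. \<And>x i. polyd m p \<Longrightarrow> x \<in> cball 0 K \<Longrightarrow> (p x)\<^sup>2 \<le> C * ball_inner p p \<and> (pd i p x)\<^sup>2 \<le> C * ball_inner p p"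
    using polyd_bound_unit by blast
  show ?thesis
  proof (intro exI[of _ "max C 1"] conjI allI impI ballI)
    show "max C 1 > 0" by simp
    fix p :: "real^'d \<Rightarrow> real" and z x :: "real^'d" and \<rho> :: real and i
    assume p: "polyd m p" and \<rho>: "\<rho> > 0" and x: "x \<in> cball z (K * \<rho>)"
    define P where "P = (\<lambda>y. p (\<rho> *\<^sub>R y + z))"
    have P: "polyd m P" unfolding P_def by (intro polyd_affine p linear_scaleR)
    define y where "y = (1 / \<rho>) *\<^sub>R (x - z)"
    have xy: "x = \<rho> *\<^sub>R y + z" using \<rho> by (simp add: y_def)
    have "norm y = norm (x - z) / \<rho>" using \<rho> by (simp add: y_def)
    then have y: "y \<in> cball 0 K" using x \<rho> by (simp add: dist_norm norm_minus_commute divide_le_eq)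
    have Py: "P y = p x" by (simp add: P_def xy)
    have "(\<lambda>y. (p y)\<^sup>2) \<in> borel_measurable borel"
      by (intro borel_measurable_continuous_onI continuous_intros smooth_continuous polyd_smooth[OF p])
    then have m: "(\<lambda>y. indicator (ball z \<rho>) y * (p y)\<^sup>2) \<in> borel_measurable borel"
      by (intro borel_measurable_times borel_measurable_indicator) auto
    have pdP: "pd i P y = \<rho> * pd i p x"
    proof -
      have "((\<lambda>y. \<rho> *\<^sub>R y + z) has_derivative (\<lambda>h. \<rho> *\<^sub>R h)) (at y)" by (auto intro!: derivative_eq_intros)
      moreover have "p differentiable (at (\<rho> *\<^sub>R y + z))" by (intro smooth_differentiable polyd_smooth[OF p])
      ultimately have "(P has_derivative (\<lambda>h. \<Sum>k\<in>UNIV. (\<rho> *\<^sub>R h) $ k * pd k p (\<rho> *\<^sub>R y + z))) (at y)"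
        unfolding P_def by (intro has_derivative_compose[OF _ has_derivative_pd])
      from pd_eq[OF this, of i] show ?thesis by (simp add: axis_def xy if_distrib if_distribR cong: if_cong)
    qed
    let ?I = "LINT y|lebesgue. indicator (ball z \<rho>) y * (p y)\<^sup>2"
    have "?I = \<rho> ^ CARD('d) * (LINT y|lebesgue. indicator (ball z \<rho>) (z + \<rho> *\<^sub>R y) * (p (z + \<rho> *\<^sub>R y))\<^sup>2)"
      using integral_scale_translate[OF m \<rho>, of z] by simp
    also have "(LINT y|lebesgue. indicator (ball z \<rho>) (z + \<rho> *\<^sub>R y) * (p (z + \<rho> *\<^sub>R y))\<^sup>2) = ball_inner P P"
      unfolding ball_inner_def P_def using \<rho>
      by (intro Bochner_Integration.integral_cong) (auto simp: indicator_def dist_norm power2_eq_square add.commute)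
    finally have I: "ball_inner P P = ?I / \<rho> ^ CARD('d)" using \<rho> by simp
    have le: "C * ball_inner P P \<le> max C 1 / \<rho> ^ CARD('d) * ?I"
      using mult_right_mono[OF max.cobounded1[of C 1] ball_inner_nonneg[of P]] I by simp
    show "(p x)\<^sup>2 \<le> max C 1 / \<rho> ^ CARD('d) * ?I" using C[OF P y] le by (auto simp: Py intro: order_trans)
    show "(\<rho> * pd i p x)\<^sup>2 \<le> max C 1 / \<rho> ^ CARD('d) * ?I" using C[OF P y] le by (auto simp: pdP[symmetric] intro: order_trans)
  qed
qed

section \<open>Weak derivatives\<close>

lemma AE_lebesgue_on_iff:
  "S \<in> sets lebesgue \<Longrightarrow> (AE x in leb S. P x) \<longleftrightarrow> (AE x\<in>S in lebesgue. P x)" by (subst AE_restrict_space_iff) auto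

lemma open_sets_lebesgue: "open S \<Longrightarrow> S \<in> sets lebesgue"
  by (simp add: borel_open)

lemma bounded_imp_subset_cball_0:
  fixes S :: "'a::real_normed_vector set"
  shows "bounded S \<Longrightarrow> \<exists>r. S \<subseteq> cball 0 r"
proof -
  assume "bounded S"
  then obtain a where "\<forall>x\<in>S. norm x \<le> a" unfolding bounded_iff by blast
  then show ?thesis by (intro exI[of _ a]) (auto simp: dist_norm)
qed

lemma integral_lebesgue_on_vanish:
  fixes u :: "'a::euclidean_space \<Rightarrow> real"
  assumes "S \<in> sets lebesgue" "\<And>x. x \<notin> S \<Longrightarrow> u x = 0"
  shows "(LINT x|leb S. u x) = (LINT x|lebesgue. u x)"
    and "integrable (leb S) u \<longleftrightarrow> integrable lebesgue u"
proof -
  have *: "indicator S x * u x = u x" for x using assms(2)[of x] by (auto simp: indicator_def)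
  show "(LINT x|leb S. u x) = (LINT x|lebesgue. u x)" using assms(1) by (subst integral_restrict_space) (auto simp: *)
  show "integrable (leb S) u \<longleftrightarrow> integrable lebesgue u" using assms(1) by (subst integrable_restrict_space) (auto simp: *)
qed

lemma integrable_mult_continuous:
  fixes u :: "'a::euclidean_space \<Rightarrow> real"
  assumes u: "u absolutely_integrable_on K" and K: "compact K"
    and \<phi>: "continuous_on UNIV \<phi>" "\<And>x. x \<notin> K \<Longrightarrow> \<phi> x = 0"
  shows "integrable lebesgue (\<lambda>x. u x * \<phi> x)"
proof -
  obtain r where "K \<subseteq> cball 0 r" using compact_imp_bounded[OF K] bounded_imp_subset_cball_0 by blast
  then obtain B where B: "\<And>x. abs (\<phi> x) \<le> B" using compact_support_bounded[OF \<phi>(1), of r] \<phi>(2) by blast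
  have int: "integrable lebesgue (\<lambda>x. indicator K x *\<^sub>R u x)" using u by (simp add: set_integrable_def)
  have eq: "u x * \<phi> x = (indicator K x *\<^sub>R u x) * \<phi> x" for x using \<phi>(2)[of x] by (auto simp: indicator_def)
  have "integrable lebesgue (\<lambda>x. (indicator K x *\<^sub>R u x) * \<phi> x)"
  proof (rule Bochner_Integration.integrable_bound)
    show "integrable lebesgue (\<lambda>x. B * (indicator K x *\<^sub>R u x))" by (intro integrable_mult_right int)
    have "\<phi> \<in> borel_measurable lebesgue" using borel_measurable_continuous_onI[OF \<phi>(1)] by (simp add: measurable_completion)
    then show "(\<lambda>x. (indicator K x *\<^sub>R u x) * \<phi> x) \<in> borel_measurable lebesgue"
      by (rule borel_measurable_times[OF borel_measurable_integrable[OF int]])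
    show "AE x in lebesgue. norm ((indicator K x *\<^sub>R u x) * \<phi> x) \<le> norm (B * (indicator K x *\<^sub>R u x))"
      using B order_trans[OF B abs_ge_self] by (intro AE_I2) (auto simp: abs_mult mult.commute intro!: mult_right_mono)
  qed
  then show ?thesis by (simp add: eq)
qed

definition local_integrable :: "(real^'d) set \<Rightarrow> 'd sfield \<Rightarrow> bool" where
  "local_integrable \<D> u \<longleftrightarrow> (\<forall>K. compact K \<and> K \<subseteq> \<D> \<longrightarrow> u absolutely_integrable_on K)"

lemma is_weak_pd_altdef: "is_weak_pd \<D> i u g \<longleftrightarrow> local_integrable \<D> u \<and> local_integrable \<D> g \<and>
     (\<forall>\<phi>. test_fun \<D> \<phi> \<longrightarrow>
        (LINT x|leb \<D>. u x * pd i \<phi> x) = - (LINT x|leb \<D>. g x * \<phi> x))" by (auto simp: is_weak_pd_def local_integrable_def)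

lemma test_fun_integrable:
  assumes "local_integrable \<D> u" "test_fun \<D> \<phi>"
  shows "integrable lebesgue (\<lambda>x. u x * \<phi> x)" "integrable lebesgue (\<lambda>x. u x * pd i \<phi> x)"
proof -
  obtain K where K: "compact K" "K \<subseteq> \<D>" "\<And>x. x \<notin> K \<Longrightarrow> \<phi> x = 0" using test_fun_support assms(2) by blast
  have "u absolutely_integrable_on K" using assms(1) K by (auto simp: local_integrable_def)
  moreover have "continuous_on UNIV \<phi>" "continuous_on UNIV (pd i \<phi>)"
    using assms(2) Ck_continuous[of 0 \<phi>] Ck.simps(2)[of 0 \<phi>] by (auto simp: test_fun_def simp del: Ck.simps(2))
  moreover have "pd i \<phi> x = 0" if "x \<notin> K" for x using that K by (intro pd_eq_0_outside[of K]) (auto dest: compact_imp_closed)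
  ultimately show "integrable lebesgue (\<lambda>x. u x * \<phi> x)" "integrable lebesgue (\<lambda>x. u x * pd i \<phi> x)"
    using K by (auto intro!: integrable_mult_continuous[where K = K])
qed

lemma test_fun_integral_lebesgue_on:
  assumes "test_fun A \<phi>" "A \<subseteq> \<D>" "open \<D>"
  shows "(LINT x|leb \<D>. u x * \<phi> x) = (LINT x|lebesgue. u x * \<phi> x)"
    "(LINT x|leb \<D>. u x * pd i \<phi> x) = (LINT x|lebesgue. u x * pd i \<phi> x)"
  by (rule integral_lebesgue_on_vanish(1)[OF open_sets_lebesgue[OF assms(3)]],
      use test_fun_pd_0[OF assms(1)] assms(2) in auto)+

lemma is_weak_pdD:
  assumes "is_weak_pd \<D> i u g" "test_fun \<D> \<phi>" "open \<D>"
  shows "(LINT x|lebesgue. u x * pd i \<phi> x) = - (LINT x|lebesgue. g x * \<phi> x)"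
  using assms(1,2)
  unfolding is_weak_pd_def test_fun_integral_lebesgue_on[OF assms(2) order_refl assms(3), symmetric] by blast

lemma is_weak_pdI:
  assumes "local_integrable \<D> u" "local_integrable \<D> g" "open \<D>"
    "\<And>\<phi>. test_fun \<D> \<phi> \<Longrightarrow> (LINT x|lebesgue. u x * pd i \<phi> x) = - (LINT x|lebesgue. g x * \<phi> x)"
  shows "is_weak_pd \<D> i u g"
  using assms test_fun_integral_lebesgue_on[OF _ order_refl assms(3)]
  by (simp add: is_weak_pd_altdef)

text \<open>A product of factors \<open>flat 0 (n * s)\<close>, one for each face of the box, is
  smooth, vanishes off the box and tends to one inside. Dominated convergence moves the hypothesis
  from these test functions to the indicator.\<close>

lemma box_integral_zero:
  fixes h :: "real^'d \<Rightarrow> real"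
  assumes h: "local_integrable \<D> h" and "open \<D>"
    and zero: "\<And>\<phi>. test_fun \<D> \<phi> \<Longrightarrow> (LINT x|leb \<D>. h x * \<phi> x) = 0"
    and sub: "cbox a b \<subseteq> \<D>"
  shows "(LINT x|lebesgue. indicator (box a b) x * h x) = 0"
proof -
  define \<phi> where "\<phi> k x = (\<Prod>i\<in>UNIV. flat 0 (real (Suc k) * (x $ i - a $ i)) * flat 0 (real (Suc k) * (b $ i - x $ i)))" for k and x :: "real^'d"
  have flat01: "0 \<le> flat 0 s" "flat 0 s \<le> 1" for s by (auto simp: flat_def)
  have \<phi>01: "0 \<le> \<phi> k x" "\<phi> k x \<le> 1" for k x unfolding \<phi>_def using flat01 by (auto intro!: prod_nonneg prod_le_1 mult_le_one)
  have \<phi>0: "\<phi> k x = 0" if "x \<notin> box a b" for k x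
  proof -
    have "\<exists>i. \<not> (a $ i < x $ i \<and> x $ i < b $ i)" using that by (simp add: mem_box_cart)
    then obtain i where i: "\<not> (a $ i < x $ i \<and> x $ i < b $ i)" by blast
    have "x $ i - a $ i \<le> 0 \<or> b $ i - x $ i \<le> 0" using i by auto
    then have "flat 0 (real (Suc k) * (x $ i - a $ i)) * flat 0 (real (Suc k) * (b $ i - x $ i)) = 0"
      by (auto simp: flat_def mult_le_0_iff)
    then show ?thesis unfolding \<phi>_def by (intro prod_zero) auto
  qed
  have sm: "smooth (\<phi> k)" for k unfolding \<phi>_def
    by (intro smooth_prod smooth_mult smooth_flat smooth_diff smooth_const smooth_coord) auto
  have test: "test_fun \<D> (\<phi> k)" for k using sub box_subset_cbox by (intro test_fun_smooth[OF sm, of "cbox a b"] \<phi>0) auto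
  have lim\<phi>: "(\<lambda>k. \<phi> k x) \<longlonglongrightarrow> 1" if x: "x \<in> box a b" for x
  proof -
    have fl: "(\<lambda>k. flat 0 (real (Suc k) * s)) \<longlonglongrightarrow> 1" if "s > 0" for s
    proof -
      have "(\<lambda>k. exp (- (1 / s) * (1 / real (Suc k)))) \<longlonglongrightarrow> exp (- (1 / s) * 0)"
        by (intro tendsto_intros LIMSEQ_Suc[OF lim_1_over_n])
      moreover have "flat 0 (real (Suc k) * s) = exp (- (1 / s) * (1 / real (Suc k)))" for k
        using that by (auto simp: flat_def mult_le_0_iff)
      ultimately show ?thesis by simp
    qed
    have "(\<lambda>k. \<phi> k x) \<longlonglongrightarrow> (\<Prod>i\<in>(UNIV::'d set). 1 * 1)"
      unfolding \<phi>_def using x by (intro tendsto_prod tendsto_mult fl) (auto simp: mem_box_cart)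
    then show ?thesis by simp
  qed
  have hK: "integrable lebesgue (\<lambda>x. indicator (cbox a b) x *\<^sub>R h x)"
    using h sub by (auto simp: local_integrable_def set_integrable_def)
  have hB: "integrable lebesgue (\<lambda>x. indicator (box a b) x * h x)"
  proof (rule Bochner_Integration.integrable_bound[OF hK])
    have "(\<lambda>x. indicator (box a b) x * (indicator (cbox a b) x *\<^sub>R h x)) \<in> borel_measurable lebesgue"
      using hK by (intro borel_measurable_times borel_measurable_integrable borel_measurable_indicator)
         (auto intro: open_sets_lebesgue)
    also have "(\<lambda>x. indicator (box a b) x * (indicator (cbox a b) x *\<^sub>R h x)) = (\<lambda>x. indicator (box a b) x * h x)"
      by (rule ext) (use box_subset_cbox[of a b] in \<open>auto simp: indicator_def\<close>)
    finally show "(\<lambda>x. indicator (box a b) x * h x) \<in> borel_measurable lebesgue" .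
    show "AE x in lebesgue. norm (indicator (box a b) x * h x) \<le> norm (indicator (cbox a b) x *\<^sub>R h x)"
      using box_subset_cbox[of a b] by (intro AE_I2) (auto simp: indicator_def)
  qed
  have "(\<lambda>k. LINT x|lebesgue. h x * \<phi> k x) \<longlonglongrightarrow> (LINT x|lebesgue. indicator (box a b) x * h x)"
  proof (rule integral_dominated_convergence[where w = "\<lambda>x. norm (indicator (cbox a b) x *\<^sub>R h x)"])
    show "integrable lebesgue (\<lambda>x. norm (indicator (cbox a b) x *\<^sub>R h x))" using hK by (rule integrable_norm)
    show "(\<lambda>x. h x * \<phi> k x) \<in> borel_measurable lebesgue" for k
      using test_fun_integrable(1)[OF h test] by (rule borel_measurable_integrable)
    show "(\<lambda>x. indicator (box a b) x * h x) \<in> borel_measurable lebesgue" using hB by (rule borel_measurable_integrable)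
    show "AE x in lebesgue. (\<lambda>k. h x * \<phi> k x) \<longlonglongrightarrow> indicator (box a b) x * h x"
    proof (rule AE_I2)
      fix x
      show "(\<lambda>k. h x * \<phi> k x) \<longlonglongrightarrow> indicator (box a b) x * h x"
        using tendsto_mult_left[OF lim\<phi>, of x "h x"] \<phi>0[of x] by (cases "x \<in> box a b") auto
    qed
    show "AE x in lebesgue. norm (h x * \<phi> k x) \<le> norm (indicator (cbox a b) x *\<^sub>R h x)" for k
    proof (rule AE_I2)
      fix x
      show "norm (h x * \<phi> k x) \<le> norm (indicator (cbox a b) x *\<^sub>R h x)" using \<phi>01[of k x] \<phi>0[of x k] box_subset_cbox[of a b]
        by (cases "x \<in> box a b") (auto simp: abs_mult mult_left_le indicator_def)
    qed
  qed
  moreover have "(LINT x|lebesgue. h x * \<phi> k x) = 0" for k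
    using zero[OF test] test_fun_integral_lebesgue_on(1)[OF test order_refl \<open>open \<D>\<close>] by simp
  ultimately show ?thesis by (simp add: LIMSEQ_const_iff)
qed

text \<open>The fundamental lemma of the calculus of variations: integrals over boxes vanish, boxes
  form an intersection-stable generator of the Borel sets, and an integrable density whose integrals
  over all Borel sets vanish is zero. Countably many closed boxes exhaust the open set.\<close>

lemma weakly_zero_imp_AE_zero:
  fixes h :: "real^'d \<Rightarrow> real"
  assumes h: "local_integrable \<D> h" and op: "open \<D>"
    and zero: "\<And>\<phi>. test_fun \<D> \<phi> \<Longrightarrow> (LINT x|leb \<D>. h x * \<phi> x) = 0"
  shows "AE x\<in>\<D> in lebesgue. h x = 0"
proof -
  have cb: "AE x in lebesgue. x \<in> cbox a b \<longrightarrow> h x = 0" if sub: "cbox a b \<subseteq> \<D>" for a b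
  proof -
    define f where "f x = indicator (cbox a b) x *\<^sub>R h x" for x
    have f: "integrable lebesgue f" using h sub by (auto simp: local_integrable_def set_integrable_def f_def[abs_def])
    \<comment> \<open>\<open>h\<close> is only Lebesgue measurable; the argument with the generator
      needs a Borel representative.\<close>
    obtain f' where f'm[measurable]: "f' \<in> borel_measurable lborel" and ff': "AE x in lborel. f x = f' x"
      using completion_ex_borel_measurable_real[of f lborel] f by auto
    have ff'': "AE x in lebesgue. f x = f' x" using ff' by (rule AE_completion)
    have f'i: "integrable lborel f'"
    proof -
      have "integrable lebesgue f'"
        using f ff'' by (subst integrable_cong_AE[THEN iffD1, OF _ _ ff'']) (auto simp: measurable_completion)
      then show ?thesis by (simp add: integrable_completion)
    qed
    have bx: "(LINT x:box u v|lborel. f' x) = 0" for u v :: "real^'d"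
    proof -
      obtain u' v' where uv: "box u v \<inter> box a b = box u' v'" using box_Int_box[of u v a b] by blast
      have sub': "cbox u' v' \<subseteq> \<D> \<or> box u' v' = {}"
      proof (cases "box u' v' = {}")
        case False
        then have "cbox u' v' = closure (box u' v')" by (simp add: closure_box)
        also have "\<dots> \<subseteq> cbox a b" by (rule closure_minimal) (use uv box_subset_cbox in auto)
        finally have "cbox u' v' \<subseteq> cbox a b" .
        then show ?thesis using sub by blast
      qed auto
      have "(LINT x:box u v|lborel. f' x) = (LINT x|lebesgue. indicator (box u v) x *\<^sub>R f' x)"
        unfolding set_lebesgue_integral_def by (subst integral_completion) auto
      also have "\<dots> = (LINT x|lebesgue. indicator (box u' v') x * h x)"
      proof (rule integral_cong_AE)
        have "AE x in lebesgue. x \<notin> cbox a b - box a b"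
          by (rule AE_not_in) (simp add: negligible_iff_null_sets[symmetric] negligible_frontier_interval)
        with ff'' show "AE x in lebesgue. indicator (box u v) x *\<^sub>R f' x = indicator (box u' v') x * h x"
        proof eventually_elim
          case (elim x)
          have "indicator (box u' v') x = (indicator (box u v) x * indicator (box a b) x :: real)"
            unfolding uv[symmetric] by (simp add: indicator_inter_arith)
          with elim show ?case using box_subset_cbox[of a b] by (auto simp: f_def indicator_def split: if_splits)
        qed
        show "(\<lambda>x. indicator (box u v) x *\<^sub>R f' x) \<in> borel_measurable lebesgue" by (rule measurable_completion) measurable
        have "(\<lambda>x. indicator (box u' v') x * f x) \<in> borel_measurable lebesgue"
          using f by (intro borel_measurable_times borel_measurable_integrable borel_measurable_indicator)
             (auto intro: open_sets_lebesgue)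
        also have "(\<lambda>x. indicator (box u' v') x * f x) = (\<lambda>x. indicator (box u' v') x * h x)"
          by (rule ext) (use uv box_subset_cbox[of a b] in \<open>auto simp: f_def indicator_def\<close>)
        finally show "(\<lambda>x. indicator (box u' v') x * h x) \<in> borel_measurable lebesgue" .
      qed
      also have "\<dots> = 0" using sub' box_integral_zero[OF h op zero] by auto
      finally show ?thesis .
    qed
    \<comment> \<open>The complement step of the induction over the generated sigma-algebra needs
      the integral over the whole space.\<close>
    have total: "(LINT x|lborel. f' x) = 0"
    proof -
      have "(LINT x|lborel. f' x) = (LINT x:box a b|lborel. f' x)" unfolding set_lebesgue_integral_def
      proof (rule integral_cong_AE)
        have "cbox a b - box a b \<in> null_sets lebesgue" by (metis negligible_frontier_interval negligible_iff_null_sets)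
        then have "cbox a b - box a b \<in> null_sets lborel" by (auto simp: null_sets_completion_iff)
        then have "AE x in lborel. x \<notin> cbox a b - box a b" by (rule AE_not_in)
        with ff' show "AE x in lborel. f' x = indicator (box a b) x *\<^sub>R f' x"
          by eventually_elim (auto simp: f_def indicator_def split: if_splits)
      qed auto
      then show ?thesis using bx by simp
    qed
    have all: "(LINT x:A|lborel. f' x) = 0" if A: "A \<in> sets lborel" for A
    proof -
      let ?E = "range (\<lambda>(a, b). box a b :: (real^'d) set)"
      have "Int_stable ?E" by (auto simp: Int_stable_def box_Int_box)
      moreover have "?E \<subseteq> Pow UNIV" by simp
      moreover have "A \<in> sigma_sets UNIV ?E" using A by (simp add: borel_eq_box)
      ultimately show ?thesis
      proof (induction rule: sigma_sets_induct_disjoint)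
        case (basic A)
        then show ?case using bx by auto
      next
        case empty
        show ?case by (simp add: set_lebesgue_integral_def)
      next
        case (compl A)
        then have "A \<in> sets lborel" by (simp add: borel_eq_box)
        then have "(LINT x:UNIV - A|lborel. f' x) + (LINT x:A|lborel. f' x) = (LINT x:(UNIV - A) \<union> A|lborel. f' x)"
          using f'i by (intro set_integral_Un[symmetric] integrable_mult_indicator[folded set_integrable_def]) auto
        then show ?case using compl total by (simp add: set_lebesgue_integral_def)
      next
        case (union A)
        then have mA: "A i \<in> sets lborel" for i by (auto simp: borel_eq_box)
        then have mU: "(\<Union>i. A i) \<in> sets lborel" by (intro sets.countable_UN) auto
        have "(LINT x:(\<Union>i. A i)|lborel. f' x) = (\<Sum>i. LINT x:A i|lborel. f' x)"
          using union f'i by (intro lebesgue_integral_countable_add integrable_mult_indicator[folded set_integrable_def] mA mU)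
             (auto simp: disjoint_family_on_def)
        then show ?case using union by simp
      qed
    qed
    have "AE x in lborel. f' x = 0" using sigma_finite_measure.density_zero[OF lborel.sigma_finite_measure_axioms f'i all] .
    then have "AE x in lebesgue. f' x = 0" by (rule AE_completion)
    with ff'' show ?thesis by eventually_elim (auto simp: f_def)
  qed
  obtain \<C> where D: "countable \<C>" "\<And>X. X \<in> \<C> \<Longrightarrow> \<exists>a b. X = cbox a b" "\<Union>\<C> = \<D>" "\<C> \<subseteq> Pow \<D>"
    using open_countable_Union_open_cbox[OF op] by metis
  have "AE x in lebesgue. \<forall>X\<in>\<C>. x \<in> X \<longrightarrow> h x = 0" unfolding AE_ball_countable[OF D(1)]
  proof
    fix X assume X: "X \<in> \<C>"
    then obtain a b where "X = cbox a b" using D(2) by blast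
    then show "AE x\<in>X in lebesgue. h x = 0" using X D(4) cb by blast
  qed
  then show ?thesis by eventually_elim (use D(3) in blast)
qed

section \<open>Uniqueness and localisation of weak derivatives, agreement with classical
  ones\<close>

lemma local_integrable_diff:
  "local_integrable \<D> u \<Longrightarrow> local_integrable \<D> v \<Longrightarrow> local_integrable \<D> (\<lambda>x. u x - v x)"
  by (auto simp: local_integrable_def intro: set_integral_diff)

lemma local_integrable_continuous: "continuous_on UNIV u \<Longrightarrow> local_integrable \<D> u"
  unfolding local_integrable_def set_integrable_def
proof (intro allI impI)
  fix K assume u: "continuous_on UNIV u" and K: "compact K \<and> K \<subseteq> \<D>"
  obtain r where r: "K \<subseteq> cball 0 r" using compact_imp_bounded K bounded_imp_subset_cball_0 by blast
  obtain B where B: "\<And>x. x \<in> cball 0 r \<Longrightarrow> abs (u x) \<le> B"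
  proof -
    have "bounded (u ` cball 0 r)"
      by (intro compact_imp_bounded compact_continuous_image) (use u in \<open>auto intro: continuous_on_subset\<close>)
    then show ?thesis using that unfolding bounded_iff by fastforce
  qed
  show "integrable lebesgue (\<lambda>x. indicator K x *\<^sub>R u x)"
  proof (rule integrable_bounded_support[where B = "abs B" and r = r])
    show "(\<lambda>x. indicator K x *\<^sub>R u x) \<in> borel_measurable borel"
      using u K by (intro borel_measurable_scaleR borel_measurable_indicator borel_measurable_continuous_onI)
        (auto dest: compact_imp_closed intro: borel_closed)
    show "abs (indicator K x *\<^sub>R u x) \<le> abs B" for x using B[of x] r by (auto simp: indicator_def)
  qed (use r in \<open>auto simp: indicator_def\<close>)
qed

lemma local_integrable_cong_AE:
  assumes "open \<D>" "AE x\<in>\<D> in lebesgue. u x = v x" "local_integrable \<D> u"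
  shows "local_integrable \<D> v"
  unfolding local_integrable_def
proof (intro allI impI)
  fix K assume K: "compact K \<and> K \<subseteq> \<D>"
  obtain N where N: "N \<in> null_sets lebesgue" "{x. \<not> (x \<in> \<D> \<longrightarrow> u x = v x)} \<subseteq> N"
    using assms(2) by (auto simp: eventually_ae_filter)
  have "u absolutely_integrable_on K" using assms(3) K by (auto simp: local_integrable_def)
  then show "v absolutely_integrable_on K"
    by (rule absolutely_integrable_spike[of _ _ N]) (use N K in \<open>auto simp: negligible_iff_null_sets\<close>)
qed

lemma is_weak_pd_unique:
  assumes "open \<D>" "is_weak_pd \<D> i u g" "is_weak_pd \<D> i u g'"
  shows "AE x\<in>\<D> in lebesgue. g x = g' x"
proof -
  have li: "local_integrable \<D> g" "local_integrable \<D> g'" using assms by (auto simp: is_weak_pd_altdef)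
  have "AE x\<in>\<D> in lebesgue. g x - g' x = 0"
  proof (rule weakly_zero_imp_AE_zero[OF local_integrable_diff[OF li] assms(1)])
    fix \<phi> assume t: "test_fun \<D> \<phi>"
    have "(LINT x|leb \<D>. (g x - g' x) * \<phi> x) = (LINT x|lebesgue. g x * \<phi> x - g' x * \<phi> x)"
      unfolding test_fun_integral_lebesgue_on(1)[OF t order_refl assms(1)] by (simp add: left_diff_distrib)
    also have "\<dots> = (LINT x|lebesgue. g x * \<phi> x) - (LINT x|lebesgue. g' x * \<phi> x)"
      using li t by (intro Bochner_Integration.integral_diff test_fun_integrable)
    also have "\<dots> = 0" using is_weak_pdD[OF assms(2) t assms(1)] is_weak_pdD[OF assms(3) t assms(1)] by simp
    finally show "(LINT x|leb \<D>. (g x - g' x) * \<phi> x) = 0" .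
  qed
  then show ?thesis by simp
qed

text \<open>All later access to the choice inside \<open>wpd\<close> goes through this fact: any
  weak derivative at hand may be substituted almost everywhere.\<close>

lemma wpd_AE:
  assumes "open \<D>" "is_weak_pd \<D> i u g"
  shows "AE x\<in>\<D> in lebesgue. wpd \<D> i u x = g x"
  by (rule is_weak_pd_unique[OF assms(1) _ assms(2)])
     (unfold wpd_def, rule someI[where P = "is_weak_pd \<D> i u"], rule assms(2))

lemma is_weak_pd_cong_AE:
  assumes "open \<D>" "is_weak_pd \<D> i u g" "AE x\<in>\<D> in lebesgue. u x = u' x" "AE x\<in>\<D> in lebesgue. g x = g' x"
  shows "is_weak_pd \<D> i u' g'"
proof -
  have li: "local_integrable \<D> u" "local_integrable \<D> g" using assms by (auto simp: is_weak_pd_altdef)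
  note li' = local_integrable_cong_AE[OF assms(1,3) li(1)] local_integrable_cong_AE[OF assms(1,4) li(2)]
  have "(LINT x|lebesgue. u' x * pd i \<phi> x) = - (LINT x|lebesgue. g' x * \<phi> x)" if t: "test_fun \<D> \<phi>" for \<phi>
  proof -
    have "(LINT x|lebesgue. u' x * pd i \<phi> x) = (LINT x|lebesgue. u x * pd i \<phi> x)"
    proof (rule integral_cong_AE)
      show "AE x in lebesgue. u' x * pd i \<phi> x = u x * pd i \<phi> x"
        using assms(3) by eventually_elim (use test_fun_pd_0[OF t] in auto)
    qed (use test_fun_integrable[OF _ t] li li' in \<open>auto intro: borel_measurable_integrable\<close>)
    moreover have "(LINT x|lebesgue. g' x * \<phi> x) = (LINT x|lebesgue. g x * \<phi> x)"
    proof (rule integral_cong_AE)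
      show "AE x in lebesgue. g' x * \<phi> x = g x * \<phi> x" using assms(4) by eventually_elim (use test_fun_pd_0[OF t] in auto)
    qed (use test_fun_integrable[OF _ t] li li' in \<open>auto intro: borel_measurable_integrable\<close>)
    ultimately show ?thesis using is_weak_pdD[OF assms(2) t assms(1)] by simp
  qed
  then show ?thesis using li' assms(1) by (intro is_weak_pdI)
qed

lemma is_weak_pd_subset:
  assumes "is_weak_pd \<D> i u g" "A \<subseteq> \<D>" "open A" "open \<D>"
  shows "is_weak_pd A i u g"
proof -
  have "(LINT x|lebesgue. u x * pd i \<phi> x) = - (LINT x|lebesgue. g x * \<phi> x)" if t: "test_fun A \<phi>" for \<phi>
    by (rule is_weak_pdD[OF assms(1) test_fun_subset[OF t assms(2)] assms(4)])
  moreover have "local_integrable A u" "local_integrable A g"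
    using assms(1,2) unfolding is_weak_pd_altdef by (auto simp: local_integrable_def)
  ultimately show ?thesis by (intro is_weak_pdI assms(3))
qed

text \<open>The derivative of the compactly supported product \<open>p * \<phi>\<close> integrates
  to zero, which is integration by parts.\<close>

lemma is_weak_pd_C1:
  assumes "Ck 1 p" "open \<D>"
  shows "is_weak_pd \<D> i p (pd i p)"
proof -
  have c: "continuous_on UNIV p" "continuous_on UNIV (pd i p)" using Ck_continuous[OF assms(1)] assms(1) by simp_all
  note li = local_integrable_continuous[OF c(1)] local_integrable_continuous[OF c(2)]
  have dp: "p differentiable (at x)" for x using Ck_differentiable[of 0 p] assms(1) by simp
  have "(LINT x|lebesgue. p x * pd i \<phi> x) = - (LINT x|lebesgue. pd i p x * \<phi> x)" if t: "test_fun \<D> \<phi>" for \<phi>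
  proof -
    have C1: "Ck 1 \<phi>" using t by (simp add: test_fun_def)
    obtain K where K: "compact K" "K \<subseteq> \<D>" "\<And>x. x \<notin> K \<Longrightarrow> \<phi> x = 0" using test_fun_support t by blast
    obtain r where r: "K \<subseteq> cball 0 r" using compact_imp_bounded[OF K(1)] bounded_imp_subset_cball_0 by blast
    have d\<phi>: "\<phi> differentiable (at x)" for x using Ck_differentiable[of 0 \<phi>] C1 by simp
    have "(LINT x|lebesgue. pd i (\<lambda>x. p x * \<phi> x) x) = 0"
    proof (intro integral_pd_compact_support[where r = r] Ck_mult assms C1)
      show "p x * \<phi> x = 0" if "x \<notin> cball 0 r" for x
      proof -
        have "x \<notin> K" using r that by blast
        then show ?thesis using K(3) by simp
      qed
    qed
    also have "(\<lambda>x. pd i (\<lambda>x. p x * \<phi> x) x) = (\<lambda>x. p x * pd i \<phi> x + pd i p x * \<phi> x)" by (simp add: pd_mult dp d\<phi>)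
    also have "(LINT x|lebesgue. p x * pd i \<phi> x + pd i p x * \<phi> x)
        = (LINT x|lebesgue. p x * pd i \<phi> x) + (LINT x|lebesgue. pd i p x * \<phi> x)"
      by (intro Bochner_Integration.integral_add test_fun_integrable[OF _ t] li)
    finally show ?thesis by simp
  qed
  then show ?thesis using li assms(2) by (intro is_weak_pdI)
qed

lemma wpd_C1_AE:
  assumes "Ck 1 p" "open \<D>" "AE x\<in>\<D> in lebesgue. u x = p x"
  shows "AE x\<in>\<D> in lebesgue. wpd \<D> i u x = pd i p x"
  by (rule wpd_AE[OF assms(2)], rule is_weak_pd_cong_AE[OF assms(2) is_weak_pd_C1[OF assms(1,2)]])
     (use assms(3) in \<open>auto elim: eventually_mono\<close>)

text \<open>A test function on the smaller set is one on the larger, so the weak derivative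
  restricts. Existence on the larger set is essential: otherwise \<open>wpd \<D>\<close> would be an
  arbitrary choice.\<close>

lemma wpd_restrict_AE:
  assumes "is_weak_pd \<D> i u g" "A \<subseteq> \<D>" "open A" "open \<D>"
  shows "AE x\<in>A in lebesgue. wpd \<D> i u x = wpd A i u x"
proof -
  have 1: "AE x\<in>A in lebesgue. wpd A i u x = g x" by (intro wpd_AE is_weak_pd_subset[OF assms] assms)
  have "AE x\<in>\<D> in lebesgue. wpd \<D> i u x = g x" by (intro wpd_AE assms)
  with 1 show ?thesis by eventually_elim (use assms(2) in auto)
qed

lemma is_weak_pd_diff_C1:
  assumes "is_weak_pd \<D> i u g" "Ck 1 p" "open \<D>"
  shows "is_weak_pd \<D> i (\<lambda>x. u x - p x) (\<lambda>x. g x - pd i p x)"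
proof -
  have p: "is_weak_pd \<D> i p (pd i p)" by (rule is_weak_pd_C1[OF assms(2,3)])
  have li: "local_integrable \<D> u" "local_integrable \<D> g" "local_integrable \<D> p" "local_integrable \<D> (pd i p)"
    using assms(1) p by (auto simp: is_weak_pd_altdef)
  have "(LINT x|lebesgue. (u x - p x) * pd i \<phi> x) = - (LINT x|lebesgue. (g x - pd i p x) * \<phi> x)" if t: "test_fun \<D> \<phi>" for \<phi>
  proof -
    have "(LINT x|lebesgue. u x * pd i \<phi> x) = - (LINT x|lebesgue. g x * \<phi> x)"
      "(LINT x|lebesgue. p x * pd i \<phi> x) = - (LINT x|lebesgue. pd i p x * \<phi> x)"
      using is_weak_pdD[OF assms(1) t assms(3)] is_weak_pdD[OF p t assms(3)] by blast+
    moreover have "(LINT x|lebesgue. (u x - p x) * pd i \<phi> x) = (LINT x|lebesgue. u x * pd i \<phi> x) - (LINT x|lebesgue. p x * pd i \<phi> x)"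
      "(LINT x|lebesgue. (g x - pd i p x) * \<phi> x) = (LINT x|lebesgue. g x * \<phi> x) - (LINT x|lebesgue. pd i p x * \<phi> x)"
      unfolding left_diff_distrib by (intro Bochner_Integration.integral_diff test_fun_integrable[OF _ t] li)+
    ultimately show ?thesis by simp
  qed
  then show ?thesis using li assms(3) by (intro is_weak_pdI local_integrable_diff)
qed

abbreviation full_simplex :: "(real^'d) set \<Rightarrow> bool" where
  "full_simplex E \<equiv> int CARD('d) simplex E"

section \<open>Simplicial meshes\<close>

lemma full_simplex_basics:
  fixes E :: "(real^'d) set"
  assumes "full_simplex E"
  shows "compact E" "closed E" "convex E" "polyhedron E" "aff_dim E = int CARD('d)" "interior E \<noteq> {}"
    "closure (interior E) = E" "E \<in> sets lebesgue" "E \<in> lmeasurable"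
proof -
  have poly: "polytope E" using assms by (rule simplex_imp_polytope)
  then show c: "compact E" "convex E" "polyhedron E"
    by (auto simp: polytope_imp_compact polytope_imp_convex polytope_imp_polyhedron)
  then show "closed E" by (auto dest: compact_imp_closed)
  show ad: "aff_dim E = int CARD('d)" using assms by (rule aff_dim_simplex)
  then have "interior E = rel_interior E" by (simp add: interior_rel_interior_gen)
  moreover have "E \<noteq> {}" using ad by auto
  ultimately show int: "interior E \<noteq> {}" using rel_interior_eq_empty[OF c(2)] by simp
  show "closure (interior E) = E" using convex_closure_interior[OF c(2) int] \<open>closed E\<close> by simp
  show "E \<in> lmeasurable" using c(1) by (rule lmeasurable_compact)
  then show "E \<in> sets lebesgue" by (simp add: fmeasurable_def)
qed

text \<open>Instead of a largest inscribed ball, one with more than half of the supremal diameter is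
  taken; then \<open>Sup X < 4 * \<rho>\<close>, which is the origin of the factor four.\<close>

lemma fat_element:
  fixes E :: "(real^'d) set"
  assumes E: "full_simplex E" and sr: "diameter E \<le> \<kappa> * inball_diameter E"
  obtains z R where "R > 0" "cball z R \<subseteq> E" "E \<subseteq> cball z (4 * \<kappa> * R)"
proof -
  note b = full_simplex_basics[OF E]
  have bd: "bounded E" using b(1) by (rule compact_imp_bounded)
  define X where "X = {2 * \<rho> | x \<rho>. 0 \<le> \<rho> \<and> cball x \<rho> \<subseteq> E}"
  obtain x0 e where e: "e > 0" "cball x0 e \<subseteq> E" using b(6) mem_interior_cball by blast
  have x0X: "2 * e \<in> X" using e by (auto simp: X_def)
  have le: "2 * \<rho> \<le> diameter E" if "0 \<le> \<rho>" "cball x \<rho> \<subseteq> E" for x \<rho>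
    using diameter_subset[OF that(2) bd] that(1) by simp
  have bdd: "bdd_above X" unfolding bdd_above_def X_def using le by blast
  have sup: "Sup X > 0" using cSup_upper[OF x0X bdd] e(1) by linarith
  then obtain r where "r \<in> X" "Sup X / 2 < r" using less_cSupD[of X "Sup X / 2"] x0X by auto
  then obtain z \<rho> where z: "0 \<le> \<rho>" "cball z \<rho> \<subseteq> E" "Sup X / 2 < 2 * \<rho>" by (auto simp: X_def)
  have dX: "diameter E \<le> \<kappa> * Sup X" using sr by (simp add: inball_diameter_def X_def)
  have "diameter E > 0" using le[OF _ e(2)] e(1) by simp
  \<comment> \<open>A positive diameter bounded by \<open>\<kappa> * Sup X\<close> forces
    \<open>\<kappa>\<close> to be positive.\<close>
  then have "\<not> \<kappa> \<le> 0" using dX sup mult_nonpos_nonneg[of \<kappa> "Sup X"] by linarith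
  then have "\<kappa> > 0" by simp
  then have "\<kappa> * Sup X \<le> \<kappa> * (4 * \<rho>)" using z(3) by (intro mult_left_mono) auto
  then have d: "diameter E \<le> 4 * \<kappa> * \<rho>" using dX by simp
  show ?thesis
  proof (rule that)
    show "\<rho> > 0" using z sup by linarith
    show "cball z \<rho> \<subseteq> E" by (rule z)
    have "z \<in> E" using z by auto
    show "E \<subseteq> cball z (4 * \<kappa> * \<rho>)" using order_trans[OF diameter_bounded_bound[OF bd \<open>z \<in> E\<close>] d] by auto
  qed
qed

text \<open>The part \<open>w\<close> of \<open>\<mu>\<close> orthogonal to \<open>\<nu>\<close> is
  a direction inside the first plane, hence orthogonal to \<open>\<mu>\<close> too, hence
  zero.\<close>

lemma hyperplane_normal_unique:
  fixes \<nu> \<mu> :: "'a::euclidean_space"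
  assumes "norm \<nu> = 1" "norm \<mu> = 1" "{x. x \<bullet> \<nu> = b} \<subseteq> {x. x \<bullet> \<mu> = c}"
  shows "\<mu> = \<nu> \<and> c = b \<or> \<mu> = - \<nu> \<and> c = - b"
proof -
  have nn: "\<nu> \<bullet> \<nu> = 1" "\<mu> \<bullet> \<mu> = 1" using assms by (simp_all add: dot_square_norm)
  define a where "a = \<mu> \<bullet> \<nu>"
  define w where "w = \<mu> - a *\<^sub>R \<nu>"
  have w\<nu>: "w \<bullet> \<nu> = 0" by (simp add: w_def a_def inner_diff_left nn)
  have "b *\<^sub>R \<nu> \<in> {x. x \<bullet> \<nu> = b}" "b *\<^sub>R \<nu> + w \<in> {x. x \<bullet> \<nu> = b}" using w\<nu> nn by (auto simp: inner_add_left)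
  then have "(b *\<^sub>R \<nu>) \<bullet> \<mu> = c" "(b *\<^sub>R \<nu> + w) \<bullet> \<mu> = c" using assms(3) by blast+
  then have w\<mu>: "w \<bullet> \<mu> = 0" by (simp add: inner_add_left)
  have "w \<bullet> w = w \<bullet> \<mu> - a * (w \<bullet> \<nu>)" by (simp add: w_def inner_diff_right)
  then have "w = 0" using w\<mu> w\<nu> by simp
  then have m: "\<mu> = a *\<^sub>R \<nu>" by (simp add: w_def)
  then have "a * a = 1" using nn by simp
  then have "a = 1 \<or> a = - 1" using square_eq_1_iff by blast
  moreover have "c = b * a" using \<open>(b *\<^sub>R \<nu>) \<bullet> \<mu> = c\<close> by (simp add: a_def inner_commute)
  ultimately show ?thesis using m by auto
qed

text \<open>An inclusion between affine sets of the same dimension \<open>CARD('d) - 1\<close> is an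
  equality.\<close>

lemma affine_hull_facet:
  fixes E :: "(real^'d) set"
  assumes E: "full_simplex E" and F: "F facet_of E" and \<nu>: "norm \<nu> = 1" and sub: "F \<subseteq> {x. x \<bullet> \<nu> = b}"
  shows "affine hull F = {x. x \<bullet> \<nu> = b}"
proof (rule affine_dim_equal)
  have eq: "{x. x \<bullet> \<nu> = b} = {x. \<nu> \<bullet> x = b}" by (simp add: inner_commute)
  show "affine {x. x \<bullet> \<nu> = b}" unfolding eq by (rule affine_hyperplane)
  then show "affine hull F \<subseteq> {x. x \<bullet> \<nu> = b}" using sub by (rule hull_minimal[rotated])
  show "affine hull F \<noteq> {}" using F by (simp add: facet_of_def)
  have "aff_dim {x. \<nu> \<bullet> x = b} = int (CARD('d)) - 1" using \<nu> by (subst aff_dim_hyperplane) auto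
  then show "aff_dim (affine hull F) = aff_dim {x. x \<bullet> \<nu> = b}"
    using F full_simplex_basics(5)[OF E] unfolding eq by (simp add: facet_of_def)
qed auto

text \<open>This settles the definite description in \<open>outer_normal\<close>. Any candidate is
  constant on \<open>F\<close>, hence normal to its affine hull, hence plus or minus
  \<open>\<nu>\<close>; the minus sign would push all of \<open>E\<close> into the supporting
  hyperplane and make the facet equal to \<open>E\<close>.\<close>

lemma facet_normal:
  fixes E :: "(real^'d) set"
  assumes E: "full_simplex E" and F: "F facet_of E"
  obtains b where "norm (outer_normal E F) = 1" "E \<subseteq> {x. x \<bullet> outer_normal E F \<le> b}"
    "F = E \<inter> {x. x \<bullet> outer_normal E F = b}" "affine hull F = {x. x \<bullet> outer_normal E F = b}"
proof -
  note bas = full_simplex_basics[OF E]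
  obtain a c where a: "a \<noteq> 0" "E \<subseteq> {x. a \<bullet> x \<le> c}" "F = E \<inter> {x. a \<bullet> x = c}" using facet_of_polyhedron[OF bas(4) F] by blast
  define \<nu> where "\<nu> = (1 / norm a) *\<^sub>R a"
  define b where "b = c / norm a"
  have na: "norm a > 0" using a by simp
  have n: "norm \<nu> = 1" using na by (simp add: \<nu>_def)
  have e: "x \<bullet> \<nu> = (a \<bullet> x) / norm a" for x by (simp add: \<nu>_def inner_commute)
  have Eb: "E \<subseteq> {x. x \<bullet> \<nu> \<le> b}" using a(2) na by (auto simp: e b_def divide_right_mono)
  have Fb: "F = E \<inter> {x. x \<bullet> \<nu> = b}" using a(3) na by (auto simp: e b_def)
  have aff: "affine hull F = {x. x \<bullet> \<nu> = b}" using affine_hull_facet[OF E F n] Fb by blast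
  obtain p where p: "p \<in> F" using F by (auto simp: facet_of_def)
  have FE: "F \<subseteq> E" using F by (rule facet_of_imp_subset)
  have "outer_normal E F = \<nu>" unfolding outer_normal_def
  proof (rule the_equality)
    show "norm \<nu> = 1 \<and> (\<forall>x\<in>F. \<forall>y\<in>E. \<nu> \<bullet> (y - x) \<le> 0)" using n Eb Fb by (auto simp: inner_diff_right inner_commute)
    fix \<mu> assume \<mu>: "norm \<mu> = 1 \<and> (\<forall>x\<in>F. \<forall>y\<in>E. \<mu> \<bullet> (y - x) \<le> 0)"
    have "x \<bullet> \<mu> = p \<bullet> \<mu>" if "x \<in> F" for x
    proof -
      have "\<mu> \<bullet> (p - x) \<le> 0" "\<mu> \<bullet> (x - p) \<le> 0" using \<mu> p that FE by blast+
      then show ?thesis by (simp add: inner_diff_right inner_commute)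
    qed
    then have "affine hull F = {x. x \<bullet> \<mu> = p \<bullet> \<mu>}" using \<mu> by (intro affine_hull_facet[OF E F]) auto
    then have "\<mu> = \<nu> \<or> \<mu> = - \<nu>" using hyperplane_normal_unique[of \<nu> \<mu> b "p \<bullet> \<mu>"] n \<mu> aff by auto
    moreover have "\<mu> \<noteq> - \<nu>"
    proof
      assume neg: "\<mu> = - \<nu>"
      have "E \<subseteq> {x. x \<bullet> \<nu> = b}"
      proof
        fix y assume y: "y \<in> E"
        have "p \<bullet> \<nu> = b" using p Fb by auto
        moreover have "\<mu> \<bullet> (y - p) \<le> 0" using \<mu> p y by blast
        ultimately have "y \<bullet> \<nu> \<ge> b" unfolding neg by (simp add: inner_diff_right inner_commute)
        then show "y \<in> {x. x \<bullet> \<nu> = b}" using Eb y by force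
      qed
      then have "F = E" using Fb by auto
      then show False using F by simp
    qed
    ultimately show "\<mu> = \<nu>" by blast
  qed
  then show ?thesis using that[of b] n Eb Fb aff by simp
qed

text \<open>Cutting the inscribed ball of a simplex parallel to a facet and projecting the section from
  the opposite vertex gives a ball of the same radius inside the facet.\<close>

lemma facet_contains_ball:
  fixes E :: "(real^'d) set"
  assumes E: "full_simplex E" and F: "F facet_of E" and Fb: "F = E \<inter> {x. x \<bullet> \<nu> = b}" "E \<subseteq> {x. x \<bullet> \<nu> \<le> b}"
    and \<nu>: "norm \<nu> = 1" and R: "R > 0" "cball z R \<subseteq> E"
  obtains y where "y \<in> F" "\<forall>v. v \<bullet> \<nu> = 0 \<longrightarrow> norm v \<le> R \<longrightarrow> y + v \<in> F" "z \<bullet> \<nu> + R \<le> b"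
proof -
  have nn: "\<nu> \<bullet> \<nu> = 1" using \<nu> by (simp add: dot_square_norm)
  have zR: "z + s *\<^sub>R \<nu> \<in> E" if "abs s \<le> R" for s using R(2) that \<nu> by (auto simp: dist_norm)
  have h: "z \<bullet> \<nu> + R \<le> b" using zR[of R] Fb(2) R(1) by (auto simp: inner_add_left nn)
  obtain C where C: "\<not> affine_dependent C" "E = convex hull C" using E by (auto simp: simplex_def)
  obtain a where a: "a \<in> C" "F = convex hull (C - {a})" using F facet_of_convex_hull_affine_independent[OF C(1)] C(2) by blast
  have ne: "C - {a} \<noteq> {}" using a F by (auto simp: facet_of_def)
  have cone: "\<exists>u\<ge>0. \<exists>v\<ge>0. \<exists>p\<in>F. u + v = 1 \<and> x = u *\<^sub>R a + v *\<^sub>R p" if "x \<in> E" for x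
  proof -
    have "x \<in> convex hull (insert a (C - {a}))" using that C(2) a(1) by (simp add: insert_absorb)
    then show ?thesis using convex_hull_insert[OF ne, of a] a(2) by auto
  qed
  have aE: "a \<in> E" using a C(2) by (simp add: hull_inc)
  have pF: "p \<bullet> \<nu> = b" if "p \<in> F" for p using that Fb by auto
  have ht: "(u *\<^sub>R a + v *\<^sub>R p) \<bullet> \<nu> = b - u * (b - a \<bullet> \<nu>)" if "u + v = 1" "p \<in> F" for u v p
    using pF[OF that(2)] that(1) by (simp add: inner_add_left algebra_simps flip: distrib_left)
  define t where "t = b - a \<bullet> \<nu>"
  have t0: "t \<ge> 0" using aE Fb(2) by (auto simp: t_def)
  have hge: "x \<bullet> \<nu> \<ge> a \<bullet> \<nu>" if x: "x \<in> E" for x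
  proof -
    obtain u v p where u: "u \<ge> 0" "v \<ge> 0" "p \<in> F" "u + v = 1" "x = u *\<^sub>R a + v *\<^sub>R p" using cone[OF x] by blast
    have "u * t \<le> 1 * t" using u t0 by (intro mult_right_mono) auto
    then show ?thesis using ht[OF u(4,3)] u(5) by (simp add: t_def)
  qed
  have h2: "z \<bullet> \<nu> - R \<ge> a \<bullet> \<nu>" using hge[OF zR[of "- R"]] R(1) by (simp add: inner_diff_left nn)
  have t: "t > 0" using h h2 R(1) by (simp add: t_def)
  have zE: "z \<in> E" using R by auto
  obtain u v y where uv: "u \<ge> 0" "v \<ge> 0" "y \<in> F" "u + v = 1" "z = u *\<^sub>R a + v *\<^sub>R y" using cone[OF zE] by blast
  have zu: "z \<bullet> \<nu> = b - u * t" using ht[OF uv(4,3)] uv(5) by (simp add: t_def)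
  have v0: "v > 0"
  proof (rule ccontr)
    assume "\<not> v > 0"
    then have "v = 0" using uv by simp
    then have "z \<bullet> \<nu> = a \<bullet> \<nu>" using zu uv(4) by (simp add: t_def)
    then show False using h2 R by simp
  qed
  show ?thesis
  proof (rule that[OF uv(3) _ h], intro allI impI)
    fix w assume w: "w \<bullet> \<nu> = 0" "norm w \<le> R"
    \<comment> \<open>The coefficient \<open>v\<close> is the contraction factor of the central
      projection from the vertex \<open>a\<close>. A displacement parallel to the facet keeps the
      height and hence the coefficients, so dividing by \<open>v\<close> recovers a point of
      \<open>F\<close>.\<close>
    have "norm (v *\<^sub>R w) \<le> R" using w(2) uv(1,2,4) mult_mono[of v 1 "norm w" R] R(1) by simp
    then have "z + v *\<^sub>R w \<in> E" using R(2) by (auto simp: dist_norm)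
    then obtain u' v' p where p: "u' \<ge> 0" "v' \<ge> 0" "p \<in> F" "u' + v' = 1" "z + v *\<^sub>R w = u' *\<^sub>R a + v' *\<^sub>R p" using cone by blast
    have "b - u * t = b - u' * t" using ht[OF p(4,3)] p(5)[symmetric] w(1) zu by (simp add: t_def inner_add_left)
    then have uu: "u' = u" using t by simp
    then have vv: "v' = v" using p(4) uv(4) by simp
    have "v *\<^sub>R (y + w) = v *\<^sub>R p" using p(5) uv(5) uu vv by (simp add: scaleR_add_right)
    then have "y + w = p" using v0 by simp
    then show "y + w \<in> F" using p by simp
  qed
qed

text \<open>Write \<open>x\<close> as a convex combination of \<open>z\<close> and a point
  \<open>y + v\<close> of the disk, where the weight \<open>\<mu>\<close> of \<open>z\<close> is the
  depth of \<open>x\<close> below the plane relative to that of \<open>z\<close>. The weight is at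
  most one half, and the smallness conditions on \<open>\<rho>\<close> keep \<open>v\<close> within
  radius \<open>r\<close>.\<close>

lemma half_ball_in_convex:
  fixes \<nu> :: "'a::euclidean_space"
  assumes E: "convex E" and \<nu>: "norm \<nu> = 1" and y: "y \<bullet> \<nu> = b" "y \<in> E"
    and B: "\<And>v. v \<bullet> \<nu> = 0 \<Longrightarrow> norm v \<le> r \<Longrightarrow> y + v \<in> E"
    and z: "z \<in> E" "z \<bullet> \<nu> + R \<le> b" "norm (z - y) \<le> K * R" and R: "R > 0" "K \<ge> 0"
    and \<rho>: "0 < \<rho>" "2 * \<rho> \<le> R" "2 * \<rho> * (1 + K) \<le> r"
    and x: "norm (x - y) \<le> \<rho>" "x \<bullet> \<nu> \<le> b"
  shows "x \<in> E"
proof -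
  define H where "H = b - z \<bullet> \<nu>"
  have H: "H \<ge> R" using z by (simp add: H_def)
  define \<mu> where "\<mu> = (b - x \<bullet> \<nu>) / H"
  have "b - x \<bullet> \<nu> = (y - x) \<bullet> \<nu>" using y by (simp add: inner_diff_left)
  also have "\<dots> \<le> norm (y - x)" using norm_cauchy_schwarz[of "y - x" \<nu>] \<nu> by simp
  finally have hx: "b - x \<bullet> \<nu> \<le> \<rho>" using x by (simp add: norm_minus_commute)
  have H0: "H > 0" using H R by simp
  have "\<rho> / H \<le> \<rho> / R" using H R \<rho> by (intro divide_left_mono) auto
  then have \<mu>: "0 \<le> \<mu>" "\<mu> \<le> \<rho> / R" using H0 x hx divide_right_mono[OF hx, of H] by (auto simp: \<mu>_def)
  have "\<rho> / R \<le> 1 / 2" using \<rho> R by (simp add: field_simps)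
  then have \<mu>2: "\<mu> \<le> 1 / 2" by (rule order_trans[OF \<mu>(2)])
  define v where "v = (1 / (1 - \<mu>)) *\<^sub>R ((x - y) - \<mu> *\<^sub>R (z - y))"
  have "((x - y) - \<mu> *\<^sub>R (z - y)) \<bullet> \<nu> = (x \<bullet> \<nu> - b) + \<mu> * H" using y by (simp add: inner_diff_left H_def algebra_simps)
  also have "\<dots> = 0" using H0 by (simp add: \<mu>_def)
  finally have v\<nu>: "v \<bullet> \<nu> = 0" by (simp add: v_def)
  have "norm ((x - y) - \<mu> *\<^sub>R (z - y)) \<le> norm (x - y) + \<mu> * norm (z - y)"
    using norm_triangle_ineq4[of "x - y" "\<mu> *\<^sub>R (z - y)"] \<mu> by simp
  also have "\<dots> \<le> \<rho> + (\<rho> / R) * (K * R)" using x z \<mu> R \<rho> by (intro add_mono mult_mono) auto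
  also have "\<dots> = \<rho> * (1 + K)" using R by (simp add: field_simps)
  finally have n: "norm ((x - y) - \<mu> *\<^sub>R (z - y)) \<le> \<rho> * (1 + K)" .
  have "norm v \<le> 2 * (\<rho> * (1 + K))"
  proof -
    have "1 / (1 - \<mu>) \<le> 2" using \<mu>2 by (simp add: field_simps)
    moreover have "norm v = (1 / (1 - \<mu>)) * norm ((x - y) - \<mu> *\<^sub>R (z - y))" using \<mu>2 by (simp add: v_def)
    ultimately show ?thesis using n \<mu>2 by (simp only:) (intro mult_mono, auto)
  qed
  then have "y + v \<in> E" using B v\<nu> \<rho> by simp
  then have "(1 - \<mu>) *\<^sub>R (y + v) + \<mu> *\<^sub>R z \<in> E" using E z \<mu> \<mu>2 by (intro convexD) auto
  also have "(1 - \<mu>) *\<^sub>R (y + v) + \<mu> *\<^sub>R z = x" using \<mu>2 by (simp add: v_def scaleR_add_right) (simp add: algebra_simps)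
  finally show ?thesis .
qed

text \<open>A Lipschitz domain lies locally on one side of its boundary: the points strictly below
  the graph form an open set \<open>W\<close> disjoint from \<open>\<D>\<close>, hence from its
  closure, and \<open>W\<close> comes arbitrarily near the boundary point. Needed because the mesh
  is a partition of \<open>closure \<D>\<close>, while weak derivatives live on the open
  set.\<close>

lemma interior_closure_lipschitz:
  fixes \<D> :: "(real^'d) set"
  assumes op: "open \<D>" and lip: "lipschitz_boundary \<D>"
  shows "interior (closure \<D>) = \<D>"
proof
  show "\<D> \<subseteq> interior (closure \<D>)" by (intro interior_maximal closure_subset op)
  show "interior (closure \<D>) \<subseteq> \<D>"
  proof
    fix x assume x: "x \<in> interior (closure \<D>)"
    show "x \<in> \<D>"
    proof (rule ccontr)
      assume "x \<notin> \<D>"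
      then have "x \<in> frontier \<D>" using x interior_subset op by (auto simp: frontier_def interior_open)
      then obtain \<nu> \<rho> L g where g: "norm \<nu> = 1" "\<rho> > 0" "L-lipschitz_on UNIV g"
        "\<D> \<inter> ball x \<rho> = {y \<in> ball x \<rho>. g (y - (y \<bullet> \<nu>) *\<^sub>R \<nu>) < y \<bullet> \<nu>}"
        using lip unfolding lipschitz_boundary_def by blast
      have nn: "\<nu> \<bullet> \<nu> = 1" using g by (simp add: dot_square_norm)
      have cg: "continuous_on UNIV g" using g(3) by (rule lipschitz_on_continuous_on)
      define W where "W = ball x \<rho> \<inter> {y. y \<bullet> \<nu> < g (y - (y \<bullet> \<nu>) *\<^sub>R \<nu>)}"
      have "open W" unfolding W_def
        by (intro open_Int open_ball open_Collect_less continuous_intros continuous_on_compose2[OF cg]) auto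
      moreover have "p \<notin> W" if "p \<in> \<D>" for p
      proof
        assume "p \<in> W"
        then have "p \<in> {y \<in> ball x \<rho>. g (y - (y \<bullet> \<nu>) *\<^sub>R \<nu>) < y \<bullet> \<nu>}"
          unfolding g(4)[symmetric] using that by (auto simp: W_def)
        then show False using \<open>p \<in> W\<close> by (simp add: W_def)
      qed
      then have "W \<inter> \<D> = {}" by blast
      ultimately have "W \<inter> closure \<D> = {}" using open_Int_closure_eq_empty by blast
      obtain e where e: "e > 0" "ball x e \<subseteq> closure \<D>" using x mem_interior by blast
      define s where "s = min e \<rho> / 2"
      define y where "y = x - s *\<^sub>R \<nu>"
      have s: "s > 0" "s < e" "s < \<rho>" using e g by (auto simp: s_def)
      have "y \<in> ball x e" "y \<in> ball x \<rho>" using s g(1) by (auto simp: y_def dist_norm)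
      have "x \<notin> \<D>" "x \<in> ball x \<rho>" using g \<open>x \<notin> \<D>\<close> by auto
      then have "x \<bullet> \<nu> \<le> g (x - (x \<bullet> \<nu>) *\<^sub>R \<nu>)" using g(4) by force
      moreover have "y - (y \<bullet> \<nu>) *\<^sub>R \<nu> = x - (x \<bullet> \<nu>) *\<^sub>R \<nu>" by (simp add: y_def inner_diff_left nn algebra_simps)
      moreover have "y \<bullet> \<nu> < x \<bullet> \<nu>" using s by (simp add: y_def inner_diff_left nn)
      ultimately have "y \<in> W" using \<open>y \<in> ball x \<rho>\<close> by (simp add: W_def)
      then show False using \<open>W \<inter> closure \<D> = {}\<close> \<open>y \<in> ball x e\<close> e(2) by blast
    qed
  qed
qed

section \<open>Neighbouring elements and interior sides\<close>

lemma conforming_partitionD: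
  assumes "conforming_partition \<D> (\<G> :: 'd::finite mesh)"
  shows "finite \<G>" "\<And>E. E \<in> \<G> \<Longrightarrow> full_simplex E" "\<Union>\<G> = closure \<D>"
    "\<And>E E'. E \<in> \<G> \<Longrightarrow> E' \<in> \<G> \<Longrightarrow> E \<inter> E' face_of E"
  using assms by (auto simp: conforming_partition_def triangulation_def)

text \<open>Otherwise the common face meets the relative interior of \<open>E\<close>, so it is all
  of \<open>E\<close>; then \<open>E\<close> is a proper face of \<open>E'\<close>, against equality
  of dimensions.\<close>

lemma interior_disjoint_element:
  fixes \<G> :: "'d::finite mesh"
  assumes cp: "conforming_partition \<D> \<G>" and E: "E \<in> \<G>" "E' \<in> \<G>" "E \<noteq> E'"
  shows "interior E \<inter> E' = {}"
proof (rule ccontr)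
  note D = conforming_partitionD[OF cp]
  note b = full_simplex_basics[OF D(2)[OF E(1)]] and b' = full_simplex_basics[OF D(2)[OF E(2)]]
  assume "interior E \<inter> E' \<noteq> {}"
  then have "(E \<inter> E') \<inter> rel_interior E \<noteq> {}" using interior_subset_rel_interior[of E] interior_subset[of E] by blast
  then have "E \<subseteq> E \<inter> E'" using subset_of_face_of[OF D(4)[OF E(1,2)]] by blast
  then have "E face_of E'" using D(4)[OF E(2,1)] by (metis Int_absorb1 le_inf_iff)
  then have "aff_dim E < aff_dim E'" using face_of_aff_dim_lt b'(3) E(3) by blast
  then show False using b(5) b'(5) by simp
qed

lemma hmesh_interior:
  fixes \<G> :: "'d::finite mesh"
  assumes cp: "conforming_partition \<D> \<G>" and E: "E \<in> \<G>" and x: "x \<in> interior E"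
  shows "hmesh \<G> x = measure lebesgue E powr (1 / real CARD('d))"
proof -
  have "neighbours \<G> {x} = {E}" using interior_disjoint_element[OF cp E] x E interior_subset[of E] by (auto simp: neighbours_def)
  then show ?thesis by (simp add: hmesh_def patch_def)
qed

lemma AE_interior_element:
  fixes E :: "(real^'d) set"
  assumes "full_simplex E"
  shows "AE x\<in>E in lebesgue. x \<in> interior E"
proof -
  have "negligible (frontier E)" using full_simplex_basics(3)[OF assms] by (rule negligible_convex_frontier)
  then have "AE x in lebesgue. x \<notin> frontier E" by (intro AE_not_in) (simp add: negligible_iff_null_sets)
  then show ?thesis by eventually_elim (use full_simplex_basics(2)[OF assms] in \<open>auto simp: frontier_def\<close>)
qed

text \<open>Everything the jump argument uses about an interior side: a point \<open>y\<close> on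
  it, half-balls of radius \<open>\<rho>\<close> inside the two elements, and a ball of radius
  \<open>K * \<rho>\<close> that covers both. The last two clauses exclude any further element
  containing \<open>y\<close> or all of \<open>F\<close>.\<close>

definition side_config :: "real \<Rightarrow> 'd mesh \<Rightarrow> (real^'d) set \<Rightarrow> (real^'d) set \<Rightarrow> (real^'d) set \<Rightarrow>
    real^'d \<Rightarrow> real \<Rightarrow> real^'d \<Rightarrow> real \<Rightarrow> bool" where
  "side_config K \<G> F E1 E2 \<nu> b y \<rho> \<longleftrightarrow>
     E1 \<in> \<G> \<and> E2 \<in> \<G> \<and> E1 \<noteq> E2 \<and> F = E1 \<inter> E2 \<and> F facet_of E1 \<and> F facet_of E2 \<and>
     outer_normal E1 F = \<nu> \<and> outer_normal E2 F = - \<nu> \<and> norm \<nu> = 1 \<and> y \<bullet> \<nu> = b \<and> \<rho> > 0 \<and>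
     E1 \<subseteq> {x. x \<bullet> \<nu> \<le> b} \<and> E2 \<subseteq> {x. b \<le> x \<bullet> \<nu>} \<and> affine hull F = {x. x \<bullet> \<nu> = b} \<and>
     ball y \<rho> \<inter> {x. x \<bullet> \<nu> \<le> b} \<subseteq> E1 \<and> ball y \<rho> \<inter> {x. b \<le> x \<bullet> \<nu>} \<subseteq> E2 \<and>
     E1 \<union> E2 \<subseteq> cball y (K * \<rho>) \<and> (\<forall>E\<in>\<G>. y \<in> E \<longrightarrow> E = E1 \<or> E = E2) \<and>
     (\<forall>E\<in>\<G>. F \<subseteq> E \<longrightarrow> E = E1 \<or> E = E2)"

text \<open>There is no dimension strictly between that of a facet and that of the simplex.\<close>

lemma facet_face_eq:
  fixes E :: "(real^'d) set"
  assumes "full_simplex E" "F facet_of E" "K face_of E" "F \<subseteq> K" "K \<noteq> E"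
  shows "F = K"
proof (rule ccontr)
  assume "F \<noteq> K"
  note b = full_simplex_basics[OF assms(1)]
  have "F face_of K" using assms by (meson face_of_subset facet_of_imp_face_of face_of_imp_subset)
  then have "aff_dim F < aff_dim K" using face_of_aff_dim_lt face_of_imp_convex[OF assms(3)] \<open>F \<noteq> K\<close> by blast
  moreover have "aff_dim K < aff_dim E" using face_of_aff_dim_lt[OF b(3) assms(3,5)] .
  ultimately show False using assms(2) by (simp add: facet_of_def)
qed

text \<open>Take a relative interior point \<open>x\<close> of the side. If no other element
  contained it, a short step along the outer normal would stay in the domain but leave the union of
  the mesh. The face property then puts all of \<open>F\<close> into the second element.\<close>

lemma interior_side_second_element:
  fixes \<G> :: "'d::finite mesh"
  assumes cp: "conforming_partition \<D> \<G>" and op: "open \<D>"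
    and E1: "E1 \<in> \<G>" and F: "F facet_of E1" and rF: "rel_interior F \<subseteq> \<D>"
  obtains E2 where "E2 \<in> \<G>" "E2 \<noteq> E1" "F = E1 \<inter> E2" "F facet_of E2"
proof -
  note D = conforming_partitionD[OF cp]
  note b = full_simplex_basics[OF D(2)[OF E1]]
  obtain c where n: "norm (outer_normal E1 F) = 1" "E1 \<subseteq> {x. x \<bullet> outer_normal E1 F \<le> c}"
    "F = E1 \<inter> {x. x \<bullet> outer_normal E1 F = c}" using facet_normal[OF D(2)[OF E1] F] by metis
  define \<nu> where "\<nu> = outer_normal E1 F"
  have nn: "\<nu> \<bullet> \<nu> = 1" using n by (simp add: \<nu>_def dot_square_norm)
  have "convex F" using F facet_of_imp_face_of face_of_imp_convex by blast
  moreover have "F \<noteq> {}" using F by (simp add: facet_of_def)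
  ultimately obtain x where x: "x \<in> rel_interior F" using rel_interior_eq_empty by blast
  have xF: "x \<in> F" using x rel_interior_subset by blast
  have x\<D>: "x \<in> \<D>" using x rF by blast
  have cl: "closed (\<Union>(\<G> - {E1}))" using D(1) full_simplex_basics(2)[OF D(2)] by (intro closed_Union) auto
  have "x \<in> \<Union>(\<G> - {E1})"
  proof (rule ccontr)
    assume "x \<notin> \<Union>(\<G> - {E1})"
    then have "x \<in> \<D> \<inter> - \<Union>(\<G> - {E1})" using x\<D> by blast
    moreover have "open (\<D> \<inter> - \<Union>(\<G> - {E1}))" using op cl by (intro open_Int) auto
    ultimately obtain e where e: "e > 0" "ball x e \<subseteq> \<D> \<inter> - \<Union>(\<G> - {E1})" using open_contains_ball by blast
    define w where "w = x + (e / 2) *\<^sub>R \<nu>"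
    have "w \<in> ball x e" using e n by (simp add: w_def \<nu>_def dist_norm)
    then have w1: "w \<in> \<D>" "w \<notin> \<Union>(\<G> - {E1})" using e(2) by blast+
    then have "w \<in> \<Union>\<G>" using closure_subset D(3) by blast
    then have "w \<in> E1" using w1 by blast
    then have "w \<bullet> \<nu> \<le> c" using n(2) by (auto simp: \<nu>_def)
    moreover have "x \<bullet> \<nu> = c" using xF n(3) by (auto simp: \<nu>_def)
    ultimately show False using e by (simp add: w_def inner_add_left nn)
  qed
  then obtain E2 where E2: "E2 \<in> \<G>" "E2 \<noteq> E1" "x \<in> E2" by blast
  have FE: "F \<subseteq> E1" using F facet_of_imp_subset by blast
  have "F \<subseteq> E1 \<inter> E2" using subset_of_face_of[OF D(4)[OF E1 E2(1)] FE] x xF E2(3) FE by blast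
  moreover have "E1 \<inter> E2 \<noteq> E1" using interior_disjoint_element[OF cp E1 E2(1)] E2(2) b(6) interior_subset[of E1] by blast
  ultimately have eq: "F = E1 \<inter> E2" using facet_face_eq[OF D(2)[OF E1] F D(4)[OF E1 E2(1)]] by blast
  then have "F face_of E2" using D(4)[OF E2(1) E1] by (simp add: Int_commute)
  then have "F facet_of E2" using F b(5) full_simplex_basics(5)[OF D(2)[OF E2(1)]] by (simp add: facet_of_def)
  with E2 eq that show ?thesis by blast
qed

text \<open>The inscribed ball of \<open>E1\<close> yields a disk of its radius inside
  \<open>F\<close>, centred at \<open>y\<close>. The same disk belongs to \<open>E2\<close>, so both
  elements contain half-balls around \<open>y\<close>; such disks also make the two inscribed radii
  comparable.\<close>

lemma side_config_exists:
  fixes \<G> :: "'d::finite mesh"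
  assumes cp: "conforming_partition \<D> \<G>" and op: "open \<D>" and d: "2 \<le> CARD('d)"
    and sr: "shape_regular \<kappa> \<G>" and E1: "E1 \<in> \<G>" and F: "F facet_of E1" and rF: "rel_interior F \<subseteq> \<D>"
    and K: "K = max 1 (4 * \<kappa>)"
  obtains E2 \<nu> b y \<rho> where "side_config (8 * K ^ 3 * (1 + K)) \<G> F E1 E2 \<nu> b y \<rho>"
proof -
  note D = conforming_partitionD[OF cp]
  have K1: "K \<ge> 1" "4 * \<kappa> \<le> K" using K by auto
  obtain E2 where E2: "E2 \<in> \<G>" "E2 \<noteq> E1" "F = E1 \<inter> E2" "F facet_of E2" using interior_side_second_element[OF cp op E1 F rF] .
  note s1 = D(2)[OF E1] and s2 = D(2)[OF E2(1)]
  note b1 = full_simplex_basics[OF s1] and b2 = full_simplex_basics[OF s2]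
  obtain c1 where n1: "norm (outer_normal E1 F) = 1" "E1 \<subseteq> {x. x \<bullet> outer_normal E1 F \<le> c1}"
    "F = E1 \<inter> {x. x \<bullet> outer_normal E1 F = c1}" "affine hull F = {x. x \<bullet> outer_normal E1 F = c1}" using facet_normal[OF s1 F] .
  obtain c2 where n2: "norm (outer_normal E2 F) = 1" "E2 \<subseteq> {x. x \<bullet> outer_normal E2 F \<le> c2}"
    "F = E2 \<inter> {x. x \<bullet> outer_normal E2 F = c2}" "affine hull F = {x. x \<bullet> outer_normal E2 F = c2}"
    using facet_normal[OF s2 E2(4)] .
  define \<nu> \<mu> where "\<nu> = outer_normal E1 F" and "\<mu> = outer_normal E2 F"
  note n1 = n1[folded \<nu>_def] and n2 = n2[folded \<mu>_def]
  have nn: "\<nu> \<bullet> \<nu> = 1" using n1 by (simp add: dot_square_norm)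
  have sr1: "diameter E \<le> \<kappa> * inball_diameter E" if "E \<in> \<G>" for E using sr that by (simp add: shape_regular_def)
  have fat: "\<exists>z R. R > 0 \<and> cball z R \<subseteq> E \<and> E \<subseteq> cball z (K * R)" if E: "E \<in> \<G>" for E
  proof -
    obtain z R where z: "R > 0" "cball z R \<subseteq> E" "E \<subseteq> cball z (4 * \<kappa> * R)" using fat_element[OF D(2)[OF E] sr1[OF E]] .
    moreover have "cball z (4 * \<kappa> * R) \<subseteq> cball z (K * R)" using K1 z(1) by (intro subset_cball mult_right_mono) auto
    ultimately show ?thesis by blast
  qed
  obtain z1 R1 where z1: "R1 > 0" "cball z1 R1 \<subseteq> E1" "E1 \<subseteq> cball z1 (K * R1)" using fat[OF E1] by blast
  obtain z2 R2 where z2: "R2 > 0" "cball z2 R2 \<subseteq> E2" "E2 \<subseteq> cball z2 (K * R2)" using fat[OF E2(1)] by blast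
  obtain y where y: "y \<in> F" "\<forall>v. v \<bullet> \<nu> = 0 \<longrightarrow> norm v \<le> R1 \<longrightarrow> y + v \<in> F" "z1 \<bullet> \<nu> + R1 \<le> c1"
    using facet_contains_ball[OF s1 F n1(3) n1(2) n1(1) z1(1,2)] .
  obtain y2 where y2: "y2 \<in> F" "\<forall>v. v \<bullet> \<mu> = 0 \<longrightarrow> norm v \<le> R2 \<longrightarrow> y2 + v \<in> F" "z2 \<bullet> \<mu> + R2 \<le> c2"
    using facet_contains_ball[OF s2 E2(4) n2(3) n2(2) n2(1) z2(1,2)] .
  have sgn: "\<mu> = \<nu> \<and> c2 = c1 \<or> \<mu> = - \<nu> \<and> c2 = - c1" using hyperplane_normal_unique[OF n1(1) n2(1)] n1(4) n2(4) by blast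
  have perp: "v \<bullet> \<mu> = 0 \<longleftrightarrow> v \<bullet> \<nu> = 0" for v using sgn by auto
  \<comment> \<open>A tangential unit vector exists because \<open>CARD('d)\<close> is at least two.
    A segment of length \<open>2 * r\<close> in \<open>F\<close> must fit into the covering ball of
    either element, which is how the inscribed radii are compared.\<close>
  obtain v where v: "v \<bullet> \<nu> = 0" "norm v = 1"
  proof -
    obtain w :: "real^'d" where "w \<noteq> 0" "orthogonal \<nu> w" using orthogonal_to_vector_exists[of \<nu>] d by auto
    then show ?thesis using that[of "(1 / norm w) *\<^sub>R w"] by (simp add: orthogonal_def inner_commute)
  qed
  have comp: "r \<le> K * R" if "p + r *\<^sub>R v \<in> F" "p - r *\<^sub>R v \<in> F" "F \<subseteq> cball z (K * R)" "r > 0" for p r z R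
  proof -
    have "norm (p + r *\<^sub>R v - z) \<le> K * R" "norm (p - r *\<^sub>R v - z) \<le> K * R"
      using that by (auto simp: dist_norm norm_minus_commute)
    then have "norm ((p + r *\<^sub>R v - z) - (p - r *\<^sub>R v - z)) \<le> 2 * (K * R)"
      using norm_triangle_ineq4[of "p + r *\<^sub>R v - z" "p - r *\<^sub>R v - z"] by linarith
    also have "(p + r *\<^sub>R v - z) - (p - r *\<^sub>R v - z) = (2 * r) *\<^sub>R v" by (simp add: algebra_simps flip: scaleR_2)
    finally show ?thesis using v that by simp
  qed
  have F12: "F \<subseteq> E1" "F \<subseteq> E2" using E2(3) by auto
  have R12: "R1 \<le> K * R2"
    using comp[of y R1 z2 R2] y(2)[rule_format, of "R1 *\<^sub>R v"] y(2)[rule_format, of "- (R1 *\<^sub>R v)"] v z1 z2 F12 by auto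
  have R21: "R2 \<le> K * R1"
    using comp[of y2 R2 z1 R1] y2(2)[rule_format, of "R2 *\<^sub>R v"] y2(2)[rule_format, of "- (R2 *\<^sub>R v)"] v perp[of v] z1 z2 F12 by auto
  \<comment> \<open>Small enough for \<open>half_ball_in_convex\<close> in both elements. The disk
    around \<open>y\<close> has radius \<open>R1\<close> in either case; the additional factor
    \<open>K\<close> pays for \<open>R1 \<le> K * R2\<close>.\<close>
  define \<rho> where "\<rho> = R1 / (4 * K * (1 + K))"
  have \<rho>0: "\<rho> > 0" using z1 K1 by (simp add: \<rho>_def)
  have R1\<rho>: "R1 = 4 * K * (1 + K) * \<rho>" using K1 by (simp add: \<rho>_def)
  have le1: "2 * \<rho> * (1 + K) \<le> R1"
  proof -
    have "1 * (2 * \<rho> * (1 + K)) \<le> (2 * K) * (2 * \<rho> * (1 + K))" using K1 \<rho>0 by (intro mult_right_mono) auto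
    then show ?thesis unfolding R1\<rho> by (simp add: algebra_simps)
  qed
  have "2 * \<rho> * 1 \<le> 2 * \<rho> * (1 + K)" using K1 \<rho>0 by (intro mult_left_mono) auto
  then have le2: "2 * \<rho> \<le> R1" using le1 by linarith
  have le3: "2 * \<rho> \<le> R2"
  proof -
    have "K * (2 * \<rho>) \<le> K * (4 * (1 + K) * \<rho>)" using K1 \<rho>0 by (intro mult_left_mono) (auto simp: algebra_simps)
    also have "\<dots> = R1" unfolding R1\<rho> by simp
    also have "\<dots> \<le> K * R2" by (rule R12)
    finally show ?thesis using K1 by simp
  qed
  have yc: "y \<bullet> \<nu> = c1" "y \<in> E1" "y \<in> E2" using y(1) n1(3) F12 by auto
  have zy1: "norm (z1 - y) \<le> K * R1" using yc z1 by (auto simp: dist_norm)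
  have zy2: "norm (z2 - y) \<le> K * R2" using yc z2 by (auto simp: dist_norm)
  have zE: "z1 \<in> E1" "z2 \<in> E2" using z1 z2 by auto
  have half1: "x \<in> E1" if "norm (x - y) \<le> \<rho>" "x \<bullet> \<nu> \<le> c1" for x
    by (rule half_ball_in_convex[OF b1(3) n1(1) yc(1,2) _ zE(1) y(3) zy1 z1(1) _ \<rho>0 le2 le1 that])
       (use y(2) F12 K1 in auto)
  have yc2: "y \<bullet> \<mu> = c2" using y(1) n2(3) by auto
  have half2: "x \<in> E2" if "norm (x - y) \<le> \<rho>" "x \<bullet> \<mu> \<le> c2" for x
    by (rule half_ball_in_convex[OF b2(3) n2(1) yc2 yc(3) _ zE(2) y2(3) zy2 z2(1) _ \<rho>0 le3 le1 that])
       (use y(2) F12 K1 perp in auto)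
  \<comment> \<open>With equal normals both elements would contain the same open half-ball, although
    the interior of an element meets no other element.\<close>
  have opp: "\<mu> = - \<nu> \<and> c2 = - c1"
  proof (rule ccontr)
    assume "\<not> ?thesis"
    then have same: "\<mu> = \<nu>" "c2 = c1" using sgn by auto
    define W where "W = ball y \<rho> \<inter> {x. x \<bullet> \<nu> < c1}"
    have "open W" unfolding W_def by (intro open_Int open_ball open_Collect_less continuous_intros)
    moreover have "W \<subseteq> E1" using half1 by (auto simp: W_def dist_norm norm_minus_commute)
    ultimately have "W \<subseteq> interior E1" by (simp add: interior_maximal)
    moreover have "W \<subseteq> E2" using half2 same by (auto simp: W_def dist_norm norm_minus_commute)
    moreover have "y - (\<rho> / 2) *\<^sub>R \<nu> \<in> W" using \<rho>0 n1(1) yc by (auto simp: W_def dist_norm inner_diff_left nn)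
    ultimately show False using interior_disjoint_element[OF cp E1 E2(1)] E2(2) by blast
  qed
  have ball12: "ball y \<rho> \<inter> {x. x \<bullet> \<nu> \<le> c1} \<subseteq> E1" "ball y \<rho> \<inter> {x. c1 \<le> x \<bullet> \<nu>} \<subseteq> E2"
    using half1 half2 opp by (auto simp: dist_norm norm_minus_commute)
  then have ballU: "ball y \<rho> \<subseteq> E1 \<union> E2" using linear by blast
  have only: "E = E1 \<or> E = E2" if E: "E \<in> \<G>" "y \<in> E" for E
  proof (rule ccontr)
    assume "\<not> ?thesis"
    then have ne: "E \<noteq> E1" "E \<noteq> E2" by auto
    note b = full_simplex_basics[OF D(2)[OF E(1)]]
    have "y \<in> ball y \<rho> \<inter> closure (interior E)" using b(7) E \<rho>0 by simp
    then have "ball y \<rho> \<inter> interior E \<noteq> {}" using open_Int_closure_eq_empty[OF open_ball, of y \<rho> "interior E"] by blast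
    then show False using interior_disjoint_element[OF cp E(1)] E1 E2(1) ne ballU by blast
  qed
  have KK: "K * R1 \<le> K * (K * R1)" using mult_right_mono[OF K1(1), of "K * R1"] K1 z1 by simp
  have "E1 \<subseteq> cball y (2 * (K * (K * R1)))"
  proof
    fix x assume "x \<in> E1"
    then have "dist z1 x \<le> K * R1" "dist z1 y \<le> K * R1" using z1 yc by auto
    then have "dist y x \<le> 2 * (K * R1)" using dist_triangle3[of y x z1] by linarith
    then show "x \<in> cball y (2 * (K * (K * R1)))" using KK by simp
  qed
  moreover have "E2 \<subseteq> cball y (2 * (K * (K * R1)))"
  proof
    fix x assume "x \<in> E2"
    then have "dist z2 x \<le> K * R2" "dist z2 y \<le> K * R2" using z2 yc by auto
    then have "dist y x \<le> 2 * (K * R2)" using dist_triangle3[of y x z2] by linarith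
    also have "\<dots> \<le> 2 * (K * (K * R1))" using mult_left_mono[OF R21, of K] K1 by simp
    finally show "x \<in> cball y (2 * (K * (K * R1)))" by simp
  qed
  \<comment> \<open>Both elements lie within \<open>2 * K * K * R1\<close> of \<open>y\<close>;
    expressed through \<open>\<rho>\<close> this is the covering ratio of the conclusion.\<close>
  moreover have "2 * (K * (K * R1)) = 8 * K ^ 3 * (1 + K) * \<rho>" unfolding R1\<rho> by (simp add: power3_eq_cube)
  ultimately have big: "E1 \<union> E2 \<subseteq> cball y (8 * K ^ 3 * (1 + K) * \<rho>)" by simp
  have yF: "E = E1 \<or> E = E2" if "E \<in> \<G>" "F \<subseteq> E" for E using only that y(1) by blast
  have "side_config (8 * K ^ 3 * (1 + K)) \<G> F E1 E2 \<nu> c1 y \<rho>" unfolding side_config_def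
  proof (intro conjI ballI impI)
    show "outer_normal E1 F = \<nu>" by (simp add: \<nu>_def)
    show "outer_normal E2 F = - \<nu>" using opp by (simp add: \<mu>_def)
    show "E2 \<subseteq> {x. c1 \<le> x \<bullet> \<nu>}" using n2(2) opp by auto
  qed (fact E1 E2(1-4) E2(2)[symmetric] F n1(1,2,4) yc(1) \<rho>0 ball12 big | rule only yF; assumption)+
  then show ?thesis by (rule that)
qed

text \<open>If \<open>y'\<close> were closer to \<open>y\<close> than \<open>\<rho>\<close>, the
  half-balls around \<open>y\<close> would leave only \<open>E1\<close> and \<open>E2\<close> as
  elements containing \<open>y'\<close>, and both sides would be the intersection of the same two
  elements. So the distance is at least either radius, hence at least their mean.\<close>

lemma side_config_disjoint:
  fixes \<G> :: "'d::finite mesh"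
  assumes cp: "conforming_partition \<D> \<G>"
    and s: "side_config K \<G> F E1 E2 \<nu> b y \<rho>" and s': "side_config K \<G> F' E1' E2' \<nu>' b' y' \<rho>'" and ne: "F \<noteq> F'"
  shows "ball y (\<rho> / 2) \<inter> ball y' (\<rho>' / 2) = {}"
proof -
  have far: "dist y y' \<ge> \<rho>"
    if s: "side_config K \<G> F E1 E2 \<nu> b y \<rho>" and s': "side_config K \<G> F' E1' E2' \<nu>' b' y' \<rho>'" and ne: "F \<noteq> F'"
    for F E1 E2 \<nu> b y \<rho> F' E1' E2' \<nu>' b' y' \<rho>'
  proof (rule ccontr)
    note D = conforming_partitionD[OF cp]
    assume "\<not> dist y y' \<ge> \<rho>"
    then have y': "y' \<in> ball y \<rho>" by simp
    have "ball y \<rho> \<inter> {x. x \<bullet> \<nu> \<le> b} \<subseteq> E1" "ball y \<rho> \<inter> {x. b \<le> x \<bullet> \<nu>} \<subseteq> E2"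
      using s by (auto simp: side_config_def)
    then have U: "ball y \<rho> \<subseteq> E1 \<union> E2" using linear by blast
    have r': "\<rho>' > 0" using s' by (simp add: side_config_def)
    have in12: "E \<in> {E1, E2}" if E: "E \<in> \<G>" "y' \<in> E" for E
    proof (rule ccontr)
      assume n: "E \<notin> {E1, E2}"
      have "y' \<in> closure (interior E)" using full_simplex_basics(7)[OF D(2)[OF E(1)]] E by simp
      then have "ball y \<rho> \<inter> interior E \<noteq> {}" using y' open_Int_closure_eq_empty[OF open_ball, of y \<rho> "interior E"] by blast
      then obtain p where p: "p \<in> interior E" "p \<in> E1 \<union> E2" using U by blast
      have "E1 \<in> \<G>" "E2 \<in> \<G>" using s by (auto simp: side_config_def)
      then show False using interior_disjoint_element[OF cp E(1)] n p by blast
    qed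
    have "ball y' \<rho>' \<inter> {x. x \<bullet> \<nu>' \<le> b'} \<subseteq> E1'" "ball y' \<rho>' \<inter> {x. b' \<le> x \<bullet> \<nu>'} \<subseteq> E2'" "y' \<bullet> \<nu>' = b'"
      using s' by (auto simp: side_config_def)
    then have "y' \<in> E1'" "y' \<in> E2'" using r' by (auto simp: subset_eq)
    then have "E1' \<in> {E1, E2}" "E2' \<in> {E1, E2}" using in12 s' by (auto simp: side_config_def)
    moreover have "E1' \<noteq> E2'" using s' by (simp add: side_config_def)
    ultimately have "E1' \<inter> E2' = E1 \<inter> E2" by auto
    then show False using ne s s' by (simp add: side_config_def)
  qed
  have "dist y y' \<ge> \<rho>" by (rule far[OF s s' ne])
  moreover have "dist y' y \<ge> \<rho>'" by (rule far[OF s' s ne[symmetric]])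
  ultimately have "dist y y' \<ge> \<rho> / 2 + \<rho>' / 2" by (simp add: dist_commute)
  then show ?thesis by (rule disjoint_ballI)
qed

section \<open>Prisms over facets and bump functions\<close>

lemma closest_point_hyperplane:
  fixes \<nu> :: "'a::euclidean_space"
  assumes "norm \<nu> = 1"
  shows "closest_point {x. x \<bullet> \<nu> = b} w = w - (w \<bullet> \<nu> - b) *\<^sub>R \<nu>"
proof -
  have eq: "{x. x \<bullet> \<nu> = b} = {x. \<nu> \<bullet> x = b}" by (simp add: inner_commute)
  have nn: "\<nu> \<bullet> \<nu> = 1" using assms by (simp add: dot_square_norm)
  have "w - (w \<bullet> \<nu> - b) *\<^sub>R \<nu> = closest_point {x. x \<bullet> \<nu> = b} w"
  proof (rule closest_point_unique)
    show "convex {x. x \<bullet> \<nu> = b}" "closed {x. x \<bullet> \<nu> = b}" unfolding eq by (auto intro: convex_hyperplane closed_hyperplane)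
    show "w - (w \<bullet> \<nu> - b) *\<^sub>R \<nu> \<in> {x. x \<bullet> \<nu> = b}" by (simp add: inner_diff_left nn)
    show "\<forall>z\<in>{x. x \<bullet> \<nu> = b}. dist w (w - (w \<bullet> \<nu> - b) *\<^sub>R \<nu>) \<le> dist w z"
    proof
      fix z assume "z \<in> {x. x \<bullet> \<nu> = b}"
      then have "abs (w \<bullet> \<nu> - b) = abs ((w - z) \<bullet> \<nu>)" by (simp add: inner_diff_left)
      also have "\<dots> \<le> norm (w - z)" using Cauchy_Schwarz_ineq2[of "w - z" \<nu>] assms by simp
      finally show "dist w (w - (w \<bullet> \<nu> - b) *\<^sub>R \<nu>) \<le> dist w z" using assms by (simp add: dist_norm)
    qed
  qed
  then show ?thesis by simp
qed

definition prism :: "'a::real_vector set \<Rightarrow> 'a \<Rightarrow> 'a set" where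
  "prism F \<nu> = {x + s *\<^sub>R \<nu> | x s. x \<in> F \<and> 0 \<le> s \<and> s \<le> 1}"

lemma prism_image: "prism F \<nu> = (\<lambda>p. fst p + snd p *\<^sub>R \<nu>) ` (F \<times> {0..1})"
  by (force simp: prism_def)

lemma compact_prism:
  fixes F :: "'a::euclidean_space set"
  assumes "compact F" shows "compact (prism F \<nu>)"
  unfolding prism_image using assms by (intro compact_continuous_image continuous_intros compact_Times) auto

lemma convex_prism:
  fixes F :: "'a::euclidean_space set"
  assumes "convex F" shows "convex (prism F \<nu>)"
proof -
  have "linear (\<lambda>p. fst p + snd p *\<^sub>R \<nu> :: 'a)" by (auto intro!: linearI simp: algebra_simps)
  then show ?thesis unfolding prism_image using assms by (intro convex_linear_image convex_Times) auto
qed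

text \<open>The upper bound is asked on the relative interior only, because the mesh size may jump
  on the relative boundary. The latter is null for the surface measure: its preimage under the
  projection lies in the frontier of the convex prism.\<close>

lemma facet_integral_le:
  fixes E :: "(real^'d) set"
  assumes E: "full_simplex E" and F: "F facet_of E"
    and \<phi>: "\<And>x. x \<in> F \<Longrightarrow> 0 \<le> \<phi> x" "\<And>x. x \<in> rel_interior F \<Longrightarrow> \<phi> x \<le> B" and B: "B \<ge> 0"
  shows "(LINT x:F|facet_measure E F. \<phi> x) \<le> B * measure lebesgue (prism F (outer_normal E F))"
proof -
  obtain b where n: "norm (outer_normal E F) = 1" "affine hull F = {x. x \<bullet> outer_normal E F = b}"
    using facet_normal[OF E F] by metis
  define \<nu> where "\<nu> = outer_normal E F"
  note n = n[folded \<nu>_def]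
  have nn: "\<nu> \<bullet> \<nu> = 1" using n by (simp add: dot_square_norm)
  note bas = full_simplex_basics[OF E]
  have Ff: "F face_of E" using F by (rule facet_of_imp_face_of)
  have cF: "convex F" "closed F" "compact F"
    using face_of_imp_convex[OF Ff] face_of_imp_closed[OF bas(3,2) Ff] face_of_imp_compact[OF bas(3,1) Ff] by auto
  define Q where "Q = prism F \<nu>"
  have Qc: "compact Q" "convex Q" unfolding Q_def using cF by (auto intro: compact_prism convex_prism)
  have Ql: "Q \<in> sets lebesgue" "Q \<in> lmeasurable" using lmeasurable_compact[OF Qc(1)] by (auto simp: fmeasurable_def)
  define \<pi> where "\<pi> = closest_point (affine hull F)"
  have \<pi>: "\<pi> w = w - (w \<bullet> \<nu> - b) *\<^sub>R \<nu>" for w unfolding \<pi>_def n(2) by (rule closest_point_hyperplane[OF n(1)])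
  have "continuous_on UNIV \<pi>" unfolding \<pi>[abs_def] by (intro continuous_intros)
  then have "\<pi> \<in> borel_measurable borel" by (rule borel_measurable_continuous_onI)
  then have \<pi>m: "\<pi> \<in> measurable (leb Q) borel" by (intro measurable_restrict_space1 measurable_completion) simp
  define \<sigma> where "\<sigma> = facet_measure E F"
  have \<sigma>: "\<sigma> = distr (leb Q) borel \<pi>" by (simp add: \<sigma>_def facet_measure_def \<pi>_def Q_def prism_def \<nu>_def)
  interpret finite_measure \<sigma>
    unfolding \<sigma> by (intro finite_measure.finite_measure_distr finite_measure_lebesgue_on Ql \<pi>m)
  have tot: "measure \<sigma> UNIV = measure lebesgue Q" using \<pi>m Ql by (simp add: \<sigma> measure_distr measure_restrict_space)
  define N where "N = rel_frontier F"
  have N: "N \<in> sets borel" by (simp add: N_def)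
  have "\<pi> -` N \<inter> Q \<subseteq> frontier Q"
  proof
    fix x assume x: "x \<in> \<pi> -` N \<inter> Q"
    have "x \<notin> interior Q"
    proof
      assume "x \<in> interior Q"
      then obtain e where e: "e > 0" "ball x e \<subseteq> Q" using mem_interior by blast
      have Q\<pi>: "\<pi> u \<in> F" if uQ: "u \<in> Q" for u
      proof -
        obtain p s where p: "u = p + s *\<^sub>R \<nu>" "p \<in> F" using uQ unfolding Q_def prism_def by blast
        have "p \<bullet> \<nu> = b" using hull_inc[OF p(2), of affine] n(2) by auto
        then have "\<pi> u = p" by (simp add: \<pi> p inner_add_left nn)
        then show ?thesis using p by simp
      qed
      have pF: "\<pi> x \<in> F" using x Q\<pi> by blast
      then have pb: "\<pi> x \<bullet> \<nu> = b" using hull_inc[OF pF, of affine] n(2) by auto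
      have "ball (\<pi> x) e \<inter> affine hull F \<subseteq> F"
      proof
        fix u assume u: "u \<in> ball (\<pi> x) e \<inter> affine hull F"
        then have ub: "u \<bullet> \<nu> = b" by (simp add: n(2))
        have "x + (u - \<pi> x) \<in> ball x e" using u by (simp add: dist_norm norm_minus_commute)
        then have "\<pi> (x + (u - \<pi> x)) \<in> F" using e Q\<pi> by blast
        also have "\<pi> (x + (u - \<pi> x)) = u" using ub pb by (simp add: \<pi> inner_add_left inner_diff_left nn)
        finally show "u \<in> F" .
      qed
      then have "\<pi> x \<in> rel_interior F" using mem_rel_interior_ball pF e by blast
      then show False using x by (simp add: N_def rel_frontier_def)
    qed
    then show "x \<in> frontier Q" using x compact_imp_closed[OF Qc(1)] by (auto simp: frontier_def)
  qed
  then have "negligible (\<pi> -` N \<inter> Q)" using negligible_subset[OF negligible_convex_frontier[OF Qc(2)]] by blast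
  then have null: "\<pi> -` N \<inter> Q \<in> null_sets lebesgue" by (simp add: negligible_iff_null_sets)
  have "N \<in> null_sets \<sigma>" unfolding \<sigma> using \<pi>m N null Ql
    by (auto simp: null_sets_def emeasure_distr emeasure_restrict_space space_restrict_space)
  then have AE: "AE x in \<sigma>. x \<notin> N" by (rule AE_not_in)
  show ?thesis
  proof (cases "integrable \<sigma> (\<lambda>x. indicator F x *\<^sub>R \<phi> x)")
    case True
    have "(\<integral>x. indicator F x *\<^sub>R \<phi> x \<partial>\<sigma>) \<le> (\<integral>x. B \<partial>\<sigma>)"
    proof (rule integral_mono_AE[OF True])
      show "AE x in \<sigma>. indicator F x *\<^sub>R \<phi> x \<le> B" using AE
      proof eventually_elim
        case (elim x)
        show ?case
        proof (cases "x \<in> F")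
          case xF: True
          then have "x \<in> rel_interior F" using elim cF(2) by (simp add: N_def rel_frontier_def)
          then show ?thesis using \<phi>(2) xF by simp
        qed (simp add: B)
      qed
    qed simp
    also have "\<dots> = B * measure lebesgue Q" using tot by (simp add: \<sigma> mult.commute)
    finally show ?thesis by (simp add: set_lebesgue_integral_def \<sigma>_def Q_def \<nu>_def)
  next
    \<comment> \<open>A function that is not integrable has integral zero by convention, so
      measurability of \<open>\<phi>\<close> is not an issue.\<close>
    case False
    then have "(LINT x:F|facet_measure E F. \<phi> x) = 0" by (simp add: set_lebesgue_integral_def \<sigma>_def not_integrable_integral_eq)
    then show ?thesis using B by simp
  qed
qed

text \<open>The prism has height one; rescaled to height \<open>\<rho>\<close> it fits into a ball
  of radius \<open>r + \<rho>\<close>. The surface measure is therefore at most a volume divided by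
  \<open>\<rho>\<close>, the right order when \<open>r\<close> is comparable to
  \<open>\<rho>\<close>.\<close>

lemma prism_measure_le:
  fixes \<nu> y :: "'a::euclidean_space"
  assumes \<nu>: "norm \<nu> = 1" and F: "F \<subseteq> {x. x \<bullet> \<nu> = b}" "F \<subseteq> cball y r" "compact F" and y: "y \<bullet> \<nu> = b" and \<rho>: "\<rho> > 0"
  shows "\<rho> * measure lebesgue (prism F \<nu>) \<le> measure lebesgue (cball y (r + \<rho>))"
proof -
  have nn: "\<nu> \<bullet> \<nu> = 1" using \<nu> by (simp add: dot_square_norm)
  define h :: "'a \<Rightarrow> real" where "h x = indicator (cball y r) (x - (x \<bullet> \<nu> - b) *\<^sub>R \<nu>)" for x
  have hm[measurable]: "h \<in> borel_measurable borel"
  proof -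
    have "(\<lambda>x. x - (x \<bullet> \<nu> - b) *\<^sub>R \<nu>) \<in> measurable borel borel" by (intro borel_measurable_continuous_onI continuous_intros)
    moreover have "(indicator (cball y r) :: 'a \<Rightarrow> real) \<in> borel_measurable borel" by (intro borel_measurable_indicator) auto
    ultimately have "(indicator (cball y r) :: 'a \<Rightarrow> real) \<circ> (\<lambda>x. x - (x \<bullet> \<nu> - b) *\<^sub>R \<nu>) \<in> borel_measurable borel"
      by (rule measurable_comp)
    then show ?thesis by (simp add: comp_def h_def[abs_def])
  qed
  have inv: "h (x + s *\<^sub>R \<nu>) = h x" for x s by (simp add: h_def inner_add_left nn algebra_simps)
  have hd: "dist y x \<le> r + abs (x \<bullet> \<nu> - b)" if "h x \<noteq> 0" for x
  proof -
    have "norm (x - (x \<bullet> \<nu> - b) *\<^sub>R \<nu> - y) \<le> r" using that by (simp add: h_def indicator_def dist_norm norm_minus_commute split: if_splits)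
    moreover have "norm (x - y) \<le> norm (x - (x \<bullet> \<nu> - b) *\<^sub>R \<nu> - y) + norm ((x \<bullet> \<nu> - b) *\<^sub>R \<nu>)"
      using norm_triangle_ineq[of "x - (x \<bullet> \<nu> - b) *\<^sub>R \<nu> - y" "(x \<bullet> \<nu> - b) *\<^sub>R \<nu>"] by (simp add: algebra_simps)
    ultimately show ?thesis using \<nu> by (simp add: dist_norm norm_minus_commute)
  qed
  have int: "integrable lebesgue (\<lambda>x. indicator (slab \<nu> a c) x * h x)" for a c
  proof (rule integrable_bounded_support[where B = 1 and r = "norm y + r + abs (a - b) + abs (c - b)"])
    show "abs (indicator (slab \<nu> a c) x * h x) \<le> 1" for x by (simp add: h_def indicator_def)
    show "indicator (slab \<nu> a c) x * h x = 0" if "x \<notin> cball 0 (norm y + r + abs (a - b) + abs (c - b))" for x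
    proof (rule ccontr)
      assume "\<not> ?thesis"
      then have x: "x \<in> slab \<nu> a c" "h x \<noteq> 0" by (auto simp: indicator_def split: if_splits)
      have "norm x \<le> norm y + dist y x" using norm_triangle_ineq[of y "x - y"] by (simp add: dist_norm norm_minus_commute)
      moreover have "abs (x \<bullet> \<nu> - b) \<le> abs (a - b) + abs (c - b)" using x by auto
      ultimately show False using hd[OF x(2)] that by simp
    qed
  qed measurable
  have cp: "prism F \<nu> \<in> lmeasurable" using compact_prism[OF F(3)] by (rule lmeasurable_compact)
  have "measure lebesgue (prism F \<nu>) = (LINT x|lebesgue. indicator (prism F \<nu>) x)" using cp by (simp add: fmeasurable_def)
  also have "\<dots> \<le> (LINT x|lebesgue. indicator (slab \<nu> b (b + 1)) x * h x)"
  proof (rule integral_mono_AE)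
    show "integrable lebesgue (indicator (prism F \<nu>) :: 'a \<Rightarrow> real)"
      using cp by (intro integrable_real_indicator) (auto simp: fmeasurable_def)
    show "integrable lebesgue (\<lambda>x. indicator (slab \<nu> b (b + 1)) x * h x)" by (rule int)
    \<comment> \<open>The slab is open at the bottom while the prism contains its base, a null
      set.\<close>
    have "negligible {x. \<nu> \<bullet> x = b}" using \<nu> by (intro negligible_hyperplane) auto
    then have "AE x in lebesgue. x \<notin> {x. \<nu> \<bullet> x = b}" by (intro AE_not_in) (simp add: negligible_iff_null_sets)
    then show "AE x in lebesgue. indicator (prism F \<nu>) x \<le> indicator (slab \<nu> b (b + 1)) x * h x"
    proof eventually_elim
      case (elim x)
      show ?case
      proof (cases "x \<in> prism F \<nu>")
        case True
        then obtain p s where p: "x = p + s *\<^sub>R \<nu>" "p \<in> F" "0 \<le> s" "s \<le> 1" by (auto simp: prism_def)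
        have pb: "p \<bullet> \<nu> = b" using F p by auto
        have xs: "x \<bullet> \<nu> = b + s" using p pb by (simp add: inner_add_left nn)
        have "s \<noteq> 0" using elim xs by (auto simp: inner_commute)
        then have "x \<in> slab \<nu> b (b + 1)" using xs p by simp
        moreover have "h x = 1" using p xs F(2) by (auto simp: h_def)
        ultimately show ?thesis by simp
      qed (simp add: h_def)
    qed
  qed
  finally have "\<rho> * measure lebesgue (prism F \<nu>) \<le> \<rho> * (LINT x|lebesgue. indicator (slab \<nu> b (b + 1)) x * h x)" using \<rho> by simp
  also have "\<dots> = (LINT x|lebesgue. indicator (slab \<nu> b (b + \<rho>)) x * h x)"
    using \<rho> by (intro slab_integral_scale[symmetric] hm \<nu> inv int) (auto simp: h_def)
  also have "\<dots> \<le> (LINT x|lebesgue. indicator (cball y (r + \<rho>)) x)"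
  proof (rule integral_mono[OF int])
    show "integrable lebesgue (indicator (cball y (r + \<rho>)) :: 'a \<Rightarrow> real)"
      using lmeasurable_cball[of y "r + \<rho>"] by (intro integrable_real_indicator) (auto simp: fmeasurable_def)
    fix x
    show "indicator (slab \<nu> b (b + \<rho>)) x * h x \<le> indicator (cball y (r + \<rho>)) x"
    proof (cases "x \<in> slab \<nu> b (b + \<rho>) \<and> h x \<noteq> 0")
      case True
      then have "abs (x \<bullet> \<nu> - b) \<le> \<rho>" by auto
      then have "x \<in> cball y (r + \<rho>)" using hd[of x] True by simp
      then show ?thesis by (simp add: h_def indicator_def)
    qed (auto simp: indicator_def)
  qed
  also have "\<dots> = measure lebesgue (cball y (r + \<rho>))" using lmeasurable_cball[of y "r + \<rho>"] by (simp add: fmeasurable_def)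
  finally show ?thesis .
qed

text \<open>The function \<open>exp (- 1 / (4 - s))\<close> with \<open>s\<close> the squared
  distance from \<open>z\<close> in units of \<open>\<rho>\<close>, and zero beyond radius
  \<open>2 * \<rho>\<close>. The square is spelled out in coordinates to fit the grammar of
  \<open>smooth\<close>.\<close>

definition bump :: "real^'d \<Rightarrow> real \<Rightarrow> 'd sfield" where
  "bump z \<rho> x = flat 0 (4 - (\<Sum>i\<in>UNIV. (1 / \<rho> * (x $ i - z $ i)) * (1 / \<rho> * (x $ i - z $ i))))"

lemma bump_eq: "bump z \<rho> x = flat 0 (4 - (norm ((1 / \<rho>) *\<^sub>R (x - z)))\<^sup>2)"
  by (simp only: bump_def power2_norm_eq_inner inner_vec_def vector_scaleR_component
      vector_minus_component inner_real_def real_scaleR_def)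

lemma bump_smooth: "smooth (bump z \<rho>)"
  unfolding bump_def by (intro smooth_flat smooth_diff smooth_const smooth_sum smooth_mult smooth_coord) auto

lemma bump_scale: "bump z \<rho> x = bump 0 1 ((1 / \<rho>) *\<^sub>R (x - z))"
  by (simp add: bump_eq)

lemma bump_bounds: "0 \<le> bump z \<rho> x" "bump z \<rho> x \<le> 1"
  by (auto simp: bump_def flat_def)

lemma bump_lower:
  assumes "\<rho> > 0" "dist z x \<le> \<rho>"
  shows "bump z \<rho> x \<ge> exp (-1)"
proof -
  have "norm ((1 / \<rho>) *\<^sub>R (x - z)) \<le> 1" using assms by (simp add: dist_norm norm_minus_commute)
  then have "(norm ((1 / \<rho>) *\<^sub>R (x - z)))\<^sup>2 \<le> 1" by (simp add: power_le_one)
  \<comment> \<open>The argument is in fact at least three; the cruder bound gives the constant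
    \<open>exp (-1)\<close>.\<close>
  then have s: "4 - (norm ((1 / \<rho>) *\<^sub>R (x - z)))\<^sup>2 \<ge> 1" by simp
  have "exp (-1) \<le> exp (- 1 / s)" if "s \<ge> 1" for s :: real using that by (simp add: field_simps)
  from this[OF s] show ?thesis using s unfolding bump_eq flat_def by simp
qed

lemma bump_zero:
  assumes "\<rho> > 0" "dist z x \<ge> 2 * \<rho>"
  shows "bump z \<rho> x = 0"
proof -
  have "norm ((1 / \<rho>) *\<^sub>R (x - z)) \<ge> 2" using assms by (simp add: dist_norm norm_minus_commute le_divide_eq)
  then have "(norm ((1 / \<rho>) *\<^sub>R (x - z)))\<^sup>2 \<ge> 2\<^sup>2" by (intro power_mono) auto
  then show ?thesis by (simp add: bump_eq flat_def)
qed

lemma bump_gradient: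
  obtains L where "L \<ge> 1" "\<And>z \<rho> x i. \<rho> > 0 \<Longrightarrow> abs (pd i (bump z \<rho>) (x :: real^'d)) \<le> L / \<rho>"
proof -
  have C: "Ck 1 (bump 0 1 :: 'd sfield)" by (intro smooth_Ck bump_smooth)
  have s: "bump 0 1 x = 0" if "x \<notin> cball 0 2" for x :: "real^'d" using that by (intro bump_zero) auto
  obtain L where "L \<ge> 0" "\<And>x h. abs (bump 0 1 (x + h) - bump 0 1 (x :: real^'d)) \<le> L * norm h"
    and L: "\<And>x i. abs (pd i (bump 0 1) (x :: real^'d)) \<le> L"
    using Ck1_lipschitz[OF C s] by blast
  have "abs (pd i (bump z \<rho>) x) \<le> max L 1 / \<rho>" if \<rho>: "\<rho> > 0" for z x :: "real^'d" and \<rho> i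
  proof -
    have A: "((\<lambda>x. (1 / \<rho>) *\<^sub>R (x - z)) has_derivative (\<lambda>h. (1 / \<rho>) *\<^sub>R h)) (at x)" by (auto intro!: derivative_eq_intros)
    have B: "(bump 0 1 has_derivative (\<lambda>h. \<Sum>k\<in>UNIV. h $ k * pd k (bump 0 1) ((1 / \<rho>) *\<^sub>R (x - z)))) (at ((1 / \<rho>) *\<^sub>R (x - z)))"
      by (rule has_derivative_pd[OF smooth_differentiable[OF bump_smooth]])
    have "bump z \<rho> = (\<lambda>y. bump 0 1 ((1 / \<rho>) *\<^sub>R (y - z)))" by (rule ext) (rule bump_scale)
    then have "(bump z \<rho> has_derivative (\<lambda>h. \<Sum>k\<in>UNIV. ((1 / \<rho>) *\<^sub>R h) $ k * pd k (bump 0 1) ((1 / \<rho>) *\<^sub>R (x - z)))) (at x)"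
      using has_derivative_compose[OF A B] by (simp only:)
    from pd_eq[OF this, of i] have "pd i (bump z \<rho>) x = (1 / \<rho>) * pd i (bump 0 1) ((1 / \<rho>) *\<^sub>R (x - z))"
      by (simp add: axis_def if_distrib if_distribR cong: if_cong)
    then have "abs (pd i (bump z \<rho>) x) = abs (pd i (bump 0 1) ((1 / \<rho>) *\<^sub>R (x - z))) / \<rho>" using \<rho> by (simp add: abs_mult)
    also have "\<dots> \<le> max L 1 / \<rho>" using L \<rho> by (intro divide_right_mono) (auto intro: max.coboundedI1)
    finally show ?thesis .
  qed
  then show ?thesis using that[of "max L 1"] by simp
qed

section \<open>Conjugate exponents and Young's inequality\<close>

lemma conj_exp_gt_1: "q > 1 \<Longrightarrow> conj_exp q > 1"
  by (simp add: conj_exp_def field_simps)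

lemma conj_exp_eq: "q > 1 \<Longrightarrow> 1 / q + 1 / conj_exp q = 1" "q > 1 \<Longrightarrow> (q - 1) * conj_exp q = q"
  by (auto simp: conj_exp_def field_simps)

lemma young:
  fixes a b :: real
  assumes "q > 1" "a \<ge> 0" "b \<ge> 0"
  shows "a * b \<le> a powr q + b powr conj_exp q"
proof -
  have q': "conj_exp q > 1" using assms(1) by (rule conj_exp_gt_1)
  have "a * b \<le> a powr q / q + b powr conj_exp q / conj_exp q" by (intro Youngs_inequality assms q' conj_exp_eq(1))
  also have "\<dots> \<le> a powr q / 1 + b powr conj_exp q / 1" using assms(1) q' by (intro add_mono divide_left_mono) auto
  finally show ?thesis by simp
qed

lemma powr_add_le:
  fixes a b :: real
  assumes "a \<ge> 0" "b \<ge> 0" "q > 0"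
  shows "(a + b) powr q \<le> 2 powr q * (a powr q + b powr q)"
proof -
  have "(a + b) powr q \<le> (2 * max a b) powr q" using assms by (intro powr_mono2) auto
  also have "\<dots> = 2 powr q * (max a b) powr q" using assms by (simp add: powr_mult)
  also have "(max a b) powr q \<le> a powr q + b powr q" by (auto simp: max_def)
  finally show ?thesis by simp
qed

section \<open>Lebesgue and Sobolev functions\<close>

text \<open>Completeness of Lebesgue measure: measurability passes to functions that agree almost
  everywhere.\<close>

lemma borel_measurable_lebesgue_on_AE:
  fixes f g :: "'a::euclidean_space \<Rightarrow> 'b::euclidean_space"
  assumes S: "S \<in> sets lebesgue" and f: "f \<in> meas_on S"
    and ae: "AE x\<in>S in lebesgue. f x = g x"
  shows "g \<in> meas_on S"
proof -
  have "(\<lambda>x. if x \<in> S then f x else 0) \<in> borel_measurable lebesgue" by (rule borel_measurable_if_I[OF f S])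
  moreover have "AE x in lebesgue. (if x \<in> S then f x else 0) = (if x \<in> S then g x else 0)" using ae by eventually_elim auto
  ultimately have "(\<lambda>x. if x \<in> S then g x else 0) \<in> borel_measurable lebesgue" by (rule borel_measurable_AE)
  then show ?thesis by (rule borel_measurable_if_D)
qed

lemma borel_measurable_lebesgue_onI:
  "f \<in> borel_measurable borel \<Longrightarrow> f \<in> meas_on S" by (intro measurable_restrict_space1 measurable_completion) simp

lemma integrable_bounded_on:
  fixes f :: "'a::euclidean_space \<Rightarrow> real"
  assumes "S \<in> lmeasurable" "f \<in> meas_on S" "AE x\<in>S in lebesgue. abs (f x) \<le> C"
  shows "integrable (leb S) f"
proof -
  have S: "S \<in> sets lebesgue" using assms(1) by (simp add: fmeasurable_def)
  show ?thesis by (rule finite_measure.integrable_const_bound[OF finite_measure_lebesgue_on[OF assms(1)] _ assms(2)])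
       (use assms(3) in \<open>simp add: AE_lebesgue_on_iff[OF S]\<close>)
qed

text \<open>If \<open>f\<close> is not integrable, its integral is zero by convention and the bound
  is nonnegative. This covers integrands whose measurability is awkward to establish.\<close>

lemma abs_integral_le:
  fixes f g :: "'a \<Rightarrow> real"
  assumes "integrable M g" "AE x in M. abs (f x) \<le> g x"
  shows "abs (integral\<^sup>L M f) \<le> integral\<^sup>L M g"
proof (cases "integrable M f")
  case True
  have "abs (integral\<^sup>L M f) \<le> (\<integral>x. abs (f x) \<partial>M)" using integral_abs_bound by blast
  also have "\<dots> \<le> integral\<^sup>L M g" by (intro integral_mono_AE assms integrable_abs True)
  finally show ?thesis .
next
  case False
  have "0 \<le> integral\<^sup>L M g" by (intro integral_nonneg_AE) (use assms(2) in \<open>auto elim: eventually_mono\<close>)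
  then show ?thesis using False by (simp add: not_integrable_integral_eq)
qed

lemma integral_le_of_bound:
  fixes f g :: "'a \<Rightarrow> real"
  assumes "integrable M g" "AE x in M. 0 \<le> f x \<and> f x \<le> g x"
  shows "integral\<^sup>L M f \<le> integral\<^sup>L M g"
proof -
  have "AE x in M. abs (f x) \<le> g x" using assms(2) by eventually_elim auto
  from abs_integral_le[OF assms(1) this] show ?thesis by simp
qed

text \<open>On a set of finite measure the bound \<open>1 + a powr s\<close> of
  \<open>a powr t\<close> is integrable.\<close>

lemma integrable_powr_mono:
  fixes f :: "'a::euclidean_space \<Rightarrow> real"
  assumes S: "S \<in> lmeasurable" and f: "f \<in> meas_on S"
    and int: "integrable (leb S) (\<lambda>x. abs (f x) powr s)" and t: "0 \<le> t" "t \<le> s"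
  shows "integrable (leb S) (\<lambda>x. abs (f x) powr t)"
proof (rule Bochner_Integration.integrable_bound)
  have "integrable (leb S) (\<lambda>x. 1 :: real)" by (rule integrable_bounded_on[OF S, where C = 1]) auto
  then show "integrable (leb S) (\<lambda>x. 1 + abs (f x) powr s)" using int by (rule Bochner_Integration.integrable_add)
  show "(\<lambda>x. abs (f x) powr t) \<in> meas_on S" using f by measurable
  have "abs (f x) powr t \<le> 1 + abs (f x) powr s" for x
  proof (cases "abs (f x) \<le> 1")
    case True
    then have "abs (f x) powr t \<le> 1" using t by (simp add: powr_le1)
    then show ?thesis by (simp add: add_increasing2)
  next
    case False
    then have "abs (f x) powr t \<le> abs (f x) powr s" using t by (intro powr_mono) auto
    then show ?thesis by simp
  qed
  then show "AE x in leb S. norm (abs (f x) powr t) \<le> norm (1 + abs (f x) powr s)" by (intro AE_I2) simp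
qed

lemma Lp_mono:
  assumes "S \<in> lmeasurable" "u \<in> Lp S s" "0 \<le> t" "t \<le> s"
  shows "u \<in> Lp S t"
proof -
  have m: "u \<in> meas_on S" using assms by (simp add: Lp_def)
  then have "(\<lambda>x. norm (u x)) \<in> meas_on S" by measurable
  then show ?thesis using integrable_powr_mono[OF assms(1), of "\<lambda>x. norm (u x)" s t] assms m by (simp add: Lp_def)
qed

lemma local_integrable_bounded:
  fixes u :: "real^'d \<Rightarrow> real"
  assumes "open \<D>" "u \<in> meas_on \<D>" "AE x\<in>\<D> in lebesgue. abs (u x) \<le> C"
  shows "local_integrable \<D> u"
  unfolding local_integrable_def
proof (intro allI impI)
  fix K assume K: "compact K \<and> K \<subseteq> \<D>"
  have Km: "K \<in> lmeasurable" using K lmeasurable_compact by blast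
  have "u \<in> meas_on K" using K Km open_sets_lebesgue[OF assms(1)] by (intro measurable_restrict_mono[OF assms(2)]) auto
  then have "integrable (leb K) u" by (rule integrable_bounded_on[OF Km]) (use assms(3) K in \<open>auto elim!: eventually_mono\<close>)
  then show "u absolutely_integrable_on K" using Km by (simp add: integrable_restrict_space set_integrable_def fmeasurable_def)
qed

lemma test_fun_mult:
  "test_fun \<D> \<phi> \<Longrightarrow> test_fun \<D> \<psi> \<Longrightarrow> test_fun \<D> (\<lambda>x. \<phi> x * \<psi> x)"
  by (rule test_fun_mult_Ck) (auto simp: test_fun_def)

lemma test_fun_differentiable: "test_fun \<D> \<phi> \<Longrightarrow> \<phi> differentiable (at x)"
  unfolding test_fun_def using Ck_differentiable by blast

lemma test_fun_bounds:
  assumes "test_fun \<D> (\<phi> :: real^'d \<Rightarrow> real)"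
  obtains B where "B \<ge> 0" "\<And>x. abs (\<phi> x) \<le> B" "\<And>x i. abs (pd i \<phi> x) \<le> B"
proof -
  obtain K where K: "compact K" "K \<subseteq> \<D>" "\<And>x. x \<notin> K \<Longrightarrow> \<phi> x = 0" using test_fun_support assms by blast
  obtain r where r: "K \<subseteq> cball 0 r" using compact_imp_bounded[OF K(1)] bounded_imp_subset_cball_0 by blast
  have s: "\<phi> x = 0" if "x \<notin> cball 0 r" for x using K(3) r that by blast
  have C: "Ck 1 \<phi>" using assms by (simp add: test_fun_def)
  obtain B where B: "\<And>x. abs (\<phi> x) \<le> B" using compact_support_bounded[OF Ck_continuous[OF C] s] by blast
  obtain L where "L \<ge> 0" "\<And>x h. abs (\<phi> (x + h) - \<phi> x) \<le> L * norm h" "\<And>x i. abs (pd i \<phi> x) \<le> L"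
    using Ck1_lipschitz[OF C s] by blast
  then show ?thesis using that[of "max L B"] B by (meson max.coboundedI1 max.coboundedI2)
qed

lemma test_fun_measurable:
  assumes "test_fun \<D> \<phi>"
  shows "\<phi> \<in> meas_on S" "pd i \<phi> \<in> meas_on S"
proof -
  have C: "Ck 1 \<phi>" using assms by (simp add: test_fun_def)
  show "\<phi> \<in> meas_on S" "pd i \<phi> \<in> meas_on S" using C Ck_continuous[OF C]
    by (auto intro!: borel_measurable_lebesgue_onI borel_measurable_continuous_onI)
qed

lemma borel_measurable_vec:
  fixes w :: "'c \<Rightarrow> 'b::euclidean_space^'e"
  assumes "\<And>j. (\<lambda>x. w x $ j) \<in> borel_measurable M"
  shows "w \<in> borel_measurable M"
proof -
  have "(\<lambda>x. w x \<bullet> b) \<in> borel_measurable M" if b: "b \<in> Basis" for b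
  proof -
    obtain i u where "b = axis i u" "u \<in> Basis" using b by (auto simp: Basis_vec_def)
    then have "(\<lambda>x. w x \<bullet> b) = (\<lambda>x. w x $ i \<bullet> u)" by (auto simp: inner_axis)
    then show ?thesis using assms[of i] by simp
  qed
  then show ?thesis by (subst borel_measurable_euclidean_space) blast
qed

lemma norm_vec_le_sum: "norm (v :: 'b::real_normed_vector^'e) \<le> (\<Sum>j\<in>UNIV. norm (v $ j))"
  unfolding norm_vec_def by (rule L2_set_le_sum) simp

text \<open>Passing to the limit in the product rule with the second factor replaced by test functions.\<close>

lemma is_weak_pd_mult:
  fixes u v g h :: "real^'d \<Rightarrow> real"
  assumes op: "open \<D>" and lm: "\<D> \<in> lmeasurable"
    and u: "is_weak_pd \<D> k u g"
    and meas: "u \<in> meas_on \<D>" "g \<in> meas_on \<D>"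
      "v \<in> meas_on \<D>" "h \<in> meas_on \<D>"
    and bd: "AE x\<in>\<D> in lebesgue. abs (u x) \<le> C" "AE x\<in>\<D> in lebesgue. abs (g x) \<le> C"
      "AE x\<in>\<D> in lebesgue. abs (v x) \<le> C" "AE x\<in>\<D> in lebesgue. abs (h x) \<le> C"
    and \<phi>: "\<And>n. test_fun \<D> (\<phi> n)"
    and lim: "(\<lambda>n. LINT x|leb \<D>. abs (v x - \<phi> n x)) \<longlonglongrightarrow> 0"
      "(\<lambda>n. LINT x|leb \<D>. abs (h x - pd k (\<phi> n) x)) \<longlonglongrightarrow> 0"
  shows "is_weak_pd \<D> k (\<lambda>x. u x * v x) (\<lambda>x. u x * h x + g x * v x)"
proof (rule is_weak_pdI[OF _ _ op])
  note [measurable] = meas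
  have So: "\<D> \<in> sets lebesgue" using op by (rule open_sets_lebesgue)
  show "local_integrable \<D> (\<lambda>x. u x * v x)"
  proof (rule local_integrable_bounded[OF op, where C = "C * C"])
    show "AE x\<in>\<D> in lebesgue. abs (u x * v x) \<le> C * C" using bd(1,3) by eventually_elim (auto simp: abs_mult intro!: mult_mono)
  qed measurable
  show "local_integrable \<D> (\<lambda>x. u x * h x + g x * v x)"
  proof (rule local_integrable_bounded[OF op, where C = "C * C + C * C"])
    show "AE x\<in>\<D> in lebesgue. abs (u x * h x + g x * v x) \<le> C * C + C * C" using bd
    proof eventually_elim
      case (elim x)
      then have "x \<in> \<D> \<Longrightarrow> abs (u x * h x) \<le> C * C \<and> abs (g x * v x) \<le> C * C" by (auto simp: abs_mult intro!: mult_mono)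
      then show ?case by linarith
    qed
  qed measurable
  fix \<psi> assume \<psi>: "test_fun \<D> \<psi>"
  obtain B where B: "B \<ge> 0" "\<And>x. abs (\<psi> x) \<le> B" "\<And>x i. abs (pd i \<psi> x) \<le> B" using test_fun_bounds[OF \<psi>] by blast
  note [measurable] = test_fun_measurable[OF \<psi>] test_fun_measurable[OF \<phi>]
  let ?M = "leb \<D>"
  \<comment> \<open>\<open>a n\<close> is the weak derivative identity for \<open>u\<close> tested
    with \<open>\<phi> n * \<psi>\<close>, so its integral vanishes; \<open>l\<close> is the formal
    limit, whose integral has to vanish.\<close>
  define a where "a n x = u x * (\<phi> n x * pd k \<psi> x + pd k (\<phi> n) x * \<psi> x) + g x * (\<phi> n x * \<psi> x)" for n x
  define l where "l x = u x * (v x * pd k \<psi> x + h x * \<psi> x) + g x * (v x * \<psi> x)" for x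
  have m1[measurable]: "a n \<in> borel_measurable ?M" "l \<in> borel_measurable ?M" for n
    unfolding a_def[abs_def] l_def[abs_def] by measurable
  have int_n: "integrable ?M (a n)" and a0: "(LINT x|?M. a n x) = 0" for n
  proof -
    have t: "test_fun \<D> (\<lambda>x. \<phi> n x * \<psi> x)" by (intro test_fun_mult \<phi> \<psi>)
    have li: "local_integrable \<D> u" "local_integrable \<D> g" using u by (auto simp: is_weak_pd_altdef)
    have p: "pd k (\<lambda>x. \<phi> n x * \<psi> x) x = \<phi> n x * pd k \<psi> x + pd k (\<phi> n) x * \<psi> x" for x
      by (rule pd_mult) (auto intro: test_fun_differentiable \<phi> \<psi>)
    have i: "integrable lebesgue (\<lambda>x. u x * pd k (\<lambda>x. \<phi> n x * \<psi> x) x)" "integrable lebesgue (\<lambda>x. g x * (\<phi> n x * \<psi> x))"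
      using test_fun_integrable[OF li(1) t] test_fun_integrable[OF li(2) t] by auto
    have ae: "a n = (\<lambda>x. u x * pd k (\<lambda>x. \<phi> n x * \<psi> x) x + g x * (\<phi> n x * \<psi> x))" by (auto simp: a_def p)
    have z: "a n x = 0" if "x \<notin> \<D>" for x using test_fun_pd_0[OF \<psi> that] by (simp add: a_def)
    have "integrable lebesgue (a n)" unfolding ae using i by (rule Bochner_Integration.integrable_add)
    then show "integrable ?M (a n)" using integral_lebesgue_on_vanish(2)[OF So z] by simp
    have "(LINT x|lebesgue. a n x) = 0" unfolding ae using is_weak_pdD[OF u t op] i by simp
    then show "(LINT x|?M. a n x) = 0" using integral_lebesgue_on_vanish(1)[OF So z] by simp
  qed
  have bl: "AE x\<in>\<D> in lebesgue. abs (u x) \<le> C \<and> abs (g x) \<le> C \<and> abs (v x) \<le> C \<and> abs (h x) \<le> C" using bd by eventually_elim auto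
  have int_l: "integrable ?M l"
  proof (rule integrable_bounded_on[OF lm m1(2), where C = "C * (C * B + C * B) + C * (C * B)"])
    show "AE x\<in>\<D> in lebesgue. abs (l x) \<le> C * (C * B + C * B) + C * (C * B)" using bl
    proof (eventually_elim, intro impI)
      fix x assume *: "x \<in> \<D> \<longrightarrow> abs (u x) \<le> C \<and> abs (g x) \<le> C \<and> abs (v x) \<le> C \<and> abs (h x) \<le> C" "x \<in> \<D>"
      have e: "abs (v x * pd k \<psi> x) \<le> C * B" "abs (h x * \<psi> x) \<le> C * B" "abs (v x * \<psi> x) \<le> C * B"
        using * B unfolding abs_mult by (auto intro!: mult_mono)
      have "abs (u x * (v x * pd k \<psi> x + h x * \<psi> x)) \<le> C * (C * B + C * B)" "abs (g x * (v x * \<psi> x)) \<le> C * (C * B)"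
      proof -
        have c: "0 \<le> C" "abs (u x) \<le> C" "abs (g x) \<le> C" using * by auto
        have "abs (v x * pd k \<psi> x + h x * \<psi> x) \<le> C * B + C * B" using e by linarith
        then show "abs (u x * (v x * pd k \<psi> x + h x * \<psi> x)) \<le> C * (C * B + C * B)"
          unfolding abs_mult[of "u x"] using c B by (intro mult_mono) auto
        show "abs (g x * (v x * \<psi> x)) \<le> C * (C * B)" unfolding abs_mult[of "g x"] using c e by (intro mult_mono) auto
      qed
      then show "abs (l x) \<le> C * (C * B + C * B) + C * (C * B)" unfolding l_def by linarith
    qed
  qed
  have intv: "integrable ?M (\<lambda>x. abs (v x - \<phi> n x))" "integrable ?M (\<lambda>x. abs (h x - pd k (\<phi> n) x))" for n
  proof -
    obtain B' where B': "B' \<ge> 0" "\<And>x. abs (\<phi> n x) \<le> B'" "\<And>x i. abs (pd i (\<phi> n) x) \<le> B'" using test_fun_bounds[OF \<phi>] by blast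
    have 1: "AE x\<in>\<D> in lebesgue. \<bar>\<bar>v x - \<phi> n x\<bar>\<bar> \<le> C + B'" using bd(3)
    proof (eventually_elim, intro impI)
      fix x assume "x \<in> \<D> \<longrightarrow> abs (v x) \<le> C" "x \<in> \<D>"
      then show "\<bar>\<bar>v x - \<phi> n x\<bar>\<bar> \<le> C + B'" using B'(2)[of x] by linarith
    qed
    have 2: "AE x\<in>\<D> in lebesgue. \<bar>\<bar>h x - pd k (\<phi> n) x\<bar>\<bar> \<le> C + B'" using bd(4)
    proof (eventually_elim, intro impI)
      fix x assume "x \<in> \<D> \<longrightarrow> abs (h x) \<le> C" "x \<in> \<D>"
      then show "\<bar>\<bar>h x - pd k (\<phi> n) x\<bar>\<bar> \<le> C + B'" using B'(3)[of k x] by linarith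
    qed
    show "integrable ?M (\<lambda>x. abs (v x - \<phi> n x))" by (rule integrable_bounded_on[OF lm _ 1]) measurable
    show "integrable ?M (\<lambda>x. abs (h x - pd k (\<phi> n) x))" by (rule integrable_bounded_on[OF lm _ 2]) measurable
  qed
  \<comment> \<open>Subtracting the vanishing integral of \<open>a n\<close> leaves an integrand
    that is linear in the two approximation errors, with bounded coefficients.\<close>
  have le: "abs (LINT x|?M. l x) \<le> 2 * (C * B) * (LINT x|?M. abs (v x - \<phi> n x)) + C * B * (LINT x|?M. abs (h x - pd k (\<phi> n) x))" for n
  proof -
    have "(LINT x|?M. l x) = (LINT x|?M. l x - a n x)" using int_l int_n a0 by simp
    also have "abs \<dots> \<le> (LINT x|?M. 2 * (C * B) * abs (v x - \<phi> n x) + C * B * abs (h x - pd k (\<phi> n) x))"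
    proof (rule abs_integral_le)
      show "integrable ?M (\<lambda>x. 2 * (C * B) * abs (v x - \<phi> n x) + C * B * abs (h x - pd k (\<phi> n) x))"
        by (intro Bochner_Integration.integrable_add integrable_mult_right intv)
      show "AE x in ?M. abs (l x - a n x) \<le> 2 * (C * B) * abs (v x - \<phi> n x) + C * B * abs (h x - pd k (\<phi> n) x)"
        unfolding AE_lebesgue_on_iff[OF So]
        using bl
      proof (eventually_elim, intro impI)
        fix x assume *: "x \<in> \<D> \<longrightarrow> abs (u x) \<le> C \<and> abs (g x) \<le> C \<and> abs (v x) \<le> C \<and> abs (h x) \<le> C" "x \<in> \<D>"
        have d: "l x - a n x = (u x * pd k \<psi> x) * (v x - \<phi> n x) + (g x * \<psi> x) * (v x - \<phi> n x) + (u x * \<psi> x) * (h x - pd k (\<phi> n) x)"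
          by (simp add: l_def a_def algebra_simps)
        have "abs (u x * pd k \<psi> x) \<le> C * B" "abs (g x * \<psi> x) \<le> C * B" "abs (u x * \<psi> x) \<le> C * B"
          using * B unfolding abs_mult by (auto intro!: mult_mono)
        then have "abs ((u x * pd k \<psi> x) * (v x - \<phi> n x)) \<le> C * B * abs (v x - \<phi> n x)"
          "abs ((g x * \<psi> x) * (v x - \<phi> n x)) \<le> C * B * abs (v x - \<phi> n x)"
          "abs ((u x * \<psi> x) * (h x - pd k (\<phi> n) x)) \<le> C * B * abs (h x - pd k (\<phi> n) x)"
          unfolding abs_mult[of _ "v x - \<phi> n x"] abs_mult[of _ "h x - pd k (\<phi> n) x"] by (auto intro!: mult_right_mono)
        then show "abs (l x - a n x) \<le> 2 * (C * B) * abs (v x - \<phi> n x) + C * B * abs (h x - pd k (\<phi> n) x)"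
          unfolding d by linarith
      qed
    qed
    also have "\<dots> = 2 * (C * B) * (LINT x|?M. abs (v x - \<phi> n x)) + C * B * (LINT x|?M. abs (h x - pd k (\<phi> n) x))"
      using intv by simp
    finally show ?thesis .
  qed
  have "(\<lambda>n. 2 * (C * B) * (LINT x|?M. abs (v x - \<phi> n x)) + C * B * (LINT x|?M. abs (h x - pd k (\<phi> n) x))) \<longlonglongrightarrow> 2 * (C * B) * 0 + C * B * 0"
    by (intro tendsto_intros lim)
  then have "abs (LINT x|?M. l x) \<le> 2 * (C * B) * 0 + C * B * 0" by (rule tendsto_lowerbound) (auto intro: always_eventually le)
  then have l0: "(LINT x|?M. l x) = 0" by simp
  have z: "l x = 0" if "x \<notin> \<D>" for x using test_fun_pd_0[OF \<psi> that] by (simp add: l_def)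
  have "(LINT x|lebesgue. l x) = 0" using l0 integral_lebesgue_on_vanish(1)[OF So z] by simp
  moreover have "(\<lambda>x. l x) = (\<lambda>x. u x * v x * pd k \<psi> x + (u x * h x + g x * v x) * \<psi> x)" by (auto simp: l_def algebra_simps)
  moreover have "integrable lebesgue (\<lambda>x. u x * v x * pd k \<psi> x)" "integrable lebesgue (\<lambda>x. (u x * h x + g x * v x) * \<psi> x)"
    using test_fun_integrable(2)[OF \<open>local_integrable \<D> (\<lambda>x. u x * v x)\<close> \<psi>]
      test_fun_integrable(1)[OF \<open>local_integrable \<D> (\<lambda>x. u x * h x + g x * v x)\<close> \<psi>] by auto
  ultimately show "(LINT x|lebesgue. u x * v x * pd k \<psi> x) = - (LINT x|lebesgue. (u x * h x + g x * v x) * \<psi> x)" by simp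
qed

lemma AE_all_finite:
  assumes "\<And>i. AE x in M. P (i::'i::finite) x" shows "AE x in M. \<forall>i. P i x"
proof -
  have "AE x in M. \<forall>i\<in>UNIV. P i x" using assms by (subst AE_finite_all[OF finite]) auto
  then show ?thesis by simp
qed

text \<open>Membership in \<open>W1\<close> supplies some weak derivatives in \<open>Lp\<close>,
  whereas \<open>wgrad\<close> selects its own. Both agree almost everywhere, so measurability and
  integrability carry over.\<close>

lemma wgrad_Lp_integrable:
  fixes w :: "real^'d \<Rightarrow> real^'d"
  assumes op: "open \<D>" and w: "w \<in> W1 \<D> s" and s: "s > 0"
  shows "integrable (leb \<D>) (\<lambda>x. norm (wgrad \<D> w x) powr s)"
proof -
  have So: "\<D> \<in> sets lebesgue" using op by (rule open_sets_lebesgue)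
  have "\<exists>g. g \<in> Lp \<D> s \<and> is_weak_pd \<D> i (\<lambda>y. w y $ j) g" for i j using w by (auto simp: W1_def)
  then obtain g where g: "\<And>i j. g i j \<in> Lp \<D> s" "\<And>i j. is_weak_pd \<D> i (\<lambda>y. w y $ j) (g i j)" by metis
  define G :: "real^'d \<Rightarrow> real^'d^'d" where "G x = (\<chi> i j. g i j x)" for x
  have "AE x in lebesgue. \<forall>i j. x \<in> \<D> \<longrightarrow> wpd \<D> i (\<lambda>y. w y $ j) x = g i j x" by (intro AE_all_finite wpd_AE op g)
  then have ae: "AE x\<in>\<D> in lebesgue. G x = wgrad \<D> w x" by eventually_elim (auto simp: G_def wgrad_def)
  have Gm: "G \<in> meas_on \<D>" by (intro borel_measurable_vec) (use g(1) in \<open>auto simp: G_def Lp_def\<close>)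
  then have Wm: "wgrad \<D> w \<in> meas_on \<D>" by (rule borel_measurable_lebesgue_on_AE[OF So _ ae])
  have gi: "integrable (leb \<D>) (\<lambda>x. abs (g i j x) powr s)" for i j using g(1)[of i j] by (simp add: Lp_def)
  let ?n = "real (CARD('d) * CARD('d))"
  show ?thesis
  proof (rule Bochner_Integration.integrable_bound)
    show "integrable (leb \<D>) (\<lambda>x. ?n powr s * (\<Sum>i\<in>UNIV. \<Sum>j\<in>UNIV. abs (g i j x) powr s))"
      by (intro integrable_mult_right Bochner_Integration.integrable_sum gi)
    show "(\<lambda>x. norm (wgrad \<D> w x) powr s) \<in> meas_on \<D>" using Wm by measurable
    show "AE x in leb \<D>. norm (norm (wgrad \<D> w x) powr s) \<le> norm (?n powr s * (\<Sum>i\<in>UNIV. \<Sum>j\<in>UNIV. abs (g i j x) powr s))"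
      unfolding AE_lebesgue_on_iff[OF So] using ae
    proof (eventually_elim, intro impI)
      fix x assume x: "x \<in> \<D> \<longrightarrow> G x = wgrad \<D> w x" "x \<in> \<D>"
      define c where "c = Max (range (\<lambda>(i, j). abs (g i j x)))"
      have fin: "finite (range (\<lambda>(i, j). abs (g i j x)))" by simp
      have gc: "abs (g i j x) \<le> c" for i j
        unfolding c_def using rangeI[of "\<lambda>(i, j). abs (g i j x)" "(i, j)"] by (intro Max_ge[OF fin]) simp
      have c0: "c \<ge> 0" using gc abs_ge_zero order_trans by blast
      have "norm (G x) \<le> (\<Sum>i\<in>UNIV. \<Sum>j\<in>UNIV. norm (G x $ i $ j))"
        by (rule order_trans[OF norm_vec_le_sum]) (intro sum_mono norm_vec_le_sum)
      also have "\<dots> \<le> (\<Sum>i\<in>(UNIV::'d set). \<Sum>j\<in>(UNIV::'d set). c)" by (intro sum_mono) (simp add: G_def gc)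
      finally have n: "norm (G x) \<le> ?n * c" by simp
      have "c \<in> range (\<lambda>(i, j). abs (g i j x))" unfolding c_def by (rule Max_in[OF fin]) simp
      then obtain i j where ij: "c = abs (g i j x)" by auto
      have "norm (G x) powr s \<le> (?n * c) powr s" using n s by (intro powr_mono2) auto
      also have "\<dots> = ?n powr s * c powr s" using c0 by (simp add: powr_mult)
      also have "c powr s \<le> (\<Sum>i\<in>UNIV. \<Sum>j\<in>UNIV. abs (g i j x) powr s)" unfolding ij
        using member_le_sum[of j UNIV "\<lambda>j. abs (g i j x) powr s"] member_le_sum[of i UNIV "\<lambda>i. \<Sum>j\<in>UNIV. abs (g i j x) powr s"]
        by (auto simp: sum_nonneg intro: order_trans)
      finally show "norm (norm (wgrad \<D> w x) powr s) \<le> norm (?n powr s * (\<Sum>i\<in>UNIV. \<Sum>j\<in>UNIV. abs (g i j x) powr s))"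
        using x by (simp add: sum_nonneg)
    qed
  qed
qed

lemma Lp_1_iff: "u \<in> Lp S 1 \<longleftrightarrow> integrable (leb S) u"
  by (auto simp: Lp_def integrable_norm_iff)

lemma test_fun_integrable_on:
  assumes lm: "S \<in> lmeasurable" and t: "test_fun \<D> \<phi>"
  shows "integrable (leb S) \<phi>" "integrable (leb S) (pd i \<phi>)"
proof -
  obtain B where B: "B \<ge> 0" "\<And>x. abs (\<phi> x) \<le> B" "\<And>x i. abs (pd i \<phi> x) \<le> B" by (rule test_fun_bounds[OF t]) blast
  show "integrable (leb S) \<phi>" "integrable (leb S) (pd i \<phi>)"
    by (rule integrable_bounded_on[OF lm, of _ B], use B test_fun_measurable[OF t] in auto)+
qed

text \<open>\<open>convection\<close> contains weak derivatives of products, and \<open>wpd\<close>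
  of a function without weak derivative would be arbitrary. Existence follows from
  \<open>is_weak_pd_mult\<close>: factors and derivatives are essentially bounded, and the second
  factor is approximated by test functions in the norm with exponent one.\<close>

lemma W10_infty_product:
  fixes U :: "real^'d \<Rightarrow> real^'d"
  assumes op: "open \<D>" and lm: "\<D> \<in> lmeasurable" and U: "U \<in> W10_infty \<D>"
  shows "\<exists>g. is_weak_pd \<D> k (\<lambda>x. U x $ i) g"
    and "\<exists>g. is_weak_pd \<D> k (\<lambda>x. U x $ i * U x $ j) g"
proof -
  have So: "\<D> \<in> sets lebesgue" using op by (rule open_sets_lebesgue)
  have Um: "U \<in> meas_on \<D>" using U by (simp add: W10_infty_def Linf_def)
  obtain C0 where C0: "AE x\<in>\<D> in lebesgue. norm (U x) \<le> C0"
    using U unfolding W10_infty_def Linf_def by (auto simp: AE_lebesgue_on_iff[OF So])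
  have gall: "\<exists>g C. g \<in> meas_on \<D> \<and> (AE x\<in>\<D> in lebesgue. abs (g x) \<le> C) \<and> is_weak_pd \<D> k (\<lambda>x. U x $ j) g" for j k
    using U unfolding W10_infty_def Linf_def by (fastforce simp: AE_lebesgue_on_iff[OF So])
  obtain gi Ci where gi: "gi \<in> meas_on \<D>" "AE x\<in>\<D> in lebesgue. abs (gi x) \<le> Ci"
    "is_weak_pd \<D> k (\<lambda>x. U x $ i) gi" using gall[of k i] by blast
  obtain gj Cj where gj: "gj \<in> meas_on \<D>" "AE x\<in>\<D> in lebesgue. abs (gj x) \<le> Cj"
    "is_weak_pd \<D> k (\<lambda>x. U x $ j) gj" using gall[of k j] by blast
  show "\<exists>g. is_weak_pd \<D> k (\<lambda>x. U x $ i) g" using gi by blast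
  define C where "C = max C0 (max Ci Cj)"
  have C0': "AE x\<in>\<D> in lebesgue. abs (U x $ j) \<le> C" for j using C0
  proof eventually_elim
    case (elim x)
    then show ?case using component_le_norm_cart[of "U x" j] by (auto simp: C_def)
  qed
  have bgi: "AE x\<in>\<D> in lebesgue. abs (gi x) \<le> C" using gi(2) by eventually_elim (auto simp: C_def)
  have bgj: "AE x\<in>\<D> in lebesgue. abs (gj x) \<le> C" using gj(2) by eventually_elim (auto simp: C_def)
  have Uj: "(\<lambda>x. U x $ j) \<in> meas_on \<D>" for j
  proof -
    have "(\<lambda>v::real^'d. v $ j) \<in> borel_measurable borel" by (intro borel_measurable_continuous_onI continuous_intros)
    then show ?thesis by (rule measurable_compose[OF Um])
  qed
  obtain \<phi> :: "nat \<Rightarrow> real^'d \<Rightarrow> real^'d" where \<phi>: "\<And>n j. test_fun \<D> (\<lambda>x. \<phi> n x $ j)"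
    "(\<lambda>n. W1norm \<D> 1 (\<lambda>x. U x - \<phi> n x)) \<longlonglongrightarrow> 0" using U unfolding W10_infty_def W10_def by blast
  have diff: "is_weak_pd \<D> k' (\<lambda>x. (U x - \<phi> n x) $ j') (\<lambda>x. G j' x - pd k' (\<lambda>x. \<phi> n x $ j') x)"
    if "is_weak_pd \<D> k' (\<lambda>x. U x $ j') (G j')" for n j' k' G
  proof -
    have "Ck 1 (\<lambda>x. \<phi> n x $ j')" using \<phi>(1)[of n j'] unfolding test_fun_def by blast
    from is_weak_pd_diff_C1[OF that this op] show ?thesis by (simp only: vector_minus_component)
  qed
  have W1: "W1norm \<D> 1 w = (LINT x|leb \<D>. norm (w x)) + (LINT x|leb \<D>. norm (wgrad \<D> w x))" for w
    by (simp add: W1norm_def Lnorm_def abs_of_nonneg integral_nonneg_AE)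
  have intw: "integrable (leb \<D>) (\<lambda>x. norm (U x - \<phi> n x))"
    "integrable (leb \<D>) (\<lambda>x. norm (wgrad \<D> (\<lambda>x. U x - \<phi> n x) x))" for n
  proof -
    have "integrable (leb \<D>) (\<lambda>x. \<Sum>j\<in>UNIV. (\<phi> n x $ j) *\<^sub>R (axis j 1 :: real^'d))"
      by (intro Bochner_Integration.integrable_sum integrable_scaleR_left test_fun_integrable_on[OF lm \<phi>(1)])
    then have "integrable (leb \<D>) (\<phi> n)" by (simp add: basis_expansion scalar_mult_eq_scaleR[symmetric])
    moreover have U1: "U \<in> W1 \<D> 1" using U by (simp add: W10_infty_def W10_def)
    ultimately have L: "(\<lambda>x. U x - \<phi> n x) \<in> Lp \<D> 1" by (simp add: W1_def Lp_1_iff)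
    have "\<exists>g\<in>Lp \<D> 1. is_weak_pd \<D> i (\<lambda>y. (U y - \<phi> n y) $ j) g" for i j
    proof -
      obtain G where G: "G \<in> Lp \<D> 1" "is_weak_pd \<D> i (\<lambda>x. U x $ j) G" using U1 by (auto simp: W1_def)
      have "(\<lambda>x. G x - pd i (\<lambda>x. \<phi> n x $ j) x) \<in> Lp \<D> 1" using G(1) test_fun_integrable_on(2)[OF lm \<phi>(1)] by (simp add: Lp_1_iff)
      then show ?thesis using diff[where G = "\<lambda>_. G", OF G(2)] by blast
    qed
    then have "(\<lambda>x. U x - \<phi> n x) \<in> W1 \<D> 1" using L by (simp add: W1_def)
    from wgrad_Lp_integrable[OF op this] show "integrable (leb \<D>) (\<lambda>x. norm (wgrad \<D> (\<lambda>x. U x - \<phi> n x) x))" by simp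
    show "integrable (leb \<D>) (\<lambda>x. norm (U x - \<phi> n x))" using L by (simp add: Lp_1_iff)
  qed
  have l1: "(\<lambda>n. LINT x|leb \<D>. abs (U x $ j - \<phi> n x $ j)) \<longlonglongrightarrow> 0"
  proof (rule tendsto_sandwich[OF _ _ tendsto_const \<phi>(2)])
    show "\<forall>\<^sub>F n in sequentially. 0 \<le> (LINT x|leb \<D>. abs (U x $ j - \<phi> n x $ j))"
      by (intro always_eventually allI integral_nonneg_AE) auto
    have "(LINT x|leb \<D>. abs (U x $ j - \<phi> n x $ j)) \<le> (LINT x|leb \<D>. norm (U x - \<phi> n x))" for n
      by (rule integral_le_of_bound[OF intw(1)]) (use component_le_norm_cart[of "U _ - \<phi> n _" j] in auto)
    moreover have "0 \<le> (LINT x|leb \<D>. norm (wgrad \<D> (\<lambda>x. U x - \<phi> n x) x))" for n by (intro integral_nonneg_AE) auto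
    ultimately show "\<forall>\<^sub>F n in sequentially. (LINT x|leb \<D>. abs (U x $ j - \<phi> n x $ j)) \<le> W1norm \<D> 1 (\<lambda>x. U x - \<phi> n x)"
      unfolding W1 by (intro always_eventually allI) (simp add: add_increasing2)
  qed
  have l2: "(\<lambda>n. LINT x|leb \<D>. abs (gj x - pd k (\<lambda>x. \<phi> n x $ j) x)) \<longlonglongrightarrow> 0"
  proof (rule tendsto_sandwich[OF _ _ tendsto_const \<phi>(2)])
    show "\<forall>\<^sub>F n in sequentially. 0 \<le> (LINT x|leb \<D>. abs (gj x - pd k (\<lambda>x. \<phi> n x $ j) x))"
      by (intro always_eventually allI integral_nonneg_AE) auto
    have "(LINT x|leb \<D>. abs (gj x - pd k (\<lambda>x. \<phi> n x $ j) x)) \<le> (LINT x|leb \<D>. norm (wgrad \<D> (\<lambda>x. U x - \<phi> n x) x))" for n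
    proof (rule integral_le_of_bound[OF intw(2)])
      show "AE x in leb \<D>. 0 \<le> abs (gj x - pd k (\<lambda>x. \<phi> n x $ j) x) \<and>
          abs (gj x - pd k (\<lambda>x. \<phi> n x $ j) x) \<le> norm (wgrad \<D> (\<lambda>x. U x - \<phi> n x) x)" unfolding AE_lebesgue_on_iff[OF So]
        using wpd_AE[OF op diff[where G = "\<lambda>_. gj", OF gj(3)], of n]
      proof eventually_elim
        case (elim x)
        have "abs (wgrad \<D> (\<lambda>x. U x - \<phi> n x) x $ k $ j) \<le> norm (wgrad \<D> (\<lambda>x. U x - \<phi> n x) x)"
          using component_le_norm_cart[of "wgrad \<D> (\<lambda>x. U x - \<phi> n x) x $ k" j] Finite_Cartesian_Product.norm_nth_le[of "wgrad \<D> (\<lambda>x. U x - \<phi> n x) x" k]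
          by linarith
        with elim show ?case by (cases "x \<in> \<D>") (auto simp: wgrad_def)
      qed
    qed
    moreover have "0 \<le> (LINT x|leb \<D>. norm (U x - \<phi> n x))" for n by (intro integral_nonneg_AE) auto
    ultimately show "\<forall>\<^sub>F n in sequentially. (LINT x|leb \<D>. abs (gj x - pd k (\<lambda>x. \<phi> n x $ j) x)) \<le> W1norm \<D> 1 (\<lambda>x. U x - \<phi> n x)"
      unfolding W1 by (intro always_eventually allI) (simp add: add_increasing)
  qed
  show "\<exists>g. is_weak_pd \<D> k (\<lambda>x. U x $ i * U x $ j) g"
    using is_weak_pd_mult[OF op lm gi(3) Uj gi(1) Uj gj(1) C0' bgi C0' bgj \<phi>(1) l1 l2] by blast
qed

text \<open>In the first case \<open>q\<close> as a function of \<open>t\<close> and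
  \<open>conj_exp r\<close> as a function of \<open>r\<close> both take the value
  \<open>3 * d / (2 * (d - 1))\<close> at the threshold \<open>3 * d / (d + 2)\<close>. The former
  increases and the latter decreases, so this value separates them below the threshold.\<close>

lemma admissible_exps_bounds:
  assumes adm: "admissible_exps d r t q" and d: "d = 2 \<or> d = 3"
  shows "q > 1" "r > 1" "q \<le> conj_exp r"
proof -
  have d0: "d > 1" "2 * d / (d + 1) > 1" using d by auto
  have r: "2 * d / (d + 1) < r" using adm by (simp add: admissible_exps_def)
  then show r1: "r > 1" using d0 by linarith
  show "q > 1" "q \<le> conj_exp r"
  proof (atomize (full), cases "r \<le> 3 * d / (d + 2)")
    case False
    then have "q = conj_exp r" using adm by (simp add: admissible_exps_def)
    then show "1 < q \<and> q \<le> conj_exp r" using conj_exp_gt_1[OF r1] by simp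
  next
    case True
    then have t: "2 * d / (d + 1) < t" "t < r" "q = 1/2 * (d * t / (d - t))" using adm by (simp_all add: admissible_exps_def)
    have "t < 3 * d / (d + 2)" using t True by simp
    then have td: "t * (d + 2) < 3 * d" using d0 by (simp add: pos_less_divide_eq)
    have td2: "2 * d < t * (d + 1)" using t d0 by (simp add: pos_divide_less_eq)
    have dt: "d - t > 0" using td d by auto
    have qe: "q = d * t / (2 * (d - t))" using t(3) by simp
    have q1: "q > 1" unfolding qe using dt td2 d by (subst pos_less_divide_eq) auto
    have "r * (d + 2) \<le> 3 * d" using True d0 by (simp add: pos_le_divide_eq)
    then have "3 * d * (r - 1) \<le> r * (2 * (d - 1))" using d by auto
    then have rr: "3 * d / (2 * (d - 1)) \<le> conj_exp r"
      using r1 d0 by (simp add: conj_exp_def frac_le_eq divide_le_0_iff field_simps)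
    have "d * t * (2 * (d - 1)) \<le> 3 * d * (2 * (d - t))" using td d by auto
    then have "q \<le> 3 * d / (2 * (d - 1))" unfolding qe using dt d0 by (subst frac_le_eq) (auto intro!: divide_nonpos_pos)
    then show "1 < q \<and> q \<le> conj_exp r" using q1 rr by simp
  qed
qed

text \<open>Approximate \<open>D\<close> by simple functions, for which the composition is a finite
  sum, and pass to the limit by continuity off a null set.\<close>

lemma caratheodory_measurable:
  fixes D :: "real^'d \<Rightarrow> real^'d^'d" and S :: "real^'d \<Rightarrow> real^'d^'d \<Rightarrow> real^'d^'d"
  assumes \<D>: "\<D> \<in> sets lebesgue" and D: "D \<in> meas_on \<D>" "\<And>x. D x \<in> sym_mats"
    and S: "\<And>\<delta>. \<delta> \<in> sym_mats \<Longrightarrow> (\<lambda>x. S x \<delta>) \<in> meas_on \<D>"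
    and cont: "AE x\<in>\<D> in lebesgue. continuous_on sym_mats (S x)"
  shows "(\<lambda>x. S x (D x)) \<in> meas_on \<D>"
proof -
  let ?M = "leb \<D>"
  define sy where "sy A = (1/2) *\<^sub>R (A + transpose A)" for A :: "real^'d^'d"
  have tt: "transpose (transpose A) = A" "transpose (A + B) = transpose A + transpose B" "transpose (c *\<^sub>R A) = c *\<^sub>R transpose A" for A B :: "real^'d^'d" and c
    by (simp_all add: transpose_def vec_eq_iff)
  have sys: "sy A \<in> sym_mats" for A by (simp add: sy_def sym_mats_def tt add.commute)
  have syid: "sy A = A" if "A \<in> sym_mats" for A using that by (simp add: sy_def sym_mats_def flip: scaleR_2)
  have syc: "continuous_on UNIV sy" unfolding sy_def transpose_def by (intro continuous_intros)
  obtain F where F: "\<And>i. simple_function ?M (F i)" "\<And>x. x \<in> \<D> \<Longrightarrow> (\<lambda>i. F i x) \<longlonglongrightarrow> D x"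
    using borel_measurable_implies_sequence_metric[OF D(1), of 0] by auto
  \<comment> \<open>The approximants are symmetrised, because \<open>S\<close> is only controlled on
    symmetric matrices; symmetrisation is continuous and fixes \<open>D x\<close>.\<close>
  define G where "G i x = sy (F i x)" for i x
  have Gs: "simple_function ?M (G i)" for i unfolding G_def using simple_function_compose[OF F(1), of sy] by (simp add: comp_def)
  have Glim: "(\<lambda>i. G i x) \<longlonglongrightarrow> D x" if "x \<in> \<D>" for x
  proof -
    have "isCont sy (D x)" using syc by (simp add: continuous_on_eq_continuous_at)
    then have "(\<lambda>i. sy (F i x)) \<longlonglongrightarrow> sy (D x)" using F(2)[OF that] by (rule isCont_tendsto_compose)
    then show ?thesis using syid[OF D(2)] by (simp add: G_def)
  qed
  have gm: "(\<lambda>x. S x (G i x)) \<in> borel_measurable ?M" for i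
  proof -
    have fin: "finite (G i ` \<D>)" using simple_functionD(1)[OF Gs] by simp
    have "(\<lambda>x. \<Sum>c\<in>G i ` \<D>. indicator (G i -` {c} \<inter> \<D>) x *\<^sub>R S x c) \<in> borel_measurable ?M"
    proof (intro borel_measurable_sum borel_measurable_scaleR borel_measurable_indicator)
      fix c assume "c \<in> G i ` \<D>"
      show "G i -` {c} \<inter> \<D> \<in> sets ?M" using simple_functionD(2)[OF Gs, of i "{c}"] by simp
      show "(\<lambda>x. S x c) \<in> borel_measurable ?M" using \<open>c \<in> G i ` \<D>\<close> S sys by (auto simp: G_def)
    qed
    also have "(\<lambda>x. \<Sum>c\<in>G i ` \<D>. indicator (G i -` {c} \<inter> \<D>) x *\<^sub>R S x c) \<in> borel_measurable ?M \<longleftrightarrow> (\<lambda>x. S x (G i x)) \<in> borel_measurable ?M"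
    proof (rule measurable_cong)
      fix x assume "x \<in> space ?M"
      then have x: "x \<in> \<D>" by simp
      have "(\<Sum>c\<in>G i ` \<D>. indicator (G i -` {c} \<inter> \<D>) x *\<^sub>R S x c) = (\<Sum>c\<in>G i ` \<D>. if c = G i x then S x c else 0)"
        using x by (intro sum.cong) (auto simp: indicator_def)
      then show "(\<Sum>c\<in>G i ` \<D>. indicator (G i -` {c} \<inter> \<D>) x *\<^sub>R S x c) = S x (G i x)" using fin x by simp
    qed
    finally show ?thesis .
  qed
  obtain N where N: "N \<in> null_sets lebesgue" "{x. \<not> (x \<in> \<D> \<longrightarrow> continuous_on sym_mats (S x))} \<subseteq> N"
    using cont by (auto simp: eventually_ae_filter)
  have Nm: "{x \<in> space ?M. x \<in> N} \<in> sets ?M" using N(1) \<D> by (auto simp: sets_restrict_space Int_def intro!: image_eqI[of _ _ N])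
  have "(\<lambda>x. if x \<in> N then 0 else S x (D x)) \<in> borel_measurable ?M"
  proof (rule borel_measurable_LIMSEQ_metric)
    show "(\<lambda>x. if x \<in> N then 0 else S x (G i x)) \<in> borel_measurable ?M" for i using gm Nm by (intro measurable_If) auto
    show "(\<lambda>i. if x \<in> N then 0 else S x (G i x)) \<longlonglongrightarrow> (if x \<in> N then 0 else S x (D x))" if "x \<in> space ?M" for x
    proof (cases "x \<in> N")
      case False
      then have c: "continuous_on sym_mats (S x)" using N that by auto
      have "(\<lambda>i. S x (G i x)) \<longlonglongrightarrow> S x (D x)"
        by (rule continuous_on_tendsto_compose[OF c Glim]) (use that sys D(2) in \<open>auto simp: G_def\<close>)
      then show ?thesis using False by simp
    qed simp
  qed
  moreover have "AE x\<in>\<D> in lebesgue. (if x \<in> N then 0 else S x (D x)) = S x (D x)"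
    using AE_not_in[OF N(1)] by eventually_elim simp
  ultimately show ?thesis by (rule borel_measurable_lebesgue_on_AE[OF \<D>])
qed

text \<open>Off the element interiors, a null set, the value is zero.\<close>

definition pw :: "'d mesh \<Rightarrow> ((real^'d) set \<Rightarrow> real^'d \<Rightarrow> 'b::real_vector) \<Rightarrow> real^'d \<Rightarrow> 'b" where
  "pw \<G> p x = (\<Sum>E\<in>\<G>. indicator (interior E) x *\<^sub>R p E x)"

section \<open>Functions given elementwise on a mesh\<close>

lemma pw_interior:
  fixes \<G> :: "'d::finite mesh"
  assumes cp: "conforming_partition \<D> \<G>" and E: "E \<in> \<G>" and x: "x \<in> interior E"
  shows "pw \<G> p x = p E x"
proof -
  have "x \<notin> interior E'" if "E' \<in> \<G>" "E' \<noteq> E" for E'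
    using interior_disjoint_element[OF cp E that(1)] that(2) x interior_subset[of E'] by blast
  then have "pw \<G> p x = (\<Sum>E'\<in>\<G>. if E' = E then p E x else 0)"
    unfolding pw_def using x by (intro sum.cong) (auto simp: indicator_def)
  then show ?thesis using conforming_partitionD(1)[OF cp] E by simp
qed

lemma element_interior_subset:
  fixes \<G> :: "'d::finite mesh"
  assumes cp: "conforming_partition \<D> \<G>" and "interior (closure \<D>) = \<D>" and E: "E \<in> \<G>"
  shows "interior E \<subseteq> \<D>"
  using conforming_partitionD(3)[OF cp] E assms(2) interior_mono[of E "closure \<D>"] by blast

lemma AE_in_element:
  fixes \<G> :: "'d::finite mesh"
  assumes cp: "conforming_partition \<D> \<G>"
  shows "AE x\<in>\<D> in lebesgue. (\<exists>E\<in>\<G>. x \<in> interior E)"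
proof -
  note D = conforming_partitionD[OF cp]
  have "AE x in lebesgue. \<forall>E\<in>\<G>. x \<in> E \<longrightarrow> x \<in> interior E" using AE_interior_element[OF D(2)] by (subst AE_finite_all[OF D(1)]) auto
  then show ?thesis
  proof eventually_elim
    case (elim x)
    then show ?case using D(3) closure_subset[of \<D>] by blast
  qed
qed

lemma AE_elementwise:
  fixes \<G> :: "'d::finite mesh"
  assumes cp: "conforming_partition \<D> \<G>" and P: "\<And>E. E \<in> \<G> \<Longrightarrow> AE x\<in>E in lebesgue. P x"
  shows "AE x\<in>\<D> in lebesgue. P x"
proof -
  note D = conforming_partitionD[OF cp]
  have "AE x in lebesgue. \<forall>E\<in>\<G>. x \<in> E \<longrightarrow> P x" using P by (subst AE_finite_all[OF D(1)]) auto
  then show ?thesis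
  proof eventually_elim
    case (elim x)
    then show ?case using D(3) closure_subset[of \<D>] by blast
  qed
qed

lemma AE_pw_eq:
  fixes \<G> :: "'d::finite mesh"
  assumes cp: "conforming_partition \<D> \<G>" and u: "\<And>E. E \<in> \<G> \<Longrightarrow> AE x\<in>E in lebesgue. u x = p E x"
  shows "AE x\<in>\<D> in lebesgue. u x = pw \<G> p x"
proof (rule AE_elementwise[OF cp])
  fix E assume E: "E \<in> \<G>"
  show "AE x\<in>E in lebesgue. u x = pw \<G> p x" using u[OF E] AE_interior_element[OF conforming_partitionD(2)[OF cp E]]
    by eventually_elim (auto simp: pw_interior[OF cp E])
qed

lemma pw_measurable:
  fixes p :: "(real^'d) set \<Rightarrow> real^'d \<Rightarrow> 'b::euclidean_space"
  assumes "\<And>E. E \<in> \<G> \<Longrightarrow> continuous_on UNIV (p E)"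
  shows "pw \<G> p \<in> borel_measurable borel"
  unfolding pw_def[abs_def] using assms
  by (intro borel_measurable_sum borel_measurable_scaleR borel_measurable_indicator borel_measurable_continuous_onI) auto

lemma pw_bounded:
  fixes \<G> :: "'d::finite mesh" and p :: "(real^'d) set \<Rightarrow> real^'d \<Rightarrow> 'b::euclidean_space"
  assumes cp: "conforming_partition \<D> \<G>" and p: "\<And>E. E \<in> \<G> \<Longrightarrow> continuous_on UNIV (p E)"
  shows "\<exists>C. \<forall>x. norm (pw \<G> p x) \<le> C"
proof -
  note D = conforming_partitionD[OF cp]
  have "\<exists>C. \<forall>x\<in>E. norm (p E x) \<le> C" if E: "E \<in> \<G>" for E
  proof -
    have "bounded (p E ` E)" using full_simplex_basics(1)[OF D(2)[OF E]] p[OF E]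
      by (intro compact_imp_bounded compact_continuous_image) (auto intro: continuous_on_subset)
    then show ?thesis unfolding bounded_iff by fastforce
  qed
  then obtain C where C: "\<And>E x. E \<in> \<G> \<Longrightarrow> x \<in> E \<Longrightarrow> norm (p E x) \<le> C E" by metis
  have "norm (pw \<G> p x) \<le> (\<Sum>E\<in>\<G>. abs (C E))" for x unfolding pw_def
  proof (rule sum_norm_le)
    fix E assume E: "E \<in> \<G>"
    show "norm (indicator (interior E) x *\<^sub>R p E x) \<le> abs (C E)"
      using C[OF E, of x] interior_subset[of E] by (auto simp: indicator_def)
  qed
  then show ?thesis by blast
qed

lemma meshes_conforming:
  fixes \<G> :: "'d::finite mesh"
  assumes "conforming_partition \<D> \<G>0" "refine_routine \<D> \<G>0 refine" "\<G> \<in> meshes \<G>0 refine"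
  shows "conforming_partition \<D> \<G>"
  using assms(3)
proof cases
  case initial
  then show ?thesis using assms(1) by simp
next
  case (refined \<G>' M)
  then show ?thesis using assms(2) by (auto simp: refine_routine_def)
qed

text \<open>The values may be scalars, vectors or matrices. Quantifying over linear functionals
  \<open>T\<close> expresses the degree bound for all of them at once and yields every component
  later.\<close>

lemma piecewise_polynomial:
  fixes u :: "real^'d \<Rightarrow> 'b::euclidean_space"
  assumes u: "u \<in> piecewise PP F \<G>" and PP: "PP \<subseteq> polys m" and E: "E \<in> \<G>" "full_simplex E"
    and F: "\<exists>A b. linear A \<and> F E = (\<lambda>x. A x + b)"
  shows "\<exists>p. (\<forall>T. linear T \<longrightarrow> polyd m (\<lambda>x. T (p x) :: real)) \<and> (AE x\<in>E in lebesgue. u x = p x)"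
proof -
  obtain p where p: "p \<in> PP" "AE x in leb E. u x = p (F E x)" using u E by (auto simp: piecewise_def)
  obtain A b where A: "linear A" "F E = (\<lambda>x. A x + b)" using F by blast
  have "polyd m (\<lambda>x. T (p (A x + b)))" if "linear T" for T :: "'b \<Rightarrow> real"
    by (rule polyd_affine[OF polys_imp_polyd[OF _ that] A(1)]) (use p PP in blast)
  moreover have "AE x\<in>E in lebesgue. u x = p (A x + b)"
    using p(2) A(2) by (simp add: AE_lebesgue_on_iff[OF full_simplex_basics(8)[OF E(2)]])
  ultimately show ?thesis by (intro exI[of _ "\<lambda>x. p (A x + b)"]) auto
qed

text \<open>Localise to the element interior, where the function is a polynomial; the frontier of
  the element is null. The weak derivative \<open>g\<close> on all of \<open>\<D>\<close> is what
  ties the choice in \<open>wpd \<D>\<close> to the element.\<close>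

lemma wpd_polynomial_AE:
  assumes "is_weak_pd \<D> k u g" "open \<D>" "full_simplex E" "interior E \<subseteq> \<D>"
    "AE x\<in>E in lebesgue. u x = p x" "smooth p"
  shows "AE x\<in>E in lebesgue. wpd \<D> k u x = pd k p x"
proof -
  have "AE x\<in>(interior E) in lebesgue. u x = p x" using assms(5) by eventually_elim (use interior_subset[of E] in auto)
  then have "AE x\<in>(interior E) in lebesgue. wpd (interior E) k u x = pd k p x" by (intro wpd_C1_AE smooth_Ck assms) auto
  moreover have "AE x\<in>(interior E) in lebesgue. wpd \<D> k u x = wpd (interior E) k u x" using assms by (intro wpd_restrict_AE) auto
  ultimately show ?thesis using AE_interior_element[OF assms(3)] by eventually_elim auto
qed

lemma wpd_interior_polynomial_AE:
  assumes "full_simplex E" "AE x\<in>E in lebesgue. u x = p x" "smooth p"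
  shows "AE x\<in>E in lebesgue. wpd (interior E) k u x = pd k p x"
proof -
  have "AE x\<in>(interior E) in lebesgue. u x = p x" using assms(2) by eventually_elim (use interior_subset[of E] in auto)
  then have "AE x\<in>(interior E) in lebesgue. wpd (interior E) k u x = pd k p x" by (intro wpd_C1_AE smooth_Ck assms) auto
  then show ?thesis using AE_interior_element[OF assms(1)] by eventually_elim auto
qed

text \<open>\<open>grad\<close>, \<open>cdiv_tensor\<close> and \<open>cconv\<close> are the
  classical counterparts of \<open>wgrad\<close>, \<open>wdiv_tensor\<close> and
  \<open>convection\<close>, meant for element polynomials and smooth test fields.\<close>

definition grad :: "(real^'d \<Rightarrow> real^'d) \<Rightarrow> real^'d \<Rightarrow> real^'d^'d" where
  "grad v x = (\<chi> i j. pd i (\<lambda>y. v y $ j) x)"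

definition cdiv_tensor :: "(real^'d \<Rightarrow> real^'d^'d) \<Rightarrow> real^'d \<Rightarrow> real^'d" where
  "cdiv_tensor T x = (\<chi> j. \<Sum>i\<in>UNIV. pd i (\<lambda>y. T y $ i $ j) x)"

definition cconv :: "(real^'d \<Rightarrow> real^'d) \<Rightarrow> real^'d \<Rightarrow> real^'d" where
  "cconv v x = (\<chi> j. 1/2 * (\<Sum>i\<in>UNIV. v x $ i * pd i (\<lambda>y. v y $ j) x + pd i (\<lambda>y. v y $ i * v y $ j) x))"

lemma wgrad_AE:
  assumes "\<And>i j. AE x\<in>A in lebesgue. wpd \<D> i (\<lambda>y. v y $ j) x = pd i (\<lambda>y. u y $ j) x"
  shows "AE x\<in>A in lebesgue. wgrad \<D> v x = grad u x"
proof -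
  have "AE x in lebesgue. \<forall>i j. x \<in> A \<longrightarrow> wpd \<D> i (\<lambda>y. v y $ j) x = pd i (\<lambda>y. u y $ j) x" by (intro AE_all_finite assms)
  then show ?thesis by eventually_elim (auto simp: wgrad_def grad_def)
qed

lemma convection_AE:
  assumes "AE x\<in>A in lebesgue. v x = u x"
    "\<And>i j. AE x\<in>A in lebesgue. wpd \<D> i (\<lambda>y. v y $ j) x = pd i (\<lambda>y. u y $ j) x"
    "\<And>i j. AE x\<in>A in lebesgue. wpd \<D> i (\<lambda>y. v y $ i * v y $ j) x = pd i (\<lambda>y. u y $ i * u y $ j) x"
  shows "AE x\<in>A in lebesgue. convection \<D> v x = cconv u x"
proof -
  have "AE x in lebesgue. \<forall>i j. x \<in> A \<longrightarrow> wpd \<D> i (\<lambda>y. v y $ j) x = pd i (\<lambda>y. u y $ j) x"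
    "AE x in lebesgue. \<forall>i j. x \<in> A \<longrightarrow> wpd \<D> i (\<lambda>y. v y $ i * v y $ j) x = pd i (\<lambda>y. u y $ i * u y $ j) x"
    by (intro AE_all_finite assms)+
  then show ?thesis using assms(1) by eventually_elim (auto simp: convection_def cconv_def)
qed

lemma vector_polynomial_AE:
  assumes "AE x\<in>E in lebesgue. U x = u x"
  shows "AE x\<in>E in lebesgue. U x $ j = u x $ j" "AE x\<in>E in lebesgue. U x $ i * U x $ j = u x $ i * u x $ j"
  using assms by (auto elim!: eventually_mono)

text \<open>The residual contains the convection term of the whole domain, the indicator that of the
  element interior. Both reduce to the classical expression in the element polynomial and may thus
  be exchanged.\<close>

lemma velocity_on_element:
  fixes U :: "real^'d \<Rightarrow> real^'d"
  assumes op: "open \<D>" and lm: "\<D> \<in> lmeasurable" and U: "U \<in> W10_infty \<D>"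
    and E: "full_simplex E" "interior E \<subseteq> \<D>" and u: "\<And>j. polyd l (\<lambda>x. u x $ j)" "AE x\<in>E in lebesgue. U x = u x"
  shows "AE x\<in>E in lebesgue. wgrad \<D> U x = grad u x"
    "AE x\<in>E in lebesgue. convection \<D> U x = cconv u x"
    "AE x\<in>E in lebesgue. convection (interior E) U x = cconv u x"
proof -
  have su: "smooth (\<lambda>x. u x $ j)" "smooth (\<lambda>x. u x $ i * u x $ j)" for i j
    using polyd_smooth[OF u(1)] by (auto intro: smooth_mult)
  note V = vector_polynomial_AE[OF u(2)]
  have W: "AE x\<in>E in lebesgue. wpd \<D> i (\<lambda>y. U y $ j) x = pd i (\<lambda>y. u y $ j) x" for i j
    using W10_infty_product(1)[OF op lm U] wpd_polynomial_AE[OF _ op E V(1) su(1)] by blast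
  have W2: "AE x\<in>E in lebesgue. wpd \<D> i (\<lambda>y. U y $ i * U y $ j) x = pd i (\<lambda>y. u y $ i * u y $ j) x" for i j
    using W10_infty_product(2)[OF op lm U] wpd_polynomial_AE[OF _ op E V(2) su(2)] by blast
  show "AE x\<in>E in lebesgue. wgrad \<D> U x = grad u x" by (rule wgrad_AE[OF W])
  show "AE x\<in>E in lebesgue. convection \<D> U x = cconv u x" by (rule convection_AE[OF u(2) W W2])
  show "AE x\<in>E in lebesgue. convection (interior E) U x = cconv u x"
    by (intro convection_AE u(2) wpd_interior_polynomial_AE[OF E(1)] V su)
qed

lemma grad_polyd: "(\<And>j. polyd m (\<lambda>x. u x $ j)) \<Longrightarrow> polyd m (\<lambda>x. grad u x $ i $ j)"
  by (simp add: grad_def polyd_pd)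

lemma cdiv_tensor_polyd: "(\<And>i j. polyd m (\<lambda>x. T x $ i $ j)) \<Longrightarrow> polyd m (\<lambda>x. cdiv_tensor T x $ j)"
  by (simp add: cdiv_tensor_def polyd_pd polyd_sum)

lemma cconv_polyd: "(\<And>j. polyd m (\<lambda>x. u x $ j)) \<Longrightarrow> polyd (2 * m) (\<lambda>x. cconv u x $ j)"
  unfolding cconv_def vec_lambda_beta mult_2 by (intro polyd_cmult polyd_sum polyd_add polyd_mult polyd_pd)

lemma continuous_on_polyd: "polyd m p \<Longrightarrow> continuous_on UNIV p"
  using polyd_smooth smooth_continuous by blast

lemma continuous_on_vec_componentwise:
  fixes f :: "'a::topological_space \<Rightarrow> 'b::real_normed_vector^'e"
  shows "(\<And>j. continuous_on S (\<lambda>x. f x $ j)) \<Longrightarrow> continuous_on S f"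
  using continuous_on_vec_lambda[of S "\<lambda>j x. f x $ j"] by simp

section \<open>Vector fields as test functions\<close>

definition vtest :: "(real^'d) set \<Rightarrow> 'd vfield \<Rightarrow> bool" where
  "vtest \<D> w \<longleftrightarrow> (\<forall>j. smooth (\<lambda>x. w x $ j)) \<and> (\<exists>K. compact K \<and> K \<subseteq> \<D> \<and> (\<forall>x. x \<notin> K \<longrightarrow> w x = 0))"

lemma vtest_test_fun: "vtest \<D> w \<Longrightarrow> test_fun \<D> (\<lambda>x. w x $ j)"
proof -
  assume "vtest \<D> w"
  then obtain K where "smooth (\<lambda>x. w x $ j)" "compact K" "K \<subseteq> \<D>" "\<And>x. x \<notin> K \<Longrightarrow> w x = 0" unfolding vtest_def by blast
  then show ?thesis by (intro test_fun_smooth[of _ K]) auto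
qed

lemma vtest_smooth: "vtest \<D> w \<Longrightarrow> smooth (\<lambda>x. w x $ j)"
  by (simp add: vtest_def)

lemma grad_continuous:
  assumes "\<And>j. smooth (\<lambda>x. w x $ j)"
  shows "continuous_on UNIV (grad w)"
  by (intro continuous_on_vec_componentwise)
     (auto simp: grad_def intro!: smooth_continuous smooth_pd assms)

lemma smooth_vec_continuous: "(\<And>j. smooth (\<lambda>x. w x $ j)) \<Longrightarrow> continuous_on UNIV (w :: real^'d \<Rightarrow> real^'d)"
  by (intro continuous_on_vec_componentwise smooth_continuous)

lemma vtest_bounded:
  assumes w: "vtest \<D> (w :: real^'d \<Rightarrow> real^'d)"
  shows "\<exists>B\<ge>0. \<forall>x. norm (w x) \<le> B \<and> norm (grad w x) \<le> B"
proof -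
  have "\<exists>B. (\<forall>x. abs (w x $ j) \<le> B) \<and> (\<forall>x i. abs (pd i (\<lambda>x. w x $ j) x) \<le> B)" for j
  proof -
    obtain B where "B \<ge> 0" "\<And>x. abs (w x $ j) \<le> B" "\<And>x i. abs (pd i (\<lambda>x. w x $ j) x) \<le> B"
      using test_fun_bounds[OF vtest_test_fun[OF w]] by blast
    then show ?thesis by blast
  qed
  then have "\<forall>j. \<exists>B. (\<forall>x. abs (w x $ j) \<le> B) \<and> (\<forall>x i. abs (pd i (\<lambda>x. w x $ j) x) \<le> B)" by blast
  from choice[OF this] obtain B where B: "\<And>j x. abs (w x $ j) \<le> B j" "\<And>j x i. abs (pd i (\<lambda>x. w x $ j) x) \<le> B j" by blast
  have 1: "norm (w x) \<le> (\<Sum>j\<in>UNIV. B j)" for x by (rule order_trans[OF norm_vec_le_sum]) (intro sum_mono, use B in auto)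
  have 2: "norm (grad w x) \<le> (\<Sum>i\<in>(UNIV::'d set). \<Sum>j\<in>UNIV. B j)" for x
    by (rule order_trans[OF norm_vec_le_sum], intro sum_mono, rule order_trans[OF norm_vec_le_sum])
       (intro sum_mono, use B in \<open>auto simp: grad_def\<close>)
  show ?thesis by (rule exI[of _ "max 0 (max (\<Sum>j\<in>UNIV. B j) (\<Sum>i\<in>(UNIV::'d set). \<Sum>j\<in>UNIV. B j))"])
       (use 1 2 in \<open>auto simp: le_max_iff_disj\<close>)
qed

lemma vtest_zero:
  assumes w: "vtest \<D> w" and x: "x \<notin> \<D>"
  shows "w x = 0" "grad w x = 0"
  using test_fun_pd_0[OF vtest_test_fun[OF w] x] by (simp_all add: vec_eq_iff grad_def)

lemma vtest_wpd_AE: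
  assumes "vtest \<D> w" "open \<D>"
  shows "AE x\<in>\<D> in lebesgue. wpd \<D> i (\<lambda>y. w y $ j) x = pd i (\<lambda>y. w y $ j) x"
  by (rule wpd_C1_AE[OF smooth_Ck[OF vtest_smooth[OF assms(1)]] assms(2)]) simp

lemma Lnorm_powr: "s > 0 \<Longrightarrow> Lnorm \<omega> s u powr s = (LINT x|leb \<omega>. norm (u x) powr s)"
  by (simp add: Lnorm_def powr_powr abs_of_nonneg integral_nonneg_AE)

lemma transpose_dot: "transpose A \<bullet> B = A \<bullet> transpose (B :: real^'d^'d)"
  unfolding inner_vec_def transpose_def by (simp, subst sum.swap) simp

lemma norm_transpose: "norm (transpose A) = norm (A :: real^'d^'d)"
proof -
  have "transpose A \<bullet> transpose A = A \<bullet> A" unfolding transpose_dot by (simp add: transpose_transpose)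
  then show ?thesis by (simp add: norm_eq_sqrt_inner)
qed

lemma sgrad_le: "norm (sgrad \<D> w x) \<le> norm (wgrad \<D> w x)"
proof -
  have "norm (wgrad \<D> w x + transpose (wgrad \<D> w x)) \<le> norm (wgrad \<D> w x) + norm (wgrad \<D> w x)"
    using norm_triangle_ineq[of "wgrad \<D> w x" "transpose (wgrad \<D> w x)"] by (simp add: norm_transpose)
  then show ?thesis by (simp add: sgrad_def)
qed

lemma wdiv_le: "abs (wdiv \<D> w x) \<le> real CARD('d) * norm (wgrad \<D> (w :: real^'d \<Rightarrow> real^'d) x)"
proof -
  have "abs (wdiv \<D> w x) \<le> (\<Sum>i\<in>(UNIV::'d set). norm (wgrad \<D> w x))" unfolding wdiv_def
  proof (intro order_trans[OF sum_abs] sum_mono)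
    fix i :: 'd
    have "abs (wgrad \<D> w x $ i $ i) \<le> norm (wgrad \<D> w x)"
      using component_le_norm_cart[of "wgrad \<D> w x $ i" i] Finite_Cartesian_Product.norm_nth_le[of "wgrad \<D> w x" i] by linarith
    then show "abs (wpd \<D> i (\<lambda>y. w y $ i) x) \<le> norm (wgrad \<D> w x)" by (simp add: wgrad_def)
  qed
  then show ?thesis by simp
qed

text \<open>A crude bound by Young's inequality on each pairing. It shows that the supremum in
  \<open>dual_norm\<close> ranges over a bounded set, without which it would say nothing about a
  single test function.\<close>

lemma residual_bounded:
  fixes w :: "real^'d \<Rightarrow> real^'d"
  assumes op: "open \<D>" and q: "q > 1"
    and int: "integrable (leb \<D>) (\<lambda>x. norm (S x) powr q)" "integrable (leb \<D>) (\<lambda>x. norm (convection \<D> U x) powr q)"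
      "integrable (leb \<D>) (\<lambda>x. abs (real CARD('d) * P x) powr q)" "integrable (leb \<D>) (\<lambda>x. norm (f x) powr q)"
    and w: "w \<in> W10 \<D> (conj_exp q)" "W1norm \<D> (conj_exp q) w \<le> 1"
  shows "abs (residual \<D> f U P S w) \<le> (LINT x|leb \<D>. norm (S x) powr q) + (LINT x|leb \<D>. norm (convection \<D> U x) powr q)
     + (LINT x|leb \<D>. abs (real CARD('d) * P x) powr q) + (LINT x|leb \<D>. norm (f x) powr q) + 4"
proof -
  define q' where "q' = conj_exp q"
  have q': "q' > 1" using conj_exp_gt_1[OF q] by (simp add: q'_def)
  have w1: "w \<in> W1 \<D> q'" using w by (simp add: W10_def q'_def)
  have iw: "integrable (leb \<D>) (\<lambda>x. norm (w x) powr q')" using w1 by (simp add: W1_def Lp_def)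
  have ig: "integrable (leb \<D>) (\<lambda>x. norm (wgrad \<D> w x) powr q')" using wgrad_Lp_integrable[OF op w1] q' by simp
  let ?W = "LINT x|leb \<D>. norm (w x) powr q'" and ?G = "LINT x|leb \<D>. norm (wgrad \<D> w x) powr q'"
  have nn: "?W \<ge> 0" "?G \<ge> 0" by (auto intro!: integral_nonneg_AE)
  have "(?W + ?G) powr (1 / q') \<le> 1" using w(2) q' by (simp add: W1norm_def Lnorm_powr q'_def)
  then have "((?W + ?G) powr (1 / q')) powr q' \<le> 1" using q' by (intro powr_le1) auto
  then have WG: "?W + ?G \<le> 1" using q' nn by (simp add: powr_powr)
  define h where "h x = norm (S x) powr q + norm (convection \<D> U x) powr q + abs (real CARD('d) * P x) powr q + norm (f x) powr q
      + 2 * norm (w x) powr q' + 2 * norm (wgrad \<D> w x) powr q'" for x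
  have hi: "integrable (leb \<D>) h" unfolding h_def by (intro Bochner_Integration.integrable_add integrable_mult_right int iw ig)
  have "abs (residual \<D> f U P S w) \<le> (LINT x|leb \<D>. h x)" unfolding residual_def
  proof (rule abs_integral_le[OF hi], rule AE_I2)
    fix x
    have Y: "a * b \<le> a powr q + b powr q'" if "a \<ge> 0" "b \<ge> 0" for a b unfolding q'_def using young[OF q that] .
    have "abs (S x \<bullet> sgrad \<D> w x) \<le> norm (S x) * norm (wgrad \<D> w x)"
      using Cauchy_Schwarz_ineq2[of "S x" "sgrad \<D> w x"] mult_left_mono[OF sgrad_le[of \<D> w x], of "norm (S x)"] by simp
    also have "\<dots> \<le> norm (S x) powr q + norm (wgrad \<D> w x) powr q'" by (rule Y) auto
    finally have 1: "abs (S x \<bullet> sgrad \<D> w x) \<le> norm (S x) powr q + norm (wgrad \<D> w x) powr q'" .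
    have 2: "abs (convection \<D> U x \<bullet> w x) \<le> norm (convection \<D> U x) powr q + norm (w x) powr q'"
      using Cauchy_Schwarz_ineq2[of "convection \<D> U x" "w x"] Y[of "norm (convection \<D> U x)" "norm (w x)"] by simp
    have 4: "abs (f x \<bullet> w x) \<le> norm (f x) powr q + norm (w x) powr q'"
      using Cauchy_Schwarz_ineq2[of "f x" "w x"] Y[of "norm (f x)" "norm (w x)"] by simp
    have "abs (P x * wdiv \<D> w x) \<le> abs (real CARD('d) * P x) * norm (wgrad \<D> w x)"
      using mult_left_mono[OF wdiv_le[of \<D> w x], of "abs (P x)"] by (simp add: abs_mult mult_ac)
    also have "\<dots> \<le> abs (real CARD('d) * P x) powr q + norm (wgrad \<D> w x) powr q'" by (rule Y) auto
    finally have 3: "abs (P x * wdiv \<D> w x) \<le> abs (real CARD('d) * P x) powr q + norm (wgrad \<D> w x) powr q'" .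
    show "abs (S x \<bullet> sgrad \<D> w x + convection \<D> U x \<bullet> w x - P x * wdiv \<D> w x - f x \<bullet> w x) \<le> h x"
      using 1 2 3 4 unfolding h_def by linarith
  qed
  also have "\<dots> = (LINT x|leb \<D>. norm (S x) powr q) + (LINT x|leb \<D>. norm (convection \<D> U x) powr q)
     + (LINT x|leb \<D>. abs (real CARD('d) * P x) powr q) + (LINT x|leb \<D>. norm (f x) powr q) + 2 * ?W + 2 * ?G"
    unfolding h_def using int iw ig
    by (simp only: Bochner_Integration.integral_add Bochner_Integration.integrable_add integrable_mult_right integral_mult_right_zero)
  finally show ?thesis using WG nn by linarith
qed

text \<open>The form for smooth test fields: the full gradient replaces the symmetric one, which
  changes nothing for symmetric \<open>S\<close>, and the divergence is the inner product of the
  gradient with the identity.\<close>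

definition cresidual :: "(real^'d) set \<Rightarrow> 'd vfield \<Rightarrow> 'd vfield \<Rightarrow>
    'd sfield \<Rightarrow> 'd tfield \<Rightarrow> 'd vfield \<Rightarrow> real" where
  "cresidual \<D> f U P S w = (LINT x|leb \<D>. S x \<bullet> grad w x + convection \<D> U x \<bullet> w x - P x * (mat 1 \<bullet> grad w x) - f x \<bullet> w x)"

lemma vtest_scale:
  assumes w: "vtest \<D> w"
  shows "vtest \<D> (\<lambda>x. c *\<^sub>R w x)" "grad (\<lambda>x. c *\<^sub>R w x) x = c *\<^sub>R grad w x"
proof -
  show "vtest \<D> (\<lambda>x. c *\<^sub>R w x)" using w unfolding vtest_def by (auto intro: smooth_mult smooth_const)
  show "grad (\<lambda>x. c *\<^sub>R w x) x = c *\<^sub>R grad w x"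
    by (simp add: grad_def vec_eq_iff pd_cmult smooth_differentiable[OF vtest_smooth[OF w]])
qed

lemma mat_1_inner: "mat 1 \<bullet> (A :: real^'d^'d) = (\<Sum>i\<in>UNIV. A $ i $ i)"
  by (simp add: inner_vec_def mat_def if_distrib if_distribR cong: if_cong)

text \<open>The constant sequence \<open>w\<close> already consists of test functions, so the
  approximation demanded by \<open>W10\<close> is trivial.\<close>

lemma vtest_in_W10:
  fixes w :: "real^'d \<Rightarrow> real^'d"
  assumes op: "open \<D>" and lm: "\<D> \<in> lmeasurable" and w: "vtest \<D> w" and s: "s > 0"
  shows "w \<in> W10 \<D> s"
    "W1norm \<D> s w = ((LINT x|leb \<D>. norm (w x) powr s) + (LINT x|leb \<D>. norm (grad w x) powr s)) powr (1 / s)"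
proof -
  have So: "\<D> \<in> sets lebesgue" using op by (rule open_sets_lebesgue)
  obtain B where B: "B \<ge> 0" "\<And>x. norm (w x) \<le> B" "\<And>x. norm (grad w x) \<le> B" using vtest_bounded[OF w] by blast
  have mw: "w \<in> meas_on \<D>"
    by (intro borel_measurable_lebesgue_onI borel_measurable_continuous_onI smooth_vec_continuous vtest_smooth[OF w])
  have lp: "v \<in> Lp \<D> s" if "v \<in> meas_on \<D>" "\<And>x. norm (v x) \<le> B" for v :: "real^'d \<Rightarrow> 'c::euclidean_space"
  proof -
    have "integrable (leb \<D>) (\<lambda>x. norm (v x) powr s)"
    proof (rule integrable_bounded_on[OF lm, where C = "B powr s"])
      show "(\<lambda>x. norm (v x) powr s) \<in> meas_on \<D>" using that(1) by measurable
      show "AE x\<in>\<D> in lebesgue. abs (norm (v x) powr s) \<le> B powr s" using that(2) s by (intro AE_I2) (auto intro!: powr_mono2)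
    qed
    then show ?thesis using that(1) by (simp add: Lp_def)
  qed
  have W1: "w \<in> W1 \<D> s" unfolding W1_def
  proof (intro CollectI conjI allI)
    show "w \<in> Lp \<D> s" using lp mw B by blast
    fix i j
    have "is_weak_pd \<D> i (\<lambda>y. w y $ j) (pd i (\<lambda>y. w y $ j))" by (intro is_weak_pd_C1[OF _ op] smooth_Ck vtest_smooth[OF w])
    moreover have "pd i (\<lambda>y. w y $ j) \<in> Lp \<D> s"
    proof (rule lp)
      show "pd i (\<lambda>y. w y $ j) \<in> meas_on \<D>" by (rule test_fun_measurable(2)[OF vtest_test_fun[OF w]])
      show "norm (pd i (\<lambda>y. w y $ j) x) \<le> B" for x
        using B(3)[of x] component_le_norm_cart[of "grad w x $ i" j] Finite_Cartesian_Product.norm_nth_le[of "grad w x" i]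
        by (simp add: grad_def)
    qed
    ultimately show "\<exists>g\<in>Lp \<D> s. is_weak_pd \<D> i (\<lambda>y. w y $ j) g" by blast
  qed
  have norm_eq: "W1norm \<D> s v = ((LINT x|leb \<D>. norm (v x) powr s) + (LINT x|leb \<D>. norm (grad v x) powr s)) powr (1 / s)"
    if v: "vtest \<D> v" for v :: "real^'d \<Rightarrow> real^'d"
  proof -
    have "AE x\<in>\<D> in lebesgue. wgrad \<D> v x = grad v x" by (rule wgrad_AE[OF vtest_wpd_AE[OF v op]])
    then have ae: "AE x\<in>\<D> in lebesgue. grad v x = wgrad \<D> v x" by eventually_elim auto
    have gm: "grad v \<in> meas_on \<D>"
      by (intro borel_measurable_lebesgue_onI borel_measurable_continuous_onI grad_continuous vtest_smooth[OF v])
    have "(LINT x|leb \<D>. norm (wgrad \<D> v x) powr s) = (LINT x|leb \<D>. norm (grad v x) powr s)"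
    proof (rule integral_cong_AE)
      show "(\<lambda>x. norm (wgrad \<D> v x) powr s) \<in> meas_on \<D>" using borel_measurable_lebesgue_on_AE[OF So gm ae] by measurable
      show "(\<lambda>x. norm (grad v x) powr s) \<in> meas_on \<D>" using gm by measurable
      show "AE x in leb \<D>. norm (wgrad \<D> v x) powr s = norm (grad v x) powr s"
        unfolding AE_lebesgue_on_iff[OF So] using ae by eventually_elim auto
    qed
    then show ?thesis using s by (simp add: W1norm_def Lnorm_powr)
  qed
  then show "W1norm \<D> s w = ((LINT x|leb \<D>. norm (w x) powr s) + (LINT x|leb \<D>. norm (grad w x) powr s)) powr (1 / s)"
    using w by blast
  have z: "vtest \<D> (\<lambda>x. 0)" unfolding vtest_def by (auto intro!: smooth_const exI[of _ "{}"])
  have "grad (\<lambda>x. 0) x = (0 :: real^'d^'d)" for x by (simp add: grad_def vec_eq_iff pd_eq[OF has_derivative_const])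
  then have "W1norm \<D> s (\<lambda>x. w x - w x) = 0" using norm_eq[OF z] s by simp
  then show "w \<in> W10 \<D> s" using W1 vtest_test_fun[OF w] unfolding W10_def by (intro CollectI conjI exI[of _ "\<lambda>k. w"]) auto
qed

lemma cresidual_eq:
  fixes w :: "real^'d \<Rightarrow> real^'d"
  assumes op: "open \<D>" and w: "vtest \<D> w"
    and S: "S \<in> meas_on \<D>" "\<And>x. x \<in> \<D> \<Longrightarrow> S x \<in> sym_mats"
    and m: "convection \<D> U \<in> meas_on \<D>" "P \<in> meas_on \<D>" "f \<in> meas_on \<D>"
  shows "residual \<D> f U P S w = cresidual \<D> f U P S w"
  unfolding residual_def cresidual_def
proof (rule integral_cong_AE)
  have So: "\<D> \<in> sets lebesgue" using op by (rule open_sets_lebesgue)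
  have mw: "w \<in> meas_on \<D>" "grad w \<in> meas_on \<D>"
    by (intro borel_measurable_lebesgue_onI borel_measurable_continuous_onI smooth_vec_continuous grad_continuous vtest_smooth[OF w])+
  show m2: "(\<lambda>x. S x \<bullet> grad w x + convection \<D> U x \<bullet> w x - P x * (mat 1 \<bullet> grad w x) - f x \<bullet> w x) \<in> meas_on \<D>"
    using mw S(1) m by measurable
  have "AE x\<in>\<D> in lebesgue. wgrad \<D> w x = grad w x" by (rule wgrad_AE[OF vtest_wpd_AE[OF w op]])
  then have ae: "AE x\<in>\<D> in lebesgue. S x \<bullet> grad w x + convection \<D> U x \<bullet> w x - P x * (mat 1 \<bullet> grad w x) - f x \<bullet> w x
      = S x \<bullet> sgrad \<D> w x + convection \<D> U x \<bullet> w x - P x * wdiv \<D> w x - f x \<bullet> w x"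
  proof (eventually_elim, intro impI)
    fix x assume x: "x \<in> \<D> \<longrightarrow> wgrad \<D> w x = grad w x" "x \<in> \<D>"
    have "transpose (S x) = S x" using S(2) x by (simp add: sym_mats_def)
    then have "S x \<bullet> transpose (grad w x) = S x \<bullet> grad w x" using transpose_dot[of "S x" "grad w x"] by simp
    then have 1: "S x \<bullet> sgrad \<D> w x = S x \<bullet> grad w x" using x by (simp add: sgrad_def inner_add_right)
    have "wdiv \<D> w x = (\<Sum>i\<in>UNIV. wgrad \<D> w x $ i $ i)" by (simp add: wdiv_def wgrad_def)
    then have 2: "wdiv \<D> w x = mat 1 \<bullet> grad w x" using x by (simp add: mat_1_inner)
    show "S x \<bullet> grad w x + convection \<D> U x \<bullet> w x - P x * (mat 1 \<bullet> grad w x) - f x \<bullet> w x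
      = S x \<bullet> sgrad \<D> w x + convection \<D> U x \<bullet> w x - P x * wdiv \<D> w x - f x \<bullet> w x" by (simp add: 1 2)
  qed
  show "(\<lambda>x. S x \<bullet> sgrad \<D> w x + convection \<D> U x \<bullet> w x - P x * wdiv \<D> w x - f x \<bullet> w x) \<in> meas_on \<D>"
    by (rule borel_measurable_lebesgue_on_AE[OF So m2 ae])
  show "AE x in leb \<D>. S x \<bullet> sgrad \<D> w x + convection \<D> U x \<bullet> w x - P x * wdiv \<D> w x - f x \<bullet> w x =
      S x \<bullet> grad w x + convection \<D> U x \<bullet> w x - P x * (mat 1 \<bullet> grad w x) - f x \<bullet> w x"
    unfolding AE_lebesgue_on_iff[OF So] using ae by eventually_elim simp
qed

lemma cresidual_scale:
  assumes w: "vtest \<D> w"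
  shows "cresidual \<D> f U P S (\<lambda>x. c *\<^sub>R w x) = c * cresidual \<D> f U P S w"
proof -
  have "(\<lambda>x. S x \<bullet> grad (\<lambda>x. c *\<^sub>R w x) x + convection \<D> U x \<bullet> c *\<^sub>R w x - P x * (mat 1 \<bullet> grad (\<lambda>x. c *\<^sub>R w x) x) - f x \<bullet> c *\<^sub>R w x)
    = (\<lambda>x. c * (S x \<bullet> grad w x + convection \<D> U x \<bullet> w x - P x * (mat 1 \<bullet> grad w x) - f x \<bullet> w x))"
    unfolding vtest_scale(2)[OF w] by (simp add: algebra_simps)
  then show ?thesis unfolding cresidual_def by simp
qed

lemma dual_norm_test:
  fixes w :: "real^'d \<Rightarrow> real^'d"
  assumes op: "open \<D>" and lm: "\<D> \<in> lmeasurable" and q: "q > 1"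
    and int: "integrable (leb \<D>) (\<lambda>x. norm (S x) powr q)" "integrable (leb \<D>) (\<lambda>x. norm (convection \<D> U x) powr q)"
      "integrable (leb \<D>) (\<lambda>x. abs (real CARD('d) * P x) powr q)" "integrable (leb \<D>) (\<lambda>x. norm (f x) powr q)"
    and S: "S \<in> meas_on \<D>" "\<And>x. x \<in> \<D> \<Longrightarrow> S x \<in> sym_mats"
    and m: "convection \<D> U \<in> meas_on \<D>" "P \<in> meas_on \<D>" "f \<in> meas_on \<D>"
    and w: "vtest \<D> w" and B: "B > 0"
      "(LINT x|leb \<D>. norm (w x) powr conj_exp q) + (LINT x|leb \<D>. norm (grad w x) powr conj_exp q) \<le> B powr conj_exp q"
  shows "cresidual \<D> f U P S w \<le> dual_norm \<D> q (residual \<D> f U P S) * B"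
    and "dual_norm \<D> q (residual \<D> f U P S) \<ge> 0"
proof -
  define q' where "q' = conj_exp q"
  have q': "q' > 1" using conj_exp_gt_1[OF q] by (simp add: q'_def)
  define X where "X = {w \<in> W10 \<D> q'. W1norm \<D> q' w \<le> 1}"
  have bdd: "bdd_above ((\<lambda>w. abs (residual \<D> f U P S w)) ` X)"
    unfolding bdd_above_def X_def q'_def using residual_bounded[OF op q int] by fast
  have up: "abs (residual \<D> f U P S v) \<le> dual_norm \<D> q (residual \<D> f U P S)" if "v \<in> X" for v
    unfolding dual_norm_def using cSUP_upper[OF that bdd] by (simp add: X_def q'_def)
  define v where "v = (\<lambda>x. (1 / B) *\<^sub>R w x)"
  have v: "vtest \<D> v" "\<And>x. grad v x = (1 / B) *\<^sub>R grad w x" unfolding v_def using vtest_scale[OF w] by auto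
  let ?W = "LINT x|leb \<D>. norm (w x) powr q'" and ?G = "LINT x|leb \<D>. norm (grad w x) powr q'"
  have pw: "norm ((1 / B) *\<^sub>R y) powr q' = (1 / B) powr q' * norm y powr q'" for y :: "'b::real_normed_vector"
    using B by (simp add: powr_mult powr_divide)
  have "W1norm \<D> q' v = ((1 / B) powr q' * (?W + ?G)) powr (1 / q')"
    using vtest_in_W10(2)[OF op lm v(1), of q'] q' unfolding v(2) unfolding v_def pw by (simp add: distrib_left)
  also have "\<dots> \<le> 1 powr (1 / q')"
  proof (rule powr_mono2)
    have "(1 / B) powr q' * (?W + ?G) \<le> (1 / B) powr q' * B powr q'" using B(2) by (intro mult_left_mono) (auto simp: q'_def)
    also have "\<dots> = 1" using B(1) by (simp add: powr_divide)
    finally show "(1 / B) powr q' * (?W + ?G) \<le> 1" .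
    show "0 \<le> (1 / B) powr q' * (?W + ?G)" by (intro mult_nonneg_nonneg add_nonneg_nonneg integral_nonneg_AE) auto
  qed (use q' in auto)
  finally have "v \<in> X" using vtest_in_W10(1)[OF op lm v(1), of q'] q' by (simp add: X_def)
  moreover have "residual \<D> f U P S v = cresidual \<D> f U P S v" by (rule cresidual_eq[OF op v(1) S m])
  moreover have "cresidual \<D> f U P S v = (1 / B) * cresidual \<D> f U P S w" unfolding v_def by (rule cresidual_scale[OF w])
  ultimately have le: "abs ((1 / B) * cresidual \<D> f U P S w) \<le> dual_norm \<D> q (residual \<D> f U P S)" using up[of v] by simp
  then show "dual_norm \<D> q (residual \<D> f U P S) \<ge> 0" by linarith
  have "(1 / B) * cresidual \<D> f U P S w \<le> dual_norm \<D> q (residual \<D> f U P S)" using le by linarith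
  then show "cresidual \<D> f U P S w \<le> dual_norm \<D> q (residual \<D> f U P S) * B" using B(1) by (simp add: field_simps)
qed

section \<open>Integration by parts across one hyperplane\<close>

definition plane_proj :: "real^'d \<Rightarrow> real \<Rightarrow> 'd vfield" where
  "plane_proj \<nu> b x = x - (x \<bullet> \<nu> - b) *\<^sub>R \<nu>"

text \<open>The surface integral over the hyperplane, written as in the definition of the facet measure.\<close>

definition plane_integral :: "real^'d \<Rightarrow> real \<Rightarrow> 'd sfield \<Rightarrow> real" where
  "plane_integral \<nu> b k = (LINT x|lebesgue. indicator (slab \<nu> b (b + 1)) x * k (plane_proj \<nu> b x))"

lemma continuous_plane_proj: "continuous_on UNIV (plane_proj \<nu> b)"
  unfolding plane_proj_def[abs_def] by (intro continuous_intros)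

lemma plane_slab_integrable:
  fixes \<nu> y :: "real^'d" and k :: "'d sfield"
  assumes \<nu>: "norm \<nu> = 1" and k: "continuous_on UNIV k" "\<And>x. x \<notin> cball y R \<Longrightarrow> k x = 0"
  shows "integrable lebesgue (\<lambda>x. indicator (slab \<nu> a c) x * k (plane_proj \<nu> b x))"
proof -
  have "x \<notin> cball 0 (norm y + R) \<Longrightarrow> k x = 0" for x
    using k(2)[of x] norm_triangle_ineq2[of x y] by (force simp: dist_norm norm_minus_commute)
  from compact_support_bounded[OF k(1) this] obtain B where B: "B \<ge> 0" "\<And>x. abs (k x) \<le> B" by blast
  show ?thesis
  proof (rule integrable_bounded_support)
    have "continuous_on UNIV (\<lambda>x. k (plane_proj \<nu> b x))" by (rule continuous_on_compose2[OF k(1) continuous_plane_proj]) simp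
    then have [measurable]: "(\<lambda>x. k (plane_proj \<nu> b x)) \<in> borel_measurable borel" by (rule borel_measurable_continuous_onI)
    show "(\<lambda>x. indicator (slab \<nu> a c) x * k (plane_proj \<nu> b x)) \<in> borel_measurable borel" by measurable
    show "abs (indicator (slab \<nu> a c) x * k (plane_proj \<nu> b x)) \<le> B" for x using B by (auto simp: indicator_def)
    show "indicator (slab \<nu> a c) x * k (plane_proj \<nu> b x) = 0" if x: "x \<notin> cball 0 (norm y + abs R + abs a + abs c + abs b)" for x
    proof (cases "x \<in> slab \<nu> a c \<and> plane_proj \<nu> b x \<in> cball y R")
      case True
      have "norm (plane_proj \<nu> b x) \<le> norm y + R"
        using True norm_triangle_ineq2[of "plane_proj \<nu> b x" y] by (auto simp: dist_norm norm_minus_commute)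
      moreover have "x = plane_proj \<nu> b x + (x \<bullet> \<nu> - b) *\<^sub>R \<nu>" by (simp add: plane_proj_def)
      then have "norm x \<le> norm (plane_proj \<nu> b x) + abs (x \<bullet> \<nu> - b)"
        using norm_triangle_ineq[of "plane_proj \<nu> b x" "(x \<bullet> \<nu> - b) *\<^sub>R \<nu>"] \<nu> by simp
      moreover have "abs (x \<bullet> \<nu> - b) \<le> abs a + abs c + abs b" using True by auto
      ultimately have "x \<in> cball 0 (norm y + abs R + abs a + abs c + abs b)" by simp
      then show ?thesis using x by blast
    qed (use k(2) in \<open>auto simp: indicator_def\<close>)
  qed
qed

text \<open>Only the difference of the two traces survives, since a compactly supported divergence
  integrates to zero over the whole space.\<close>

lemma elementwise_divergence:
  fixes \<G> :: "'d::finite mesh" and w :: "'d vfield" and T :: "(real^'d) set \<Rightarrow> 'd tfield"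
  assumes cp: "conforming_partition \<D> \<G>" and op: "open \<D>" and E: "E1 \<in> \<G>" "E2 \<in> \<G>" and \<nu>: "norm \<nu> = 1"
    and half: "ball z \<rho> \<inter> {x. x \<bullet> \<nu> \<le> b} \<subseteq> E1" "ball z \<rho> \<inter> {x. b \<le> x \<bullet> \<nu>} \<subseteq> E2"
    and T: "\<And>E i j. E \<in> \<G> \<Longrightarrow> polyd m (\<lambda>x. T E x $ i $ j)" "\<And>E x. E \<in> \<G> \<Longrightarrow> T E x \<in> sym_mats"
    and w: "vtest \<D> w" "\<And>x. x \<notin> cball z r \<Longrightarrow> w x = 0" and sup: "cball z r \<subseteq> ball z \<rho>"
  shows "(LINT x|leb \<D>. pw \<G> T x \<bullet> grad w x + pw \<G> (\<lambda>E. cdiv_tensor (T E)) x \<bullet> w x)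
    = plane_integral \<nu> b (\<lambda>x. ((T E1 x - T E2 x) *v \<nu>) \<bullet> w x)"
proof -
  note D = conforming_partitionD[OF cp]
  let ?f = "\<lambda>x. pw \<G> T x \<bullet> grad w x + pw \<G> (\<lambda>E. cdiv_tensor (T E)) x \<bullet> w x"
  define H where "H = {x. x \<bullet> \<nu> \<le> b}"
  define G where "G E i j x = T E x $ i $ j * w x $ j" for E i j x
  have sT: "smooth (\<lambda>x. T E x $ i $ j)" if "E \<in> \<G>" for E i j using T(1)[OF that] polyd_smooth by blast
  have sw: "smooth (\<lambda>x. w x $ j)" for j using w(1) by (rule vtest_smooth)
  have sG: "smooth (G E i j)" if "E \<in> \<G>" for E i j unfolding G_def by (intro smooth_mult sT sw that)
  have G0: "G E i j x = 0" if "x \<notin> cball z r" for E i j x using w(2)[OF that] by (simp add: G_def)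
  have G0': "G E i j x = 0" if "x \<notin> cball 0 (norm z + r)" for E i j x
    using that norm_triangle_ineq2[of x z] by (intro G0) (auto simp: dist_norm norm_minus_commute)
  have pG: "pd i (G E i j) x = T E x $ i $ j * pd i (\<lambda>y. w y $ j) x + pd i (\<lambda>y. T E y $ i $ j) x * w x $ j" if "E \<in> \<G>" for E i j x
    unfolding G_def by (intro pd_mult smooth_differentiable sT sw that)
  have pG0: "pd i (G E i j) x = 0" if "x \<notin> cball z r" for E i j x by (rule pd_eq_0_outside[OF closed_cball G0 that])
  have sum_eq: "T E x \<bullet> grad w x + cdiv_tensor (T E) x \<bullet> w x = (\<Sum>i\<in>UNIV. \<Sum>j\<in>UNIV. pd i (G E i j) x)" if "E \<in> \<G>" for E x
  proof -
    have "cdiv_tensor (T E) x \<bullet> w x = (\<Sum>j\<in>UNIV. \<Sum>i\<in>UNIV. pd i (\<lambda>y. T E y $ i $ j) x * w x $ j)"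
      by (simp add: inner_vec_def cdiv_tensor_def sum_distrib_right)
    also have "\<dots> = (\<Sum>i\<in>UNIV. \<Sum>j\<in>UNIV. pd i (\<lambda>y. T E y $ i $ j) x * w x $ j)" by (rule sum.swap)
    finally show ?thesis by (simp add: pG[OF that] inner_vec_def grad_def sum.distrib)
  qed
  have Hb: "H \<in> sets borel" unfolding H_def by (intro borel_closed closed_Collect_le continuous_intros)
  have i0: "integrable lebesgue (pd i (G E i j))" if E: "E \<in> \<G>" for E i j
    by (rule integrable_compact_support[OF smooth_continuous[OF smooth_pd[OF sG[OF E]]] pG0])
  have intG: "integrable lebesgue (\<lambda>x. indicator A x * pd i (G E i j) x)" if E: "E \<in> \<G>" and A: "A \<in> sets borel" for E i j A
    using integrable_mult_indicator[OF _ i0[OF E], of A] A by simp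
  have So: "\<D> \<in> sets lebesgue" using op by (rule open_sets_lebesgue)
  have z: "?f x = 0" if "x \<notin> \<D>" for x using vtest_zero[OF w(1) that] by simp
  have gw0: "grad w x = 0" if "x \<notin> cball z r" for x
    using pd_eq_0_outside[OF closed_cball _ that, of "\<lambda>y. w y $ _"] w(2) by (simp add: grad_def vec_eq_iff)
  \<comment> \<open>On the support of \<open>w\<close> the mesh looks like two half-spaces, so the
    piecewise field may be replaced by the polynomial of \<open>E1\<close> on \<open>H\<close> and
    that of \<open>E2\<close> on its complement, both defined everywhere.\<close>
  let ?F = "\<lambda>x. (\<Sum>i\<in>UNIV. \<Sum>j\<in>UNIV. indicator H x * pd i (G E1 i j) x + indicator (- H) x * pd i (G E2 i j) x)"
  have Fint: "integrable lebesgue ?F"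
    by (intro Bochner_Integration.integrable_sum Bochner_Integration.integrable_add intG E Hb) (use Hb in auto)
  have ae: "AE x in lebesgue. ?f x = ?F x" using AE_interior_element[OF D(2)[OF E(1)]] AE_interior_element[OF D(2)[OF E(2)]]
  proof eventually_elim
    case (elim x)
    have "x \<in> cball z r \<Longrightarrow> x \<in> (if x \<in> H then E1 else E2)"
      using subsetD[OF half(1), of x] subsetD[OF half(2), of x] sup by (auto simp: H_def)
    then consider "x \<notin> cball z r" | "x \<in> interior E1" "x \<in> H" | "x \<in> interior E2" "x \<notin> H" using elim by (cases "x \<in> H") auto
    then show ?case
      by cases (use gw0 w(2) pG0 in \<open>simp_all add: pw_interior[OF cp E(1)] sum_eq[OF E(1)] pw_interior[OF cp E(2)] sum_eq[OF E(2)]\<close>)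
  qed
  have "(LINT x|leb \<D>. ?f x) = (LINT x|lebesgue. ?f x)" by (rule integral_lebesgue_on_vanish(1)[OF So z])
  also have "\<dots> = (LINT x|lebesgue. ?F x)"
  proof (rule integral_cong_AE[OF _ _ ae])
    show Fm: "?F \<in> borel_measurable lebesgue" using Fint by (rule borel_measurable_integrable)
    show "?f \<in> borel_measurable lebesgue" by (rule borel_measurable_AE[OF Fm]) (use ae in eventually_elim, simp)
  qed
  also have "\<dots> = (\<Sum>i\<in>UNIV. \<Sum>j\<in>UNIV. (LINT x|lebesgue. indicator H x * pd i (G E1 i j) x) + (LINT x|lebesgue. indicator (- H) x * pd i (G E2 i j) x))"
    using intG[OF E(1) Hb] intG[OF E(2), of "- H"] Hb
    by (simp add: Bochner_Integration.integral_sum Bochner_Integration.integrable_sum Bochner_Integration.integral_add borel_comp)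
  also have "\<dots> = (\<Sum>i\<in>UNIV. \<Sum>j\<in>UNIV. \<nu> $ i * plane_integral \<nu> b (G E1 i j) - \<nu> $ i * plane_integral \<nu> b (G E2 i j))"
  proof (intro sum.cong refl)
    fix i j :: 'd
    have hd: "(LINT x|lebesgue. indicator H x * pd i (G E i j) x) = \<nu> $ i * plane_integral \<nu> b (G E i j)" if "E \<in> \<G>" for E
      unfolding H_def plane_integral_def plane_proj_def by (rule half_space_divergence[OF smooth_Ck[OF sG[OF that]] G0' \<nu>])
    have "(LINT x|lebesgue. indicator (- H) x * pd i (G E2 i j) x) = (LINT x|lebesgue. pd i (G E2 i j) x - indicator H x * pd i (G E2 i j) x)"
      by (intro Bochner_Integration.integral_cong refl) (auto simp: indicator_def)
    also have "\<dots> = (LINT x|lebesgue. pd i (G E2 i j) x) - (LINT x|lebesgue. indicator H x * pd i (G E2 i j) x)"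
      by (intro Bochner_Integration.integral_diff intG i0 E Hb)
    also have "(LINT x|lebesgue. pd i (G E2 i j) x) = 0" by (rule integral_pd_compact_support[OF smooth_Ck[OF sG[OF E(2)]] G0'])
    finally show "(LINT x|lebesgue. indicator H x * pd i (G E1 i j) x) + (LINT x|lebesgue. indicator (- H) x * pd i (G E2 i j) x)
      = \<nu> $ i * plane_integral \<nu> b (G E1 i j) - \<nu> $ i * plane_integral \<nu> b (G E2 i j)" unfolding hd[OF E(1)] hd[OF E(2)] by simp
  qed
  also have "\<dots> = plane_integral \<nu> b (\<lambda>x. \<Sum>i\<in>UNIV. \<Sum>j\<in>UNIV. \<nu> $ i * (G E1 i j x - G E2 i j x))"
  proof -
    have si: "integrable lebesgue (\<lambda>x. indicator (slab \<nu> b (b + 1)) x * G E i j (plane_proj \<nu> b x))" if "E \<in> \<G>" for E i j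
      by (rule plane_slab_integrable[OF \<nu> smooth_continuous[OF sG[OF that]] G0])
    have "indicator (slab \<nu> b (b + 1)) x * (\<Sum>i\<in>UNIV. \<Sum>j\<in>UNIV. \<nu> $ i * (G E1 i j y - G E2 i j y))
      = (\<Sum>i\<in>UNIV. \<Sum>j\<in>UNIV. \<nu> $ i * (indicator (slab \<nu> b (b + 1)) x * G E1 i j y) - \<nu> $ i * (indicator (slab \<nu> b (b + 1)) x * G E2 i j y))" for x y
      by (simp add: sum_distrib_left right_diff_distrib mult.left_commute)
    then show ?thesis unfolding plane_integral_def using si[OF E(1)] si[OF E(2)]
      by (simp add: Bochner_Integration.integral_sum Bochner_Integration.integrable_sum)
  qed
  also have "(\<lambda>x. \<Sum>i\<in>UNIV. \<Sum>j\<in>UNIV. \<nu> $ i * (G E1 i j x - G E2 i j x)) = (\<lambda>x. ((T E1 x - T E2 x) *v \<nu>) \<bullet> w x)"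
  proof
    fix y
    \<comment> \<open>The divergence contracts \<open>\<nu>\<close> with the first index, the
      matrix-vector product with the second; symmetry reconciles them.\<close>
    have sy: "T E y $ j $ i = T E y $ i $ j" if "E \<in> \<G>" for E i j
      using T(2)[OF that, of y] by (auto simp: sym_mats_def transpose_def vec_eq_iff)
    have "((T E1 y - T E2 y) *v \<nu>) \<bullet> w y = (\<Sum>j\<in>UNIV. \<Sum>i\<in>UNIV. (T E1 y $ j $ i - T E2 y $ j $ i) * \<nu> $ i * w y $ j)"
      by (simp add: inner_vec_def matrix_vector_mult_def sum_distrib_right)
    also have "\<dots> = (\<Sum>j\<in>UNIV. \<Sum>i\<in>UNIV. \<nu> $ i * (G E1 i j y - G E2 i j y))"
      by (intro sum.cong refl) (simp add: G_def sy[OF E(1)] sy[OF E(2)] algebra_simps)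
    also have "\<dots> = (\<Sum>i\<in>UNIV. \<Sum>j\<in>UNIV. \<nu> $ i * (G E1 i j y - G E2 i j y))" by (rule sum.swap)
    finally show "(\<Sum>i\<in>UNIV. \<Sum>j\<in>UNIV. \<nu> $ i * (G E1 i j y - G E2 i j y)) = ((T E1 y - T E2 y) *v \<nu>) \<bullet> w y" by simp
  qed
  finally show ?thesis .
qed

section \<open>Bubble functions\<close>

text \<open>Young's inequality for \<open>a / t\<close> and \<open>t * b\<close> with
  \<open>t powr conj_exp q = \<epsilon>\<close>; then \<open>(1 / t) powr q\<close> is
  \<open>\<epsilon> powr (1 - q)\<close>, since \<open>q / conj_exp q = q - 1\<close>.\<close>

lemma young_weighted:
  fixes a b \<epsilon> :: real
  assumes q: "q > 1" and \<epsilon>: "\<epsilon> > 0" and ab: "a \<ge> 0" "b \<ge> 0"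
  shows "a * b \<le> \<epsilon> powr (1 - q) * a powr q + \<epsilon> * b powr conj_exp q"
proof -
  define q' where "q' = conj_exp q"
  have q': "q' > 1" "(q - 1) * q' = q" using conj_exp_gt_1 conj_exp_eq(2) q by (auto simp: q'_def)
  define t where "t = \<epsilon> powr (1 / q')"
  have t: "t > 0" "t powr q' = \<epsilon>" using \<epsilon> q' by (auto simp: t_def powr_powr)
  have "q / q' = q - 1" using q' by (simp add: field_simps)
  then have tq: "(1 / t) powr q = \<epsilon> powr (1 - q)" using \<epsilon> by (simp add: t_def powr_powr powr_divide flip: powr_minus_divide)
  have "a * b = (1 / t * a) * (t * b)" using t by simp
  also have "\<dots> \<le> (1 / t * a) powr q + (t * b) powr q'" unfolding q'_def using t ab q by (intro young) auto
  also have "\<dots> = (1 / t) powr q * a powr q + \<epsilon> * b powr q'" using t ab by (simp add: powr_mult powr_divide)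
  finally show ?thesis by (simp add: q'_def tq)
qed

lemma measure_cball_eq:
  "r \<ge> 0 \<Longrightarrow> measure lebesgue (cball z r :: (real^'d) set) = unit_ball_vol (real CARD('d)) * r ^ CARD('d)"
  using content_cball[of r z] by simp

definition bubble :: "real \<Rightarrow> real \<Rightarrow> real \<Rightarrow> real^'d \<Rightarrow> 'd vfield \<Rightarrow> 'd vfield" where
  "bubble q \<rho> M z p x = (\<rho> * M powr (q - 2) * bump z \<rho> x) *\<^sub>R p x"

lemma bubble_smooth:
  assumes "\<And>j. smooth (\<lambda>x. p x $ j)"
  shows "smooth (\<lambda>x. bubble q \<rho> M z p x $ j)"
  unfolding bubble_def vector_scaleR_component real_scaleR_def by (intro smooth_mult smooth_const bump_smooth assms)

lemma bubble_zero: "\<rho> > 0 \<Longrightarrow> x \<notin> cball z (2 * \<rho>) \<Longrightarrow> bubble q \<rho> M z p x = 0"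
  using bump_zero[of \<rho> z x] by (simp add: bubble_def)

lemma bubble_vtest:
  assumes "\<And>j. smooth (\<lambda>x. p x $ j)" "\<rho> > 0" "cball z (2 * \<rho>) \<subseteq> \<D>"
  shows "vtest \<D> (bubble q \<rho> M z p)"
  unfolding vtest_def
proof (intro conjI allI exI[of _ "cball z (2 * \<rho>)"])
  show "smooth (\<lambda>x. bubble q \<rho> M z p x $ j)" for j by (rule bubble_smooth[OF assms(1)])
qed (use assms bubble_zero in auto)

text \<open>In the product rule the derivative falls on the bump, costing \<open>L / \<rho>\<close>,
  or on \<open>p\<close>, where \<open>\<rho>\<close> times the derivative is bounded by hypothesis.
  The weight \<open>\<rho>\<close> compensates both. The constant is chosen before \<open>q\<close>,
  \<open>\<rho>\<close> and \<open>p\<close>.\<close>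

lemma bubble_bounds:
  "\<exists>c. \<forall>C1\<ge>0. \<forall>q \<rho> M z (p :: real^'d \<Rightarrow> real^'d). \<rho> > 0 \<longrightarrow> M \<ge> 0 \<longrightarrow> (\<forall>j. smooth (\<lambda>x. p x $ j)) \<longrightarrow>
    (\<forall>x\<in>cball z (2 * \<rho>). \<forall>j. abs (p x $ j) \<le> C1 * M \<and> (\<forall>i. abs (\<rho> * pd i (\<lambda>x. p x $ j) x) \<le> C1 * M)) \<longrightarrow>
    (\<forall>x. norm (bubble q \<rho> M z p x) \<le> (c * C1) * \<rho> * M powr (q - 1) \<and> norm (grad (bubble q \<rho> M z p) x) \<le> (c * C1) * M powr (q - 1))"
proof -
  obtain L where L: "L \<ge> 1" "\<And>z \<rho> x i. \<rho> > 0 \<Longrightarrow> abs (pd i (bump z \<rho>) (x :: real^'d)) \<le> L / \<rho>" using bump_gradient by blast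
  define n where "n = real CARD('d)"
  have n: "n \<ge> 1" by (simp add: n_def)
  show ?thesis
  proof (rule exI[of _ "n * n * (L + 1)"], intro allI impI)
    fix C1 :: real and q \<rho> M and z :: "real^'d" and p :: "real^'d \<Rightarrow> real^'d" and x :: "real^'d"
    assume C1: "C1 \<ge> 0" and \<rho>: "\<rho> > 0" and M: "M \<ge> 0" and sm: "\<forall>j. smooth (\<lambda>x. p x $ j)"
      and bd: "\<forall>x\<in>cball z (2 * \<rho>). \<forall>j. abs (p x $ j) \<le> C1 * M \<and> (\<forall>i. abs (\<rho> * pd i (\<lambda>x. p x $ j) x) \<le> C1 * M)"
    define Z where "Z = C1 * M powr (q - 1)"
    have Z: "Z \<ge> 0" using C1 by (simp add: Z_def)
    have MM: "M powr (q - 2) * (C1 * M) = Z"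
    \<comment> \<open>Zero to any real power is zero, so the degenerate case needs no restriction on
      \<open>q\<close>.\<close>
    proof (cases "M = 0")
      case False
      have "M powr (q - 2) * M powr 1 = M powr (q - 2 + 1)" by (rule powr_add[symmetric])
      moreover have "M powr 1 = M" using M by simp
      ultimately have "M powr (q - 2) * M = M powr (q - 1)" by (simp add: algebra_simps)
      then show ?thesis by (simp add: Z_def mult.left_commute)
    qed (simp add: Z_def)
    have comp: "abs (bubble q \<rho> M z p x $ j) \<le> \<rho> * Z \<and> (\<forall>i. abs (pd i (\<lambda>x. bubble q \<rho> M z p x $ j) x) \<le> (L + 1) * Z)" for j
    proof (cases "x \<in> cball z (2 * \<rho>)")
      case False
      have "pd i (\<lambda>x. bubble q \<rho> M z p x $ j) x = 0" for i
        by (rule pd_eq_0_outside[OF closed_cball _ False]) (simp add: bubble_zero \<rho>)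
      then show ?thesis using bubble_zero[OF \<rho> False] Z \<rho> L(1) by simp
    next
      case True
      have p1: "abs (p x $ j) \<le> C1 * M" and p2: "\<And>i. abs (\<rho> * pd i (\<lambda>x. p x $ j) x) \<le> C1 * M" using bd True by auto
      have b: "abs (bump z \<rho> x) \<le> 1" using bump_bounds[of z \<rho> x] by simp
      have "abs (bubble q \<rho> M z p x $ j) = \<rho> * (M powr (q - 2) * (abs (bump z \<rho> x) * abs (p x $ j)))"
        using \<rho> by (simp add: bubble_def abs_mult mult.assoc)
      also have "\<dots> \<le> \<rho> * (M powr (q - 2) * (1 * (C1 * M)))" using \<rho> p1 b C1 M by (intro mult_left_mono mult_mono) auto
      finally have 1: "abs (bubble q \<rho> M z p x $ j) \<le> \<rho> * Z" using MM by simp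
      have 2: "abs (pd i (\<lambda>x. bubble q \<rho> M z p x $ j) x) \<le> (L + 1) * Z" for i
      proof -
        have "(\<lambda>x. bubble q \<rho> M z p x $ j) = (\<lambda>x. (\<rho> * M powr (q - 2)) * (bump z \<rho> x * p x $ j))" by (auto simp: bubble_def)
        then have "pd i (\<lambda>x. bubble q \<rho> M z p x $ j) x = (\<rho> * M powr (q - 2)) * pd i (\<lambda>x. bump z \<rho> x * p x $ j) x"
          using sm by (simp add: pd_cmult smooth_differentiable smooth_mult bump_smooth)
        also have "pd i (\<lambda>x. bump z \<rho> x * p x $ j) x = bump z \<rho> x * pd i (\<lambda>x. p x $ j) x + pd i (bump z \<rho>) x * p x $ j"
          using sm by (intro pd_mult smooth_differentiable bump_smooth) auto
        finally have eq: "pd i (\<lambda>x. bubble q \<rho> M z p x $ j) x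
          = M powr (q - 2) * (bump z \<rho> x * (\<rho> * pd i (\<lambda>x. p x $ j) x) + (\<rho> * pd i (bump z \<rho>) x) * p x $ j)"
          by (simp add: algebra_simps)
        have "\<rho> * abs (pd i (bump z \<rho>) x) \<le> \<rho> * (L / \<rho>)" using \<rho> by (intro mult_left_mono L(2)) auto
        then have bg: "abs (\<rho> * pd i (bump z \<rho>) x) \<le> L" using \<rho> by (simp add: abs_mult)
        have "abs (bump z \<rho> x * (\<rho> * pd i (\<lambda>x. p x $ j) x)) \<le> 1 * (C1 * M)"
          unfolding abs_mult[of "bump z \<rho> x"] by (intro mult_mono b p2) auto
        moreover have "abs ((\<rho> * pd i (bump z \<rho>) x) * p x $ j) \<le> L * (C1 * M)"
          unfolding abs_mult[of "\<rho> * pd i (bump z \<rho>) x"] using L(1) by (intro mult_mono bg p1) auto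
        ultimately have "abs (bump z \<rho> x * (\<rho> * pd i (\<lambda>x. p x $ j) x) + (\<rho> * pd i (bump z \<rho>) x) * p x $ j) \<le> (L + 1) * (C1 * M)"
          by (simp add: distrib_right)
        then have "abs (pd i (\<lambda>x. bubble q \<rho> M z p x $ j) x) \<le> M powr (q - 2) * ((L + 1) * (C1 * M))"
          unfolding eq abs_mult[of "M powr (q - 2)"] by (simp add: mult_left_mono)
        also have "\<dots> = (L + 1) * Z" using MM by (simp add: mult.left_commute)
        finally show ?thesis .
      qed
      show ?thesis using 1 2 by blast
    qed
    have "norm (bubble q \<rho> M z p x) \<le> (\<Sum>j\<in>(UNIV::'d set). \<rho> * Z)"
      by (rule order_trans[OF norm_vec_le_sum]) (intro sum_mono, use comp in auto)
    also have "\<dots> = n * (\<rho> * Z)" by (simp add: n_def)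
    also have "\<dots> \<le> (n * n * (L + 1)) * (\<rho> * Z)"
    proof (rule mult_right_mono)
      have "n * 1 \<le> n * (n * (L + 1))" using n L(1) mult_mono[of 1 n 1 "L + 1"] by (intro mult_left_mono) auto
      then show "n \<le> n * n * (L + 1)" by (simp add: mult.assoc)
    qed (use \<rho> Z in auto)
    finally have 1: "norm (bubble q \<rho> M z p x) \<le> (n * n * (L + 1)) * (\<rho> * Z)" .
    have "norm (grad (bubble q \<rho> M z p) x) \<le> (\<Sum>i\<in>(UNIV::'d set). \<Sum>j\<in>(UNIV::'d set). (L + 1) * Z)"
      by (rule order_trans[OF norm_vec_le_sum], intro sum_mono, rule order_trans[OF norm_vec_le_sum])
         (intro sum_mono, use comp in \<open>auto simp: grad_def\<close>)
    also have "\<dots> = (n * n * (L + 1)) * Z" by (simp add: n_def mult.assoc)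
    finally have 2: "norm (grad (bubble q \<rho> M z p) x) \<le> (n * n * (L + 1)) * Z" .
    show "norm (bubble q \<rho> M z p x) \<le> (n * n * (L + 1) * C1) * \<rho> * M powr (q - 1) \<and> norm (grad (bubble q \<rho> M z p) x) \<le> (n * n * (L + 1) * C1) * M powr (q - 1)"
      using 1 2 by (simp add: Z_def mult_ac)
  qed
qed

lemma grad_zero_outside:
  assumes "\<And>x. x \<notin> cball z r \<Longrightarrow> w x = 0" "x \<notin> cball z r"
  shows "grad w x = 0"
  using pd_eq_0_outside[OF closed_cball _ assms(2), of "\<lambda>y. w y $ _"] assms(1) by (simp add: grad_def vec_eq_iff)

lemma bounded_support_energy:
  fixes g :: "real^'d \<Rightarrow> 'b::euclidean_space"
  assumes \<D>: "\<D> \<in> lmeasurable" and s: "s > 0" and g: "continuous_on UNIV g" "\<And>x. norm (g x) \<le> B" "\<And>x. x \<notin> cball z r \<Longrightarrow> g x = 0"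
    and r: "r \<ge> 0" "B \<ge> 0"
  shows "integrable (leb \<D>) (\<lambda>x. norm (g x) powr s)"
    "(LINT x|leb \<D>. norm (g x) powr s) \<le> B powr s * (unit_ball_vol (real CARD('d)) * r ^ CARD('d))"
proof -
  have So: "\<D> \<in> sets lebesgue" using \<D> by (simp add: fmeasurable_def)
  have gm: "g \<in> meas_on \<D>" by (intro borel_measurable_lebesgue_onI borel_measurable_continuous_onI g)
  have bd: "norm (g x) powr s \<le> B powr s * indicator (cball z r) x" for x
    using g(2)[of x] g(3)[of x] s by (cases "x \<in> cball z r") (auto intro!: powr_mono2)
  show int: "integrable (leb \<D>) (\<lambda>x. norm (g x) powr s)"
  proof (rule integrable_bounded_on[OF \<D>, where C = "B powr s"])
    show "(\<lambda>x. norm (g x) powr s) \<in> meas_on \<D>" using gm by measurable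
    show "AE x\<in>\<D> in lebesgue. abs (norm (g x) powr s) \<le> B powr s" using g(2) s by (intro AE_I2) (auto intro!: powr_mono2)
  qed
  have cb: "integrable lebesgue (\<lambda>x. B powr s * indicator (cball z r) x :: real)"
    using lmeasurable_cball[of z r] by (intro integrable_mult_right integrable_real_indicator) (auto simp: fmeasurable_def)
  have "(LINT x|leb \<D>. norm (g x) powr s) = (LINT x|lebesgue. indicator \<D> x * norm (g x) powr s)"
    using So by (subst integral_restrict_space) auto
  also have "\<dots> \<le> (LINT x|lebesgue. B powr s * indicator (cball z r) x)"
  proof (rule integral_le_of_bound[OF cb], rule AE_I2)
    fix x
    have "0 \<le> B powr s * indicator (cball z r) x" by simp
    then show "0 \<le> indicator \<D> x * norm (g x) powr s \<and> indicator \<D> x * norm (g x) powr s \<le> B powr s * indicator (cball z r) x"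
      using bd[of x] by (cases "x \<in> \<D>") auto
  qed
  also have "\<dots> = B powr s * (unit_ball_vol (real CARD('d)) * r ^ CARD('d))"
    using measure_cball_eq[OF r(1), of z] lmeasurable_cball[of z r] by (simp add: fmeasurable_def)
  finally show "(LINT x|leb \<D>. norm (g x) powr s) \<le> B powr s * (unit_ball_vol (real CARD('d)) * r ^ CARD('d))" .
qed

text \<open>Here \<open>(q - 1) * conj_exp q = q\<close> turns the energy of a bubble into
  \<open>M powr q\<close>.\<close>

lemma powr_conj:
  assumes "q > 1" "c \<ge> 0" "M \<ge> 0"
  shows "(c * M powr (q - 1)) powr conj_exp q = c powr conj_exp q * M powr q"
  using assms conj_exp_eq(2)[OF assms(1)] by (simp add: powr_mult powr_powr)

lemma vtest_sum:
  assumes "finite I" "\<And>i. i \<in> I \<Longrightarrow> vtest \<D> (w i)"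
  shows "vtest \<D> (\<lambda>x. \<Sum>i\<in>I. w i x)" "grad (\<lambda>x. \<Sum>i\<in>I. w i x) x = (\<Sum>i\<in>I. grad (w i) x)"
proof -
  have "vtest \<D> (\<lambda>x. \<Sum>i\<in>I. w i x) \<and> (\<forall>x. grad (\<lambda>x. \<Sum>i\<in>I. w i x) x = (\<Sum>i\<in>I. grad (w i) x))" using assms
  proof (induction I rule: finite_induct)
    case empty
    have "vtest \<D> (\<lambda>x. 0)" unfolding vtest_def by (auto intro!: smooth_const exI[of _ "{}"])
    then show ?case by (simp add: grad_def vec_eq_iff pd_eq[OF has_derivative_const])
  next
    case (insert i I)
    have v: "vtest \<D> (w i)" "vtest \<D> (\<lambda>x. \<Sum>i\<in>I. w i x)" using insert by auto
    obtain K K' where K: "compact K" "K \<subseteq> \<D>" "\<And>x. x \<notin> K \<Longrightarrow> w i x = 0"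
      "compact K'" "K' \<subseteq> \<D>" "\<And>x. x \<notin> K' \<Longrightarrow> (\<Sum>i\<in>I. w i x) = 0" using v unfolding vtest_def by metis
    have s: "smooth (\<lambda>x. w i x $ j)" "smooth (\<lambda>x. (\<Sum>i\<in>I. w i x) $ j)" for j by (rule vtest_smooth[OF v(1)], rule vtest_smooth[OF v(2)])
    have "vtest \<D> (\<lambda>x. w i x + (\<Sum>i\<in>I. w i x))" unfolding vtest_def
    proof (intro conjI allI exI[of _ "K \<union> K'"] impI)
      show "smooth (\<lambda>x. (w i x + (\<Sum>i\<in>I. w i x)) $ j)" for j using smooth_add[OF s] by simp
    qed (use K in auto)
    moreover have "grad (\<lambda>x. w i x + (\<Sum>i\<in>I. w i x)) x = grad (w i) x + grad (\<lambda>x. \<Sum>i\<in>I. w i x) x" for x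
      using pd_add[OF smooth_differentiable[OF s(1)] smooth_differentiable[OF s(2)]]
      by (simp add: grad_def vec_eq_iff)
    ultimately show ?case using insert by simp
  qed
  then show "vtest \<D> (\<lambda>x. \<Sum>i\<in>I. w i x)" "grad (\<lambda>x. \<Sum>i\<in>I. w i x) x = (\<Sum>i\<in>I. grad (w i) x)" by auto
qed

text \<open>At most one summand is nonzero, so the power of the norm is additive even though it is
  not linear.\<close>

lemma disjoint_norm_powr_sum:
  assumes I: "finite I" and dis: "\<And>i j. i \<in> I \<Longrightarrow> j \<in> I \<Longrightarrow> i \<noteq> j \<Longrightarrow> S i \<inter> S j = {}"
    and z: "\<And>i. i \<in> I \<Longrightarrow> x \<notin> S i \<Longrightarrow> g i = 0"
  shows "norm (\<Sum>i\<in>I. g i :: 'b::real_normed_vector) powr s = (\<Sum>i\<in>I. norm (g i) powr s)"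
proof (cases "\<exists>i\<in>I. x \<in> S i")
  case True
  then obtain i where i: "i \<in> I" "x \<in> S i" by blast
  have 0: "g j = 0" if "j \<in> I - {i}" for j using z dis i that by blast
  have "(\<Sum>j\<in>I. g j) = g i + (\<Sum>j\<in>I - {i}. g j)" using I i by (simp add: sum.remove)
  moreover have "(\<Sum>j\<in>I. norm (g j) powr s) = norm (g i) powr s + (\<Sum>j\<in>I - {i}. norm (g j) powr s)" using I i by (simp add: sum.remove)
  ultimately show ?thesis using 0 by simp
next
  case False
  then have "\<And>i. i \<in> I \<Longrightarrow> g i = 0" using z by blast
  then show ?thesis by simp
qed

text \<open>The normalisation is by \<open>\<rho> ^ CARD('d)\<close> and not by the volume of the
  ball, so the value differs from the true mean by a factor depending on the dimension only.\<close>

definition rms :: "'d vfield \<Rightarrow> real^'d \<Rightarrow> real \<Rightarrow> real" where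
  "rms p z \<rho> = sqrt ((LINT y|lebesgue. indicator (ball z \<rho>) y * (norm (p y))\<^sup>2) / \<rho> ^ CARD('d))"

lemma rms_nonneg: "\<rho> > 0 \<Longrightarrow> rms p z \<rho> \<ge> 0"
  unfolding rms_def by (intro real_sqrt_ge_zero divide_nonneg_nonneg integral_nonneg) auto

text \<open>The identity behind the exponent \<open>q - 2\<close>: weighted by this power, a squared
  mean becomes a power with exponent \<open>q\<close>.\<close>

lemma rms_energy:
  fixes p :: "real^'d \<Rightarrow> real^'d"
  assumes "\<rho> > 0"
  shows "rms p z \<rho> powr (q - 2) * (LINT y|lebesgue. indicator (ball z \<rho>) y * (norm (p y))\<^sup>2) = \<rho> ^ CARD('d) * rms p z \<rho> powr q"
proof -
  define M where "M = rms p z \<rho>"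
  have M: "M \<ge> 0" unfolding M_def by (rule rms_nonneg[OF assms])
  have I: "(LINT y|lebesgue. indicator (ball z \<rho>) y * (norm (p y))\<^sup>2) = \<rho> ^ CARD('d) * M\<^sup>2"
    using assms by (simp add: M_def rms_def integral_nonneg)
  have "M powr (q - 2) * M\<^sup>2 = M powr q"
  proof (cases "M = 0")
    case False
    then have "M powr (q - 2) * M powr 2 = M powr (q - 2 + 2)" by (intro powr_add[symmetric])
    then show ?thesis using False M by (simp add: powr_numeral)
  qed simp
  then show ?thesis unfolding M_def[symmetric] I by (simp add: mult.left_commute)
qed

lemma radius_le_volume:
  fixes E :: "(real^'d) set"
  assumes "cball z \<rho> \<subseteq> E" "E \<in> lmeasurable" "\<rho> > 0"
  shows "\<rho> \<le> (1 / unit_ball_vol (real CARD('d))) powr (1 / real CARD('d)) * measure lebesgue E powr (1 / real CARD('d))"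
proof -
  have V: "unit_ball_vol (real CARD('d)) > 0" by simp
  have "unit_ball_vol (real CARD('d)) * \<rho> ^ CARD('d) \<le> measure lebesgue E"
    using measure_mono_fmeasurable[OF assms(1) _ assms(2)] measure_cball_eq[of \<rho> z] assms(3) by simp
  then have "\<rho> ^ CARD('d) \<le> 1 / unit_ball_vol (real CARD('d)) * measure lebesgue E" using V by (simp add: field_simps)
  then have "(\<rho> ^ CARD('d)) powr (1 / real CARD('d)) \<le> (1 / unit_ball_vol (real CARD('d)) * measure lebesgue E) powr (1 / real CARD('d))"
    using assms(3) by (intro powr_mono2) auto
  moreover have "(\<rho> ^ CARD('d)) powr (1 / real CARD('d)) = \<rho>" using assms(3) by (simp add: powr_powr flip: powr_realpow)
  ultimately show ?thesis using V by (simp add: powr_divide)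
qed

lemma volume_le_radius:
  fixes E :: "(real^'d) set"
  assumes "E \<subseteq> cball z \<rho>" "E \<in> lmeasurable" "\<rho> \<ge> 0"
  shows "measure lebesgue E powr (1 / real CARD('d)) \<le> unit_ball_vol (real CARD('d)) powr (1 / real CARD('d)) * \<rho>"
proof -
  have "measure lebesgue E \<le> unit_ball_vol (real CARD('d)) * \<rho> ^ CARD('d)"
    using measure_mono_fmeasurable[OF assms(1) _ lmeasurable_cball] measure_cball_eq[of \<rho> z] assms(2,3) by (simp add: fmeasurable_def)
  then have "measure lebesgue E powr (1 / real CARD('d)) \<le> (unit_ball_vol (real CARD('d)) * \<rho> ^ CARD('d)) powr (1 / real CARD('d))"
    by (intro powr_mono2) auto
  also have "\<dots> = unit_ball_vol (real CARD('d)) powr (1 / real CARD('d)) * (\<rho> ^ CARD('d)) powr (1 / real CARD('d))"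
    using assms(3) by (simp add: powr_mult)
  also have "(\<rho> ^ CARD('d)) powr (1 / real CARD('d)) = \<rho>"
    using assms(3) by (cases "\<rho> = 0") (auto simp: powr_powr simp flip: powr_realpow)
  finally show ?thesis .
qed

lemma vector_polynomial_bound:
  "\<exists>C>0. \<forall>(p :: real^'d \<Rightarrow> real^'d) z \<rho>. (\<forall>j. polyd m (\<lambda>x. p x $ j)) \<longrightarrow> \<rho> > 0 \<longrightarrow> (\<forall>x\<in>cball z (K * \<rho>). \<forall>j.
     abs (p x $ j) \<le> C * rms p z \<rho> \<and> (\<forall>i. abs (\<rho> * pd i (\<lambda>x. p x $ j) x) \<le> C * rms p z \<rho>))"
proof -
  obtain C where C: "C > 0" "\<And>(p :: real^'d \<Rightarrow> real) z \<rho> x. polyd m p \<Longrightarrow> \<rho> > 0 \<Longrightarrow> x \<in> cball z (K * \<rho>) \<Longrightarrow>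
     (p x)\<^sup>2 \<le> C / \<rho> ^ CARD('d) * (LINT y|lebesgue. indicator (ball z \<rho>) y * (p y)\<^sup>2) \<and>
     (\<forall>i. (\<rho> * pd i p x)\<^sup>2 \<le> C / \<rho> ^ CARD('d) * (LINT y|lebesgue. indicator (ball z \<rho>) y * (p y)\<^sup>2))"
    using polyd_bound[of m K] by blast
  show ?thesis unfolding rms_def
  proof (rule exI[of _ "sqrt C"], intro conjI allI impI ballI)
    show "sqrt C > 0" using C by simp
    fix p :: "real^'d \<Rightarrow> real^'d" and z x :: "real^'d" and \<rho> :: real and j :: 'd
    assume p: "\<forall>j. polyd m (\<lambda>x. p x $ j)" and \<rho>: "\<rho> > 0" and x: "x \<in> cball z (K * \<rho>)"
    define I where "I = (LINT y|lebesgue. indicator (ball z \<rho>) y * (norm (p y))\<^sup>2)"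
    have cont: "continuous_on UNIV p" using p by (intro continuous_on_vec_componentwise continuous_on_polyd) auto
    have "(LINT y|lebesgue. indicator (ball z \<rho>) y * (p y $ j)\<^sup>2) \<le> I" unfolding I_def
    proof (rule integral_le_of_bound, rule integrable_ball_mult)
      show "continuous_on UNIV (\<lambda>y. (norm (p y))\<^sup>2)" by (intro continuous_intros cont)
      have "(p y $ j)\<^sup>2 \<le> (norm (p y))\<^sup>2" for y using component_le_norm_cart[of "p y" j] by (simp add: abs_le_square_iff[symmetric])
      then show "AE y in lebesgue. 0 \<le> indicator (ball z \<rho>) y * (p y $ j)\<^sup>2 \<and> indicator (ball z \<rho>) y * (p y $ j)\<^sup>2 \<le> indicator (ball z \<rho>) y * (norm (p y))\<^sup>2"
        by (intro AE_I2 conjI mult_left_mono) auto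
    qed
    then have le: "C / \<rho> ^ CARD('d) * (LINT y|lebesgue. indicator (ball z \<rho>) y * (p y $ j)\<^sup>2) \<le> C / \<rho> ^ CARD('d) * I"
      using C \<rho> by (intro mult_left_mono) auto
    have sq: "abs t \<le> sqrt C * sqrt (I / \<rho> ^ CARD('d))" if "t\<^sup>2 \<le> C / \<rho> ^ CARD('d) * I" for t
    proof -
      have "abs t = sqrt (t\<^sup>2)" by simp
      also have "\<dots> \<le> sqrt (C * (I / \<rho> ^ CARD('d)))" using that by (intro real_sqrt_le_mono) simp
      finally show ?thesis unfolding real_sqrt_mult .
    qed
    note b = C(2)[OF p[rule_format, of j] \<rho> x]
    show "abs (p x $ j) \<le> sqrt C * sqrt (I / \<rho> ^ CARD('d))" using b le by (intro sq) linarith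
    show "abs (\<rho> * pd i (\<lambda>x. p x $ j) x) \<le> sqrt C * sqrt (I / \<rho> ^ CARD('d))" for i using b le by (intro sq) (meson order_trans)
  qed
qed

lemma sum_disjoint_integral_le:
  fixes \<Phi> :: "real^'d \<Rightarrow> real"
  assumes I: "finite I" and S: "\<And>i. i \<in> I \<Longrightarrow> closed (S i)" and dis: "\<And>i j. i \<in> I \<Longrightarrow> j \<in> I \<Longrightarrow> i \<noteq> j \<Longrightarrow> S i \<inter> S j = {}"
    and int: "integrable (leb \<D>) \<Phi>" and nn: "\<And>x. \<Phi> x \<ge> 0"
  shows "(\<Sum>i\<in>I. LINT x|leb \<D>. indicator (S i) x * \<Phi> x) \<le> (LINT x|leb \<D>. \<Phi> x)"
proof -
  have i: "integrable (leb \<D>) (\<lambda>x. indicator (S i) x * \<Phi> x)" if "i \<in> I" for i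
  proof (rule Bochner_Integration.integrable_bound[OF int])
    show "(\<lambda>x. indicator (S i) x * \<Phi> x) \<in> meas_on \<D>"
      using S[OF that] by (intro borel_measurable_times borel_measurable_lebesgue_onI borel_measurable_indicator borel_measurable_integrable int) simp
    show "AE x in leb \<D>. norm (indicator (S i) x * \<Phi> x) \<le> norm (\<Phi> x)" by (intro AE_I2) (simp add: indicator_def)
  qed
  have "(\<Sum>i\<in>I. LINT x|leb \<D>. indicator (S i) x * \<Phi> x) = (LINT x|leb \<D>. (\<Sum>i\<in>I. indicator (S i) x * \<Phi> x))"
    using i by (simp add: Bochner_Integration.integral_sum)
  also have "\<dots> \<le> (LINT x|leb \<D>. \<Phi> x)"
  proof (rule integral_le_of_bound[OF int], intro AE_I2 conjI)
    fix x
    show "0 \<le> (\<Sum>i\<in>I. indicator (S i) x * \<Phi> x)" using nn by (intro sum_nonneg) auto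
    have "(\<Sum>i\<in>I. indicator (S i) x) = (indicator (\<Union>i\<in>I. S i) x :: real)"
      using I dis by (intro indicator_UN_disjoint[symmetric]) (auto simp: disjoint_family_on_def)
    also have "\<dots> \<le> 1" by (simp add: indicator_def)
    finally show "(\<Sum>i\<in>I. indicator (S i) x * \<Phi> x) \<le> \<Phi> x"
      using nn[of x] mult_right_mono[of _ 1 "\<Phi> x"] by (simp flip: sum_distrib_right)
  qed
  finally show ?thesis .
qed

lemma integrable_inner_bounded:
  fixes u v :: "real^'d \<Rightarrow> 'b::euclidean_space"
  assumes u: "u \<in> meas_on \<D>" "integrable (leb \<D>) (\<lambda>x. norm (u x))"
    and v: "continuous_on UNIV v" "\<And>x. norm (v x) \<le> B"
  shows "integrable (leb \<D>) (\<lambda>x. u x \<bullet> v x)"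
proof (rule Bochner_Integration.integrable_bound)
  show "integrable (leb \<D>) (\<lambda>x. B * norm (u x))" using u(2) by simp
  show "(\<lambda>x. u x \<bullet> v x) \<in> meas_on \<D>"
    by (intro borel_measurable_inner u(1) borel_measurable_lebesgue_onI borel_measurable_continuous_onI v)
  have "abs (u x \<bullet> v x) \<le> abs (B * norm (u x))" for x
  proof -
    have "abs (u x \<bullet> v x) \<le> norm (u x) * norm (v x)" by (rule Cauchy_Schwarz_ineq2)
    also have "\<dots> \<le> norm (u x) * B" by (intro mult_left_mono v) auto
    finally show ?thesis by (simp add: mult.commute)
  qed
  then show "AE x in leb \<D>. norm (u x \<bullet> v x) \<le> norm (B * norm (u x))" by (intro AE_I2) simp
qed

text \<open>Support and averaging ball are kept apart: \<open>z\<close> and \<open>\<rho>\<close>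
  locate the bubble, \<open>z'\<close> and \<open>\<rho>'\<close> the ball of the mean square. For a
  side the former is centred on the side, the latter next to it.\<close>

definition bubble_estimate :: "real \<Rightarrow> real \<Rightarrow> real \<Rightarrow> real \<Rightarrow> real \<Rightarrow> real^'d \<Rightarrow> real^'d \<Rightarrow> 'd vfield \<Rightarrow> bool" where
  "bubble_estimate q K c \<rho> \<rho>' z z' p \<longleftrightarrow>
     (\<forall>x. norm (bubble q \<rho> (rms p z' \<rho>') z p x) \<le> c * \<rho> * rms p z' \<rho>' powr (q - 1) \<and>
          norm (grad (bubble q \<rho> (rms p z' \<rho>') z p) x) \<le> c * rms p z' \<rho>' powr (q - 1)) \<and>
     (\<forall>x\<in>cball z' (K * \<rho>'). norm (p x) \<le> c * rms p z' \<rho>')"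

lemma bubble_bounds_polynomial:
  shows "\<exists>c\<ge>0. \<forall>q \<rho> z (p :: real^'d \<Rightarrow> real^'d) z' \<rho>'. \<rho> > 0 \<longrightarrow> \<rho>' > 0 \<longrightarrow> \<rho> \<le> 2 * \<rho>' \<longrightarrow> cball z (2 * \<rho>) \<subseteq> cball z' (K * \<rho>') \<longrightarrow>
     (\<forall>j. polyd m (\<lambda>x. p x $ j)) \<longrightarrow> bubble_estimate q K c \<rho> \<rho>' z z' p"
proof -
  obtain C where C: "C > 0" and C2: "\<forall>(p :: real^'d \<Rightarrow> real^'d) z \<rho>. (\<forall>j. polyd m (\<lambda>x. p x $ j)) \<longrightarrow> \<rho> > 0 \<longrightarrow> (\<forall>x\<in>cball z (K * \<rho>). \<forall>j.
     abs (p x $ j) \<le> C * rms p z \<rho> \<and> (\<forall>i. abs (\<rho> * pd i (\<lambda>x. p x $ j) x) \<le> C * rms p z \<rho>))"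
    using vector_polynomial_bound[of m K] by blast
  obtain cb where cb: "\<forall>C1\<ge>0. \<forall>q \<rho> M z (p :: real^'d \<Rightarrow> real^'d). \<rho> > 0 \<longrightarrow> M \<ge> 0 \<longrightarrow> (\<forall>j. smooth (\<lambda>x. p x $ j)) \<longrightarrow>
    (\<forall>x\<in>cball z (2 * \<rho>). \<forall>j. abs (p x $ j) \<le> C1 * M \<and> (\<forall>i. abs (\<rho> * pd i (\<lambda>x. p x $ j) x) \<le> C1 * M)) \<longrightarrow>
    (\<forall>x. norm (bubble q \<rho> M z p x) \<le> (cb * C1) * \<rho> * M powr (q - 1) \<and> norm (grad (bubble q \<rho> M z p) x) \<le> (cb * C1) * M powr (q - 1))"
    by (rule exE[OF bubble_bounds])
  define c where "c = max (abs cb * (2 * C)) (real CARD('d) * C)"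
  show ?thesis unfolding bubble_estimate_def
  proof (rule exI[of _ c], intro conjI allI impI)
    show "c \<ge> 0" using C by (simp add: c_def le_max_iff_disj)
    fix q \<rho> \<rho>' :: real and z z' :: "real^'d" and p :: "real^'d \<Rightarrow> real^'d"
    assume \<rho>: "\<rho> > 0" and \<rho>': "\<rho>' > (0::real)" and le: "\<rho> \<le> 2 * \<rho>'" and sub: "cball z (2 * \<rho>) \<subseteq> cball z' (K * \<rho>')"
      and p: "\<forall>j. polyd m (\<lambda>x. p x $ j :: real)"
    define M where "M = rms p z' \<rho>'"
    have M: "M \<ge> 0" unfolding M_def by (rule rms_nonneg[OF \<rho>'])
    have CM: "C * M \<ge> 0" using C M by simp
    have bd: "abs (p x $ j) \<le> C * M" "abs (\<rho>' * pd i (\<lambda>x. p x $ j) x) \<le> C * M" if "x \<in> cball z' (K * \<rho>')" for x i j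
      using C2[rule_format, of p \<rho>' x z' j] p \<rho>' that by (auto simp: M_def)
    \<comment> \<open>Derivatives are controlled at scale \<open>\<rho>'\<close>; passing to
      \<open>\<rho>\<close> costs the factor two allowed by
      \<open>\<rho> \<le> 2 * \<rho>'\<close>.\<close>
    have bd2: "abs (p x $ j) \<le> 2 * C * M" "abs (\<rho> * pd i (\<lambda>x. p x $ j) x) \<le> 2 * C * M" if "x \<in> cball z (2 * \<rho>)" for x i j
    proof -
      have x: "x \<in> cball z' (K * \<rho>')" using sub that by blast
      show "abs (p x $ j) \<le> 2 * C * M" using bd(1)[OF x, of j] CM by simp
      have "abs (\<rho> * pd i (\<lambda>x. p x $ j) x) = \<rho> * abs (pd i (\<lambda>x. p x $ j) x)" using \<rho> by (simp add: abs_mult)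
      also have "\<dots> \<le> (2 * \<rho>') * abs (pd i (\<lambda>x. p x $ j) x)" using le by (intro mult_right_mono) auto
      also have "\<dots> = 2 * abs (\<rho>' * pd i (\<lambda>x. p x $ j) x)" using \<rho>' by (simp add: abs_mult)
      also have "\<dots> \<le> 2 * C * M" using bd(2)[OF x, of i j] by simp
      finally show "abs (\<rho> * pd i (\<lambda>x. p x $ j) x) \<le> 2 * C * M" .
    qed
    have "\<forall>x. norm (bubble q \<rho> M z p x) \<le> (cb * (2 * C)) * \<rho> * M powr (q - 1) \<and> norm (grad (bubble q \<rho> M z p) x) \<le> (cb * (2 * C)) * M powr (q - 1)"
    proof (rule cb[THEN spec, THEN mp, THEN spec, THEN spec, THEN spec, THEN spec, THEN spec, THEN mp, THEN mp, THEN mp, THEN mp])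
      show "\<forall>x\<in>cball z (2 * \<rho>). \<forall>j. abs (p x $ j) \<le> 2 * C * M \<and> (\<forall>i. abs (\<rho> * pd i (\<lambda>x. p x $ j) x) \<le> 2 * C * M)"
        using bd2 by blast
    qed (use C \<rho> M p polyd_smooth in auto)
    moreover have "cb * (2 * C) \<le> c" using C mult_right_mono[of cb "abs cb" "2 * C"] unfolding c_def by linarith
    ultimately show "norm (bubble q \<rho> (rms p z' \<rho>') z p x) \<le> c * \<rho> * rms p z' \<rho>' powr (q - 1)"
      "norm (grad (bubble q \<rho> (rms p z' \<rho>') z p) x) \<le> c * rms p z' \<rho>' powr (q - 1)" for x unfolding M_def[symmetric] using \<rho>
      by (meson order_trans mult_right_mono powr_ge_zero less_imp_le)+
    show "\<forall>x\<in>cball z' (K * \<rho>'). norm (p x) \<le> c * rms p z' \<rho>'"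
    proof
      fix x assume x: "x \<in> cball z' (K * \<rho>')"
      have "norm (p x) \<le> (\<Sum>j\<in>(UNIV::'d set). C * M)"
        by (rule order_trans[OF norm_vec_le_sum]) (intro sum_mono, use bd[OF x] in auto)
      also have "\<dots> = (real CARD('d) * C) * M" by simp
      also have "\<dots> \<le> c * M" using M by (intro mult_right_mono) (auto simp: c_def)
      finally show "norm (p x) \<le> c * rms p z' \<rho>'" by (simp add: M_def)
    qed
  qed
qed

text \<open>The covering ratio of \<open>side_config_exists\<close>, with its \<open>K\<close> equal
  to \<open>max 1 (4 * \<kappa>)\<close>.\<close>

definition side_ratio :: "real \<Rightarrow> real" where
  "side_ratio \<kappa> = 8 * max 1 (4 * \<kappa>) ^ 3 * (1 + max 1 (4 * \<kappa>))"

lemma side_ratio_ge: "side_ratio \<kappa> \<ge> 1" "side_ratio \<kappa> \<ge> \<kappa>"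
proof -
  have k: "max 1 (4 * \<kappa>) \<ge> 1" by simp
  have 1: "8 * max 1 (4 * \<kappa>) ^ 3 \<ge> 1" using one_le_power[OF k, of 3] by linarith
  have "1 * (1 + max 1 (4 * \<kappa>)) \<le> side_ratio \<kappa>" unfolding side_ratio_def using 1 by (intro mult_right_mono) auto
  then have *: "1 + max 1 (4 * \<kappa>) \<le> side_ratio \<kappa>" by simp
  show "side_ratio \<kappa> \<ge> 1" using * by linarith
  show "side_ratio \<kappa> \<ge> \<kappa>" using * by linarith
qed

text \<open>The residual after integrating by parts elementwise: \<open>s\<close> and \<open>g\<close> are the oscillations of stress and
  force, \<open>T\<close> is the discrete stress including the pressure, and \<open>r\<close> the element residual.\<close>

definition wresidual :: "(real^'d) set \<Rightarrow> 'd mesh \<Rightarrow> ((real^'d) set \<Rightarrow> 'd tfield) \<Rightarrow>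
    ((real^'d) set \<Rightarrow> 'd vfield) \<Rightarrow> 'd tfield \<Rightarrow> 'd vfield \<Rightarrow> 'd vfield \<Rightarrow> real" where
  "wresidual \<D> \<G> T r s g w = (LINT x|leb \<D>. (s x \<bullet> grad w x + pw \<G> r x \<bullet> w x - g x \<bullet> w x)
     + (pw \<G> T x \<bullet> grad w x + pw \<G> (\<lambda>E. cdiv_tensor (T E)) x \<bullet> w x))"

section \<open>Testing the residual\<close>

text \<open>The analytic content separated from the flow problem: piecewise polynomials
  \<open>T\<close> and \<open>r\<close>, error terms \<open>s\<close> and \<open>g\<close>, and a
  number \<open>N\<close> in the role of the dual norm. The value of \<open>K\<close> makes the ball
  of radius \<open>K * \<rho>'\<close> contain the elements concerned for both kinds of bubbles; for
  sides the averaging ball has \<open>\<rho>' = \<rho> / 2\<close> and is off centre by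
  \<open>\<rho> / 2\<close>.\<close>

locale residual_data =
  fixes q :: real and m :: nat and \<kappa> K c D :: real and \<D> :: "(real^'d) set" and \<G> :: "'d::finite mesh"
    and T :: "(real^'d) set \<Rightarrow> 'd tfield" and r :: "(real^'d) set \<Rightarrow> 'd vfield"
    and s :: "'d tfield" and g :: "'d vfield" and N :: real
  assumes q: "q > 1" and c: "c \<ge> 0" and D: "D \<ge> 0"
    and bubble: "\<And>\<rho> \<rho>' z z' (p :: 'd vfield). \<rho> > 0 \<Longrightarrow> \<rho>' > 0 \<Longrightarrow> \<rho> \<le> 2 * \<rho>' \<Longrightarrow>
       cball z (2 * \<rho>) \<subseteq> cball z' (K * \<rho>') \<Longrightarrow> (\<And>j. polyd m (\<lambda>x. p x $ j)) \<Longrightarrow> bubble_estimate q K c \<rho> \<rho>' z z' p"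
    and cp: "conforming_partition \<D> \<G>" and op: "open \<D>" and lm: "\<D> \<in> lmeasurable"
    and ic: "interior (closure \<D>) = \<D>" and sub: "\<D> \<subseteq> cball 0 D"
    and sr: "shape_regular \<kappa> \<G>" and K: "K = 16 * side_ratio \<kappa> + 1"
    and T_poly: "\<And>E i j. E \<in> \<G> \<Longrightarrow> polyd m (\<lambda>x. T E x $ i $ j)" and T_sym: "\<And>E x. E \<in> \<G> \<Longrightarrow> T E x \<in> sym_mats"
    and r_poly: "\<And>E j. E \<in> \<G> \<Longrightarrow> polyd m (\<lambda>x. r E x $ j)"
    and s_meas: "s \<in> meas_on \<D>" and s_int: "integrable (leb \<D>) (\<lambda>x. norm (s x))"
      "integrable (leb \<D>) (\<lambda>x. norm (s x) powr q)"
    and g_meas: "g \<in> meas_on \<D>" and g_int: "integrable (leb \<D>) (\<lambda>x. norm (g x))"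
      "integrable (leb \<D>) (\<lambda>x. (hmesh \<G> x * norm (g x)) powr q)"
    and N: "N \<ge> 0"
    and dual: "\<And>v B. vtest \<D> v \<Longrightarrow> B > 0 \<Longrightarrow>
       (LINT x|leb \<D>. norm (v x) powr conj_exp q) + (LINT x|leb \<D>. norm (grad v x) powr conj_exp q) \<le> B powr conj_exp q \<Longrightarrow>
       wresidual \<D> \<G> T r s g v \<le> N * B"
begin

lemma So: "\<D> \<in> sets lebesgue"
  using lm by (simp add: fmeasurable_def)

lemma continuous_poly:
  assumes "E \<in> \<G>"
  shows "continuous_on UNIV (r E)" "continuous_on UNIV (T E)" "continuous_on UNIV (cdiv_tensor (T E))"
proof -
  show "continuous_on UNIV (r E)" "continuous_on UNIV (cdiv_tensor (T E))"
    using r_poly[OF assms] cdiv_tensor_polyd[OF T_poly[OF assms]]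
    by (auto intro!: continuous_on_vec_componentwise continuous_on_polyd)
  show "continuous_on UNIV (T E)" using T_poly[OF assms] by (auto intro!: continuous_on_vec_componentwise continuous_on_polyd)
qed

lemma pw_integrable:
  fixes p :: "(real^'d) set \<Rightarrow> real^'d \<Rightarrow> 'b::euclidean_space"
  assumes p: "\<And>E. E \<in> \<G> \<Longrightarrow> continuous_on UNIV (p E)"
  shows "pw \<G> p \<in> meas_on \<D>" "integrable (leb \<D>) (\<lambda>x. norm (pw \<G> p x))"
proof -
  show m: "pw \<G> p \<in> meas_on \<D>" by (intro borel_measurable_lebesgue_onI pw_measurable p)
  obtain C where C: "\<And>x. norm (pw \<G> p x) \<le> C" using pw_bounded[of \<D> \<G> p, OF cp p] by blast
  show "integrable (leb \<D>) (\<lambda>x. norm (pw \<G> p x))" by (rule integrable_bounded_on[OF lm]) (use C m in auto)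
qed

lemma wresidual_integrable:
  assumes w: "vtest \<D> w"
  shows "integrable (leb \<D>) (\<lambda>x. s x \<bullet> grad w x)" "integrable (leb \<D>) (\<lambda>x. pw \<G> r x \<bullet> w x)"
    "integrable (leb \<D>) (\<lambda>x. g x \<bullet> w x)" "integrable (leb \<D>) (\<lambda>x. pw \<G> T x \<bullet> grad w x)"
    "integrable (leb \<D>) (\<lambda>x. pw \<G> (\<lambda>E. cdiv_tensor (T E)) x \<bullet> w x)"
proof -
  obtain B where B: "\<And>x. norm (w x) \<le> B" "\<And>x. norm (grad w x) \<le> B" using vtest_bounded[OF w] by blast
  have c: "continuous_on UNIV w" "continuous_on UNIV (grad w)"
    by (intro smooth_vec_continuous grad_continuous vtest_smooth[OF w])+
  show "integrable (leb \<D>) (\<lambda>x. s x \<bullet> grad w x)" "integrable (leb \<D>) (\<lambda>x. pw \<G> r x \<bullet> w x)"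
    "integrable (leb \<D>) (\<lambda>x. g x \<bullet> w x)" "integrable (leb \<D>) (\<lambda>x. pw \<G> T x \<bullet> grad w x)"
    "integrable (leb \<D>) (\<lambda>x. pw \<G> (\<lambda>E. cdiv_tensor (T E)) x \<bullet> w x)"
    using integrable_inner_bounded[OF s_meas s_int(1) c(2) B(2)] integrable_inner_bounded[OF g_meas g_int(1) c(1) B(1)]
      integrable_inner_bounded[OF pw_integrable[of r, OF continuous_poly(1)] c(1) B(1)]
      integrable_inner_bounded[OF pw_integrable[of T, OF continuous_poly(2)] c(2) B(2)]
      integrable_inner_bounded[OF pw_integrable[of "\<lambda>E. cdiv_tensor (T E)", OF continuous_poly(3)] c(1) B(1)]
    by auto
qed

lemma wresidual_split:
  assumes w: "vtest \<D> w"
  shows "wresidual \<D> \<G> T r s g w = (LINT x|leb \<D>. s x \<bullet> grad w x + pw \<G> r x \<bullet> w x - g x \<bullet> w x)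
    + (LINT x|leb \<D>. pw \<G> T x \<bullet> grad w x + pw \<G> (\<lambda>E. cdiv_tensor (T E)) x \<bullet> w x)"
    "(LINT x|leb \<D>. s x \<bullet> grad w x + pw \<G> r x \<bullet> w x - g x \<bullet> w x)
     = (LINT x|leb \<D>. s x \<bullet> grad w x - g x \<bullet> w x) + (LINT x|leb \<D>. pw \<G> r x \<bullet> w x)"
  unfolding wresidual_def using wresidual_integrable[OF w] by (simp_all)

lemma wresidual_sum:
  assumes I: "finite I" and w: "\<And>i. i \<in> I \<Longrightarrow> vtest \<D> (w i)"
  shows "wresidual \<D> \<G> T r s g (\<lambda>x. \<Sum>i\<in>I. w i x) = (\<Sum>i\<in>I. wresidual \<D> \<G> T r s g (w i))"
proof -
  have gr: "grad (\<lambda>x. \<Sum>i\<in>I. w i x) x = (\<Sum>i\<in>I. grad (w i) x)" for x by (rule vtest_sum[OF I]; rule w; assumption)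
  have i: "integrable (leb \<D>) (\<lambda>x. (s x \<bullet> grad (w i) x + pw \<G> r x \<bullet> w i x - g x \<bullet> w i x)
     + (pw \<G> T x \<bullet> grad (w i) x + pw \<G> (\<lambda>E. cdiv_tensor (T E)) x \<bullet> w i x))" if "i \<in> I" for i
    using wresidual_integrable[OF w[OF that]] by simp
  show ?thesis unfolding wresidual_def gr inner_sum_right sum.distrib[symmetric] sum_subtractf[symmetric]
    by (rule Bochner_Integration.integral_sum) (rule i)
qed

lemma oscillation_integrable: "integrable (leb \<D>) (\<lambda>x. norm (s x) powr q + (hmesh \<G> x * norm (g x)) powr q)"
  using s_int g_int by simp

lemma finite_elements: "finite \<G>" and elements: "E \<in> \<G> \<Longrightarrow> full_simplex E"
  using conforming_partitionD[OF cp] by auto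

lemma element_interior: "E \<in> \<G> \<Longrightarrow> interior E \<subseteq> \<D>"
  by (rule element_interior_subset[OF cp ic])

end

text \<open>The volume of the support ball of radius \<open>2 * \<rho>\<close> in units of
  \<open>\<rho> ^ d\<close>, times the power of the pointwise bound: the gradient energy of a bubble
  per unit of \<open>\<rho> ^ d * M powr q\<close>.\<close>

definition energy_const :: "real \<Rightarrow> nat \<Rightarrow> real \<Rightarrow> real" where
  "energy_const q d c = c powr conj_exp q * (unit_ball_vol (real d) * 2 ^ d)"

text \<open>Chosen so that its product with the energy factor of the whole test field is
  \<open>a / 4\<close>; the one added to the energy constant keeps the denominator positive.\<close>

definition young_weight :: "real \<Rightarrow> nat \<Rightarrow> real \<Rightarrow> real \<Rightarrow> real \<Rightarrow> real" where
  "young_weight q d c D a = a / (4 * ((D powr conj_exp q + 1) * (energy_const q d c + 1)))"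

text \<open>What is left after absorption: \<open>a / 4\<close> times the sum is bounded by the
  Young factor times the data, and \<open>H powr q\<close> comes from trading the radius for the
  mesh size.\<close>

definition test_const :: "real \<Rightarrow> nat \<Rightarrow> real \<Rightarrow> real \<Rightarrow> real \<Rightarrow> real \<Rightarrow> real" where
  "test_const q d c D a H = 4 / a * (young_weight q d c D a powr (1 - q) * (1 + H powr q))"

text \<open>Testing with a sum of bubbles with disjoint supports, each of energy comparable to \<open>A i\<close>.
  The functions \<open>F i\<close> collect the local errors; by Young's inequality, the part of them that is
  proportional to the energy is absorbed.\<close>

locale bubble_test = residual_data q m \<kappa> K c D \<D> \<G> T r s g N
  for q m \<kappa> K c D and \<D> :: "(real^'d) set" and \<G> :: "'d::finite mesh" and T r s g N +
  fixes a H :: real and I :: "'i set" and y :: "'i \<Rightarrow> real^'d" and \<rho> :: "'i \<Rightarrow> real" and z :: "'i \<Rightarrow> real^'d" and \<rho>' :: "'i \<Rightarrow> real"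
    and p :: "'i \<Rightarrow> 'd vfield" and n :: "'d sfield" and F :: "'i \<Rightarrow> 'd sfield"
    and M :: "'i \<Rightarrow> real" and w :: "'i \<Rightarrow> 'd vfield"
  assumes a: "a > 0" and H: "H \<ge> 0" and I: "finite I"
    and M_def: "M = (\<lambda>i. rms (p i) (z i) (\<rho>' i))" and w_def: "w = (\<lambda>i. bubble q (\<rho> i) (M i) (y i) (p i))"
    and \<rho>: "\<And>i. i \<in> I \<Longrightarrow> \<rho> i > 0" "\<And>i. i \<in> I \<Longrightarrow> \<rho>' i > 0" "\<And>i. i \<in> I \<Longrightarrow> \<rho> i \<le> 2 * \<rho>' i"
    and ball: "\<And>i. i \<in> I \<Longrightarrow> cball (y i) (2 * \<rho> i) \<subseteq> \<D>" "\<And>i. i \<in> I \<Longrightarrow> cball (y i) (2 * \<rho> i) \<subseteq> cball (z i) (K * \<rho>' i)"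
    and dis: "\<And>i j. i \<in> I \<Longrightarrow> j \<in> I \<Longrightarrow> i \<noteq> j \<Longrightarrow> cball (y i) (2 * \<rho> i) \<inter> cball (y j) (2 * \<rho> j) = {}"
    and poly: "\<And>i j. i \<in> I \<Longrightarrow> polyd m (\<lambda>x. p i x $ j)"
    and n: "\<And>x. n x \<ge> 0" "integrable (leb \<D>) (\<lambda>x. norm (s x) powr q + (hmesh \<G> x * n x) powr q)"
    and h: "\<And>i. i \<in> I \<Longrightarrow> AE x in lebesgue. x \<in> \<D> \<longrightarrow> x \<in> cball (y i) (2 * \<rho> i) \<longrightarrow> \<rho> i \<le> H * hmesh \<G> x"
    and F: "\<And>i x. i \<in> I \<Longrightarrow> abs (F i x) \<le> norm (s x) * norm (grad (w i) x) + n x * norm (w i x)"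
    and low: "\<And>i. i \<in> I \<Longrightarrow> a * (\<rho> i ^ CARD('d) * M i powr q) + (LINT x|leb \<D>. F i x) \<le> wresidual \<D> \<G> T r s g (w i)"
begin

definition \<Phi> :: "real^'d \<Rightarrow> real" where
  "\<Phi> x = norm (s x) powr q + (hmesh \<G> x * n x) powr q"

definition A :: "'i \<Rightarrow> real" where
  "A i = \<rho> i ^ CARD('d) * M i powr q"

lemma A_nonneg: "i \<in> I \<Longrightarrow> A i \<ge> 0"
  using \<rho>(1)[of i] by (simp add: A_def)

lemma \<Phi>_nonneg: "\<Phi> x \<ge> 0"
  by (simp add: \<Phi>_def add_nonneg_nonneg)

lemma bubbles:
  assumes i: "i \<in> I"
  shows "norm (w i x) \<le> c * \<rho> i * M i powr (q - 1)" "norm (grad (w i) x) \<le> c * M i powr (q - 1)" "M i \<ge> 0" "vtest \<D> (w i)"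
    "x \<in> cball (z i) (K * \<rho>' i) \<Longrightarrow> norm (p i x) \<le> c * M i"
    "x \<notin> cball (y i) (2 * \<rho> i) \<Longrightarrow> w i x = 0" "x \<notin> cball (y i) (2 * \<rho> i) \<Longrightarrow> grad (w i) x = 0"
proof -
  show "norm (w i x) \<le> c * \<rho> i * M i powr (q - 1)" "norm (grad (w i) x) \<le> c * M i powr (q - 1)"
    "x \<in> cball (z i) (K * \<rho>' i) \<Longrightarrow> norm (p i x) \<le> c * M i"
    using bubble[OF \<rho>[OF i] ball(2)[OF i] poly[OF i]] unfolding bubble_estimate_def M_def w_def by auto
  show "M i \<ge> 0" unfolding M_def by (rule rms_nonneg[OF \<rho>(2)[OF i]])
  show "vtest \<D> (w i)" unfolding w_def by (intro bubble_vtest polyd_smooth[OF poly[OF i]] \<rho>(1)[OF i] ball(1)[OF i])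
  have z: "x \<notin> cball (y i) (2 * \<rho> i) \<Longrightarrow> w i x = 0" for x unfolding w_def by (rule bubble_zero[OF \<rho>(1)[OF i]])
  then show "x \<notin> cball (y i) (2 * \<rho> i) \<Longrightarrow> w i x = 0" .
  show "x \<notin> cball (y i) (2 * \<rho> i) \<Longrightarrow> grad (w i) x = 0" by (rule grad_zero_outside[OF z])
qed

definition E :: real where
  "E = energy_const q CARD('d) c"

definition \<epsilon> :: real where
  "\<epsilon> = young_weight q CARD('d) c D a"

lemma constants: "E \<ge> 0" "\<epsilon> > 0" "\<epsilon> * ((D powr conj_exp q + 1) * (E + 1)) = a / 4" "2 * \<epsilon> * E \<le> a / 2"
proof -
  show E: "E \<ge> 0" by (simp add: E_def energy_const_def)
  have pos: "(D powr conj_exp q + 1) * (E + 1) > 0" using E by (simp add: add_nonneg_pos)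
  show \<epsilon>: "\<epsilon> > 0" using a pos unfolding \<epsilon>_def young_weight_def E_def by (intro divide_pos_pos) auto
  show e: "\<epsilon> * ((D powr conj_exp q + 1) * (E + 1)) = a / 4"
    using pos unfolding \<epsilon>_def young_weight_def E_def by (simp add: field_simps)
  have "1 * E \<le> (D powr conj_exp q + 1) * (E + 1)" using E by (intro mult_mono) auto
  then have "\<epsilon> * E \<le> \<epsilon> * ((D powr conj_exp q + 1) * (E + 1))" using \<epsilon> by (intro mult_left_mono) auto
  then show "2 * \<epsilon> * E \<le> a / 2" unfolding e by simp
qed

lemma energy:
  assumes i: "i \<in> I" and k: "continuous_on UNIV k" "\<And>x. norm (k x) \<le> c * M i powr (q - 1)" "\<And>x. x \<notin> cball (y i) (2 * \<rho> i) \<Longrightarrow> k x = 0"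
  shows "integrable (leb \<D>) (\<lambda>x. norm (k x :: 'b::euclidean_space) powr conj_exp q)"
    "(LINT x|leb \<D>. norm (k x) powr conj_exp q) \<le> E * A i"
proof -
  have r0: "0 \<le> 2 * \<rho> i" "0 \<le> c * M i powr (q - 1)" "conj_exp q > 0" using \<rho>(1)[OF i] c conj_exp_gt_1[OF q] by auto
  note e = bounded_support_energy[OF lm r0(3) k r0(1,2)]
  show "integrable (leb \<D>) (\<lambda>x. norm (k x) powr conj_exp q)" by (rule e(1))
  have "(c * M i powr (q - 1)) powr conj_exp q * (unit_ball_vol (real CARD('d)) * (2 * \<rho> i) ^ CARD('d)) = E * A i"
    unfolding powr_conj[OF q c bubbles(3)[OF i]] by (simp add: E_def energy_const_def A_def power_mult_distrib mult_ac)
  then show "(LINT x|leb \<D>. norm (k x) powr conj_exp q) \<le> E * A i" using e(2) by simp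
qed

lemma bubble_energy:
  assumes i: "i \<in> I"
  shows "integrable (leb \<D>) (\<lambda>x. norm (grad (w i) x) powr conj_exp q)"
    "(LINT x|leb \<D>. norm (grad (w i) x) powr conj_exp q) \<le> E * A i"
    "integrable (leb \<D>) (\<lambda>x. norm (w i x) powr conj_exp q)"
    "(LINT x|leb \<D>. norm (w i x) powr conj_exp q) \<le> \<rho> i powr conj_exp q * (E * A i)"
proof -
  have c: "continuous_on UNIV (w i)" "continuous_on UNIV (grad (w i))"
    by (intro smooth_vec_continuous grad_continuous vtest_smooth[OF bubbles(4)[OF i]])+
  show "integrable (leb \<D>) (\<lambda>x. norm (grad (w i) x) powr conj_exp q)"
    "(LINT x|leb \<D>. norm (grad (w i) x) powr conj_exp q) \<le> E * A i" by (rule energy[OF i c(2) bubbles(2,7)[OF i]]; assumption)+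
  \<comment> \<open>Divided by \<open>\<rho>\<close> the bubble satisfies the bounds of its
    gradient, so the same energy estimate applies.\<close>
  define v where "v x = (1 / \<rho> i) *\<^sub>R w i x" for x
  have eq: "norm (w i x) powr conj_exp q = \<rho> i powr conj_exp q * norm (v x) powr conj_exp q" for x
    using \<rho>(1)[OF i] by (simp add: v_def flip: powr_mult)
  have v: "continuous_on UNIV v" "\<And>x. norm (v x) \<le> c * M i powr (q - 1)" "\<And>x. x \<notin> cball (y i) (2 * \<rho> i) \<Longrightarrow> v x = 0"
    using \<rho>(1)[OF i] bubbles(1,6)[OF i] c(1) unfolding v_def by (auto intro!: continuous_intros simp: divide_le_eq mult_ac)
  show "integrable (leb \<D>) (\<lambda>x. norm (w i x) powr conj_exp q)" unfolding eq using energy(1)[OF i v] by simp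
  show "(LINT x|leb \<D>. norm (w i x) powr conj_exp q) \<le> \<rho> i powr conj_exp q * (E * A i)"
    unfolding eq using energy(2)[OF i v] by (simp add: mult_left_mono)
qed

text \<open>Weighted Young is used twice, for the gradient and for the field; each use leaves
  \<open>\<epsilon>\<close> times the energy, together at most \<open>a / 2 * A i\<close>.\<close>

lemma local_error:
  assumes i: "i \<in> I"
  shows "abs (LINT x|leb \<D>. F i x) \<le> \<epsilon> powr (1 - q) * (1 + H powr q) * (LINT x|leb \<D>. indicator (cball (y i) (2 * \<rho> i)) x * \<Phi> x) + a / 2 * A i"
proof -
  let ?B = "cball (y i) (2 * \<rho> i)"
  have \<rho>i: "\<rho> i > 0" by (rule \<rho>(1)[OF i])
  let ?R = "\<lambda>x. \<epsilon> powr (1 - q) * (1 + H powr q) * (indicator ?B x * \<Phi> x) + (\<epsilon> * norm (grad (w i) x) powr conj_exp q + \<epsilon> * (norm (w i x) powr conj_exp q / \<rho> i powr conj_exp q))"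
  have int\<Phi>: "integrable (leb \<D>) (\<lambda>x. indicator ?B x * \<Phi> x)"
  proof (rule Bochner_Integration.integrable_bound[OF n(2)])
    show "(\<lambda>x. indicator ?B x * \<Phi> x) \<in> meas_on \<D>"
      unfolding \<Phi>_def by (intro borel_measurable_times borel_measurable_lebesgue_onI borel_measurable_indicator borel_measurable_integrable n(2)) simp
  qed (simp add: indicator_def \<Phi>_def)
  have ig: "integrable (leb \<D>) ?R"
    by (intro Bochner_Integration.integrable_add integrable_mult_right integrable_divide int\<Phi> bubble_energy(1,3)[OF i])
  have "abs (LINT x|leb \<D>. F i x) \<le> (LINT x|leb \<D>. ?R x)"
  proof (rule abs_integral_le[OF ig])
    show "AE x in leb \<D>. abs (F i x) \<le> ?R x" unfolding AE_lebesgue_on_iff[OF So] using h[OF i]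
    proof (eventually_elim, intro impI)
      fix x assume x: "x \<in> \<D> \<longrightarrow> x \<in> ?B \<longrightarrow> \<rho> i \<le> H * hmesh \<G> x" "x \<in> \<D>"
      show "abs (F i x) \<le> ?R x"
      proof (cases "x \<in> ?B")
        case False
        then show ?thesis using F[OF i, of x] bubbles(6,7)[OF i False] by simp
      next
        case True
        define h where "h = hmesh \<G> x"
        have \<rho>h: "\<rho> i \<le> H * h" "h \<ge> 0" using x True by (auto simp: h_def hmesh_def)
        have 1: "norm (s x) * norm (grad (w i) x) \<le> \<epsilon> powr (1 - q) * norm (s x) powr q + \<epsilon> * norm (grad (w i) x) powr conj_exp q"
          by (intro young_weighted q constants) auto
        \<comment> \<open>The factor \<open>\<rho>\<close> is shifted to the error, where it becomes
          \<open>H\<close> times the mesh size; what remains, \<open>w / \<rho>\<close>, has the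
          energy of a gradient.\<close>
        have "n x * norm (w i x) = (\<rho> i * n x) * (norm (w i x) / \<rho> i)" using \<rho>i by simp
        also have "\<dots> \<le> \<epsilon> powr (1 - q) * (\<rho> i * n x) powr q + \<epsilon> * (norm (w i x) / \<rho> i) powr conj_exp q"
          using n(1)[of x] \<rho>i by (intro young_weighted q constants) auto
        also have "\<dots> \<le> \<epsilon> powr (1 - q) * (H * h * n x) powr q + \<epsilon> * (norm (w i x) / \<rho> i) powr conj_exp q"
          using \<rho>h n(1)[of x] \<rho>i q by (intro add_right_mono mult_left_mono powr_mono2 mult_right_mono) auto
        also have "(H * h * n x) powr q = H powr q * (h * n x) powr q" using n(1)[of x] H \<rho>h by (simp add: powr_mult mult.assoc)
        finally have 2: "n x * norm (w i x) \<le> \<epsilon> powr (1 - q) * (H powr q * (h * n x) powr q) + \<epsilon> * (norm (w i x) powr conj_exp q / \<rho> i powr conj_exp q)"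
          using \<rho>i by (simp add: powr_divide)
        have "norm (s x) powr q + H powr q * (h * n x) powr q \<le> (1 + H powr q) * \<Phi> x"
          by (simp add: \<Phi>_def h_def algebra_simps add_nonneg_nonneg)
        then have "\<epsilon> powr (1 - q) * (norm (s x) powr q + H powr q * (h * n x) powr q) \<le> \<epsilon> powr (1 - q) * ((1 + H powr q) * \<Phi> x)"
          by (intro mult_left_mono) auto
        then show ?thesis using F[OF i, of x] 1 2 True unfolding distrib_left[of "\<epsilon> powr (1 - q)" "norm (s x) powr q"] by (simp add: mult.assoc)
      qed
    qed
  qed
  also have "\<dots> = \<epsilon> powr (1 - q) * (1 + H powr q) * (LINT x|leb \<D>. indicator ?B x * \<Phi> x)
    + (\<epsilon> * (LINT x|leb \<D>. norm (grad (w i) x) powr conj_exp q) + \<epsilon> * ((LINT x|leb \<D>. norm (w i x) powr conj_exp q) / \<rho> i powr conj_exp q))"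
    using int\<Phi> bubble_energy(1,3)[OF i] by simp
  also have "\<dots> \<le> \<epsilon> powr (1 - q) * (1 + H powr q) * (LINT x|leb \<D>. indicator ?B x * \<Phi> x) + (\<epsilon> * (E * A i) + \<epsilon> * (E * A i))"
    using bubble_energy(2,4)[OF i] constants \<rho>i by (intro add_left_mono add_mono mult_left_mono) (auto simp: divide_le_eq mult.commute)
  also have "\<epsilon> * (E * A i) + \<epsilon> * (E * A i) = 2 * \<epsilon> * E * A i" by simp
  also have "\<dots> \<le> a / 2 * A i" by (intro mult_right_mono constants A_nonneg i)
  finally show ?thesis by simp
qed

text \<open>Of the coefficient \<open>a\<close> on the left, the local errors take one half and the
  dual norm one quarter, so one quarter survives.\<close>

lemma estimate: "(\<Sum>i\<in>I. A i) \<le> test_const q CARD('d) c D a H * (N powr q + (LINT x|leb \<D>. \<Phi> x))"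
proof -
  let ?W = "\<lambda>x. \<Sum>i\<in>I. w i x" and ?A = "\<Sum>i\<in>I. A i" and ?Y = "\<epsilon> powr (1 - q)" and ?X = "LINT x|leb \<D>. \<Phi> x"
  have q': "conj_exp q > 1" by (rule conj_exp_gt_1[OF q])
  have W: "vtest \<D> ?W" "grad ?W x = (\<Sum>i\<in>I. grad (w i) x)" for x by (rule vtest_sum[OF I]; rule bubbles(4); assumption)+
  have A0: "?A \<ge> 0" by (intro sum_nonneg A_nonneg)
  have e: "norm (?W x) powr t = (\<Sum>i\<in>I. norm (w i x) powr t)" "norm (\<Sum>i\<in>I. grad (w i) x) powr t = (\<Sum>i\<in>I. norm (grad (w i) x) powr t)" for x t
    by (rule disjoint_norm_powr_sum[OF I dis bubbles(6)], assumption+) (rule disjoint_norm_powr_sum[OF I dis bubbles(7)], assumption+)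
  have "(LINT x|leb \<D>. norm (?W x) powr conj_exp q) + (LINT x|leb \<D>. norm (grad ?W x) powr conj_exp q)
    = (\<Sum>i\<in>I. (LINT x|leb \<D>. norm (w i x) powr conj_exp q) + (LINT x|leb \<D>. norm (grad (w i) x) powr conj_exp q))"
    unfolding W(2) e using bubble_energy(1,3) by (simp add: Bochner_Integration.integral_sum sum.distrib)
  also have "\<dots> \<le> (\<Sum>i\<in>I. (D powr conj_exp q + 1) * (E + 1) * A i)"
  proof (rule sum_mono)
    fix i assume i: "i \<in> I"
    \<comment> \<open>The Sobolev norm includes the field itself, whose energy carries the
      additional factor \<open>\<rho> powr conj_exp q\<close>. The support lies in the domain, so
      \<open>\<rho> \<le> D\<close>.\<close>
    have "cball (y i) (2 * \<rho> i) \<subseteq> cball 0 D" using ball(1)[OF i] sub by blast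
    then have "norm (y i) + 2 * \<rho> i \<le> D" using \<rho>(1)[OF i] by (simp add: cball_subset_cball_iff)
    then have "\<rho> i \<le> D" using \<rho>(1)[OF i] norm_ge_zero[of "y i"] by linarith
    then have "\<rho> i powr conj_exp q * (E * A i) \<le> D powr conj_exp q * (E * A i)"
      using \<rho>(1)[OF i] q' constants(1) A_nonneg[OF i] by (intro mult_right_mono powr_mono2) auto
    then have "(LINT x|leb \<D>. norm (w i x) powr conj_exp q) + (LINT x|leb \<D>. norm (grad (w i) x) powr conj_exp q) \<le> (D powr conj_exp q + 1) * (E * A i)"
      using bubble_energy(2,4)[OF i] by (simp add: distrib_right)
    also have "\<dots> \<le> (D powr conj_exp q + 1) * ((E + 1) * A i)" using A_nonneg[OF i] by (intro mult_left_mono mult_right_mono) auto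
    finally show "(LINT x|leb \<D>. norm (w i x) powr conj_exp q) + (LINT x|leb \<D>. norm (grad (w i) x) powr conj_exp q) \<le> (D powr conj_exp q + 1) * (E + 1) * A i"
      by (simp add: mult.assoc)
  qed
  also have "\<dots> = (D powr conj_exp q + 1) * (E + 1) * ?A" by (simp add: sum_distrib_left)
  finally have en: "(LINT x|leb \<D>. norm (?W x) powr conj_exp q) + (LINT x|leb \<D>. norm (grad ?W x) powr conj_exp q)
    \<le> (D powr conj_exp q + 1) * (E + 1) * ?A" .
  have W2: "wresidual \<D> \<G> T r s g ?W \<le> ?Y * N powr q + a / 4 * ?A" if "?A > 0"
  proof -
    \<comment> \<open>\<open>B\<close> bounds the norm of the summed test field; the positive sum
      makes it positive, as \<open>dual\<close> requires.\<close>
    define B where "B = ((D powr conj_exp q + 1) * (E + 1) * ?A) powr (1 / conj_exp q)"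
    have pos: "(D powr conj_exp q + 1) * (E + 1) * ?A > 0" using that constants(1) by (intro mult_pos_pos add_nonneg_pos) auto
    then have B: "B > 0" "B powr conj_exp q = (D powr conj_exp q + 1) * (E + 1) * ?A" using q' by (auto simp: B_def powr_powr)
    have "wresidual \<D> \<G> T r s g ?W \<le> N * B" by (rule dual[OF W(1) B(1)]) (use en B(2) in simp)
    also have "\<dots> \<le> ?Y * N powr q + \<epsilon> * B powr conj_exp q" using B by (intro young_weighted q constants N) auto
    also have "\<epsilon> * B powr conj_exp q = a / 4 * ?A" unfolding B(2) constants(3)[symmetric] by simp
    finally show ?thesis .
  qed
  have X0: "?X \<ge> 0" using \<Phi>_nonneg by simp
  have "(\<Sum>i\<in>I. a * A i) \<le> (\<Sum>i\<in>I. wresidual \<D> \<G> T r s g (w i) + (?Y * (1 + H powr q) * (LINT x|leb \<D>. indicator (cball (y i) (2 * \<rho> i)) x * \<Phi> x) + a / 2 * A i))"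
  proof (rule sum_mono)
    fix i assume i: "i \<in> I"
    show "a * A i \<le> wresidual \<D> \<G> T r s g (w i) + (?Y * (1 + H powr q) * (LINT x|leb \<D>. indicator (cball (y i) (2 * \<rho> i)) x * \<Phi> x) + a / 2 * A i)"
      using low[OF i] local_error[OF i] unfolding A_def by linarith
  qed
  also have "\<dots> = wresidual \<D> \<G> T r s g ?W + (?Y * (1 + H powr q) * (\<Sum>i\<in>I. LINT x|leb \<D>. indicator (cball (y i) (2 * \<rho> i)) x * \<Phi> x) + a / 2 * ?A)"
    unfolding sum.distrib sum_distrib_left[symmetric] using wresidual_sum[OF I bubbles(4)] by simp
  also have "\<dots> \<le> wresidual \<D> \<G> T r s g ?W + (?Y * (1 + H powr q) * ?X + a / 2 * ?A)"
    using n(2) \<Phi>_nonneg by (intro add_left_mono add_right_mono mult_left_mono sum_disjoint_integral_le I dis) (auto simp: \<Phi>_def[abs_def])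
  finally have 1: "a * ?A \<le> wresidual \<D> \<G> T r s g ?W + (?Y * (1 + H powr q) * ?X + a / 2 * ?A)" by (simp add: sum_distrib_left)
  have "a / 4 * ?A \<le> ?Y * N powr q + ?Y * (1 + H powr q) * ?X"
  proof (cases "?A > 0")
    case True
    then show ?thesis using 1 W2 by linarith
  next
    case False
    then have "?A = 0" using A0 by linarith
    then show ?thesis using X0 by simp
  qed
  also have "\<dots> \<le> ?Y * (1 + H powr q) * (N powr q + ?X)" by (simp add: algebra_simps)
  finally have "?A \<le> 4 / a * (?Y * (1 + H powr q) * (N powr q + ?X))" using a by (simp add: field_simps)
  then show ?thesis unfolding test_const_def \<epsilon>_def by (simp only: mult.assoc)
qed

end

section \<open>Bubbles centred on a side\<close>

lemma plane_proj_simps: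
  fixes \<nu> :: "real^'d"
  assumes "norm \<nu> = 1"
  shows "plane_proj \<nu> b x \<bullet> \<nu> = b" "plane_proj \<nu> b (x + s *\<^sub>R \<nu>) = plane_proj \<nu> b x"
    "x \<bullet> \<nu> = b \<Longrightarrow> plane_proj \<nu> b x = x" "plane_proj \<nu> b (plane_proj \<nu> b x) = plane_proj \<nu> b x"
proof -
  have n: "\<nu> \<bullet> \<nu> = 1" using assms by (simp add: dot_square_norm)
  show 1: "plane_proj \<nu> b x \<bullet> \<nu> = b" using n by (simp add: plane_proj_def inner_diff_left)
  show "plane_proj \<nu> b (x + s *\<^sub>R \<nu>) = plane_proj \<nu> b x" using n by (simp add: plane_proj_def inner_add_left algebra_simps)
  show "x \<bullet> \<nu> = b \<Longrightarrow> plane_proj \<nu> b x = x" for x by (simp add: plane_proj_def)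
  from this[OF 1] show "plane_proj \<nu> b (plane_proj \<nu> b x) = plane_proj \<nu> b x" .
qed

text \<open>The projection discards the normal component, so the offset \<open>t\<close> drops out
  and Pythagoras gives the inequality.\<close>

lemma plane_proj_dist:
  fixes \<nu> y :: "real^'d"
  assumes \<nu>: "norm \<nu> = 1" and y: "y \<bullet> \<nu> = b"
  shows "dist y (plane_proj \<nu> b x) \<le> dist (y + t *\<^sub>R \<nu>) x"
proof -
  have n: "\<nu> \<bullet> \<nu> = 1" using \<nu> by (simp add: dot_square_norm)
  define v where "v = x - (y + t *\<^sub>R \<nu>)"
  have "plane_proj \<nu> b x - y = v - (v \<bullet> \<nu>) *\<^sub>R \<nu>"
    using n y by (simp add: plane_proj_def v_def inner_diff_left inner_add_left algebra_simps)
  moreover have "(norm (v - (v \<bullet> \<nu>) *\<^sub>R \<nu>))\<^sup>2 = (norm v)\<^sup>2 - (v \<bullet> \<nu>)\<^sup>2" using n unfolding power2_norm_eq_inner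
    by (simp add: inner_diff_left inner_diff_right inner_commute[of \<nu> v] power2_eq_square)
  then have "(norm (v - (v \<bullet> \<nu>) *\<^sub>R \<nu>))\<^sup>2 \<le> (norm v)\<^sup>2" by simp
  then have "norm (v - (v \<bullet> \<nu>) *\<^sub>R \<nu>) \<le> norm v" by (rule power2_le_imp_le) simp
  ultimately show ?thesis by (metis dist_commute dist_norm v_def)
qed

lemma polyd_plane_proj:
  assumes "polyd m f"
  shows "polyd m (\<lambda>x. f (plane_proj \<nu> b x))"
proof -
  have "linear (\<lambda>x. x - (x \<bullet> \<nu>) *\<^sub>R \<nu>)" by (intro linearI) (auto simp: inner_add_left algebra_simps)
  from polyd_affine[OF assms this, of "b *\<^sub>R \<nu>"] show ?thesis by (simp add: plane_proj_def algebra_simps)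
qed

text \<open>The integrand does not depend on the coordinate normal to the plane, so the slab of height
  one may be rescaled to height \<open>\<rho>\<close>, where it contains a ball of radius \<open>\<rho>/2\<close>.\<close>

lemma plane_bubble_lower:
  fixes \<nu> y :: "real^'d" and p :: "'d vfield"
  assumes \<nu>: "norm \<nu> = 1" and y: "y \<bullet> \<nu> = b" and \<rho>: "\<rho> > 0" and p: "continuous_on UNIV p" "\<And>x. p (plane_proj \<nu> b x) = p x"
  defines "M \<equiv> rms p (y + (\<rho> / 2) *\<^sub>R \<nu>) (\<rho> / 2)"
  shows "exp (-1) / 2 ^ CARD('d) * (\<rho> ^ CARD('d) * M powr q)
    \<le> plane_integral \<nu> b (\<lambda>x. p x \<bullet> bubble q \<rho> M y p x)"
proof -
  define z where "z = y + (\<rho> / 2) *\<^sub>R \<nu>"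
  define k where "k x = bump y \<rho> x * (norm (p x))\<^sup>2" for x
  define h where "h x = k (plane_proj \<nu> b x)" for x
  have n: "\<nu> \<bullet> \<nu> = 1" using \<nu> by (simp add: dot_square_norm)
  have ck: "continuous_on UNIV k" unfolding k_def[abs_def] by (intro continuous_intros p smooth_continuous[OF bump_smooth])
  have kz: "x \<notin> cball y (2 * \<rho>) \<Longrightarrow> k x = 0" for x using bump_zero[OF \<rho>, of y x] by (simp add: k_def)
  have k0: "k x \<ge> 0" for x using bump_bounds[of y \<rho> x] by (simp add: k_def)
  note int = plane_slab_integrable[OF \<nu> ck kz]
  have "continuous_on UNIV h" unfolding h_def[abs_def] by (rule continuous_on_compose2[OF ck continuous_plane_proj]) simp
  then have hm: "h \<in> borel_measurable borel" by (rule borel_measurable_continuous_onI)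
  have "exp (-1) * (LINT x|lebesgue. indicator (ball z (\<rho> / 2)) x * (norm (p x))\<^sup>2) = (LINT x|lebesgue. exp (-1) * (indicator (ball z (\<rho> / 2)) x * (norm (p x))\<^sup>2))"
    by simp
  also have "\<dots> \<le> (LINT x|lebesgue. indicator (slab \<nu> b (b + \<rho>)) x * h x)"
  proof (rule integral_le_of_bound)
    show "integrable lebesgue (\<lambda>x. indicator (slab \<nu> b (b + \<rho>)) x * h x)" unfolding h_def by (rule int)
    show "AE x in lebesgue. 0 \<le> exp (-1) * (indicator (ball z (\<rho> / 2)) x * (norm (p x))\<^sup>2) \<and>
      exp (-1) * (indicator (ball z (\<rho> / 2)) x * (norm (p x))\<^sup>2) \<le> indicator (slab \<nu> b (b + \<rho>)) x * h x"
    proof (intro AE_I2 conjI)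
      fix x
      show "exp (-1) * (indicator (ball z (\<rho> / 2)) x * (norm (p x))\<^sup>2) \<le> indicator (slab \<nu> b (b + \<rho>)) x * h x"
      proof (cases "x \<in> ball z (\<rho> / 2)")
        case True
        have "abs ((x - z) \<bullet> \<nu>) \<le> norm (x - z)" using Cauchy_Schwarz_ineq2[of "x - z" \<nu>] \<nu> by simp
        also have "\<dots> < \<rho> / 2" using True by (simp add: dist_norm norm_minus_commute)
        finally have "abs (x \<bullet> \<nu> - (b + \<rho> / 2)) < \<rho> / 2" using n y by (simp add: z_def inner_diff_left inner_add_left)
        then have "x \<in> slab \<nu> b (b + \<rho>)" unfolding abs_less_iff by auto
        moreover have "dist y (plane_proj \<nu> b x) \<le> \<rho>" using plane_proj_dist[OF \<nu> y, of x "\<rho> / 2"] True \<rho> by (simp add: z_def)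
        then have "exp (-1) \<le> bump y \<rho> (plane_proj \<nu> b x)" by (rule bump_lower[OF \<rho>])
        then have "exp (-1) * (norm (p x))\<^sup>2 \<le> h x" unfolding h_def k_def p(2) by (intro mult_right_mono) auto
        ultimately show ?thesis using True by simp
      next
        case False
        then show ?thesis using k0 by (simp add: h_def)
      qed
    qed simp
  qed
  also have "\<dots> = \<rho> * (LINT x|lebesgue. indicator (slab \<nu> b (b + 1)) x * h x)"
  proof (rule slab_integral_scale[OF hm \<nu>])
    show "h (x + s *\<^sub>R \<nu>) = h x" for x s by (simp add: h_def plane_proj_simps[OF \<nu>])
    show "integrable lebesgue (\<lambda>x. indicator (slab \<nu> a c) x * h x)" for a c unfolding h_def by (rule int)
  qed (use k0 \<rho> in \<open>auto simp: h_def\<close>)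
  finally have le: "exp (-1) * (LINT x|lebesgue. indicator (ball z (\<rho> / 2)) x * (norm (p x))\<^sup>2) \<le> \<rho> * (LINT x|lebesgue. indicator (slab \<nu> b (b + 1)) x * h x)" .
  have "exp (-1) / 2 ^ CARD('d) * (\<rho> ^ CARD('d) * M powr q) = exp (-1) * ((\<rho> / 2) ^ CARD('d) * M powr q)"
    by (simp add: power_divide)
  also have "\<dots> = M powr (q - 2) * (exp (-1) * (LINT x|lebesgue. indicator (ball z (\<rho> / 2)) x * (norm (p x))\<^sup>2))"
    using rms_energy[of "\<rho> / 2" p z q] \<rho> by (simp add: M_def z_def)
  also have "\<dots> \<le> M powr (q - 2) * (\<rho> * (LINT x|lebesgue. indicator (slab \<nu> b (b + 1)) x * h x))"
    by (intro mult_left_mono le) auto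
  also have "\<dots> = (LINT x|lebesgue. (M powr (q - 2) * \<rho>) * (indicator (slab \<nu> b (b + 1)) x * h x))" by simp
  also have "\<dots> = plane_integral \<nu> b (\<lambda>x. p x \<bullet> bubble q \<rho> M y p x)"
    unfolding plane_integral_def by (intro Bochner_Integration.integral_cong) (auto simp: bubble_def h_def k_def p(2) dot_square_norm)
  finally show ?thesis .
qed

text \<open>The radius is written as \<open>8 * \<rho>\<close> to leave room: bubbles occupy radius
  \<open>2 * \<rho>\<close>, disjointness holds at \<open>4 * \<rho>\<close>, and either element
  contains a full ball of radius \<open>\<rho>\<close>, which compares \<open>\<rho>\<close> with
  its volume.\<close>

lemma side_config_geometry:
  fixes \<G> :: "'d::finite mesh"
  assumes s: "side_config K \<G> F E1 E2 \<nu> b y (8 * \<rho>)"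
  shows "ball y (8 * \<rho>) \<subseteq> E1 \<union> E2" "cball (y - (2 * \<rho>) *\<^sub>R \<nu>) \<rho> \<subseteq> E1" "cball (y + (2 * \<rho>) *\<^sub>R \<nu>) \<rho> \<subseteq> E2" "\<rho> > 0"
proof -
  have s': "norm \<nu> = 1" "y \<bullet> \<nu> = b" "\<rho> > 0" "ball y (8 * \<rho>) \<inter> {x. x \<bullet> \<nu> \<le> b} \<subseteq> E1" "ball y (8 * \<rho>) \<inter> {x. b \<le> x \<bullet> \<nu>} \<subseteq> E2"
    using s unfolding side_config_def by auto
  have n: "\<nu> \<bullet> \<nu> = 1" using s'(1) by (simp add: dot_square_norm)
  show "\<rho> > 0" by (rule s')
  show "ball y (8 * \<rho>) \<subseteq> E1 \<union> E2"
  proof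
    fix x assume "x \<in> ball y (8 * \<rho>)"
    then show "x \<in> E1 \<union> E2" using s'(4,5) by (cases "x \<bullet> \<nu> \<le> b") auto
  qed
  have d: "dist y x < 8 * \<rho>" "abs (x \<bullet> \<nu> - (b + c)) \<le> \<rho>" if "dist (y + c *\<^sub>R \<nu>) x \<le> \<rho>" "abs c = 2 * \<rho>" for x c
  proof -
    have "dist y x \<le> dist y (y + c *\<^sub>R \<nu>) + dist (y + c *\<^sub>R \<nu>) x" by (rule dist_triangle)
    also have "dist y (y + c *\<^sub>R \<nu>) = 2 * \<rho>" using s'(1) that by (simp add: dist_norm)
    finally show "dist y x < 8 * \<rho>" using that s'(3) by linarith
    have "abs ((x - (y + c *\<^sub>R \<nu>)) \<bullet> \<nu>) \<le> norm (x - (y + c *\<^sub>R \<nu>))"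
      using Cauchy_Schwarz_ineq2[of "x - (y + c *\<^sub>R \<nu>)" \<nu>] s'(1) by simp
    also have "\<dots> \<le> \<rho>" using that by (simp add: dist_norm norm_minus_commute)
    finally show "abs (x \<bullet> \<nu> - (b + c)) \<le> \<rho>" using n s'(2) by (simp add: inner_diff_left inner_add_left)
  qed
  show "cball (y - (2 * \<rho>) *\<^sub>R \<nu>) \<rho> \<subseteq> E1"
  proof
    fix x assume "x \<in> cball (y - (2 * \<rho>) *\<^sub>R \<nu>) \<rho>"
    then have "dist (y + (- 2 * \<rho>) *\<^sub>R \<nu>) x \<le> \<rho>" by simp
    from d[OF this] s'(3) have "dist y x < 8 * \<rho>" "x \<bullet> \<nu> \<le> b" by auto
    then show "x \<in> E1" using s'(4) by auto
  qed
  show "cball (y + (2 * \<rho>) *\<^sub>R \<nu>) \<rho> \<subseteq> E2"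
  proof
    fix x assume "x \<in> cball (y + (2 * \<rho>) *\<^sub>R \<nu>) \<rho>"
    then have "dist (y + (2 * \<rho>) *\<^sub>R \<nu>) x \<le> \<rho>" by simp
    from d[OF this] s'(3) have "dist y x < 8 * \<rho>" "b \<le> x \<bullet> \<nu>" by auto
    then show "x \<in> E2" using s'(5) by auto
  qed
qed

text \<open>A face containing a relative interior point of the side contains the whole side, so only
  the two adjacent elements meet there. On the relative boundary further elements may join the
  patch.\<close>

lemma hmesh_side:
  fixes \<G> :: "'d::finite mesh"
  assumes cp: "conforming_partition \<D> \<G>" and s: "side_config K \<G> F E1 E2 \<nu> b y \<rho>" and x: "x \<in> rel_interior F"
  shows "hmesh \<G> x = measure lebesgue (E1 \<union> E2) powr (1 / real CARD('d))"
proof -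
  have s': "E1 \<in> \<G>" "E2 \<in> \<G>" "F = E1 \<inter> E2" "\<And>E. E \<in> \<G> \<Longrightarrow> F \<subseteq> E \<Longrightarrow> E = E1 \<or> E = E2"
    using s unfolding side_config_def by auto
  have xF: "x \<in> F" using x rel_interior_subset by blast
  have "E = E1 \<or> E = E2" if E: "E \<in> \<G>" "x \<in> E" for E
  proof -
    have "F \<subseteq> E1 \<inter> E" by (rule subset_of_face_of[OF conforming_partitionD(4)[OF cp s'(1) E(1)]]) (use s'(3) x xF E in auto)
    then show ?thesis using s'(4)[OF E(1)] by blast
  qed
  then have "patch \<G> {x} = E1 \<union> E2" using s' xF by (auto simp: patch_def neighbours_def)
  then show ?thesis by (simp add: hmesh_def)
qed

text \<open>The two elements at a side erect their prisms in opposite directions; both are covered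
  here.\<close>

lemma prism_uminus_measure_le:
  fixes \<nu> y :: "'a::euclidean_space"
  assumes \<nu>: "norm \<nu> = 1" and F: "F \<subseteq> {x. x \<bullet> \<nu> = b}" "F \<subseteq> cball y r" "compact F" and y: "y \<bullet> \<nu> = b" and \<rho>: "\<rho> > 0"
    and \<mu>: "\<mu> = \<nu> \<or> \<mu> = - \<nu>"
  shows "\<rho> * measure lebesgue (prism F \<mu>) \<le> measure lebesgue (cball y (r + \<rho>))"
proof -
  have "\<exists>c. norm \<mu> = 1 \<and> F \<subseteq> {x. x \<bullet> \<mu> = c} \<and> y \<bullet> \<mu> = c"
    using \<mu> \<nu> F(1) y by (intro exI[of _ "y \<bullet> \<mu>"]) auto
  then show ?thesis using prism_measure_le F(2,3) \<rho> by blast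
qed

text \<open>Almost every point lies in an element interior, where the patch is that element alone;
  so the mesh size is piecewise constant up to a null set.\<close>

lemma hmesh_AE:
  fixes \<G> :: "'d::finite mesh"
  assumes cp: "conforming_partition \<D> \<G>"
  shows "AE x\<in>\<D> in lebesgue. hmesh \<G> x = pw \<G> (\<lambda>E x. measure lebesgue E powr (1 / real CARD('d))) x"
  using AE_in_element[OF cp] by eventually_elim (auto simp: hmesh_interior[OF cp] pw_interior[OF cp])

lemma hmesh_measurable:
  fixes \<G> :: "'d::finite mesh"
  assumes cp: "conforming_partition \<D> \<G>" and So: "\<D> \<in> sets lebesgue"
  shows "hmesh \<G> \<in> meas_on \<D>"
proof (rule borel_measurable_lebesgue_on_AE[OF So])
  show "pw \<G> (\<lambda>E x. measure lebesgue E powr (1 / real CARD('d))) \<in> meas_on \<D>"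
    by (intro borel_measurable_lebesgue_onI pw_measurable) auto
  show "AE x\<in>\<D> in lebesgue. pw \<G> (\<lambda>E x. measure lebesgue E powr (1 / real CARD('d))) x = hmesh \<G> x"
    using hmesh_AE[OF cp] by eventually_elim auto
qed

lemma hmesh_le:
  fixes \<G> :: "'d::finite mesh"
  assumes cp: "conforming_partition \<D> \<G>"
  shows "hmesh \<G> x \<le> measure lebesgue (closure \<D>) powr (1 / real CARD('d))"
proof -
  note P = conforming_partitionD[OF cp]
  have "patch \<G> {x} \<in> sets lebesgue"
    unfolding patch_def neighbours_def using P(1) full_simplex_basics(8)[OF P(2)] by (intro sets.finite_Union) auto
  moreover have "\<Union>\<G> \<in> lmeasurable" using P(1) full_simplex_basics(1)[OF P(2)] by (intro lmeasurable_compact compact_Union) auto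
  moreover have "patch \<G> {x} \<subseteq> \<Union>\<G>" by (auto simp: patch_def neighbours_def)
  ultimately have "measure lebesgue (patch \<G> {x}) \<le> measure lebesgue (\<Union>\<G>)" by (intro measure_mono_fmeasurable)
  then show ?thesis unfolding hmesh_def P(3) by (intro powr_mono2) auto
qed

text \<open>The volume of the ball covering an element, times the power of mesh size and polynomial
  bound there, times the constant of the bubble test with \<open>a = exp (-1)\<close>.\<close>

definition element_const :: "nat \<Rightarrow> real \<Rightarrow> real \<Rightarrow> real \<Rightarrow> real \<Rightarrow> real" where
  "element_const n q K c D = unit_ball_vol n * K ^ n * (unit_ball_vol n powr (1 / n) * K * c) powr q
     * test_const q n c D (exp (-1)) ((1 / unit_ball_vol n) powr (1 / n))"

text \<open>The factor two counts the elements at a side. The rest collects the mesh size, the bound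
  of the jump and the volume of the ball around the prism, all in units of \<open>\<rho>\<close>,
  and the bubble test with the lower bound of \<open>plane_bubble_lower\<close>.\<close>

definition jump_const :: "nat \<Rightarrow> real \<Rightarrow> real \<Rightarrow> real \<Rightarrow> real \<Rightarrow> real" where
  "jump_const n q \<kappa> c D = 2 * (unit_ball_vol n powr (1 / n) * (side_ratio \<kappa> * 8) * c powr q * (unit_ball_vol n * (8 * side_ratio \<kappa> + 1) ^ n))
     * test_const q n c D (exp (-1) / 2 ^ n) ((1 / unit_ball_vol n) powr (1 / n))"

section \<open>Bounds for element residuals and jumps\<close>

context residual_data
begin

lemma element_residual_integrable:
  shows "integrable (leb \<D>) (\<lambda>x. (hmesh \<G> x * norm (pw \<G> r x)) powr q)"
    "integrable (leb \<D>) (\<lambda>x. norm (s x) powr q + (hmesh \<G> x * (norm (pw \<G> r x) + norm (g x))) powr q)"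
proof -
  have m: "pw \<G> r \<in> meas_on \<D>" by (rule pw_integrable[OF continuous_poly(1)])
  obtain C where C: "\<And>x. norm (pw \<G> r x) \<le> C" using pw_bounded[of \<D> \<G> r, OF cp continuous_poly(1)] by blast
  define C' where "C' = measure lebesgue (closure \<D>) powr (1 / real CARD('d))"
  show i: "integrable (leb \<D>) (\<lambda>x. (hmesh \<G> x * norm (pw \<G> r x)) powr q)"
  proof (rule integrable_bounded_on[OF lm, where C = "(C' * C) powr q"])
    show "(\<lambda>x. (hmesh \<G> x * norm (pw \<G> r x)) powr q) \<in> meas_on \<D>" using m hmesh_measurable[OF cp So] by measurable
    show "AE x\<in>\<D> in lebesgue. abs ((hmesh \<G> x * norm (pw \<G> r x)) powr q) \<le> (C' * C) powr q"
    proof (intro AE_I2 impI)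
      fix x
      have "hmesh \<G> x * norm (pw \<G> r x) \<le> C' * C" using C[of x] hmesh_le[OF cp, of x] unfolding C'_def by (intro mult_mono) auto
      then show "abs ((hmesh \<G> x * norm (pw \<G> r x)) powr q) \<le> (C' * C) powr q"
        using q by (auto intro!: powr_mono2 simp: hmesh_def)
    qed
  qed
  have "integrable (leb \<D>) (\<lambda>x. (hmesh \<G> x * (norm (pw \<G> r x) + norm (g x))) powr q)"
  proof (rule Bochner_Integration.integrable_bound)
    show "integrable (leb \<D>) (\<lambda>x. 2 powr q * ((hmesh \<G> x * norm (pw \<G> r x)) powr q + (hmesh \<G> x * norm (g x)) powr q))"
      using i g_int(2) by simp
    show "(\<lambda>x. (hmesh \<G> x * (norm (pw \<G> r x) + norm (g x))) powr q) \<in> meas_on \<D>"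
      using m g_meas hmesh_measurable[OF cp So] by measurable
    have "(hmesh \<G> x * (norm (pw \<G> r x) + norm (g x))) powr q \<le> 2 powr q * ((hmesh \<G> x * norm (pw \<G> r x)) powr q + (hmesh \<G> x * norm (g x)) powr q)" for x
      using powr_add_le[of "hmesh \<G> x * norm (pw \<G> r x)" "hmesh \<G> x * norm (g x)" q] q by (simp add: hmesh_def distrib_left)
    then show "AE x in leb \<D>. norm ((hmesh \<G> x * (norm (pw \<G> r x) + norm (g x))) powr q)
      \<le> norm (2 powr q * ((hmesh \<G> x * norm (pw \<G> r x)) powr q + (hmesh \<G> x * norm (g x)) powr q))" by (intro AE_I2) simp
  qed
  then show "integrable (leb \<D>) (\<lambda>x. norm (s x) powr q + (hmesh \<G> x * (norm (pw \<G> r x) + norm (g x))) powr q)"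
    using s_int(2) by simp
qed

lemma K_ge: "K \<ge> 17" "16 * \<kappa> \<le> K"
  using side_ratio_ge[of \<kappa>] K by auto

text \<open>Each bubble lives inside one element, so \<open>T\<close> contributes no jump and
  testing isolates the pairing with \<open>r\<close>. The weighted norm on the element is recovered
  from the mean square by the polynomial bound on the covering ball.\<close>

lemma element_residual_estimate:
  "(LINT x|leb \<D>. (hmesh \<G> x * norm (pw \<G> r x)) powr q)
    \<le> element_const CARD('d) q K c D * (N powr q + (LINT x|leb \<D>. norm (s x) powr q + (hmesh \<G> x * norm (g x)) powr q))"
proof -
  define V where "V = unit_ball_vol (real CARD('d))"
  have V: "V > 0" by (simp add: V_def)
  define H where "H = (1 / V) powr (1 / real CARD('d))"
  have "\<exists>z \<rho>. \<rho> > 0 \<and> cball z (4 * \<rho>) \<subseteq> E \<and> E \<subseteq> cball z (K * \<rho>)" if E: "E \<in> \<G>" for E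
  proof -
    have "diameter E \<le> \<kappa> * inball_diameter E" using sr E by (auto simp: shape_regular_def)
    from fat_element[OF elements[OF E] this] obtain z R where R: "R > 0" "cball z R \<subseteq> E" "E \<subseteq> cball z (4 * \<kappa> * R)" .
    \<comment> \<open>\<open>R / 4\<close> becomes the radius \<open>\<rho>\<close>, so that
      supports of radius \<open>2 * \<rho>\<close> stay in the interior of the element.\<close>
    have "4 * \<kappa> * R \<le> K * (R / 4)" using R(1) mult_right_mono[OF K_ge(2), of R] by simp
    then have "E \<subseteq> cball z (K * (R / 4))" using R(3) subset_cball by blast
    then show ?thesis using R by (intro exI[of _ z] exI[of _ "R / 4"]) simp
  qed
  then obtain z \<rho> where z\<rho>: "\<And>E. E \<in> \<G> \<Longrightarrow> \<rho> E > 0 \<and> cball (z E) (4 * \<rho> E) \<subseteq> E \<and> E \<subseteq> cball (z E) (K * \<rho> E)"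
    by metis
  \<comment> \<open>The residual is multiplied by the radius, which makes \<open>p\<close>
    comparable to the mesh-weighted residual and its pairing with the bubble
    \<open>M powr (q - 2)\<close> times bump times a square.\<close>
  define p where "p E x = \<rho> E *\<^sub>R r E x" for E x
  define M where "M = (\<lambda>E. rms (p E) (z E) (\<rho> E))"
  define w where "w = (\<lambda>E. bubble q (\<rho> E) (M E) (z E) (p E))"
  have pp: "polyd m (\<lambda>x. p E x $ j)" if "E \<in> \<G>" for E j using polyd_cmult[OF r_poly[OF that]] by (simp add: p_def)
  have \<rho>: "\<rho> E > 0" if "E \<in> \<G>" for E using z\<rho>[OF that] by blast
  have inE: "ball (z E) (4 * \<rho> E) \<subseteq> interior E" "cball (z E) (2 * \<rho> E) \<subseteq> ball (z E) (4 * \<rho> E)" if "E \<in> \<G>" for E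
    using z\<rho>[OF that] interior_mono[of "cball (z E) (4 * \<rho> E)" E] by (auto simp: interior_cball)
  have inE2: "cball (z E) (2 * \<rho> E) \<subseteq> interior E" if "E \<in> \<G>" for E using inE[OF that] by blast
  have wz: "w E x = 0" if "E \<in> \<G>" "x \<notin> cball (z E) (2 * \<rho> E)" for E x
    unfolding w_def by (rule bubble_zero[OF \<rho>[OF that(1)] that(2)])
  have wv: "vtest \<D> (w E)" if E: "E \<in> \<G>" for E unfolding w_def using inE2[OF E] element_interior[OF E]
    by (intro bubble_vtest polyd_smooth[OF pp[OF E]] \<rho>[OF E]) auto
  interpret bubble_test q m \<kappa> K c D \<D> \<G> T r s g N "exp (-1)" H \<G> z \<rho> z \<rho> p "\<lambda>x. norm (g x)" "\<lambda>E x. s x \<bullet> grad (w E) x - g x \<bullet> w E x" M w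
  proof unfold_locales
    fix E assume E: "E \<in> \<G>"
    show "cball (z E) (2 * \<rho> E) \<subseteq> \<D>" using inE2[OF E] element_interior[OF E] by blast
    show "cball (z E) (2 * \<rho> E) \<subseteq> cball (z E) (K * \<rho> E)" using K_ge(1) \<rho>[OF E] by (intro subset_cball mult_right_mono) auto
    show "AE x in lebesgue. x \<in> \<D> \<longrightarrow> x \<in> cball (z E) (2 * \<rho> E) \<longrightarrow> \<rho> E \<le> H * hmesh \<G> x"
    proof (intro AE_I2 impI)
      fix x assume "x \<in> cball (z E) (2 * \<rho> E)"
      then have h: "hmesh \<G> x = measure lebesgue E powr (1 / real CARD('d))" using inE2[OF E] by (intro hmesh_interior[OF cp E]) blast
      show "\<rho> E \<le> H * hmesh \<G> x" unfolding h H_def V_def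
        using z\<rho>[OF E] by (intro radius_le_volume[of "z E"] full_simplex_basics(9) elements[OF E]) (auto intro: order_trans[OF subset_cball])
    qed
    show "abs (s x \<bullet> grad (w E) x - g x \<bullet> w E x) \<le> norm (s x) * norm (grad (w E) x) + norm (g x) * norm (w E x)" for x
      by (rule order_trans[OF abs_triangle_ineq4 add_mono[OF Cauchy_Schwarz_ineq2 Cauchy_Schwarz_ineq2]])
    \<comment> \<open>Any hyperplane serves: with the same element on both sides the jump in
      \<open>elementwise_divergence\<close> cancels.\<close>
    obtain k :: 'd where True by blast
    have half: "ball (z E) (4 * \<rho> E) \<inter> {x. x \<bullet> axis k 1 \<le> 0} \<subseteq> E" "ball (z E) (4 * \<rho> E) \<inter> {x. 0 \<le> x \<bullet> axis k 1} \<subseteq> E"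
      using inE(1)[OF E] interior_subset by blast+
    have k1: "norm (axis k 1 :: real^'d) = 1" by simp
    have 0: "(LINT x|leb \<D>. pw \<G> T x \<bullet> grad (w E) x + pw \<G> (\<lambda>E. cdiv_tensor (T E)) x \<bullet> w E x) = 0" using inE(2)[OF E]
      by (subst elementwise_divergence[OF cp op E E k1 half T_poly T_sym wv[OF E] wz[OF E]]) (auto simp: plane_integral_def)
    have "exp (-1) * (\<rho> E ^ CARD('d) * M E powr q) = (LINT x|lebesgue. M E powr (q - 2) * exp (-1) * (indicator (ball (z E) (\<rho> E)) x * (norm (p E x))\<^sup>2))"
      unfolding integral_mult_right_zero using rms_energy[OF \<rho>[OF E], of "p E" "z E" q]
      by (simp add: M_def mult.left_commute[of _ "exp (-1)"] mult.commute[of _ "exp (-1)"] mult.assoc)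
    also have "\<dots> \<le> (LINT x|lebesgue. pw \<G> r x \<bullet> w E x)"
    proof (rule integral_le_of_bound, rule integral_lebesgue_on_vanish(2)[OF So, THEN iffD1])
      show "pw \<G> r x \<bullet> w E x = 0" if "x \<notin> \<D>" for x using vtest_zero[OF wv[OF E] that] by simp
      show "integrable (leb \<D>) (\<lambda>x. pw \<G> r x \<bullet> w E x)" by (rule wresidual_integrable(2)[OF wv[OF E]])
      show "AE x in lebesgue. 0 \<le> M E powr (q - 2) * exp (-1) * (indicator (ball (z E) (\<rho> E)) x * (norm (p E x))\<^sup>2) \<and>
        M E powr (q - 2) * exp (-1) * (indicator (ball (z E) (\<rho> E)) x * (norm (p E x))\<^sup>2) \<le> pw \<G> r x \<bullet> w E x"
      proof (intro AE_I2 conjI)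
        fix x
        show "M E powr (q - 2) * exp (-1) * (indicator (ball (z E) (\<rho> E)) x * (norm (p E x))\<^sup>2) \<le> pw \<G> r x \<bullet> w E x"
        proof (cases "x \<in> interior E")
          case False
          then have "x \<notin> cball (z E) (2 * \<rho> E)" using inE2[OF E] by blast
          moreover from this have "x \<notin> ball (z E) (\<rho> E)" using \<rho>[OF E] by auto
          ultimately show ?thesis using wz[OF E] by simp
        next
          case True
          have "pw \<G> r x \<bullet> w E x = M E powr (q - 2) * bump (z E) (\<rho> E) x * (norm (p E x))\<^sup>2"
            unfolding pw_interior[OF cp E True] w_def bubble_def p_def using \<rho>[OF E]
            by (simp add: dot_square_norm power_mult_distrib power2_eq_square mult_ac)
          moreover have "exp (-1) * indicator (ball (z E) (\<rho> E)) x \<le> bump (z E) (\<rho> E) x"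
            using bump_lower[OF \<rho>[OF E], of "z E" x] bump_bounds[of "z E" "\<rho> E" x] by (auto simp: indicator_def)
          then have "M E powr (q - 2) * (exp (-1) * indicator (ball (z E) (\<rho> E)) x) * (norm (p E x))\<^sup>2 \<le> M E powr (q - 2) * bump (z E) (\<rho> E) x * (norm (p E x))\<^sup>2"
            by (intro mult_right_mono mult_left_mono) auto
          ultimately show ?thesis by (simp add: mult.assoc)
        qed
      qed simp
    qed
    also have "\<dots> = (LINT x|leb \<D>. pw \<G> r x \<bullet> w E x)"
      using vtest_zero[OF wv[OF E]] by (intro integral_lebesgue_on_vanish(1)[OF So, symmetric]) auto
    finally show "exp (-1) * (\<rho> E ^ CARD('d) * M E powr q) + (LINT x|leb \<D>. s x \<bullet> grad (w E) x - g x \<bullet> w E x) \<le> wresidual \<D> \<G> T r s g (w E)"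
      using wresidual_split[OF wv[OF E]] 0 by simp
  next
    fix E E' assume E: "E \<in> \<G>" "E' \<in> \<G>" "E \<noteq> E'"
    show "cball (z E) (2 * \<rho> E) \<inter> cball (z E') (2 * \<rho> E') = {}"
      using interior_disjoint_element[OF cp E] inE2[OF E(1)] inE2[OF E(2)] interior_subset[of E'] by blast
  qed (use pp \<rho> oscillation_integrable finite_elements in \<open>auto simp: H_def M_def w_def less_imp_le\<close>)
  define Kg where "Kg = V * K ^ CARD('d) * (V powr (1 / real CARD('d)) * K * c) powr q"
  have Kg: "Kg \<ge> 0" using V K_ge by (simp add: Kg_def)
  define Q where "Q E = (V powr (1 / real CARD('d)) * K * c) powr q * M E powr q" for E
  have Q0: "Q E \<ge> 0" for E by (simp add: Q_def)
  have indE: "integrable lebesgue (indicat_real E)" if "E \<in> \<G>" for E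
    using full_simplex_basics(9)[OF elements[OF that]] by (simp add: lmeasurable_iff_integrable)
  have intE: "integrable lebesgue (\<lambda>x. \<Sum>E\<in>\<G>. indicator E x * Q E)"
    by (intro Bochner_Integration.integrable_sum integrable_mult_left indE)
  have "(LINT x|leb \<D>. (hmesh \<G> x * norm (pw \<G> r x)) powr q) = (LINT x|lebesgue. indicator \<D> x * (hmesh \<G> x * norm (pw \<G> r x)) powr q)"
    using So by (subst integral_restrict_space) auto
  also have "\<dots> \<le> (LINT x|lebesgue. (\<Sum>E\<in>\<G>. indicator E x * Q E))"
  proof (rule integral_le_of_bound[OF intE])
    show "AE x in lebesgue. 0 \<le> indicator \<D> x * (hmesh \<G> x * norm (pw \<G> r x)) powr q \<and> indicator \<D> x * (hmesh \<G> x * norm (pw \<G> r x)) powr q \<le> (\<Sum>E\<in>\<G>. indicator E x * Q E)"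
      using AE_in_element[OF cp]
    proof (eventually_elim, intro conjI)
      fix x assume x: "x \<in> \<D> \<longrightarrow> (\<exists>E\<in>\<G>. x \<in> interior E)"
      show "indicator \<D> x * (hmesh \<G> x * norm (pw \<G> r x)) powr q \<le> (\<Sum>E\<in>\<G>. indicator E x * Q E)"
      proof (cases "x \<in> \<D>")
        case True
        then obtain E where E: "E \<in> \<G>" "x \<in> interior E" using x by blast
        have xE: "x \<in> E" "x \<in> cball (z E) (K * \<rho> E)" using E(2) interior_subset z\<rho>[OF E(1)] by blast+
        have "hmesh \<G> x \<le> V powr (1 / real CARD('d)) * (K * \<rho> E)" unfolding hmesh_interior[OF cp E] V_def
          using z\<rho>[OF E(1)] K_ge by (intro volume_le_radius[of _ "z E"] full_simplex_basics(9) elements[OF E(1)]) auto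
        then have "hmesh \<G> x * norm (r E x) \<le> V powr (1 / real CARD('d)) * (K * \<rho> E) * norm (r E x)" by (intro mult_right_mono) auto
        also have "\<dots> = V powr (1 / real CARD('d)) * K * norm (p E x)" using \<rho>[OF E(1)] by (simp add: p_def)
        also have "\<dots> \<le> V powr (1 / real CARD('d)) * K * (c * M E)" using K_ge by (intro mult_left_mono bubbles(5)[OF E(1) xE(2)]) auto
        finally have "(hmesh \<G> x * norm (r E x)) powr q \<le> ((V powr (1 / real CARD('d)) * K * c) * M E) powr q"
          using q by (intro powr_mono2) (auto simp: hmesh_def mult_ac)
        also have "\<dots> = indicator E x * Q E" using bubbles(3)[OF E(1)] K_ge c xE by (simp add: Q_def powr_mult)
        also have "\<dots> \<le> (\<Sum>E\<in>\<G>. indicator E x * Q E)" using E(1) finite_elements Q0 by (intro member_le_sum) auto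
        finally show ?thesis using True by (simp add: pw_interior[OF cp E])
      next
        case False
        then show ?thesis using Q0 by (simp add: sum_nonneg)
      qed
    qed simp
  qed
  also have "\<dots> = (\<Sum>E\<in>\<G>. measure lebesgue E * Q E)"
    by (subst Bochner_Integration.integral_sum) (auto intro!: integrable_mult_left indE)
  also have "\<dots> \<le> (\<Sum>E\<in>\<G>. Kg * A E)"
  proof (rule sum_mono)
    fix E assume E: "E \<in> \<G>"
    have "measure lebesgue E \<le> measure lebesgue (cball (z E) (K * \<rho> E))"
      using z\<rho>[OF E] full_simplex_basics(8)[OF elements[OF E]] by (intro measure_mono_fmeasurable) auto
    also have "\<dots> = V * (K * \<rho> E) ^ CARD('d)" unfolding V_def using K_ge \<rho>[OF E] by (intro measure_cball_eq) auto
    finally have "measure lebesgue E * Q E \<le> V * (K * \<rho> E) ^ CARD('d) * Q E" by (intro mult_right_mono Q0)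
    also have "\<dots> = Kg * A E" by (simp add: Kg_def A_def Q_def power_mult_distrib mult_ac)
    finally show "measure lebesgue E * Q E \<le> Kg * A E" .
  qed
  also have "\<dots> = Kg * (\<Sum>E\<in>\<G>. A E)" by (simp add: sum_distrib_left)
  also have "\<dots> \<le> Kg * (test_const q CARD('d) c D (exp (-1)) H * (N powr q + (LINT x|leb \<D>. \<Phi> x)))" by (intro mult_left_mono estimate Kg)
  finally show ?thesis by (simp add: \<Phi>_def element_const_def Kg_def H_def V_def mult.assoc)
qed

text \<open>A side bubble also meets the element residuals, which therefore appear among the errors
  on the right and are controlled by \<open>element_residual_estimate\<close>. The integrand
  \<open>\<phi>\<close> stays abstract, so that the one-sided traces of the indicator have to be
  identified on interior sides only.\<close>

lemma jump_estimate:
  assumes d: "2 \<le> CARD('d)" and \<phi>0: "\<And>F x. \<phi> F x \<ge> (0::real)" and \<phi>b: "\<And>F x. \<not> rel_interior F \<subseteq> \<D> \<Longrightarrow> \<phi> F x = 0"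
    and \<phi>: "\<And>L F E1 E2 \<nu> b y \<rho> x. rel_interior F \<subseteq> \<D> \<Longrightarrow> side_config L \<G> F E1 E2 \<nu> b y \<rho> \<Longrightarrow> x \<in> F \<Longrightarrow>
       \<phi> F x = hmesh \<G> x * norm ((T E1 x - T E2 x) *v \<nu>) powr q"
  shows "(\<Sum>E\<in>\<G>. \<Sum>F | F facet_of E. LINT x:F|facet_measure E F. \<phi> F x)
    \<le> jump_const CARD('d) q \<kappa> c D * (N powr q + (LINT x|leb \<D>. norm (s x) powr q + (hmesh \<G> x * (norm (pw \<G> r x) + norm (g x))) powr q))"
proof -
  define V where "V = unit_ball_vol (real CARD('d))"
  have V: "V > 0" by (simp add: V_def)
  define L where "L = side_ratio \<kappa>"
  have L: "L \<ge> 1" "K = 16 * L + 1" using side_ratio_ge K by (auto simp: L_def)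
  define a :: real where "a = exp (-1) / 2 ^ CARD('d)"
  define H where "H = (1 / V) powr (1 / real CARD('d))"
  define Kg where "Kg = V powr (1 / real CARD('d)) * (L * 8) * c powr q * (V * (8 * L + 1) ^ CARD('d))"
  have Kg: "Kg \<ge> 0" using V L by (simp add: Kg_def)
  define I where "I = {F. rel_interior F \<subseteq> \<D> \<and> (\<exists>E\<in>\<G>. F facet_of E)}"
  have ff: "finite {F. F facet_of E}" if "E \<in> \<G>" for E
    by (rule finite_polyhedron_facets[OF full_simplex_basics(4)[OF elements[OF that]]])
  have "I \<subseteq> (\<Union>E\<in>\<G>. {F. F facet_of E})" by (auto simp: I_def)
  then have finI: "finite I" by (rule finite_subset) (use finite_elements ff in blast)
  have "\<exists>E1 E2 \<nu> b y \<rho>. side_config L \<G> F E1 E2 \<nu> b y (8 * \<rho>)" if F: "F \<in> I" for F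
  proof -
    obtain E where E: "E \<in> \<G>" "F facet_of E" "rel_interior F \<subseteq> \<D>" using F by (auto simp: I_def)
    from side_config_exists[OF cp op d sr E refl] obtain E2 \<nu> b y \<rho> where "side_config L \<G> F E E2 \<nu> b y \<rho>"
      unfolding L_def side_ratio_def .
    then have "side_config L \<G> F E E2 \<nu> b y (8 * (\<rho> / 8))" by simp
    then show ?thesis by blast
  qed
  then obtain E1 E2 \<nu> b y \<rho> where sc: "\<And>F. F \<in> I \<Longrightarrow> side_config L \<G> F (E1 F) (E2 F) (\<nu> F) (b F) (y F) (8 * \<rho> F)" by metis
  have S: "E1 F \<in> \<G>" "E2 F \<in> \<G>" "E1 F \<noteq> E2 F" "F = E1 F \<inter> E2 F" "F facet_of E1 F" "F facet_of E2 F"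
    "outer_normal (E1 F) F = \<nu> F" "outer_normal (E2 F) F = - \<nu> F" "norm (\<nu> F) = 1" "y F \<bullet> \<nu> F = b F" "\<rho> F > 0"
    "affine hull F = {x. x \<bullet> \<nu> F = b F}" "ball (y F) (8 * \<rho> F) \<inter> {x. x \<bullet> \<nu> F \<le> b F} \<subseteq> E1 F"
    "ball (y F) (8 * \<rho> F) \<inter> {x. b F \<le> x \<bullet> \<nu> F} \<subseteq> E2 F" "E1 F \<union> E2 F \<subseteq> cball (y F) (L * (8 * \<rho> F))"
    "\<And>E. E \<in> \<G> \<Longrightarrow> F \<subseteq> E \<Longrightarrow> E = E1 F \<or> E = E2 F" if "F \<in> I" for F
    using sc[OF that] unfolding side_config_def by (auto simp del: Int_iff)
  note G = side_config_geometry[OF sc]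
  have ball\<D>: "ball (y F) (8 * \<rho> F) \<subseteq> \<D>" if F: "F \<in> I" for F
  proof -
    have "ball (y F) (8 * \<rho> F) \<subseteq> closure \<D>" using G(1)[OF F] S(1,2)[OF F] conforming_partitionD(3)[OF cp] by blast
    then have "ball (y F) (8 * \<rho> F) \<subseteq> interior (closure \<D>)" by (rule interior_maximal) simp
    then show ?thesis by (simp add: ic)
  qed
  \<comment> \<open>The jump is extended constantly in the normal direction. This makes it a
    polynomial on the whole space, so that mean squares over balls control its values on the
    side.\<close>
  define p where "p F x = (T (E1 F) (plane_proj (\<nu> F) (b F) x) - T (E2 F) (plane_proj (\<nu> F) (b F) x)) *v \<nu> F" for F x
  define z where "z F = y F + (\<rho> F / 2) *\<^sub>R \<nu> F" for F
  define M where "M = (\<lambda>F. rms (p F) (z F) (\<rho> F / 2))"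
  define w where "w = (\<lambda>F. bubble q (\<rho> F) (M F) (y F) (p F))"
  have pp: "polyd m (\<lambda>x. p F x $ j)" if F: "F \<in> I" for F j
  proof -
    have "polyd m (\<lambda>x. \<Sum>k\<in>UNIV. \<nu> F $ k * (T (E1 F) (plane_proj (\<nu> F) (b F) x) $ j $ k - T (E2 F) (plane_proj (\<nu> F) (b F) x) $ j $ k))"
      using T_poly[OF S(1)[OF F]] T_poly[OF S(2)[OF F]]
      by (intro polyd_sum polyd_cmult polyd_diff polyd_plane_proj)
    then show ?thesis by (simp add: p_def matrix_vector_mult_def mult.commute)
  qed
  have pproj: "p F (plane_proj (\<nu> F) (b F) x) = p F x" if F: "F \<in> I" for F x
    unfolding p_def plane_proj_simps(4)[OF S(9)[OF F]] ..
  have incl: "cball (y F) (2 * \<rho> F) \<subseteq> cball (z F) (K * (\<rho> F / 2))" "cball (y F) (L * (8 * \<rho> F)) \<subseteq> cball (z F) (K * (\<rho> F / 2))" if F: "F \<in> I" for F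
  proof -
    have k: "1 * \<rho> F \<le> L * \<rho> F" using S(11)[OF F] L by (intro mult_right_mono) auto
    \<comment> \<open>Here \<open>K = 16 * L + 1\<close> is used exactly: half of it times
      \<open>\<rho>\<close> is the covering radius \<open>8 * L * \<rho>\<close> plus the offset
      \<open>\<rho> / 2\<close> of the averaging ball.\<close>
    have e: "dist (y F) (z F) = \<rho> F / 2" "K * (\<rho> F / 2) = 8 * (L * \<rho> F) + \<rho> F / 2" "L * (8 * \<rho> F) = 8 * (L * \<rho> F)"
      using S(9,11)[OF F] by (auto simp: z_def dist_norm L(2) algebra_simps)
    show "cball (y F) (2 * \<rho> F) \<subseteq> cball (z F) (K * (\<rho> F / 2))" "cball (y F) (L * (8 * \<rho> F)) \<subseteq> cball (z F) (K * (\<rho> F / 2))"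
      unfolding cball_subset_cball_iff e using k S(11)[OF F] by linarith+
  qed
  have wz: "w F x = 0" if "F \<in> I" "x \<notin> cball (y F) (2 * \<rho> F)" for F x
    unfolding w_def by (rule bubble_zero[OF S(11)[OF that(1)] that(2)])
  have in8: "cball (y F) (2 * \<rho> F) \<subseteq> ball (y F) (4 * \<rho> F)" "ball (y F) (4 * \<rho> F) \<subseteq> ball (y F) (8 * \<rho> F)" if F: "F \<in> I" for F
    using S(11)[OF F] by auto
  have in\<D>: "cball (y F) (2 * \<rho> F) \<subseteq> \<D>" if F: "F \<in> I" for F using in8[OF F] ball\<D>[OF F] by blast
  have wv: "vtest \<D> (w F)" if F: "F \<in> I" for F
    unfolding w_def by (intro bubble_vtest polyd_smooth[OF pp[OF F]] S(11)[OF F] in\<D>[OF F])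
  interpret bubble_test q m \<kappa> K c D \<D> \<G> T r s g N a H I y \<rho> z "\<lambda>F. \<rho> F / 2" p "\<lambda>x. norm (pw \<G> r x) + norm (g x)"
    "\<lambda>F x. s x \<bullet> grad (w F) x + pw \<G> r x \<bullet> w F x - g x \<bullet> w F x" M w
  proof unfold_locales
    fix F F' assume F: "F \<in> I" "F' \<in> I" "F \<noteq> F'"
    have "ball (y F) (4 * \<rho> F) \<inter> ball (y F') (4 * \<rho> F') = {}" using side_config_disjoint[OF cp sc[OF F(1)] sc[OF F(2)] F(3)] by simp
    then show "cball (y F) (2 * \<rho> F) \<inter> cball (y F') (2 * \<rho> F') = {}" using in8(1)[OF F(1)] in8(1)[OF F(2)] by blast
  next
    fix F assume F: "F \<in> I"
    show "AE x in lebesgue. x \<in> \<D> \<longrightarrow> x \<in> cball (y F) (2 * \<rho> F) \<longrightarrow> \<rho> F \<le> H * hmesh \<G> x"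
      using AE_in_element[OF cp]
    proof (eventually_elim, intro impI)
      fix x assume "x \<in> \<D> \<longrightarrow> (\<exists>E\<in>\<G>. x \<in> interior E)" "x \<in> \<D>" and xb: "x \<in> cball (y F) (2 * \<rho> F)"
      then obtain E where E: "E \<in> \<G>" "x \<in> interior E" by blast
      have "x \<in> E1 F \<union> E2 F" using xb in8[OF F] G(1)[OF F] by blast
      then have "E = E1 F \<or> E = E2 F"
        using interior_disjoint_element[OF cp E(1) S(1)[OF F]] interior_disjoint_element[OF cp E(1) S(2)[OF F]] E(2) by blast
      then have "\<exists>z. cball z (\<rho> F) \<subseteq> E" using G(2,3)[OF F] by blast
      then show "\<rho> F \<le> H * hmesh \<G> x" unfolding hmesh_interior[OF cp E] H_def V_def
        using radius_le_volume full_simplex_basics(9)[OF elements[OF E(1)]] S(11)[OF F] by blast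
    qed
    show "abs (s x \<bullet> grad (w F) x + pw \<G> r x \<bullet> w F x - g x \<bullet> w F x)
      \<le> norm (s x) * norm (grad (w F) x) + (norm (pw \<G> r x) + norm (g x)) * norm (w F x)" for x
      using Cauchy_Schwarz_ineq2[of "s x" "grad (w F) x"] Cauchy_Schwarz_ineq2[of "g x" "w F x"] Cauchy_Schwarz_ineq2[of "pw \<G> r x" "w F x"]
      unfolding distrib_right by linarith
    have cont: "continuous_on UNIV (p F)" by (intro continuous_on_vec_componentwise) (rule continuous_on_polyd[OF pp[OF F]])
    have "a * (\<rho> F ^ CARD('d) * M F powr q) \<le> plane_integral (\<nu> F) (b F) (\<lambda>x. p F x \<bullet> w F x)"
      unfolding a_def w_def M_def z_def by (rule plane_bubble_lower[OF S(9,10,11)[OF F] cont pproj[OF F]])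
    also have "\<dots> = plane_integral (\<nu> F) (b F) (\<lambda>x. ((T (E1 F) x - T (E2 F) x) *v \<nu> F) \<bullet> w F x)"
      unfolding plane_integral_def p_def plane_proj_simps(4)[OF S(9)[OF F]] ..
    also have "\<dots> = (LINT x|leb \<D>. pw \<G> T x \<bullet> grad (w F) x + pw \<G> (\<lambda>E. cdiv_tensor (T E)) x \<bullet> w F x)"
      using in8[OF F] by (intro elementwise_divergence[OF cp op S(1,2,9,13,14)[OF F] T_poly T_sym wv[OF F] wz[OF F], symmetric]) auto
    finally show "a * (\<rho> F ^ CARD('d) * M F powr q) + (LINT x|leb \<D>. s x \<bullet> grad (w F) x + pw \<G> r x \<bullet> w F x - g x \<bullet> w F x) \<le> wresidual \<D> \<G> T r s g (w F)"
      using wresidual_split(1)[OF wv[OF F]] by linarith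
  qed (use S(11) pp in\<D> incl finI element_residual_integrable(2) in \<open>auto simp: M_def w_def a_def H_def add_nonneg_nonneg less_imp_le\<close>)
  have term_le: "(LINT x:F|facet_measure E F. \<phi> F x) \<le> Kg * A F" if F: "F \<in> I" and E: "E = E1 F \<or> E = E2 F" for E F
  proof -
    have Ef: "E \<in> \<G>" "F facet_of E" using E S(1,2,5,6)[OF F] by auto
    define B where "B = V powr (1 / real CARD('d)) * (L * (8 * \<rho> F)) * (c * M F) powr q"
    have B0: "B \<ge> 0" using L S(11)[OF F] by (simp add: B_def)
    have Fsub: "F \<subseteq> cball (y F) (L * (8 * \<rho> F))" using S(4,15)[OF F] by blast
    have Fpl: "F \<subseteq> {x. x \<bullet> \<nu> F = b F}" using S(12)[OF F] hull_subset[of F affine] by simp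
    have "(LINT x:F|facet_measure E F. \<phi> F x) \<le> B * measure lebesgue (prism F (outer_normal E F))"
    proof (rule facet_integral_le[OF elements[OF Ef(1)] Ef(2) \<phi>0 _ B0])
      fix x assume x: "x \<in> rel_interior F"
      have xF: "x \<in> F" using x rel_interior_subset by blast
      have px: "p F x = (T (E1 F) x - T (E2 F) x) *v \<nu> F"
        using plane_proj_simps(3)[OF S(9)[OF F], of x "b F"] Fpl xF by (auto simp: p_def)
      have "\<phi> F x = hmesh \<G> x * norm (p F x) powr q" using \<phi>[OF _ sc[OF F] xF] F px unfolding I_def by auto
      also have "\<dots> \<le> (V powr (1 / real CARD('d)) * (L * (8 * \<rho> F))) * (c * M F) powr q"
      proof (rule mult_mono)
        show "hmesh \<G> x \<le> V powr (1 / real CARD('d)) * (L * (8 * \<rho> F))"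
          unfolding hmesh_side[OF cp sc[OF F] x] V_def using L S(11)[OF F]
          by (intro volume_le_radius[OF S(15)[OF F]] fmeasurable.Un full_simplex_basics(9) elements S(1,2)[OF F]) auto
        have "x \<in> cball (z F) (K * (\<rho> F / 2))" using incl(2)[OF F] Fsub xF by blast
        then show "norm (p F x) powr q \<le> (c * M F) powr q" using q by (intro powr_mono2 bubbles(5)[OF F]) auto
      qed (use L S(11)[OF F] in auto)
      finally show "\<phi> F x \<le> B" by (simp add: B_def)
    qed
    moreover have "\<rho> F * measure lebesgue (prism F (outer_normal E F)) \<le> measure lebesgue (cball (y F) (L * (8 * \<rho> F) + \<rho> F))"
    proof (rule prism_uminus_measure_le[OF S(9)[OF F] Fpl Fsub _ S(10,11)[OF F]])
      show "compact F" using S(4)[OF F] full_simplex_basics(1)[OF elements[OF S(1)[OF F]]] full_simplex_basics(1)[OF elements[OF S(2)[OF F]]]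
        by (metis compact_Int)
      show "outer_normal E F = \<nu> F \<or> outer_normal E F = - \<nu> F" using E S(7,8)[OF F] by auto
    qed
    moreover have "measure lebesgue (cball (y F) (L * (8 * \<rho> F) + \<rho> F)) = V * ((8 * L + 1) * \<rho> F) ^ CARD('d)"
      unfolding V_def using L S(11)[OF F] by (subst measure_cball_eq) (auto simp: algebra_simps)
    ultimately have le: "(LINT x:F|facet_measure E F. \<phi> F x) \<le> B * measure lebesgue (prism F (outer_normal E F))"
      "\<rho> F * measure lebesgue (prism F (outer_normal E F)) \<le> V * ((8 * L + 1) * \<rho> F) ^ CARD('d)" by auto
    have "B * measure lebesgue (prism F (outer_normal E F))
      = V powr (1 / real CARD('d)) * (L * 8) * (c * M F) powr q * (\<rho> F * measure lebesgue (prism F (outer_normal E F)))"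
      by (simp add: B_def)
    also have "\<dots> \<le> V powr (1 / real CARD('d)) * (L * 8) * (c * M F) powr q * (V * ((8 * L + 1) * \<rho> F) ^ CARD('d))"
      using L by (intro mult_left_mono le(2)) auto
    also have "\<dots> = Kg * A F" using c bubbles(3)[OF F] by (simp add: Kg_def A_def powr_mult power_mult_distrib)
    finally show ?thesis using le(1) by linarith
  qed
  have zero: "(LINT x:F|facet_measure E F. \<phi> F x) = 0" if "E \<in> \<G>" "F facet_of E" "F \<notin> I" for E F
  proof -
    have "\<phi> F x = 0" for x using \<phi>b that by (auto simp: I_def)
    then show ?thesis by (simp add: set_lebesgue_integral_def)
  qed
  \<comment> \<open>The sum over elements meets every interior side from both adjacent elements;
    exchanging the summations turns this into the factor two.\<close>
  have "(\<Sum>E\<in>\<G>. \<Sum>F | F facet_of E. LINT x:F|facet_measure E F. \<phi> F x)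
    \<le> (\<Sum>E\<in>\<G>. \<Sum>F\<in>I. if E = E1 F \<or> E = E2 F then Kg * A F else 0)"
  proof (rule sum_mono)
    fix E assume E: "E \<in> \<G>"
    have "(\<Sum>F | F facet_of E. LINT x:F|facet_measure E F. \<phi> F x) = (\<Sum>F\<in>{F. F facet_of E} \<inter> I. LINT x:F|facet_measure E F. \<phi> F x)"
      using ff[OF E] zero[OF E] by (intro sum.mono_neutral_right) auto
    also have "\<dots> \<le> (\<Sum>F\<in>{F. F facet_of E} \<inter> I. if E = E1 F \<or> E = E2 F then Kg * A F else 0)"
    proof (rule sum_mono)
      fix F assume F: "F \<in> {F. F facet_of E} \<inter> I"
      then have "E = E1 F \<or> E = E2 F" using S(16)[of F E] E facet_of_imp_subset[of F E] by auto
      then show "(LINT x:F|facet_measure E F. \<phi> F x) \<le> (if E = E1 F \<or> E = E2 F then Kg * A F else 0)" using term_le F by auto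
    qed
    also have "\<dots> \<le> (\<Sum>F\<in>I. if E = E1 F \<or> E = E2 F then Kg * A F else 0)" using finI A_nonneg Kg by (intro sum_mono2) auto
    finally show "(\<Sum>F | F facet_of E. LINT x:F|facet_measure E F. \<phi> F x) \<le> (\<Sum>F\<in>I. if E = E1 F \<or> E = E2 F then Kg * A F else 0)" .
  qed
  also have "\<dots> = (\<Sum>F\<in>I. \<Sum>E\<in>\<G>. if E = E1 F \<or> E = E2 F then Kg * A F else 0)" by (rule sum.swap)
  also have "\<dots> = (\<Sum>F\<in>I. 2 * Kg * A F)"
  proof (rule sum.cong)
    fix F assume F: "F \<in> I"
    have "(\<Sum>E\<in>\<G>. if E = E1 F \<or> E = E2 F then Kg * A F else 0) = (\<Sum>E\<in>{E1 F, E2 F}. if E = E1 F \<or> E = E2 F then Kg * A F else 0)"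
      using S(1,2)[OF F] finite_elements by (intro sum.mono_neutral_right) auto
    then show "(\<Sum>E\<in>\<G>. if E = E1 F \<or> E = E2 F then Kg * A F else 0) = 2 * Kg * A F" using S(3)[OF F] by simp
  qed simp
  also have "\<dots> = 2 * Kg * (\<Sum>F\<in>I. A F)" by (simp add: sum_distrib_left)
  also have "\<dots> \<le> 2 * Kg * (test_const q CARD('d) c D a H * (N powr q + (LINT x|leb \<D>. \<Phi> x)))" using Kg by (intro mult_left_mono estimate) auto
  finally show ?thesis by (simp add: \<Phi>_def jump_const_def Kg_def H_def V_def a_def L_def mult.assoc)
qed

end

section \<open>Discrete flows\<close>

text \<open>Elements are closed and may stick out of the open domain, but only by null sets, and
  they overlap only in null sets. The cut-off \<open>\<xi>\<close> makes values outside the domain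
  irrelevant.\<close>

lemma element_integral_sum:
  fixes \<G> :: "'d::finite mesh" and \<psi> :: "'d sfield"
  assumes cp: "conforming_partition \<D> \<G>" and So: "\<D> \<in> sets lebesgue" and ic: "interior (closure \<D>) = \<D>"
    and int: "integrable (leb \<D>) \<psi>"
  shows "E \<in> \<G> \<Longrightarrow> integrable (leb E) \<psi>"
    "(\<Sum>E\<in>\<G>. LINT x|leb E. \<psi> x) = (LINT x|leb \<D>. \<psi> x)"
proof -
  define \<xi> where "\<xi> x = indicator \<D> x * \<psi> x" for x
  have int\<xi>: "integrable lebesgue \<xi>" using int So by (simp add: \<xi>_def[abs_def] integrable_restrict_space mult.commute)
  have E: "integrable (leb E) \<psi>" "(LINT x|leb E. \<psi> x) = (LINT x|lebesgue. indicator E x * \<xi> x)"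
    "integrable lebesgue (\<lambda>x. indicator E x * \<xi> x)" if E: "E \<in> \<G>" for E
  proof -
    have fs: "full_simplex E" by (rule conforming_partitionD(2)[OF cp E])
    have SE: "E \<in> sets lebesgue" by (rule full_simplex_basics(8)[OF fs])
    show i: "integrable lebesgue (\<lambda>x. indicator E x * \<xi> x)" using integrable_mult_indicator[OF SE int\<xi>] by simp
    have ae: "AE x\<in>E in lebesgue. \<xi> x = \<psi> x" using AE_interior_element[OF fs]
      by eventually_elim (use element_interior_subset[OF cp ic E] in \<open>auto simp: \<xi>_def indicator_def\<close>)
    have iE: "integrable (leb E) \<xi>" using i SE by (simp add: integrable_restrict_space mult.commute)
    have m: "\<psi> \<in> meas_on E" by (rule borel_measurable_lebesgue_on_AE[OF SE borel_measurable_integrable[OF iE] ae])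
    have ae': "AE x in leb E. \<xi> x = \<psi> x" using ae AE_lebesgue_on_iff[OF SE] by blast
    show "integrable (leb E) \<psi>" using iE integrable_cong_AE[OF borel_measurable_integrable[OF iE] m ae'] by blast
    have "(LINT x|leb E. \<psi> x) = (LINT x|leb E. \<xi> x)" using integral_cong_AE[OF borel_measurable_integrable[OF iE] m ae'] by simp
    then show "(LINT x|leb E. \<psi> x) = (LINT x|lebesgue. indicator E x * \<xi> x)" using SE by (simp add: integral_restrict_space)
  qed
  show "E \<in> \<G> \<Longrightarrow> integrable (leb E) \<psi>" by (rule E(1))
  have "(\<Sum>E\<in>\<G>. LINT x|leb E. \<psi> x) = (LINT x|lebesgue. (\<Sum>E\<in>\<G>. indicator E x * \<xi> x))"
    using E(2,3) by (subst Bochner_Integration.integral_sum) auto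
  also have "\<dots> = (LINT x|lebesgue. \<xi> x)"
  proof (rule integral_cong_AE)
    show "(\<lambda>x. \<Sum>E\<in>\<G>. indicator E x * \<xi> x) \<in> borel_measurable lebesgue"
      by (intro borel_measurable_sum borel_measurable_integrable E(3))
    show "AE x in lebesgue. (\<Sum>E\<in>\<G>. indicator E x * \<xi> x) = \<xi> x" using AE_in_element[OF cp]
    proof eventually_elim
      fix x assume x: "x \<in> \<D> \<longrightarrow> (\<exists>E\<in>\<G>. x \<in> interior E)"
      show "(\<Sum>E\<in>\<G>. indicator E x * \<xi> x) = \<xi> x"
      proof (cases "x \<in> \<D>")
        case True
        then obtain E where E: "E \<in> \<G>" "x \<in> interior E" using x by blast
        have "indicator E' x * \<xi> x = 0" if "E' \<in> \<G> - {E}" for E'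
          using interior_disjoint_element[OF cp E(1), of E'] that E(2) by (auto simp: indicator_def)
        then have "(\<Sum>E'\<in>\<G> - {E}. indicator E' x * \<xi> x) = 0" by (rule sum.neutral[OF ballI])
        moreover have "x \<in> E" using E interior_subset by blast
        ultimately show ?thesis using sum.remove[OF conforming_partitionD(1)[OF cp] E(1), of "\<lambda>E. indicator E x * \<xi> x"] by simp
      next
        case False
        then show ?thesis by (simp add: \<xi>_def)
      qed
    qed
  qed (use int\<xi> in auto)
  also have "\<dots> = (LINT x|leb \<D>. \<psi> x)" using So by (simp add: \<xi>_def integral_restrict_space)
  finally show "(\<Sum>E\<in>\<G>. LINT x|leb E. \<psi> x) = (LINT x|leb \<D>. \<psi> x)" .
qed

text \<open>Continuous functions that agree almost everywhere agree on the interior, as an open null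
  set is empty, and then on its closure, the whole simplex. So the choice in
  \<open>elem_trace\<close> is the polynomial.\<close>

lemma elem_trace_eq:
  fixes E :: "(real^'d) set" and u p :: "real^'d \<Rightarrow> 'b::real_normed_vector"
  assumes E: "full_simplex E" and p: "continuous_on UNIV p" "AE x\<in>E in lebesgue. u x = p x" and x: "x \<in> E"
  shows "elem_trace E u x = p x"
proof -
  note B = full_simplex_basics[OF E]
  define g where "g = elem_trace E u"
  have "\<exists>g. continuous_on E g \<and> (AE x in leb E. u x = g x)" using p continuous_on_subset AE_lebesgue_on_iff[OF B(8)] by blast
  then have "continuous_on E g \<and> (AE x in leb E. u x = g x)" unfolding g_def elem_trace_def by (rule someI_ex)
  then have g: "continuous_on E g" "AE x\<in>E in lebesgue. u x = g x" using AE_lebesgue_on_iff[OF B(8), of "\<lambda>x. u x = g x"] by auto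
  have h: "continuous_on E (\<lambda>x. norm (g x - p x))" by (intro continuous_intros g continuous_on_subset[OF p(1)]) auto
  define U where "U = {x \<in> interior E. norm (g x - p x) \<in> {0<..}}"
  have U: "U = interior E \<inter> (\<lambda>x. norm (g x - p x)) -` {0<..}" by (auto simp: U_def)
  have "open U" unfolding U by (rule continuous_open_preimage[OF continuous_on_subset[OF h interior_subset]]) auto
  moreover have "AE x in lebesgue. x \<notin> U" using g(2) p(2) by eventually_elim (use interior_subset[of E] in \<open>auto simp: U_def\<close>)
  then have "negligible U" using AE_iff_null_sets[OF open_sets_lebesgue[OF \<open>open U\<close>]] by (simp add: negligible_iff_null_sets)
  ultimately have "U = {}" using open_not_negligible by blast
  then have eq: "norm (g y - p y) = 0" if "y \<in> interior E" for y using that by (auto simp: U_def)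
  have "norm (g x - p x) = 0"
  proof (rule continuous_constant_on_closure[of "interior E" "\<lambda>x. norm (g x - p x)"])
    show "continuous_on (closure (interior E)) (\<lambda>x. norm (g x - p x))" using h B(7) by simp
    show "x \<in> closure (interior E)" using x B(7) by simp
  qed (rule eq)
  then show ?thesis by (simp add: g_def)
qed

text \<open>Exactly two elements have \<open>F\<close> as a facet, and their outer normals are
  opposite, so the sum in the definition becomes a difference.\<close>

lemma normal_jump_side:
  fixes \<G> :: "'d::finite mesh"
  assumes cp: "conforming_partition \<D> \<G>" and s: "side_config K \<G> F E1 E2 \<nu> b y \<rho>" and F: "rel_interior F \<subseteq> \<D>" and x: "x \<in> F"
    and T: "\<And>E. E \<in> \<G> \<Longrightarrow> continuous_on UNIV (T E)" "\<And>E. E \<in> \<G> \<Longrightarrow> AE x\<in>E in lebesgue. \<tau> x = T E x"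
  shows "normal_jump \<D> \<G> \<tau> F x = (T E1 x - T E2 x) *v \<nu>"
proof -
  have s': "E1 \<in> \<G>" "E2 \<in> \<G>" "E1 \<noteq> E2" "F = E1 \<inter> E2" "F facet_of E1" "F facet_of E2" "outer_normal E1 F = \<nu>" "outer_normal E2 F = - \<nu>"
    "\<And>E. E \<in> \<G> \<Longrightarrow> F \<subseteq> E \<Longrightarrow> E = E1 \<or> E = E2" using s unfolding side_config_def by auto
  have "{E. E \<in> \<G> \<and> F facet_of E} = {E1, E2}" using s'(1,2,5,6) s'(9) facet_of_imp_subset by blast
  moreover have "elem_trace E \<tau> x = T E x" if "E \<in> {E1, E2}" for E
    using that s'(1,2,4) x by (intro elem_trace_eq conforming_partitionD(2)[OF cp] T) auto
  ultimately show ?thesis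
    using s'(3,7,8) F matrix_vector_mult_scaleR[of "T E2 x" "-1" \<nu>] by (simp add: normal_jump_def matrix_vector_mult_diff_rdistrib)
qed

lemma Lp_bounded:
  assumes "S \<in> lmeasurable" "u \<in> meas_on S" "AE x\<in>S in lebesgue. norm (u x) \<le> C" "s \<ge> 0"
  shows "u \<in> Lp S s"
  unfolding Lp_def
proof (intro CollectI conjI assms(2) integrable_bounded_on[OF assms(1)])
  show "(\<lambda>x. norm (u x) powr s) \<in> meas_on S" using assms(2) by measurable
  show "AE x\<in>S in lebesgue. abs (norm (u x) powr s) \<le> C powr s"
    using assms(3) by eventually_elim (use assms(4) in \<open>auto intro!: powr_mono2\<close>)
qed

lemma Lp_dominated:
  fixes u :: "real^'d \<Rightarrow> 'b::euclidean_space" and k :: "real^'d \<Rightarrow> 'c::euclidean_space"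
  assumes S: "S \<in> lmeasurable" and u: "u \<in> meas_on S" and k: "k \<in> Lp S s" and s: "s > 0" and C: "C \<ge> 0"
    and le: "AE x\<in>S in lebesgue. norm (u x) \<le> C + norm (k x)"
  shows "u \<in> Lp S s"
  unfolding Lp_def
proof (intro CollectI conjI u)
  have So: "S \<in> sets lebesgue" using S by (simp add: fmeasurable_def)
  show "integrable (leb S) (\<lambda>x. norm (u x) powr s)"
  proof (rule Bochner_Integration.integrable_bound)
    have "integrable (leb S) (\<lambda>x. C powr s)" by (rule integrable_bounded_on[OF S, of _ "C powr s"]) auto
    then show "integrable (leb S) (\<lambda>x. 2 powr s * (C powr s + norm (k x) powr s))" using k by (simp add: Lp_def)
    show "(\<lambda>x. norm (u x) powr s) \<in> meas_on S" using u by measurable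
    show "AE x in leb S. norm (norm (u x) powr s) \<le> norm (2 powr s * (C powr s + norm (k x) powr s))"
      unfolding AE_lebesgue_on_iff[OF So] using le
    proof (eventually_elim, intro impI)
      fix x assume "x \<in> S \<longrightarrow> norm (u x) \<le> C + norm (k x)" "x \<in> S"
      then have "norm (u x) powr s \<le> (C + norm (k x)) powr s" using s by (intro powr_mono2) auto
      also have "\<dots> \<le> 2 powr s * (C powr s + norm (k x) powr s)" using s C by (intro powr_add_le) auto
      finally show "norm (norm (u x) powr s) \<le> norm (2 powr s * (C powr s + norm (k x) powr s))" by simp
    qed
  qed
qed

text \<open>A discrete solution reduced to what the estimate uses: element polynomials
  \<open>u\<close>, \<open>p\<close>, \<open>\<sigma>\<close> representing velocity, pressure and
  the projected stress \<open>Q\<close>, all of degree at most \<open>l\<close>, and integrability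
  of stress and force.\<close>

locale discrete_flow =
  fixes q :: real and l :: nat and \<D> :: "(real^'d) set" and \<G> :: "'d::finite mesh"
    and U :: "'d vfield" and P :: "'d sfield" and f :: "'d vfield" and S Q :: "'d tfield"
    and u :: "(real^'d) set \<Rightarrow> 'd vfield" and p :: "(real^'d) set \<Rightarrow> 'd sfield"
    and \<sigma> :: "(real^'d) set \<Rightarrow> 'd tfield"
  assumes q: "q > 1" and cp: "conforming_partition \<D> \<G>" and op: "open \<D>" and lm: "\<D> \<in> lmeasurable"
    and ic: "interior (closure \<D>) = \<D>"
    and U: "U \<in> W10_infty \<D>" and u: "\<And>E j. E \<in> \<G> \<Longrightarrow> polyd l (\<lambda>x. u E x $ j)" "\<And>E. E \<in> \<G> \<Longrightarrow> AE x\<in>E in lebesgue. U x = u E x"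
    and p: "\<And>E. E \<in> \<G> \<Longrightarrow> polyd l (p E)" "\<And>E. E \<in> \<G> \<Longrightarrow> AE x\<in>E in lebesgue. P x = p E x"
    and f: "f \<in> Lp \<D> q" and S: "S \<in> Lp \<D> q" "\<And>x. x \<in> \<D> \<Longrightarrow> S x \<in> sym_mats"
    and \<sigma>: "\<And>E i j. E \<in> \<G> \<Longrightarrow> polyd l (\<lambda>x. \<sigma> E x $ i $ j)" "\<And>E x. E \<in> \<G> \<Longrightarrow> \<sigma> E x \<in> sym_mats"
      "\<And>E. E \<in> \<G> \<Longrightarrow> AE x\<in>E in lebesgue. Q x = \<sigma> E x"
begin

definition T :: "(real^'d) set \<Rightarrow> 'd tfield" where
  "T E x = \<sigma> E x - p E x *\<^sub>R mat 1"

text \<open>The strong residual on an element with the force replaced by a polynomial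
  \<open>\<phi>\<close>, so that it is a polynomial; what is replaced goes into the error
  \<open>g \<phi>\<close>. Degrees double because convection is quadratic.\<close>

definition r :: "((real^'d) set \<Rightarrow> 'd vfield) \<Rightarrow> (real^'d) set \<Rightarrow> 'd vfield" where
  "r \<phi> E x = - cdiv_tensor (T E) x + cconv (u E) x - \<phi> E x"

lemma So: "\<D> \<in> sets lebesgue"
  using lm by (simp add: fmeasurable_def)

lemma elements: "E \<in> \<G> \<Longrightarrow> full_simplex E" "finite \<G>"
  using conforming_partitionD[OF cp] by auto

lemma T_poly:
  assumes E: "E \<in> \<G>"
  shows "polyd l (\<lambda>x. T E x $ i $ j)"
proof -
  have "polyd l (\<lambda>x. \<sigma> E x $ i $ j - mat 1 $ i $ j * p E x)" by (intro polyd_diff polyd_cmult \<sigma>(1)[OF E] p(1)[OF E])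
  then show ?thesis by (simp add: T_def mult.commute)
qed

lemma T_poly2: "E \<in> \<G> \<Longrightarrow> polyd (2 * l) (\<lambda>x. T E x $ i $ j)"
  by (rule polyd_mono[OF T_poly]) auto

lemma T_sym: "E \<in> \<G> \<Longrightarrow> T E x \<in> sym_mats"
  using \<sigma>(2)[of E x] by (auto simp: T_def sym_mats_def transpose_def vec_eq_iff mat_def)

lemma continuous_T: "E \<in> \<G> \<Longrightarrow> continuous_on UNIV (T E)"
  using T_poly by (auto intro!: continuous_on_vec_componentwise continuous_on_polyd)

lemma continuous_\<sigma>: "E \<in> \<G> \<Longrightarrow> continuous_on UNIV (\<sigma> E)"
  using \<sigma>(1) by (auto intro!: continuous_on_vec_componentwise continuous_on_polyd)

lemma r_poly:
  assumes E: "E \<in> \<G>" and \<phi>: "\<And>j. polyd (2 * l) (\<lambda>x. \<phi> E x $ j)"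
  shows "polyd (2 * l) (\<lambda>x. r \<phi> E x $ j)"
proof -
  have "polyd (2 * l) (\<lambda>x. cconv (u E) x $ j - \<phi> E x $ j - cdiv_tensor (T E) x $ j)"
    by (intro polyd_diff cconv_polyd u(1)[OF E] \<phi> cdiv_tensor_polyd T_poly2[OF E])
  then show ?thesis by (simp add: r_def algebra_simps)
qed

lemma cdiv_T:
  assumes E: "E \<in> \<G>"
  shows "cdiv_tensor (T E) x $ j = cdiv_tensor (\<sigma> E) x $ j - pd j (p E) x"
proof -
  have s: "smooth (\<lambda>x. \<sigma> E x $ i $ j)" "smooth (p E)" for i using \<sigma>(1)[OF E] p(1)[OF E] polyd_smooth by blast+
  have "pd i (\<lambda>y. T E y $ i $ j) x = pd i (\<lambda>y. \<sigma> E y $ i $ j) x - (if i = j then pd j (p E) x else 0)" for i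
  proof -
    have "pd i (\<lambda>y. \<sigma> E y $ i $ j + c * p E y) x = pd i (\<lambda>y. \<sigma> E y $ i $ j) x + c * pd i (p E) x" for c
      using s by (subst pd_add) (auto simp: pd_cmult smooth_differentiable smooth_mult smooth_const)
    from this[of "- mat 1 $ i $ j"]
    have "pd i (\<lambda>y. \<sigma> E y $ i $ j + (- mat 1 $ i $ j) * p E y) x = pd i (\<lambda>y. \<sigma> E y $ i $ j) x + (- mat 1 $ i $ j) * pd i (p E) x" .
    moreover have "(\<lambda>y. T E y $ i $ j) = (\<lambda>y. \<sigma> E y $ i $ j + (- mat 1 $ i $ j) * p E y)" by (auto simp: T_def)
    ultimately show ?thesis by (simp add: mat_def)
  qed
  then show ?thesis by (simp add: cdiv_tensor_def sum_subtractf)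
qed

lemma data_AE:
  "AE x\<in>\<D> in lebesgue. wgrad \<D> U x = pw \<G> (\<lambda>E. grad (u E)) x"
  "AE x\<in>\<D> in lebesgue. convection \<D> U x = pw \<G> (\<lambda>E. cconv (u E)) x"
  "AE x\<in>\<D> in lebesgue. P x = pw \<G> p x"
  "AE x\<in>\<D> in lebesgue. Q x = pw \<G> \<sigma> x" using velocity_on_element[OF op lm U elements(1) element_interior_subset[OF cp ic] u]
  by (auto intro!: AE_pw_eq[OF cp] p(2) \<sigma>(3))

lemma data_measurable:
  "wgrad \<D> U \<in> meas_on \<D>" "convection \<D> U \<in> meas_on \<D>"
  "P \<in> meas_on \<D>" "Q \<in> meas_on \<D>"
  and data_bounded: "\<exists>C. AE x\<in>\<D> in lebesgue. norm (convection \<D> U x) \<le> C"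
  "\<exists>C. AE x\<in>\<D> in lebesgue. norm (P x) \<le> C" "\<exists>C. AE x\<in>\<D> in lebesgue. norm (Q x) \<le> C"
  "\<exists>C. AE x\<in>\<D> in lebesgue. norm (wgrad \<D> U x) \<le> C"
proof -
  have c: "continuous_on UNIV (grad (u E))" "continuous_on UNIV (cconv (u E))" "continuous_on UNIV (p E)" if "E \<in> \<G>" for E
    using grad_polyd[OF u(1)[OF that]] cconv_polyd[OF u(1)[OF that]] p(1)[OF that]
    by (auto intro!: continuous_on_vec_componentwise continuous_on_polyd)
  have m: "v \<in> meas_on \<D> \<and> (\<exists>C. AE x\<in>\<D> in lebesgue. norm (v x) \<le> C)"
    if ae: "AE x\<in>\<D> in lebesgue. v x = pw \<G> k x" and k: "\<And>E. E \<in> \<G> \<Longrightarrow> continuous_on UNIV (k E)"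
    for v :: "real^'d \<Rightarrow> 'b::euclidean_space" and k
  proof
    show "v \<in> meas_on \<D>"
    proof (rule borel_measurable_lebesgue_on_AE[OF So])
      show "pw \<G> k \<in> meas_on \<D>" by (intro borel_measurable_lebesgue_onI pw_measurable k)
      show "AE x\<in>\<D> in lebesgue. pw \<G> k x = v x" using ae by eventually_elim auto
    qed
    obtain C where C: "\<And>x. norm (pw \<G> k x) \<le> C" using pw_bounded[of \<D> \<G> k, OF cp k] by blast
    show "\<exists>C. AE x\<in>\<D> in lebesgue. norm (v x) \<le> C" by (rule exI[of _ C]) (use ae in eventually_elim, use C in auto)
  qed
  note M = m[OF data_AE(1) c(1)] m[OF data_AE(2) c(2)] m[OF data_AE(3) c(3)] m[OF data_AE(4) continuous_\<sigma>]
  show "wgrad \<D> U \<in> meas_on \<D>" "convection \<D> U \<in> meas_on \<D>"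
    "P \<in> meas_on \<D>" "Q \<in> meas_on \<D>"
    "\<exists>C. AE x\<in>\<D> in lebesgue. norm (convection \<D> U x) \<le> C"
    "\<exists>C. AE x\<in>\<D> in lebesgue. norm (P x) \<le> C" "\<exists>C. AE x\<in>\<D> in lebesgue. norm (Q x) \<le> C"
    "\<exists>C. AE x\<in>\<D> in lebesgue. norm (wgrad \<D> U x) \<le> C" using M by blast+
qed

lemma LpD: "v \<in> Lp \<D> s \<Longrightarrow> v \<in> meas_on \<D>" "v \<in> Lp \<D> s \<Longrightarrow> integrable (leb \<D>) (\<lambda>x. norm (v x) powr s)"
  by (auto simp: Lp_def)

lemma Lp_1: "v \<in> Lp \<D> q \<Longrightarrow> integrable (leb \<D>) (\<lambda>x. norm (v x))"
  using Lp_mono[OF lm, of v q 1] q by (simp add: Lp_def)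

lemma data_Lp: "convection \<D> U \<in> Lp \<D> q" "P \<in> Lp \<D> q" "Q \<in> Lp \<D> q"
proof -
  obtain C1 C2 C3 where C: "AE x\<in>\<D> in lebesgue. norm (convection \<D> U x) \<le> C1"
    "AE x\<in>\<D> in lebesgue. norm (P x) \<le> C2" "AE x\<in>\<D> in lebesgue. norm (Q x) \<le> C3" using data_bounded by blast
  show "convection \<D> U \<in> Lp \<D> q" "P \<in> Lp \<D> q" "Q \<in> Lp \<D> q"
    using q Lp_bounded[OF lm data_measurable(2) C(1)] Lp_bounded[OF lm data_measurable(3) C(2)] Lp_bounded[OF lm data_measurable(4) C(3)]
    by auto
qed

lemma Lp_diff_bounded:
  fixes v k :: "real^'d \<Rightarrow> 'b::euclidean_space"
  assumes v: "v \<in> Lp \<D> q" and k: "k \<in> meas_on \<D>" "AE x\<in>\<D> in lebesgue. norm (k x) \<le> C"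
  shows "(\<lambda>x. v x - k x) \<in> Lp \<D> q"
proof (rule Lp_dominated[OF lm _ v, of _ "abs C"])
  show "(\<lambda>x. v x - k x) \<in> meas_on \<D>" using LpD(1)[OF v] k(1) by measurable
  show "AE x\<in>\<D> in lebesgue. norm (v x - k x) \<le> abs C + norm (v x)" using k(2)
  proof (eventually_elim, intro impI)
    fix x assume "x \<in> \<D> \<longrightarrow> norm (k x) \<le> C" "x \<in> \<D>"
    then show "norm (v x - k x) \<le> abs C + norm (v x)" using norm_triangle_ineq4[of "v x" "k x"] by simp
  qed
qed (use q in auto)

abbreviation s :: "real^'d \<Rightarrow> real^'d^'d" where
  "s \<equiv> \<lambda>x. S x - Q x"

abbreviation g :: "((real^'d) set \<Rightarrow> 'd vfield) \<Rightarrow> 'd vfield" where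
  "g \<phi> \<equiv> \<lambda>x. f x - pw \<G> \<phi> x"

abbreviation strong :: "(real^'d) set \<Rightarrow> 'd vfield" where
  "strong E \<equiv> \<lambda>x. - wdiv_tensor (interior E) Q x + convection (interior E) U x + wgrad_scalar (interior E) P x - f x"

abbreviation jump :: "(real^'d) set \<Rightarrow> 'd vfield" where
  "jump \<equiv> normal_jump \<D> \<G> (\<lambda>y. Q y - P y *\<^sub>R mat 1)"

abbreviation N :: real where
  "N \<equiv> dual_norm \<D> q (residual \<D> f U P S)"

section \<open>Splitting the force into a piecewise polynomial and a remainder\<close>

context
  fixes \<phi> :: "(real^'d) set \<Rightarrow> 'd vfield"
  assumes \<phi>: "\<And>E j. E \<in> \<G> \<Longrightarrow> polyd (2 * l) (\<lambda>x. \<phi> E x $ j)"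
begin

lemma continuous_\<phi>: "E \<in> \<G> \<Longrightarrow> continuous_on UNIV (\<phi> E)"
  using \<phi> by (auto intro!: continuous_on_vec_componentwise continuous_on_polyd)

lemma s_Lp: "s \<in> Lp \<D> q"
proof -
  obtain C where C: "AE x\<in>\<D> in lebesgue. norm (Q x) \<le> C" using data_bounded(3) by blast
  show ?thesis by (rule Lp_diff_bounded[OF S(1) data_measurable(4) C])
qed

lemma g_Lp: "g \<phi> \<in> Lp \<D> q"
proof -
  obtain C where C: "\<And>x. norm (pw \<G> \<phi> x) \<le> C" using pw_bounded[of \<D> \<G> \<phi>, OF cp continuous_\<phi>] by blast
  show ?thesis
    by (rule Lp_diff_bounded[OF f, of _ C]) (use C continuous_\<phi> in \<open>auto intro!: borel_measurable_lebesgue_onI pw_measurable\<close>)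
qed

lemma hg_integrable: "integrable (leb \<D>) (\<lambda>x. (hmesh \<G> x * norm (g \<phi> x)) powr q)"
proof -
  define h where "h = measure lebesgue (closure \<D>) powr (1 / real CARD('d))"
  show ?thesis
  proof (rule Bochner_Integration.integrable_bound)
    show "integrable (leb \<D>) (\<lambda>x. h powr q * norm (g \<phi> x) powr q)" using LpD(2)[OF g_Lp] by simp
    show "(\<lambda>x. (hmesh \<G> x * norm (g \<phi> x)) powr q) \<in> meas_on \<D>" using LpD(1)[OF g_Lp] hmesh_measurable[OF cp So] by measurable
    have "(hmesh \<G> x * norm (g \<phi> x)) powr q \<le> (h * norm (g \<phi> x)) powr q" for x
      using q hmesh_le[OF cp, of x] by (intro powr_mono2 mult_right_mono) (auto simp: h_def hmesh_def)
    then show "AE x in leb \<D>. norm ((hmesh \<G> x * norm (g \<phi> x)) powr q) \<le> norm (h powr q * norm (g \<phi> x) powr q)"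
      by (intro AE_I2) (simp add: h_def powr_mult)
  qed
qed

text \<open>On an element the stress splits into \<open>s\<close>, \<open>T\<close> and the pressure
  part; the divergence of \<open>T\<close> is subtracted in \<open>r\<close> and added back, and
  \<open>\<phi>\<close> cancels between \<open>r\<close> and \<open>g\<close>.\<close>

lemma wresidual_eq:
  assumes w: "vtest \<D> w"
  shows "wresidual \<D> \<G> T (r \<phi>) s (g \<phi>) w = cresidual \<D> f U P S w"
  unfolding wresidual_def cresidual_def
proof (rule integral_cong_AE)
  have cr: "continuous_on UNIV (r \<phi> E)" "continuous_on UNIV (cdiv_tensor (T E))" if "E \<in> \<G>" for E
    using r_poly[of _ \<phi>, OF that \<phi>[OF that]] cdiv_tensor_polyd[OF T_poly[OF that]]
    by (auto intro!: continuous_on_vec_componentwise continuous_on_polyd)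
  have m: "pw \<G> (r \<phi>) \<in> meas_on \<D>" "pw \<G> T \<in> meas_on \<D>"
    "pw \<G> (\<lambda>E. cdiv_tensor (T E)) \<in> meas_on \<D>"
    "w \<in> meas_on \<D>" "grad w \<in> meas_on \<D>"
    by (intro borel_measurable_lebesgue_onI pw_measurable cr continuous_T borel_measurable_continuous_onI
        smooth_vec_continuous grad_continuous vtest_smooth[OF w]; assumption)+
  note m' = LpD(1)[OF s_Lp] LpD(1)[OF g_Lp] LpD(1)[OF f] LpD(1)[OF S(1)] data_measurable(2,3)
  show "(\<lambda>x. s x \<bullet> grad w x + pw \<G> (r \<phi>) x \<bullet> w x - g \<phi> x \<bullet> w x + (pw \<G> T x \<bullet> grad w x + pw \<G> (\<lambda>E. cdiv_tensor (T E)) x \<bullet> w x))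
    \<in> meas_on \<D>" by (intro borel_measurable_add borel_measurable_diff borel_measurable_inner m m')
  show "(\<lambda>x. S x \<bullet> grad w x + convection \<D> U x \<bullet> w x - P x * (mat 1 \<bullet> grad w x) - f x \<bullet> w x) \<in> meas_on \<D>"
    by (intro borel_measurable_add borel_measurable_diff borel_measurable_inner borel_measurable_times m m' borel_measurable_const)
  show "AE x in leb \<D>. s x \<bullet> grad w x + pw \<G> (r \<phi>) x \<bullet> w x - g \<phi> x \<bullet> w x + (pw \<G> T x \<bullet> grad w x + pw \<G> (\<lambda>E. cdiv_tensor (T E)) x \<bullet> w x)
    = S x \<bullet> grad w x + convection \<D> U x \<bullet> w x - P x * (mat 1 \<bullet> grad w x) - f x \<bullet> w x"
    unfolding AE_lebesgue_on_iff[OF So] using AE_in_element[OF cp] data_AE(2-4)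
  proof (eventually_elim, intro impI)
    fix x assume x: "x \<in> \<D> \<longrightarrow> (\<exists>E\<in>\<G>. x \<in> interior E)" "x \<in> \<D>" and eq: "x \<in> \<D> \<longrightarrow> convection \<D> U x = pw \<G> (\<lambda>E. cconv (u E)) x"
      "x \<in> \<D> \<longrightarrow> P x = pw \<G> p x" "x \<in> \<D> \<longrightarrow> Q x = pw \<G> \<sigma> x"
    then obtain E where E: "E \<in> \<G>" "x \<in> interior E" by blast
    have eq': "convection \<D> U x = cconv (u E) x" "P x = p E x" "Q x = \<sigma> E x" using eq x pw_interior[OF cp E] by auto
    show "s x \<bullet> grad w x + pw \<G> (r \<phi>) x \<bullet> w x - g \<phi> x \<bullet> w x + (pw \<G> T x \<bullet> grad w x + pw \<G> (\<lambda>E. cdiv_tensor (T E)) x \<bullet> w x)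
      = S x \<bullet> grad w x + convection \<D> U x \<bullet> w x - P x * (mat 1 \<bullet> grad w x) - f x \<bullet> w x"
      unfolding eq' pw_interior[OF cp E] r_def T_def by (simp add: inner_diff_left inner_add_left)
  qed
qed

lemma dual_norm_bound:
  assumes w: "vtest \<D> w" and B: "B > 0"
    "(LINT x|leb \<D>. norm (w x) powr conj_exp q) + (LINT x|leb \<D>. norm (grad w x) powr conj_exp q) \<le> B powr conj_exp q"
  shows "wresidual \<D> \<G> T (r \<phi>) s (g \<phi>) w \<le> N * B" "N \<ge> 0"
proof -
  have P: "integrable (leb \<D>) (\<lambda>x. abs (real CARD('d) * P x) powr q)"
    using LpD(2)[OF data_Lp(2)] by (simp add: abs_mult powr_mult)
  note D = dual_norm_test[OF op lm q LpD(2)[OF S(1)] LpD(2)[OF data_Lp(1)] P LpD(2)[OF f] LpD(1)[OF S(1)] S(2)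
    data_measurable(2,3) LpD(1)[OF f] w B]
  show "wresidual \<D> \<G> T (r \<phi>) s (g \<phi>) w \<le> N * B" unfolding wresidual_eq[OF w] by (rule D(1))
  show "N \<ge> 0" by (rule D(2))
qed

lemma dual_norm_nonneg: "N \<ge> 0"
proof -
  have "vtest \<D> (\<lambda>x. 0)" unfolding vtest_def by (auto intro!: smooth_const exI[of _ "{}"])
  moreover have "grad (\<lambda>x. 0) = (\<lambda>x. 0 :: real^'d^'d)" by (simp add: fun_eq_iff grad_def vec_eq_iff pd_eq[OF has_derivative_const])
  ultimately show ?thesis by (intro dual_norm_bound(2)[where w = "\<lambda>x. 0" and B = 1]) auto
qed

lemma residual_data:
  assumes "c \<ge> 0" "D \<ge> 0" "\<D> \<subseteq> cball 0 D" "shape_regular \<kappa> \<G>" and K: "K = 16 * side_ratio \<kappa> + 1"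
    and "\<And>\<rho> \<rho>' z z' (p :: real^'d \<Rightarrow> real^'d). \<rho> > 0 \<Longrightarrow> \<rho>' > 0 \<Longrightarrow> \<rho> \<le> 2 * \<rho>' \<Longrightarrow> cball z (2 * \<rho>) \<subseteq> cball z' (K * \<rho>') \<Longrightarrow>
      (\<And>j. polyd (2 * l) (\<lambda>x. p x $ j)) \<Longrightarrow> bubble_estimate q K c \<rho> \<rho>' z z' p"
  shows "residual_data q (2 * l) \<kappa> K c D \<D> \<G> T (r \<phi>) s (g \<phi>) N"
  by (unfold residual_data_def, intro conjI allI impI assms dual_norm_bound(1))
    (use K assms(3,4) q cp op lm ic T_poly2 T_sym r_poly \<phi> LpD[OF s_Lp] Lp_1[OF s_Lp] LpD[OF g_Lp] Lp_1[OF g_Lp] hg_integrable dual_norm_nonneg in auto)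

text \<open>The strong residual equals \<open>r \<phi> E\<close> minus the force remainder; the
  factor \<open>2 powr q\<close> comes from separating the two.\<close>

lemma element_terms:
  assumes int: "integrable (leb \<D>) (\<lambda>x. (hmesh \<G> x * norm (pw \<G> (r \<phi>) x)) powr q)"
  shows "(\<Sum>E\<in>\<G>. Lnorm E q (\<lambda>x. hmesh \<G> x *\<^sub>R strong E x) powr q)
    \<le> 2 powr q * ((LINT x|leb \<D>. (hmesh \<G> x * norm (pw \<G> (r \<phi>) x)) powr q) + (LINT x|leb \<D>. (hmesh \<G> x * norm (g \<phi> x)) powr q))"
proof -
  define \<psi> where "\<psi> x = 2 powr q * ((hmesh \<G> x * norm (pw \<G> (r \<phi>) x)) powr q + (hmesh \<G> x * norm (g \<phi> x)) powr q)" for x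
  have int\<psi>: "integrable (leb \<D>) \<psi>" unfolding \<psi>_def[abs_def] using int hg_integrable by simp
  note sum = element_integral_sum[OF cp So ic int\<psi>]
  have "Lnorm E q (\<lambda>x. hmesh \<G> x *\<^sub>R strong E x) powr q \<le> (LINT x|leb E. \<psi> x)" if E: "E \<in> \<G>" for E
  proof -
    note fs = elements(1)[OF E]
    have q0: "q > 0" using q by simp
    have c1: "AE x in lebesgue. \<forall>i j. x \<in> E \<longrightarrow> wpd (interior E) i (\<lambda>y. Q y $ i $ j) x = pd i (\<lambda>y. \<sigma> E y $ i $ j) x"
    proof (intro AE_all_finite)
      fix i j
      have "AE x\<in>E in lebesgue. Q x $ i $ j = \<sigma> E x $ i $ j" using \<sigma>(3)[OF E] by eventually_elim auto
      then show "AE x\<in>E in lebesgue. wpd (interior E) i (\<lambda>y. Q y $ i $ j) x = pd i (\<lambda>y. \<sigma> E y $ i $ j) x"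
        by (rule wpd_interior_polynomial_AE[OF fs _ polyd_smooth[OF \<sigma>(1)[OF E]]])
    qed
    have c2: "AE x in lebesgue. \<forall>j. x \<in> E \<longrightarrow> wpd (interior E) j P x = pd j (p E) x"
      by (intro AE_all_finite wpd_interior_polynomial_AE[OF fs p(2)[OF E] polyd_smooth[OF p(1)[OF E]]])
    have c3: "AE x\<in>E in lebesgue. convection (interior E) U x = cconv (u E) x"
      by (rule velocity_on_element(3)[OF op lm U fs element_interior_subset[OF cp ic E] u(1)[OF E] u(2)[OF E]])
    show ?thesis unfolding Lnorm_powr[OF q0]
    proof (rule integral_le_of_bound[OF sum(1)[OF E]])
      show "AE x in leb E. 0 \<le> norm (hmesh \<G> x *\<^sub>R strong E x) powr q \<and> norm (hmesh \<G> x *\<^sub>R strong E x) powr q \<le> \<psi> x"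
        unfolding AE_lebesgue_on_iff[OF full_simplex_basics(8)[OF fs]]
        using c1 c2 c3 AE_interior_element[OF fs]
      proof (eventually_elim, intro impI conjI)
        fix x assume x: "x \<in> E" "x \<in> E \<longrightarrow> x \<in> interior E" and ae: "\<forall>i j. x \<in> E \<longrightarrow> wpd (interior E) i (\<lambda>y. Q y $ i $ j) x = pd i (\<lambda>y. \<sigma> E y $ i $ j) x"
          "\<forall>j. x \<in> E \<longrightarrow> wpd (interior E) j P x = pd j (p E) x" "x \<in> E \<longrightarrow> convection (interior E) U x = cconv (u E) x"
        have xi: "x \<in> interior E" using x by blast
        have "strong E x = r \<phi> E x - (f x - \<phi> E x)"
          using ae x cdiv_T[OF E, of x] by (simp add: vec_eq_iff wdiv_tensor_def wgrad_scalar_def r_def cdiv_tensor_def)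
        then have "norm (hmesh \<G> x *\<^sub>R strong E x)
          \<le> hmesh \<G> x * norm (pw \<G> (r \<phi>) x) + hmesh \<G> x * norm (g \<phi> x)"
          unfolding pw_interior[OF cp E xi] norm_scaleR using mult_left_mono[OF norm_triangle_ineq4[of "r \<phi> E x" "f x - \<phi> E x"], of "hmesh \<G> x"]
          by (simp only:) (simp add: hmesh_def distrib_left)
        then have "norm (hmesh \<G> x *\<^sub>R strong E x) powr q
          \<le> (hmesh \<G> x * norm (pw \<G> (r \<phi>) x) + hmesh \<G> x * norm (g \<phi> x)) powr q" using q by (intro powr_mono2) auto
        also have "\<dots> \<le> \<psi> x" unfolding \<psi>_def using q by (intro powr_add_le) (auto simp: hmesh_def)
        finally show "norm (hmesh \<G> x *\<^sub>R strong E x) powr q \<le> \<psi> x" .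
      qed simp
    qed
  qed
  then have "(\<Sum>E\<in>\<G>. Lnorm E q (\<lambda>x. hmesh \<G> x *\<^sub>R strong E x) powr q) \<le> (\<Sum>E\<in>\<G>. LINT x|leb E. \<psi> x)" by (intro sum_mono)
  also have "\<dots> = (LINT x|leb \<D>. \<psi> x)" by (rule sum(2))
  finally show ?thesis using int hg_integrable by (simp add: \<psi>_def distrib_left)
qed

lemma oscillation_terms:
  "(\<Sum>E\<in>\<G>. Lnorm E q s powr q) = (LINT x|leb \<D>. norm (s x) powr q)"
  "(\<Sum>E\<in>\<G>. Lnorm E q (\<lambda>x. hmesh \<G> x *\<^sub>R (f x - \<phi> E x)) powr q) = (LINT x|leb \<D>. (hmesh \<G> x * norm (g \<phi> x)) powr q)"
proof -
  have q0: "q > 0" using q by simp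
  show "(\<Sum>E\<in>\<G>. Lnorm E q s powr q) = (LINT x|leb \<D>. norm (s x) powr q)"
    unfolding Lnorm_powr[OF q0] by (rule element_integral_sum(2)[OF cp So ic LpD(2)[OF s_Lp]])
  note es = element_integral_sum[OF cp So ic hg_integrable]
  have "Lnorm E q (\<lambda>x. hmesh \<G> x *\<^sub>R (f x - \<phi> E x)) powr q = (LINT x|leb E. (hmesh \<G> x * norm (g \<phi> x)) powr q)" if E: "E \<in> \<G>" for E
    unfolding Lnorm_powr[OF q0]
  proof (rule integral_cong_AE)
    note fs = elements(1)[OF E] and sE = full_simplex_basics(8)[OF elements(1)[OF E]]
    have ae: "AE x\<in>E in lebesgue. (hmesh \<G> x * norm (g \<phi> x)) powr q = norm (hmesh \<G> x *\<^sub>R (f x - \<phi> E x)) powr q"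
      using AE_interior_element[OF fs] by eventually_elim (auto simp: pw_interior[OF cp E] hmesh_def)
    show "(\<lambda>x. (hmesh \<G> x * norm (g \<phi> x)) powr q) \<in> meas_on E" by (rule borel_measurable_integrable[OF es(1)[OF E]])
    then show "(\<lambda>x. norm (hmesh \<G> x *\<^sub>R (f x - \<phi> E x)) powr q) \<in> meas_on E" by (rule borel_measurable_lebesgue_on_AE[OF sE _ ae])
    show "AE x in leb E. norm (hmesh \<G> x *\<^sub>R (f x - \<phi> E x)) powr q = (hmesh \<G> x * norm (g \<phi> x)) powr q"
      unfolding AE_lebesgue_on_iff[OF sE] using ae by eventually_elim auto
  qed
  then show "(\<Sum>E\<in>\<G>. Lnorm E q (\<lambda>x. hmesh \<G> x *\<^sub>R (f x - \<phi> E x)) powr q) = (LINT x|leb \<D>. (hmesh \<G> x * norm (g \<phi> x)) powr q)"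
    using es(2) by simp
qed

end

text \<open>The exponent \<open>1 / q\<close> on the mesh size becomes one under the outer power
  \<open>q\<close>, and the root in \<open>boundary_norm\<close> is undone because the sum is
  nonnegative.\<close>

lemma side_terms:
  "(\<Sum>E\<in>\<G>. boundary_norm E q (\<lambda>F x. hmesh \<G> x powr (1 / q) *\<^sub>R jump F x) powr q)
   = (\<Sum>E\<in>\<G>. \<Sum>F | F facet_of E. LINT x:F|facet_measure E F. hmesh \<G> x * norm (jump F x) powr q)"
proof (rule sum.cong[OF refl])
  fix E
  have e: "norm (hmesh \<G> x powr (1 / q) *\<^sub>R v) powr q = hmesh \<G> x * norm v powr q" for x and v :: "real^'d"
    using q by (simp add: powr_mult powr_powr hmesh_def)
  have "(\<Sum>F | F facet_of E. LINT x:F|facet_measure E F. hmesh \<G> x * norm (jump F x) powr q) \<ge> 0"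
    by (intro sum_nonneg) (auto simp: set_lebesgue_integral_def hmesh_def intro!: integral_nonneg)
  then show "boundary_norm E q (\<lambda>F x. hmesh \<G> x powr (1 / q) *\<^sub>R jump F x) powr q
    = (\<Sum>F | F facet_of E. LINT x:F|facet_measure E F. hmesh \<G> x * norm (jump F x) powr q)"
    using q unfolding boundary_norm_def e by (simp add: powr_powr)
qed

lemma jump_side:
  assumes "rel_interior F \<subseteq> \<D>" "side_config K \<G> F E1 E2 \<nu> b y \<rho>" "x \<in> F"
  shows "jump F x = (T E1 x - T E2 x) *v \<nu>"
proof (rule normal_jump_side[OF cp assms(2,1,3) continuous_T])
  fix E assume E: "E \<in> \<G>"
  show "AE x\<in>E in lebesgue. Q x - P x *\<^sub>R mat 1 = T E x" using \<sigma>(3)[OF E] p(2)[OF E] by eventually_elim (auto simp: T_def)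
qed

end

lemma linear_component: "linear (\<lambda>v :: real^'n. v $ j)" "linear (\<lambda>A :: real^'n^'m. A $ i $ k)"
  by (auto intro!: linearI)

lemma sgrad_sym: "sgrad \<D> U x \<in> sym_mats"
  by (simp add: sgrad_def sym_mats_def transpose_def vec_eq_iff)

lemma zero_sym: "0 \<in> sym_mats"
  by (simp add: sym_mats_def transpose_def vec_eq_iff)

text \<open>Besides collecting polynomial representatives, this has to place the stress in
  \<open>Lp \<D> q\<close>: it is measurable as a Caratheodory composition and bounded by a constant
  plus the growth function, as the gradient of \<open>U\<close> is essentially bounded. Then
  \<open>q \<le> conj_exp r\<close> applies.\<close>

lemma discrete_flow_exists:
  fixes \<D> :: "(real^'d) set" and \<G> :: "'d::finite mesh" and n :: nat
  assumes d: "CARD('d) = 2 \<or> CARD('d) = 3" and dom: "polyhedral_lipschitz_domain \<D>" and ref: "reference_spaces PV PQ l j"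
    and disc: "discretization \<D> PV PQ l J c1 Pr cP IQ cQ \<G>0 refine VV QQ F" and adm: "admissible_exps (real CARD('d)) r t q"
    and f: "f \<in> Lp \<D> (conj_exp r)" and SM: "stress_maps \<D> r S" and \<G>: "\<G> \<in> meshes \<G>0 refine"
    and U: "U \<in> FE_V \<D> VV PV F \<G>" and P: "P \<in> FE_Q QQ PQ F \<G>"
  defines "SU \<equiv> \<lambda>x. S n x (sgrad \<D> U x)"
  shows "\<exists>u p \<sigma>. discrete_flow q l \<D> \<G> U P f SU (Pr \<G> SU) u p \<sigma>"
proof -
  have q: "q > 1" and r: "r > 1" and qr: "q \<le> conj_exp r" using admissible_exps_bounds[OF adm] d by auto
  have op: "open \<D>" and bd: "bounded \<D>" and ic: "interior (closure \<D>) = \<D>"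
    using dom interior_closure_lipschitz by (auto simp: polyhedral_lipschitz_domain_def)
  have lm: "\<D> \<in> lmeasurable" by (rule lmeasurable_open[OF bd op])
  have So: "\<D> \<in> sets lebesgue" using lm by (simp add: fmeasurable_def)
  have cp0: "conforming_partition \<D> \<G>0" "refine_routine \<D> \<G>0 refine" and aff: "\<And>E. E \<in> \<G> \<Longrightarrow> affine_bijection (F E) E ref_simplex"
    and VV: "VV \<subseteq> W10_infty \<D>" and pr: "local_L1_projection \<D> (meshes \<G>0 refine) (L1_sym \<D>) (\<lambda>\<G>. piecewise_polys (l - 1) \<G> sym_mats) Pr cP"
    using disc \<G> unfolding discretization_def by blast+
  have cp: "conforming_partition \<D> \<G>" by (rule meshes_conforming[OF cp0 \<G>])
  note fs = conforming_partitionD(2)[OF cp]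
  have lin: "\<exists>A b. linear A \<and> F E = (\<lambda>x. A x + b)" if "E \<in> \<G>" for E using aff[OF that] by (auto simp: affine_bijection_def)
  have PV: "PV \<subseteq> polys l" "PQ \<subseteq> polys j" "j \<le> l" using ref by (auto simp: reference_spaces_def)
  have U': "U \<in> W10_infty \<D>" "U \<in> piecewise PV F \<G>" using U VV by (auto simp: FE_V_def)
  have P': "P \<in> piecewise PQ F \<G>" using P by (auto simp: FE_Q_def)
  have "\<forall>E\<in>\<G>. \<exists>u. (\<forall>T. linear T \<longrightarrow> polyd l (\<lambda>x. T (u x) :: real)) \<and> (AE x\<in>E in lebesgue. U x = u x)"
    using piecewise_polynomial[OF U'(2) PV(1) _ fs lin] by blast
  then obtain u where u: "\<And>E T. E \<in> \<G> \<Longrightarrow> linear T \<Longrightarrow> polyd l (\<lambda>x. T (u E x) :: real)" "\<And>E. E \<in> \<G> \<Longrightarrow> AE x\<in>E in lebesgue. U x = u E x"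
    by (auto dest!: bchoice)
  have "\<forall>E\<in>\<G>. \<exists>p. (\<forall>T. linear T \<longrightarrow> polyd j (\<lambda>x. T (p x) :: real)) \<and> (AE x\<in>E in lebesgue. P x = p x)"
    using piecewise_polynomial[OF P' PV(2) _ fs lin] by blast
  then obtain p where p: "\<And>E T. E \<in> \<G> \<Longrightarrow> linear T \<Longrightarrow> polyd j (\<lambda>x. T (p E x :: real) :: real)" "\<And>E. E \<in> \<G> \<Longrightarrow> AE x\<in>E in lebesgue. P x = p E x"
    by (auto dest!: bchoice)
  have p': "polyd l (p E)" if "E \<in> \<G>" for E using polyd_mono[OF p(1)[OF that linear_ident] PV(3)] .
  have fq: "f \<in> Lp \<D> q" using Lp_mono[OF lm f _ qr] q by simp
  have Lp0: "(\<lambda>x. 0) \<in> Lp \<D> q" using q by (auto simp: Lp_def)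
  \<comment> \<open>An auxiliary flow with zero stress makes the facts about \<open>U\<close>
    available, in particular measurability and boundedness of its gradient, before integrability of
    the true stress is known.\<close>
  have "discrete_flow q l \<D> \<G> U P f (\<lambda>x. 0) (\<lambda>x. 0) u p (\<lambda>E x. 0)"
    by unfold_locales (use q cp op lm ic U' u(1)[OF _ linear_component(1)] u(2) p' p(2) fq Lp0 zero_sym in \<open>auto intro: polyd_const\<close>)
  then interpret flow0: discrete_flow q l \<D> \<G> U P f "\<lambda>x. 0" "\<lambda>x. 0" u p "\<lambda>E x. 0" .
  obtain C where C: "AE x\<in>\<D> in lebesgue. norm (wgrad \<D> U x) \<le> C" using flow0.data_bounded(4) by blast
  have S: "\<And>x \<delta>. x \<in> \<D> \<Longrightarrow> \<delta> \<in> sym_mats \<Longrightarrow> S n x \<delta> \<in> sym_mats"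
    "\<And>\<delta>. \<delta> \<in> sym_mats \<Longrightarrow> (\<lambda>x. S n x \<delta>) \<in> meas_on \<D>"
    "AE x\<in>\<D> in lebesgue. continuous_on sym_mats (S n x)" using SM unfolding stress_maps_def AE_lebesgue_on_iff[OF So] by blast+
  obtain a1 k where k: "a1 > 0" "k \<in> Lp \<D> (conj_exp r)"
    "\<forall>n. AE x\<in>\<D> in lebesgue. (\<forall>\<delta>\<in>sym_mats. norm (S n x \<delta>) \<le> a1 * norm \<delta> powr (r - 1) + k x)"
  proof -
    obtain a1 a2 m k where *: "a1 > 0" "k \<in> Lp \<D> (conj_exp r)" "\<forall>n. AE x in leb \<D>. \<forall>\<delta> \<in> sym_mats.
           norm (S n x \<delta>) \<le> a1 * norm \<delta> powr (r - 1) + k x \<and>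
           S n x \<delta> \<bullet> \<delta> \<ge> a2 * norm \<delta> powr r - m x" using SM unfolding stress_maps_def by blast
    have "AE x\<in>\<D> in lebesgue. (\<forall>\<delta>\<in>sym_mats. norm (S n x \<delta>) \<le> a1 * norm \<delta> powr (r - 1) + k x)" for n
      using *(3)[rule_format, of n] unfolding AE_lebesgue_on_iff[OF So] by eventually_elim blast
    then show ?thesis using that *(1,2) by blast
  qed
  have sm: "sgrad \<D> U \<in> meas_on \<D>"
  proof -
    have "(\<lambda>x. transpose (wgrad \<D> U x)) \<in> meas_on \<D>"
    proof (intro borel_measurable_vec)
      fix i j
      have "(\<lambda>x. wgrad \<D> U x \<bullet> axis j (axis i 1)) \<in> meas_on \<D>" using flow0.data_measurable(1) by measurable
      then show "(\<lambda>x. transpose (wgrad \<D> U x) $ i $ j) \<in> meas_on \<D>" by (simp add: inner_axis transpose_def)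
    qed
    then show ?thesis using flow0.data_measurable(1) unfolding sgrad_def[abs_def] by measurable
  qed
  have SUm: "SU \<in> meas_on \<D>" unfolding SU_def by (rule caratheodory_measurable[OF So sm sgrad_sym S(2,3)])
  have SUr: "SU \<in> Lp \<D> (conj_exp r)"
  proof (rule Lp_dominated[OF lm SUm k(2), of "a1 * abs C powr (r - 1)"])
    show "AE x\<in>\<D> in lebesgue. norm (SU x) \<le> a1 * abs C powr (r - 1) + norm (k x)" using C k(3)[rule_format, of n]
    proof (eventually_elim, intro impI)
      fix x assume x: "x \<in> \<D> \<longrightarrow> norm (wgrad \<D> U x) \<le> C" "x \<in> \<D>" and b: "x \<in> \<D> \<longrightarrow> (\<forall>\<delta>\<in>sym_mats. norm (S n x \<delta>) \<le> a1 * norm \<delta> powr (r - 1) + k x)"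
      have "norm (SU x) \<le> a1 * norm (sgrad \<D> U x) powr (r - 1) + k x" using b x(2) sgrad_sym unfolding SU_def by blast
      also have "\<dots> \<le> a1 * abs C powr (r - 1) + norm (k x)"
        using sgrad_le[of \<D> U x] x r k(1) by (intro add_mono mult_left_mono powr_mono2) auto
      finally show "norm (SU x) \<le> a1 * abs C powr (r - 1) + norm (k x)" .
    qed
  qed (use k(1) conj_exp_gt_1[OF r] in auto)
  have SUq: "SU \<in> Lp \<D> q" "SU \<in> Lp \<D> 1" using Lp_mono[OF lm SUr] qr q by auto
  have SUsym: "x \<in> \<D> \<Longrightarrow> SU x \<in> sym_mats" for x unfolding SU_def using S(1) sgrad_sym by blast
  have "SU \<in> L1_sym \<D>" unfolding L1_sym_def AE_lebesgue_on_iff[OF So] using SUq(2) SUsym by auto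
  then have "Pr \<G> SU \<in> piecewise_polys (l - 1) \<G> sym_mats"
    using pr \<G> by (auto simp: local_L1_projection_def linear_projection_def)
  then have "\<forall>E\<in>\<G>. \<exists>\<sigma>. \<sigma> \<in> polys (l - 1) \<and> range \<sigma> \<subseteq> sym_mats \<and> (AE x\<in>E in lebesgue. Pr \<G> SU x = \<sigma> x)"
    unfolding piecewise_polys_def piecewise_def using AE_lebesgue_on_iff[OF full_simplex_basics(8)[OF fs]] by auto
  then obtain \<sigma> where \<sigma>: "\<And>E. E \<in> \<G> \<Longrightarrow> \<sigma> E \<in> polys (l - 1)" "\<And>E. E \<in> \<G> \<Longrightarrow> range (\<sigma> E) \<subseteq> sym_mats"
    "\<And>E. E \<in> \<G> \<Longrightarrow> AE x\<in>E in lebesgue. Pr \<G> SU x = \<sigma> E x" by (auto dest!: bchoice)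
  have \<sigma>': "polyd l (\<lambda>x. \<sigma> E x $ i $ k)" if "E \<in> \<G>" for E i k
    by (rule polyd_mono[OF polys_imp_polyd[OF \<sigma>(1)[OF that] linear_component(2)]]) simp
  have \<sigma>s: "\<sigma> E x \<in> sym_mats" if "E \<in> \<G>" for E x using \<sigma>(2)[OF that] by blast
  have "discrete_flow q l \<D> \<G> U P f SU (Pr \<G> SU) u p \<sigma>"
    by unfold_locales (use q cp op lm ic U' u(1)[OF _ linear_component(1)] u(2) p' p(2) fq SUq(1) SUsym \<sigma>' \<sigma>s \<sigma>(3) in auto)
  then show ?thesis by blast
qed

section \<open>Oscillation and the global bound\<close>

abbreviation osc_term :: "'d mesh \<Rightarrow> 'd vfield \<Rightarrow> real \<Rightarrow> (real^'d) set \<Rightarrow> 'd vfield \<Rightarrow> real" where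
  "osc_term \<G> f q E \<phi> \<equiv> Lnorm E q (\<lambda>x. hmesh \<G> x *\<^sub>R (f x - \<phi> x)) powr q"

text \<open>Approaching the infimum up to \<open>\<delta>\<close> replaces a proof that a best
  approximation exists.\<close>

lemma osc_summand:
  fixes f :: "real^'d \<Rightarrow> real^'d"
  assumes "\<delta> > 0"
  shows "\<exists>\<phi>\<in>polys m. osc_term \<G> f q E \<phi>
      \<le> (INF \<phi>\<in>polys m. osc_term \<G> f q E \<phi>) + \<delta>"
    "(INF \<phi>\<in>polys m. osc_term \<G> f q E \<phi>) \<ge> 0"
proof -
  let ?X = "(\<lambda>\<phi>. osc_term \<G> f q E \<phi>) ` polys m"
  have ne: "?X \<noteq> {}" by (auto simp: polys_def)
  show "(INF \<phi>\<in>polys m. osc_term \<G> f q E \<phi>) \<ge> 0" by (rule cInf_greatest[OF ne]) auto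
  have "Inf ?X < Inf ?X + \<delta>" using assms by simp
  from cInf_lessD[OF ne this] obtain \<phi> where "\<phi> \<in> polys m" "osc_term \<G> f q E \<phi> < Inf ?X + \<delta>" by blast
  then show "\<exists>\<phi>\<in>polys m. osc_term \<G> f q E \<phi>
      \<le> (INF \<phi>\<in>polys m. osc_term \<G> f q E \<phi>) + \<delta>" by (intro bexI[of _ \<phi>]) auto
qed

lemma osc_nonneg: "osc \<G> f q l S Q \<ge> 0"
  unfolding osc_def by (intro sum_nonneg add_nonneg_nonneg osc_summand(2)[of 1]) auto

lemma osc_approx:
  fixes f :: "real^'d \<Rightarrow> real^'d"
  assumes "\<delta> > 0"
  shows "\<exists>\<phi>. (\<forall>E\<in>\<G>. \<phi> E \<in> polys (2 * l - 1)) \<and>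
    (\<Sum>E\<in>\<G>. osc_term \<G> f q E (\<phi> E)) + (\<Sum>E\<in>\<G>. Lnorm E q (\<lambda>x. S x - Q x) powr q) \<le> osc \<G> f q l S Q + real (card \<G>) * \<delta>"
proof -
  have *: "\<forall>E. \<exists>\<phi>. \<phi> \<in> polys (2 * l - 1) \<and> osc_term \<G> f q E \<phi>
      \<le> (INF \<phi>\<in>polys (2 * l - 1). osc_term \<G> f q E \<phi>) + \<delta>" using osc_summand(1)[OF assms] by blast
  from choice[OF *] obtain \<phi> where \<phi>: "\<And>E. \<phi> E \<in> polys (2 * l - 1)"
    "\<And>E. osc_term \<G> f q E (\<phi> E)
      \<le> (INF \<phi>\<in>polys (2 * l - 1). osc_term \<G> f q E \<phi>) + \<delta>" by blast
  have "(\<Sum>E\<in>\<G>. osc_term \<G> f q E (\<phi> E))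
    \<le> (\<Sum>E\<in>\<G>. (INF \<phi>\<in>polys (2 * l - 1). osc_term \<G> f q E \<phi>) + \<delta>)" by (intro sum_mono \<phi>)
  then have "(\<Sum>E\<in>\<G>. osc_term \<G> f q E (\<phi> E)) + (\<Sum>E\<in>\<G>. Lnorm E q (\<lambda>x. S x - Q x) powr q) \<le> osc \<G> f q l S Q + real (card \<G>) * \<delta>"
    by (simp add: osc_def sum.distrib)
  then show ?thesis using \<phi>(1) by blast
qed

text \<open>The constant is fixed before domain and mesh; it depends on \<open>q\<close>,
  \<open>l\<close>, \<open>\<kappa>\<close>, \<open>D\<close> and the dimension. The slack
  \<open>\<delta>\<close> per element adds up to a multiple of the number of elements, but for a
  given mesh it is sent to zero without touching the constant.\<close>

lemma indicator_estimate:
  assumes q: "q > 1" and d: "2 \<le> CARD('d::finite)" and D0: "D \<ge> 0"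
  shows "\<exists>C>0. \<forall>(\<D> :: (real^'d::finite) set) \<G> U P f S Q u p \<sigma>. discrete_flow q l \<D> \<G> U P f S Q u p \<sigma> \<longrightarrow>
    \<D> \<subseteq> cball 0 D \<longrightarrow> shape_regular \<kappa> \<G> \<longrightarrow>
    (\<Sum>E\<in>\<G>. indicator_pde \<D> \<G> f q U P S Q E) \<le> C * (dual_norm \<D> q (residual \<D> f U P S) powr q + osc \<G> f q l S Q)"
proof -
  define K where "K = 16 * side_ratio \<kappa> + 1"
  obtain c where c: "c \<ge> 0" and bubble: "\<forall>q \<rho> z (p :: 'd vfield) z' \<rho>'. \<rho> > 0 \<longrightarrow> \<rho>' > 0 \<longrightarrow> \<rho> \<le> 2 * \<rho>' \<longrightarrow> cball z (2 * \<rho>) \<subseteq> cball z' (K * \<rho>') \<longrightarrow>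
     (\<forall>j. polyd (2 * l) (\<lambda>x. p x $ j)) \<longrightarrow> bubble_estimate q K c \<rho> \<rho>' z z' p" using bubble_bounds_polynomial by blast
  \<comment> \<open>Absolute values make both constants nonnegative without inspecting their
    formulas.\<close>
  define K1 where "K1 = abs (element_const CARD('d) q K c D)"
  define K2 where "K2 = abs (jump_const CARD('d) q \<kappa> c D)"
  have K1: "K1 \<ge> 0" and K2: "K2 \<ge> 0" by (simp_all add: K1_def K2_def)
  define a where "a = (2::real) powr q"
  have a: "a \<ge> 1" using q by (simp add: a_def ge_one_powr_ge_zero)
  \<comment> \<open>One summand for each part of the indicator: element residuals, jumps, and the
    stress oscillation with constant one. The jumps inherit the bound for the element
    residuals.\<close>
  define C where "C = a * (K1 + 1) + K2 * (1 + a * (1 + K1)) + 1"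
  have C: "C \<ge> 1" using a K1 K2 by (simp add: C_def)
  show ?thesis
  proof (rule exI[of _ C], intro conjI allI impI)
    show "C > 0" using C by simp
    fix \<D> :: "(real^'d) set" and \<G> U P f S Q u p \<sigma>
    assume flow: "discrete_flow q l \<D> \<G> U P f S Q u p \<sigma>" and D: "\<D> \<subseteq> cball 0 D" and sr: "shape_regular \<kappa> \<G>"
    interpret discrete_flow q l \<D> \<G> U P f S Q u p \<sigma> by (rule flow)
    define O' where "O' = osc \<G> f q l S Q"
    have est: "(\<Sum>E\<in>\<G>. indicator_pde \<D> \<G> f q U P S Q E) \<le> C * (N powr q + (O' + real (card \<G>) * \<delta>))" if \<delta>: "\<delta> > 0" for \<delta>
    proof -
      obtain \<phi> where \<phi>: "\<forall>E\<in>\<G>. \<phi> E \<in> polys (2 * l - 1)"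
        "(\<Sum>E\<in>\<G>. osc_term \<G> f q E (\<phi> E)) + (\<Sum>E\<in>\<G>. Lnorm E q (\<lambda>x. S x - Q x) powr q) \<le> O' + real (card \<G>) * \<delta>"
        using osc_approx[OF \<delta>, of \<G> l q f S Q] unfolding O'_def by blast
      have \<phi>p: "polyd (2 * l) (\<lambda>x. \<phi> E x $ j)" if "E \<in> \<G>" for E j
        by (rule polyd_mono[OF polys_imp_polyd[OF \<phi>(1)[rule_format, OF that] linear_component(1)]]) simp
      have data: "residual_data q (2 * l) \<kappa> K c D \<D> \<G> T (r \<phi>) s (g \<phi>) N"
        by (rule residual_data[OF \<phi>p c D0 D sr K_def bubble[rule_format]])
      note int = residual_data.element_residual_integrable[OF data]
      define X where "X = (LINT x|leb \<D>. norm (s x) powr q)"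
      define Y where "Y = (LINT x|leb \<D>. (hmesh \<G> x * norm (g \<phi> x)) powr q)"
      define R where "R = (LINT x|leb \<D>. (hmesh \<G> x * norm (pw \<G> (r \<phi>) x)) powr q)"
      define Z where "Z = N powr q + (X + Y)"
      have nn: "X \<ge> 0" "Y \<ge> 0" "R \<ge> 0" by (auto simp: X_def Y_def R_def)
      have Z: "X + Y \<le> Z" "X \<le> Z" "Y \<le> Z" "Z \<ge> 0" using nn by (auto simp: Z_def add_increasing)
      have X1: "(\<Sum>E\<in>\<G>. Lnorm E q s powr q) = X" unfolding X_def by (rule oscillation_terms(1)[of \<phi>]) (rule \<phi>p)
      have Y1: "(\<Sum>E\<in>\<G>. osc_term \<G> f q E (\<phi> E)) = Y" unfolding Y_def by (rule oscillation_terms(2)[of \<phi>]) (rule \<phi>p)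
      have XY: "Y + X \<le> O' + real (card \<G>) * \<delta>" using \<phi>(2) unfolding X1 Y1 .
      have i: "integrable (leb \<D>) (\<lambda>x. norm (s x) powr q)" "integrable (leb \<D>) (\<lambda>x. (hmesh \<G> x * norm (g \<phi> x)) powr q)"
        using LpD(2)[OF s_Lp[OF \<phi>p]] hg_integrable[OF \<phi>p] by auto
      have "R \<le> element_const CARD('d) q K c D * Z"
        using residual_data.element_residual_estimate[OF data] i by (simp add: R_def Z_def X_def Y_def)
      also have "\<dots> \<le> K1 * Z" using Z(4) by (auto simp: K1_def intro!: mult_right_mono)
      finally have R: "R \<le> K1 * Z" .
      have 1: "(\<Sum>E\<in>\<G>. Lnorm E q (\<lambda>x. hmesh \<G> x *\<^sub>R strong E x) powr q) \<le> a * (R + Y)"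
        unfolding a_def R_def Y_def by (rule element_terms[OF \<phi>p int(1)])
      have nj: "0 \<le> hmesh \<G> x * norm (jump F x) powr q" "\<not> rel_interior F \<subseteq> \<D> \<Longrightarrow> hmesh \<G> x * norm (jump F x) powr q = 0"
        "rel_interior F \<subseteq> \<D> \<Longrightarrow> side_config L \<G> F E1 E2 \<nu> b y \<rho> \<Longrightarrow> x \<in> F \<Longrightarrow>
          hmesh \<G> x * norm (jump F x) powr q = hmesh \<G> x * norm ((T E1 x - T E2 x) *v \<nu>) powr q" for L F E1 E2 \<nu> b y \<rho> x
        using jump_side by (auto simp: hmesh_def normal_jump_def)
      have "(\<Sum>E\<in>\<G>. \<Sum>F | F facet_of E. LINT x:F|facet_measure E F. hmesh \<G> x * norm (jump F x) powr q)
        \<le> jump_const CARD('d) q \<kappa> c D * (N powr q + (LINT x|leb \<D>. norm (s x) powr q + (hmesh \<G> x * (norm (pw \<G> (r \<phi>) x) + norm (g \<phi> x))) powr q))"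
        by (rule residual_data.jump_estimate[OF data d nj])
      also have "\<dots> \<le> K2 * (N powr q + (LINT x|leb \<D>. norm (s x) powr q + (hmesh \<G> x * (norm (pw \<G> (r \<phi>) x) + norm (g \<phi> x))) powr q))"
        unfolding K2_def by (intro mult_right_mono abs_ge_self add_nonneg_nonneg integral_nonneg) auto
      also have "\<dots> \<le> K2 * (N powr q + (X + a * (R + Y)))"
      proof (intro mult_left_mono add_left_mono K2)
        have "(LINT x|leb \<D>. norm (s x) powr q + (hmesh \<G> x * (norm (pw \<G> (r \<phi>) x) + norm (g \<phi> x))) powr q)
          \<le> (LINT x|leb \<D>. norm (s x) powr q + a * ((hmesh \<G> x * norm (pw \<G> (r \<phi>) x)) powr q + (hmesh \<G> x * norm (g \<phi> x)) powr q))"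
        proof (rule integral_mono[OF int(2)])
          show "integrable (leb \<D>) (\<lambda>x. norm (s x) powr q + a * ((hmesh \<G> x * norm (pw \<G> (r \<phi>) x)) powr q + (hmesh \<G> x * norm (g \<phi> x)) powr q))"
            using i int(1) by simp
          fix x
          show "norm (s x) powr q + (hmesh \<G> x * (norm (pw \<G> (r \<phi>) x) + norm (g \<phi> x))) powr q
            \<le> norm (s x) powr q + a * ((hmesh \<G> x * norm (pw \<G> (r \<phi>) x)) powr q + (hmesh \<G> x * norm (g \<phi> x)) powr q)"
            unfolding a_def distrib_left[of "hmesh \<G> x"] using q by (intro add_left_mono powr_add_le) (auto simp: hmesh_def)
        qed
        also have "\<dots> = X + a * (R + Y)" using i int(1) by (simp add: X_def R_def Y_def)
        finally show "(LINT x|leb \<D>. norm (s x) powr q + (hmesh \<G> x * (norm (pw \<G> (r \<phi>) x) + norm (g \<phi> x))) powr q) \<le> X + a * (R + Y)" .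
      qed
      finally have 2: "(\<Sum>E\<in>\<G>. \<Sum>F | F facet_of E. LINT x:F|facet_measure E F. hmesh \<G> x * norm (jump F x) powr q)
        \<le> K2 * (N powr q + (X + a * (R + Y)))" .
      have RY: "a * (R + Y) \<le> a * ((K1 + 1) * Z)" using R Z a by (intro mult_left_mono) (auto simp: distrib_right)
      have "N powr q + (X + a * (R + Y)) \<le> (1 + a * (1 + K1)) * Z" using RY nn by (simp add: Z_def algebra_simps)
      then have "K2 * (N powr q + (X + a * (R + Y))) \<le> K2 * ((1 + a * (1 + K1)) * Z)" by (intro mult_left_mono K2)
      then have "a * (R + Y) + K2 * (N powr q + (X + a * (R + Y))) + X \<le> C * Z"
        using RY Z(2) by (simp add: C_def distrib_right mult.assoc)
      moreover have "(\<Sum>E\<in>\<G>. indicator_pde \<D> \<G> f q U P S Q E) \<le> a * (R + Y) + K2 * (N powr q + (X + a * (R + Y))) + X"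
        unfolding indicator_pde_def sum.distrib side_terms X1 using 1 2 by linarith
      moreover have "C * Z \<le> C * (N powr q + (O' + real (card \<G>) * \<delta>))" using XY C by (intro mult_left_mono) (auto simp: Z_def)
      ultimately show ?thesis by linarith
    qed
    show "(\<Sum>E\<in>\<G>. indicator_pde \<D> \<G> f q U P S Q E) \<le> C * (N powr q + osc \<G> f q l S Q)"
    proof (rule field_le_epsilon)
      fix e :: real assume e: "e > 0"
      define D' where "D' = C * (real (card \<G>) + 1)"
      define \<delta> where "\<delta> = e / D'"
      have den: "D' > 0" using C by (simp add: D'_def)
      have \<delta>: "\<delta> > 0" using e den by (simp add: \<delta>_def)
      have "C * (real (card \<G>) * \<delta>) \<le> D' * \<delta>" using C \<delta> by (simp add: D'_def)
      also have "\<dots> = e" using den by (simp add: \<delta>_def)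
      finally show "(\<Sum>E\<in>\<G>. indicator_pde \<D> \<G> f q U P S Q E) \<le> C * (N powr q + osc \<G> f q l S Q) + e"
        using est[OF \<delta>] by (simp add: O'_def distrib_left)
    qed
  qed
qed

theorem theorem21:
  fixes \<Omega> :: "(real^'d) set"
    and PV :: "(real^'d \<Rightarrow> real^'d) set" and PQ :: "(real^'d \<Rightarrow> real) set" and l j :: nat
    and J :: "'d mesh \<Rightarrow> (real^'d \<Rightarrow> real^'d) \<Rightarrow> real^'d \<Rightarrow> real^'d"
    and Pr :: "'d mesh \<Rightarrow> (real^'d \<Rightarrow> real^'d^'d) \<Rightarrow> real^'d \<Rightarrow> real^'d^'d"
    and IQ :: "'d mesh \<Rightarrow> (real^'d \<Rightarrow> real) \<Rightarrow> real^'d \<Rightarrow> real"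
    and c1 cP cQ :: real
    and \<kappa> tt :: real
  assumes "CARD('d) = 2 \<or> CARD('d) = 3"
    and "polyhedral_lipschitz_domain \<Omega>"
    and "reference_spaces PV PQ l j"
  shows "\<exists>c2 > 0.
    \<forall>(\<G>0 :: 'd mesh) (refine :: 'd mesh \<Rightarrow> (real^'d) set set \<Rightarrow> 'd mesh)
     (VV :: (real^'d \<Rightarrow> real^'d) set) (QQ :: (real^'d \<Rightarrow> real) set)
     (F :: (real^'d) set \<Rightarrow> real^'d \<Rightarrow> real^'d)
     (r :: real) (t :: real) (f :: real^'d \<Rightarrow> real^'d)
     (S :: nat \<Rightarrow> real^'d \<Rightarrow> real^'d^'d \<Rightarrow> real^'d^'d)
     (n :: nat) (\<G> :: 'd mesh) (U :: real^'d \<Rightarrow> real^'d) (P :: real^'d \<Rightarrow> real).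
      discretization \<Omega> PV PQ l J c1 Pr cP IQ cQ \<G>0 refine VV QQ F \<longrightarrow>
      admissible_exps (real CARD('d)) r t tt \<longrightarrow>
      f \<in> Lp \<Omega> (conj_exp r) \<longrightarrow>
      stress_maps \<Omega> r S \<longrightarrow>
      \<G> \<in> meshes \<G>0 refine \<longrightarrow>
      shape_regular \<kappa> \<G> \<longrightarrow>
      galerkin \<Omega> (FE_V \<Omega> VV PV F \<G>) (FE_Q QQ PQ F \<G>) (S n) f U P \<longrightarrow>
      (let SU = (\<lambda>x. S n x (sgrad \<Omega> U x)) in
       c2 * (\<Sum>E\<in>\<G>. indicator_pde \<Omega> \<G> f tt U P SU (Pr \<G> SU) E) powr (1 / tt)
       \<le> dual_norm \<Omega> tt (residual \<Omega> f U P SU) + osc \<G> f tt l SU (Pr \<G> SU) powr (1 / tt))"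
proof (cases "tt > 1")
  \<comment> \<open>Admissible exponents force \<open>tt > 1\<close>, so here the claim is vacuous
    and any constant will do.\<close>
  case False
  show ?thesis
  proof (rule exI[of _ 1], intro conjI allI impI)
    fix r t :: real assume "admissible_exps (real CARD('d)) r t tt"
    then have "tt > 1" using admissible_exps_bounds(1) assms(1) by auto
    then show "let SU = (\<lambda>x. S n x (sgrad \<Omega> U x)) in
       1 * (\<Sum>E\<in>\<G>. indicator_pde \<Omega> \<G> f tt U P SU (Pr \<G> SU) E) powr (1 / tt)
       \<le> dual_norm \<Omega> tt (residual \<Omega> f U P SU) + osc \<G> f tt l SU (Pr \<G> SU) powr (1 / tt)" for S n \<G> f U P using False by simp
  qed simp
next
  case q: True
  have d: "2 \<le> CARD('d)" using assms(1) by auto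
  \<comment> \<open>The domain is given before \<open>c2\<close>, so the radius of a ball containing
    it may enter the constant.\<close>
  obtain D where D: "\<Omega> \<subseteq> cball 0 D" "D > 0" using assms(2) by (auto simp: polyhedral_lipschitz_domain_def bounded_pos subset_eq)
  obtain C where C: "C > 0" and est: "\<forall>(\<Omega> :: (real^'d) set) \<G> U P f S Q u p \<sigma>. discrete_flow tt l \<Omega> \<G> U P f S Q u p \<sigma> \<longrightarrow>
    \<Omega> \<subseteq> cball 0 D \<longrightarrow> shape_regular \<kappa> \<G> \<longrightarrow>
    (\<Sum>E\<in>\<G>. indicator_pde \<Omega> \<G> f tt U P S Q E) \<le> C * (dual_norm \<Omega> tt (residual \<Omega> f U P S) powr tt + osc \<G> f tt l S Q)"
    using indicator_estimate[OF q d less_imp_le[OF D(2)], of l \<kappa>] by blast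
  \<comment> \<open>Each of \<open>N powr tt\<close> and \<open>O'\<close> is at most
    \<open>(N + O' powr (1 / tt)) powr tt\<close>, which gives the factor two; taking the root of
    \<open>2 * C\<close> leaves this constant.\<close>
  define c where "c = (2 * C) powr (1 / tt)"
  have c: "c > 0" using C by (simp add: c_def)
  show ?thesis unfolding Let_def
  proof (rule exI[of _ "1 / c"], intro conjI allI impI)
    show "1 / c > 0" using c by simp
    fix \<G>0 refine VV QQ F r t f S n \<G> U P
    assume disc: "discretization \<Omega> PV PQ l J c1 Pr cP IQ cQ \<G>0 refine VV QQ F"
      and adm: "admissible_exps (real CARD('d)) r t tt" and f: "f \<in> Lp \<Omega> (conj_exp r)" and SM: "stress_maps \<Omega> r S"
      and \<G>: "\<G> \<in> meshes \<G>0 refine" and sr: "shape_regular \<kappa> \<G>"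
      and gal: "galerkin \<Omega> (FE_V \<Omega> VV PV F \<G>) (FE_Q QQ PQ F \<G>) (S n) f U P"
    define SU where "SU = (\<lambda>x. S n x (sgrad \<Omega> U x))"
    define I where "I = (\<Sum>E\<in>\<G>. indicator_pde \<Omega> \<G> f tt U P SU (Pr \<G> SU) E)"
    define N where "N = dual_norm \<Omega> tt (residual \<Omega> f U P SU)"
    define O' where "O' = osc \<G> f tt l SU (Pr \<G> SU)"
    have UP: "U \<in> FE_V \<Omega> VV PV F \<G>" "P \<in> FE_Q QQ PQ F \<G>" using gal by (auto simp: galerkin_def)
    obtain u p \<sigma> where flow: "discrete_flow tt l \<Omega> \<G> U P f SU (Pr \<G> SU) u p \<sigma>"
      using discrete_flow_exists[OF assms(1-3) disc adm f SM \<G> UP, of n] unfolding SU_def by blast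
    have "I \<le> C * (N powr tt + O')" unfolding I_def N_def O'_def using est flow D(1) sr by blast
    have N: "N \<ge> 0" unfolding N_def by (rule discrete_flow.dual_norm_nonneg[OF flow, of "\<lambda>E x. 0"]) (simp add: polyd_const)
    have O: "O' \<ge> 0" unfolding O'_def by (rule osc_nonneg)
    have "O' = (O' powr (1 / tt)) powr tt" using O q by (simp add: powr_powr)
    also have "\<dots> \<le> (N + O' powr (1 / tt)) powr tt" using N q by (intro powr_mono2) auto
    finally have "N powr tt + O' \<le> 2 * (N + O' powr (1 / tt)) powr tt"
      using powr_mono2[of tt N "N + O' powr (1 / tt)"] N q by simp
    then have "C * (N powr tt + O') \<le> 2 * C * (N + O' powr (1 / tt)) powr tt" using C by simp
    then have le: "I \<le> 2 * C * (N + O' powr (1 / tt)) powr tt" using \<open>I \<le> C * (N powr tt + O')\<close> by linarith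
    have I0: "I \<ge> 0" unfolding I_def indicator_pde_def by (intro sum_nonneg add_nonneg_nonneg) auto
    have "I powr (1 / tt) \<le> (2 * C * (N + O' powr (1 / tt)) powr tt) powr (1 / tt)" using le I0 q by (intro powr_mono2) auto
    also have "\<dots> = c * (N + O' powr (1 / tt))" using C N q by (simp add: c_def powr_mult powr_powr)
    finally have "1 / c * I powr (1 / tt) \<le> N + O' powr (1 / tt)" using c by (simp add: field_simps)
    then show "1 / c * (\<Sum>E\<in>\<G>. indicator_pde \<Omega> \<G> f tt U P (\<lambda>x. S n x (sgrad \<Omega> U x)) (Pr \<G> (\<lambda>x. S n x (sgrad \<Omega> U x))) E) powr (1 / tt)
      \<le> dual_norm \<Omega> tt (residual \<Omega> f U P (\<lambda>x. S n x (sgrad \<Omega> U x))) + osc \<G> f tt l (\<lambda>x. S n x (sgrad \<Omega> U x)) (Pr \<G> (\<lambda>x. S n x (sgrad \<Omega> U x))) powr (1 / tt)"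
      unfolding I_def N_def O'_def SU_def .
  qed
qed

end
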